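(* Assume either condition (A1) when $s\in I_\mu^-$, or condition (A2) when $s\in I_\mu^+$. Let $s\in I_\mu^\circ\setminus\{0\}$ and $q=\Lambda'(s)$. Then, for any $0<\gamma\le\min\{|s|,1\}$ and $f\in\mathcal S$, there exists a constant $\delta>0$ such that for any $z\in B_\delta(0)$ and $n\ge1$, $$R_{s,z,f}^n=\lambda_{s,z}^n\Pi_{s,z,f}+N_{s,z,f}^n,$$ where $\lambda_{s,z}=e^{-qz}\frac{\kappa(s+z)}{\kappa(s)}$, the maps $z\mapsto\Pi_{s,z,f}$ and $z\mapsto N_{s,z,f}$, $B_\delta(0)\to\mathscr L(\mathscr B_\gamma,\mathscr B_\gamma)$, are analytic with $\Pi_{s,z,f}N_{s,z,f}=N_{s,z,f}\Pi_{s,z,f}=0$ and $\Pi_{s,0,f}(\varphi)(v)=\pi_{s,f}(\varphi)$ for $\varphi\in\mathscr B_\gamma$ and $v\in\mathcal S_\epsilon$. Moreover, for any compact set $J\subseteq I_\mu^\circ\setminus\{0\}$, $$\sup_{f\in\mathcal S}\sup_{s\in J}\sup_{z\in B_\delta(0)}\rho(N_{s,z,f})<1.$$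
   Context: Let $d\ge2$. $\mathbb R^d$ carries the standard scalar product and the norm $\|v\|=\sum_i|v_i|$; $\mathbb R^d_+$ is the set of vectors with non-negative coordinates; $\mathcal S=\{v\in\mathbb R^d_+:\|v\|=1\}$; for $\epsilon\in(0,1)$, $\mathcal S_\epsilon=\{v\in\mathcal S:\langle f,v\rangle\ge\epsilon\ \forall f\in\mathcal S\}$. $\mathbb G$ is the semigroup of non-negative $d\times d$ matrices, $\|g\|=\sum_{i,j}g^{i,j}$, $g>0$ means all entries are strictly positive, $g^{\mathrm T}$ is the transpose, $g\cdot v=gv/\|gv\|$. $(g_n)_{n\ge1}$ are i.i.d. in $\mathbb G$ with law $\mu$, $G_n=g_n\cdots g_1$; $\Gamma_\mu$ is the closed semigroup spanned by $\operatorname{supp}\mu$. Condition (A1): $0\notin\Gamma_\mu$ and there is a constant $\varkappa_0>1$ such that for $\mu$-almost every $g$: $g>0$ and $\max_{i,j}g^{i,j}\le\varkappa_0\min_{i,j}g^{i,j}$. Condition (A2): $0\notin\Gamma_\mu$ and there is a constant $\varkappa>1$ such that for $\mu$-almost every $g$: $g>0$ and $\max_ig^{i,j}\le\varkappa\min_ig^{i,j}$ for all $1\le j\le d$. Throughout, $\epsilon\in(0,1)$ is a fixed constant such that $g\cdot\mathcal S\subseteq\mathcal S_\epsilon$ and $g^{\mathrm T}\cdot\mathcal S\subseteq\mathcal S_\epsilon$ for $g\in\operatorname{supp}\mu$. $I_\mu^+=\{s\ge0:\mathbb E\|g_1\|^s<\infty\}$, $I_\mu^-=\{s\le0:\mathbb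 E\|g_1\|^s<\infty\}$, $I_\mu=I_\mu^+\cup I_\mu^-$ with interior $I_\mu^\circ$. $\kappa(s)=\lim_n(\mathbb E\|G_n\|^s)^{1/n}$, $\Lambda=\log\kappa$; $\Lambda$ is analytic on $I_\mu^\circ$ and $\kappa(s+z)$ for small complex $z$ denotes the analytic extension. $P_s\varphi(v)=\int\|gv\|^s\varphi(g\cdot v)\mu(dg)$, $P_s^*\varphi(v)=\int\|g^{\mathrm T}v\|^s\varphi(g^{\mathrm T}\cdot v)\mu(dg)$, and on measures $(P_s\eta)\varphi=\eta(P_s\varphi)$ (likewise for $P_s^*$). Under the hypotheses there are unique probability measures $\nu_s,\nu_s^*$ on $\mathcal S$ with $P_s\nu_s=\kappa(s)\nu_s$, $P_s^*\nu_s^*=\kappa(s)\nu_s^*$, and $r_s(v)=\int\langle v,u\rangle^s\nu_s^*(du)$ is strictly positive, continuous and satisfies $P_sr_s=\kappa(s)r_s$. For $f\in\mathcal S$, $v\in\mathcal S_\epsilon$: $r_{s,f}(v)=\langle f,v\rangle^{-s}r_s(v)$, $\nu_{s,f}(\varphi)=\nu_s(\langle f,\cdot\rangle^s\varphi)/\nu_s(r_s)$, $\pi_{s,f}(\varphi)=\nu_{s,f}(\varphi r_{s,f})$. For $z\in\mathbb C$ with $s+\Re z\in I_\mu$ and $q=\Lambda'(s)$, the perturbed operator is, for continuous $\varphi$ on $\mathcal S_\epsilon$, $$R_{s,z,f}\varphi(v)=\int_{\mathbb G}e^{z\left(\log\frac{\langle f,gv\rangle}{\langle f,v\rangle}-q\right)}\varphi(g\cdot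 v)\,\frac{\langle f,gv\rangle^s}{\kappa(s)\langle f,v\rangle^s}\,\frac{r_{s,f}(g\cdot v)}{r_{s,f}(v)}\,\mu(dg),\quad v\in\mathcal S_\epsilon.$$ $B_\delta(0)=\{z\in\mathbb C:|z|<\delta\}$. The space $\mathcal S$ is equipped with the Hilbert cross-ratio metric $\mathbf d(u,v)=\frac{1-m(u,v)m(v,u)}{1+m(u,v)m(v,u)}$, $m(u,v)=\sup\{\lambda\ge0:\lambda v_i\le u_i\ \forall i\}$. $\mathscr B_\gamma$ is the Banach space of complex-valued continuous $\varphi$ on $\mathcal S$ with $\|\varphi\|_\gamma=\sup|\varphi|+\sup_{u\ne v}|\varphi(u)-\varphi(v)|/\mathbf d(u,v)^\gamma<\infty$; $\mathscr L(\mathscr B_\gamma,\mathscr B_\gamma)$ is the set of bounded linear operators on it and $\rho(A)$ is the spectral radius of such an operator $A$. *)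

theory Defs
  imports "HOL-Probability.Probability"
begin

section \<open>Vectors, matrices and the projective action\<close>

definition norm1 :: "real ^ 'n \<Rightarrow> real" where
  "norm1 v = (\<Sum>i\<in>UNIV. \<bar>v $ i\<bar>)"

definition sphere1 :: "(real ^ 'n) set" where
  "sphere1 = {v. (\<forall>i. 0 \<le> v $ i) \<and> norm1 v = 1}"

definition sphere1_eps :: "real \<Rightarrow> (real ^ 'n) set" where
  "sphere1_eps \<epsilon> = {v \<in> sphere1. \<forall>f\<in>sphere1. f \<bullet> v \<ge> \<epsilon>}"

definition nonneg_matrices :: "(real ^ 'n ^ 'n) set" where
  "nonneg_matrices = {h. \<forall>i j. 0 \<le> h $ i $ j}"

definition mat_norm1 :: "real ^ 'n ^ 'n \<Rightarrow> real" where
  "mat_norm1 h = (\<Sum>i\<in>UNIV. \<Sum>j\<in>UNIV. h $ i $ j)"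

text \<open>If the image \<open>h *v v\<close> is the zero vector then so is \<open>act h v\<close>, which therefore
  lies outside the simplex.\<close>

definition act :: "real ^ 'n ^ 'n \<Rightarrow> real ^ 'n \<Rightarrow> real ^ 'n" where
  "act h v = (1 / norm1 (h *v v)) *\<^sub>R (h *v v)"

section \<open>The random matrices\<close>

definition iid_nonneg_matrices ::
  "'w measure \<Rightarrow> (nat \<Rightarrow> 'w \<Rightarrow> real ^ 'n ^ 'n) \<Rightarrow> (real ^ 'n ^ 'n) measure \<Rightarrow> bool" where
  "iid_nonneg_matrices M g \<mu> \<longleftrightarrow>
     prob_space M \<and>
     prob_space.indep_vars M (\<lambda>_. borel) g {1..} \<and>
     (\<forall>n\<ge>1. distr M borel (g n) = \<mu>) \<and>
     (AE h in \<mu>. h \<in> nonneg_matrices)"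

text \<open>\<open>left_prod g n\<close> is the product of \<open>g n, \<dots>, g 1\<close> in this order; the value \<open>g 0\<close> is never used.\<close>

primrec left_prod :: "(nat \<Rightarrow> 'w \<Rightarrow> real ^ 'n ^ 'n) \<Rightarrow> nat \<Rightarrow> 'w \<Rightarrow> real ^ 'n ^ 'n" where
  "left_prod g 0 = (\<lambda>\<omega>. mat 1)"
| "left_prod g (Suc n) = (\<lambda>\<omega>. g (Suc n) \<omega> ** left_prod g n \<omega>)"

definition measure_support :: "'a::topological_space measure \<Rightarrow> 'a set" where
  "measure_support \<mu> = {x. \<forall>U. open U \<and> x \<in> U \<longrightarrow> emeasure \<mu> U > 0}"

definition closed_semigroup :: "(real ^ 'n ^ 'n) measure \<Rightarrow> (real ^ 'n ^ 'n) set" where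
  "closed_semigroup \<mu> =
     (\<lambda>T. closed T \<and> (\<forall>a\<in>T. \<forall>b\<in>T. a ** b \<in> T)) hull measure_support \<mu>"

definition cond_A1 :: "(real ^ 'n ^ 'n) measure \<Rightarrow> bool" where
  "cond_A1 \<mu> \<longleftrightarrow> 0 \<notin> closed_semigroup \<mu> \<and>
     (\<exists>c>1. AE h in \<mu>. (\<forall>i j. h $ i $ j > 0) \<and>
        (MAX (i, j)\<in>UNIV. h $ i $ j) \<le> c * (MIN (i, j)\<in>UNIV. h $ i $ j))"

definition cond_A2 :: "(real ^ 'n ^ 'n) measure \<Rightarrow> bool" where
  "cond_A2 \<mu> \<longleftrightarrow> 0 \<notin> closed_semigroup \<mu> \<and>
     (\<exists>c>1. AE h in \<mu>. (\<forall>i j. h $ i $ j > 0) \<and>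
        (\<forall>j. (MAX i. h $ i $ j) \<le> c * (MIN i. h $ i $ j)))"

text \<open>Negative powers and the power zero of a vanishing norm (where \<open>0 powr s = 0\<close> is the library
  convention) play no role: under either condition above all the matrices are almost surely
  entrywise positive.\<close>

definition I_plus :: "'w measure \<Rightarrow> (nat \<Rightarrow> 'w \<Rightarrow> real ^ 'n ^ 'n) \<Rightarrow> real set" where
  "I_plus M g = {s. s \<ge> 0 \<and> integrable M (\<lambda>\<omega>. mat_norm1 (g 1 \<omega>) powr s)}"

definition I_minus :: "'w measure \<Rightarrow> (nat \<Rightarrow> 'w \<Rightarrow> real ^ 'n ^ 'n) \<Rightarrow> real set" where
  "I_minus M g = {s. s \<le> 0 \<and> integrable M (\<lambda>\<omega>. mat_norm1 (g 1 \<omega>) powr s)}"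

definition I_all :: "'w measure \<Rightarrow> (nat \<Rightarrow> 'w \<Rightarrow> real ^ 'n ^ 'n) \<Rightarrow> real set" where
  "I_all M g = I_plus M g \<union> I_minus M g"

definition A1_or_A2 ::
  "'w measure \<Rightarrow> (nat \<Rightarrow> 'w \<Rightarrow> real ^ 'n ^ 'n) \<Rightarrow> (real ^ 'n ^ 'n) measure \<Rightarrow> real \<Rightarrow> bool" where
  "A1_or_A2 M g \<mu> s \<longleftrightarrow>
     (s \<in> I_minus M g \<longrightarrow> cond_A1 \<mu>) \<and> (s \<in> I_plus M g \<longrightarrow> cond_A2 \<mu>)"

definition kappa :: "'w measure \<Rightarrow> (nat \<Rightarrow> 'w \<Rightarrow> real ^ 'n ^ 'n) \<Rightarrow> real \<Rightarrow> real" where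
  "kappa M g s =
     lim (\<lambda>n. (\<integral>\<omega>. mat_norm1 (left_prod g n \<omega>) powr s \<partial>M) powr (1 / real n))"

definition Lambda :: "'w measure \<Rightarrow> (nat \<Rightarrow> 'w \<Rightarrow> real ^ 'n ^ 'n) \<Rightarrow> real \<Rightarrow> real" where
  "Lambda M g s = ln (kappa M g s)"

section \<open>Transfer operators and eigenmeasures\<close>

text \<open>Functions on the simplex are represented by functions on the whole space, so all integrals
  are taken over the simplex, respectively over the non-negative matrices.\<close>

definition P_op ::
  "(real ^ 'n ^ 'n) measure \<Rightarrow> real \<Rightarrow> (real ^ 'n \<Rightarrow> real) \<Rightarrow> real ^ 'n \<Rightarrow> real" where
  "P_op \<mu> s \<phi> v = (LINT h:nonneg_matrices|\<mu>. norm1 (h *v v) powr s * \<phi> (act h v))"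

definition P_star_op ::
  "(real ^ 'n ^ 'n) measure \<Rightarrow> real \<Rightarrow> (real ^ 'n \<Rightarrow> real) \<Rightarrow> real ^ 'n \<Rightarrow> real" where
  "P_star_op \<mu> s \<phi> v =
     (LINT h:nonneg_matrices|\<mu>. norm1 (transpose h *v v) powr s * \<phi> (act (transpose h) v))"

definition eigenmeasure ::
  "((real ^ 'n \<Rightarrow> real) \<Rightarrow> real ^ 'n \<Rightarrow> real) \<Rightarrow> real \<Rightarrow> (real ^ 'n) measure \<Rightarrow> bool" where
  "eigenmeasure P k \<eta> \<longleftrightarrow>
     prob_space \<eta> \<and> sets \<eta> = sets borel \<and> emeasure \<eta> sphere1 = 1 \<and>
     (\<forall>\<phi>. continuous_on sphere1 \<phi> \<longrightarrow>
        (LINT v:sphere1|\<eta>. P \<phi> v) = k * (LINT v:sphere1|\<eta>. \<phi> v))"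

text \<open>In the next definitions \<open>\<nu>\<close> and \<open>\<eta>\<close> stand for the eigenmeasures of \<open>P_op \<mu> s\<close> and
  \<open>P_star_op \<mu> s\<close>, respectively.\<close>

definition r_fun :: "(real ^ 'n) measure \<Rightarrow> real \<Rightarrow> real ^ 'n \<Rightarrow> real" where
  "r_fun \<eta> s v = (LINT u:sphere1|\<eta>. (v \<bullet> u) powr s)"

definition rf_fun :: "(real ^ 'n) measure \<Rightarrow> real \<Rightarrow> real ^ 'n \<Rightarrow> real ^ 'n \<Rightarrow> real" where
  "rf_fun \<eta> s f v = (f \<bullet> v) powr (- s) * r_fun \<eta> s v"

definition nu_f ::
  "(real ^ 'n) measure \<Rightarrow> (real ^ 'n) measure \<Rightarrow> real \<Rightarrow> real ^ 'n \<Rightarrow> (real ^ 'n \<Rightarrow> complex) \<Rightarrow> complex"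
  where
  "nu_f \<nu> \<eta> s f \<phi> =
     (LINT v:sphere1|\<nu>. of_real ((f \<bullet> v) powr s) * \<phi> v) /
     of_real (LINT v:sphere1|\<nu>. r_fun \<eta> s v)"

definition pi_f ::
  "(real ^ 'n) measure \<Rightarrow> (real ^ 'n) measure \<Rightarrow> real \<Rightarrow> real ^ 'n \<Rightarrow> (real ^ 'n \<Rightarrow> complex) \<Rightarrow> complex"
  where
  "pi_f \<nu> \<eta> s f \<phi> = nu_f \<nu> \<eta> s f (\<lambda>v. \<phi> v * of_real (rf_fun \<eta> s f v))"

text \<open>The perturbed operator acts on functions on \<open>sphere1_eps \<epsilon>\<close>; as the representing functions are
  total, its values are put to zero elsewhere. Here \<open>k\<close> and \<open>q\<close> stand for the values at \<open>s\<close> of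
  \<open>kappa\<close> and of the derivative of \<open>Lambda\<close>.\<close>

definition R_op ::
  "(real ^ 'n ^ 'n) measure \<Rightarrow> (real ^ 'n) measure \<Rightarrow> real \<Rightarrow> real \<Rightarrow> real \<Rightarrow> real \<Rightarrow> complex \<Rightarrow> real ^ 'n
     \<Rightarrow> (real ^ 'n \<Rightarrow> complex) \<Rightarrow> real ^ 'n \<Rightarrow> complex" where
  "R_op \<mu> \<eta> \<epsilon> k q s z f \<phi> v =
     (if v \<in> sphere1_eps \<epsilon> then
        (LINT h:nonneg_matrices|\<mu>.
           exp (z * of_real (ln ((f \<bullet> (h *v v)) / (f \<bullet> v)) - q)) * \<phi> (act h v) *
           of_real ((f \<bullet> (h *v v)) powr s / (k * (f \<bullet> v) powr s)) *
           of_real (rf_fun \<eta> s f (act h v) / rf_fun \<eta> s f v))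
      else 0)"

section \<open>Bounded operators on a normed space of functions\<close>

text \<open>The spaces of Hoelder functions below depend on a real parameter and hence are not types.
  In this section \<open>B\<close> is the carrier of a complex normed space of functions, with pointwise operations
  and norm \<open>nrm\<close>; operators matter only through their restriction to \<open>B\<close>.\<close>

definition bounded_op ::
  "('a \<Rightarrow> complex) set \<Rightarrow> (('a \<Rightarrow> complex) \<Rightarrow> real) \<Rightarrow> (('a \<Rightarrow> complex) \<Rightarrow> 'a \<Rightarrow> complex) \<Rightarrow> bool" where
  "bounded_op B nrm A \<longleftrightarrow>
     (\<forall>\<phi>\<in>B. A \<phi> \<in> B) \<and>
     (\<forall>\<phi>\<in>B. \<forall>\<psi>\<in>B. A (\<lambda>v. \<phi> v + \<psi> v) = (\<lambda>v. A \<phi> v + A \<psi> v)) \<and>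
     (\<forall>c. \<forall>\<phi>\<in>B. A (\<lambda>v. c * \<phi> v) = (\<lambda>v. c * A \<phi> v)) \<and>
     (\<exists>C. \<forall>\<phi>\<in>B. nrm (A \<phi>) \<le> C * nrm \<phi>)"

definition op_norm ::
  "('a \<Rightarrow> complex) set \<Rightarrow> (('a \<Rightarrow> complex) \<Rightarrow> real) \<Rightarrow> (('a \<Rightarrow> complex) \<Rightarrow> 'a \<Rightarrow> complex) \<Rightarrow> real" where
  "op_norm B nrm A = (SUP \<phi>\<in>B. nrm (A \<phi>) / nrm \<phi>)"

definition op_spectrum ::
  "('a \<Rightarrow> complex) set \<Rightarrow> (('a \<Rightarrow> complex) \<Rightarrow> real) \<Rightarrow> (('a \<Rightarrow> complex) \<Rightarrow> 'a \<Rightarrow> complex) \<Rightarrow> complex set"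
  where
  "op_spectrum B nrm A =
     {l. \<not> (\<exists>T. bounded_op B nrm T \<and>
              (\<forall>\<phi>\<in>B. T (\<lambda>v. A \<phi> v - l * \<phi> v) = \<phi> \<and> (\<lambda>v. A (T \<phi>) v - l * T \<phi> v) = \<phi>))}"

definition op_spectral_radius ::
  "('a \<Rightarrow> complex) set \<Rightarrow> (('a \<Rightarrow> complex) \<Rightarrow> real) \<Rightarrow> (('a \<Rightarrow> complex) \<Rightarrow> 'a \<Rightarrow> complex) \<Rightarrow> ereal" where
  "op_spectral_radius B nrm A = (SUP l\<in>op_spectrum B nrm A. ereal (cmod l))"

text \<open>As for \<open>analytic_on\<close> in the library, analyticity on an open set \<open>U\<close> is complex differentiability
  at each of its points, here with respect to the operator norm.\<close>

definition op_analytic_on ::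
  "('a \<Rightarrow> complex) set \<Rightarrow> (('a \<Rightarrow> complex) \<Rightarrow> real) \<Rightarrow>
   (complex \<Rightarrow> ('a \<Rightarrow> complex) \<Rightarrow> 'a \<Rightarrow> complex) \<Rightarrow> complex set \<Rightarrow> bool" where
  "op_analytic_on B nrm F U \<longleftrightarrow>
     (\<forall>z\<in>U. bounded_op B nrm (F z)) \<and>
     (\<forall>z\<in>U. \<exists>D. bounded_op B nrm D \<and>
        ((\<lambda>h. op_norm B nrm (\<lambda>\<phi> v. (F (z + h) \<phi> v - F z \<phi> v) / h - D \<phi> v)) \<longlongrightarrow> 0) (at 0))"

section \<open>The Hilbert cross-ratio metric and Hoelder functions\<close>

definition hilbert_m :: "real ^ 'n \<Rightarrow> real ^ 'n \<Rightarrow> real" where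
  "hilbert_m u v = Sup {l. l \<ge> 0 \<and> (\<forall>i. l * v $ i \<le> u $ i)}"

definition hilbert_dist :: "real ^ 'n \<Rightarrow> real ^ 'n \<Rightarrow> real" where
  "hilbert_dist u v =
     (1 - hilbert_m u v * hilbert_m v u) / (1 + hilbert_m u v * hilbert_m v u)"

definition holder_quotients :: "real \<Rightarrow> (real ^ 'n \<Rightarrow> complex) \<Rightarrow> real set" where
  "holder_quotients \<gamma> \<phi> =
     {cmod (\<phi> u - \<phi> v) / hilbert_dist u v powr \<gamma> | u v. u \<in> sphere1 \<and> v \<in> sphere1 \<and> u \<noteq> v}"

definition holder_norm :: "real \<Rightarrow> (real ^ 'n \<Rightarrow> complex) \<Rightarrow> real" where
  "holder_norm \<gamma> \<phi> = (SUP v\<in>sphere1. cmod (\<phi> v)) + Sup (holder_quotients \<gamma> \<phi>)"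

text \<open>The normalisation outside the simplex makes functions on the simplex correspond bijectively to
  their representatives. Finiteness of \<open>holder_norm\<close> is expressed by the two boundedness
  conditions.\<close>

definition holder_space :: "real \<Rightarrow> (real ^ 'n \<Rightarrow> complex) set" where
  "holder_space \<gamma> =
     {\<phi>. continuous_on sphere1 \<phi> \<and> (\<forall>v. v \<notin> sphere1 \<longrightarrow> \<phi> v = 0) \<and>
         bdd_above ((\<lambda>v. cmod (\<phi> v)) ` sphere1) \<and> bdd_above (holder_quotients \<gamma> \<phi>)}"

section \<open>The spectral decomposition on a disc\<close>

text \<open>\<open>K\<close> is the (unique) analytic extension of \<open>kappa (s + _)\<close> to the disc. Since \<open>R_op\<close> acts on
  functions on \<open>sphere1_eps \<epsilon>\<close> while \<open>Pr z\<close> and \<open>N z\<close> act on the Hoelder space over the whole simplex, the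
  decomposition is an identity between functions on \<open>sphere1_eps \<epsilon>\<close>. The first conjunct says that
  \<open>R_op\<close> is defined for all \<open>z\<close> in the disc.\<close>

definition spectral_decomposition ::
  "'w measure \<Rightarrow> (nat \<Rightarrow> 'w \<Rightarrow> real ^ 'n ^ 'n) \<Rightarrow> (real ^ 'n ^ 'n) measure \<Rightarrow>
   (real ^ 'n) measure \<Rightarrow> (real ^ 'n) measure \<Rightarrow> real \<Rightarrow> real \<Rightarrow> real \<Rightarrow> real ^ 'n \<Rightarrow> real \<Rightarrow>
   (complex \<Rightarrow> (real ^ 'n \<Rightarrow> complex) \<Rightarrow> real ^ 'n \<Rightarrow> complex) \<Rightarrow>
   (complex \<Rightarrow> (real ^ 'n \<Rightarrow> complex) \<Rightarrow> real ^ 'n \<Rightarrow> complex) \<Rightarrow> bool" where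
  "spectral_decomposition M g \<mu> \<nu> \<eta> \<epsilon> \<gamma> s f \<delta> Pr N \<longleftrightarrow>
     (let k = kappa M g s; q = deriv (Lambda M g) s; B = holder_space \<gamma>; nrm = holder_norm \<gamma> in
      (\<forall>z\<in>ball 0 \<delta>. s + Re z \<in> I_all M g) \<and>
      (\<exists>K. K holomorphic_on ball 0 \<delta> \<and>
           (\<forall>t. \<bar>t\<bar> < \<delta> \<longrightarrow> K (of_real t) = of_real (kappa M g (s + t))) \<and>
           (\<forall>z\<in>ball 0 \<delta>. \<forall>n\<ge>1. \<forall>\<phi>\<in>B. \<forall>v\<in>sphere1_eps \<epsilon>.
              (R_op \<mu> \<eta> \<epsilon> k q s z f ^^ n) \<phi> v =
              (exp (- of_real q * z) * K z / of_real k) ^ n * Pr z \<phi> v + (N z ^^ n) \<phi> v)) \<and>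
      op_analytic_on B nrm Pr (ball 0 \<delta>) \<and>
      op_analytic_on B nrm N (ball 0 \<delta>) \<and>
      (\<forall>z\<in>ball 0 \<delta>. \<forall>\<phi>\<in>B. Pr z (N z \<phi>) = (\<lambda>_. 0) \<and> N z (Pr z \<phi>) = (\<lambda>_. 0)) \<and>
      (\<forall>\<phi>\<in>B. \<forall>v\<in>sphere1_eps \<epsilon>. Pr 0 \<phi> v = pi_f \<nu> \<eta> s f \<phi>))"

end

theory Submission
  imports Defs "HOL-Complex_Analysis.Cauchy_Integral_Formula"
begin

text \<open>
  The hypothesis on the projective actions of the matrices in the support and of their transposes
  makes all entries of such a matrix comparable. Hence the matrices contract the cross-ratio metric
  uniformly, and the weights of the transfer operator at two points of \<open>sphere1_eps \<epsilon>\<close> are comparable,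
  up to a factor that tends to one with their distance. Coupling the two weights gives a one-step
  contraction, modulo constants, of the unperturbed Markov operator for the Hoelder seminorm of a
  suitable increasing function of the distance. The operator is carried over to functions on the
  whole simplex by composition with the metric projection onto \<open>sphere1_eps \<epsilon>\<close>.

  If \<open>\<pi>\<close> is the stationary functional and \<open>A z = R z - 1 \<otimes> \<pi>\<close>, then for small \<open>z\<close> the operator \<open>A z\<close> is a
  strict contraction, and \<open>w\<close> is an eigenvalue of \<open>R z\<close> near one exactly if
  \<open>w = (\<Sum>n. \<pi> (A z ^ n 1) / w ^ n)\<close>. This scalar fixed point equation determines the eigenvalue; the
  eigenvector and the eigenfunctional are \<open>\<Sum>n. A z ^ n 1 / w ^ (n + 1)\<close> and
  \<open>\<Sum>n. \<pi> \<circ> A z ^ n / w ^ (n + 1)\<close>. All these formulas are independent of the radius of the disc, so one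
  choice of the operators serves all compact sets of exponents. For real perturbations the eigenvalue
  is identified by integrating the eigenvector against the eigenmeasure of the shifted exponent. The
  derivative \<open>q\<close> of \<open>Lambda\<close> only enters through the factor \<open>exp (- q z)\<close> and is bounded on compact sets
  by Cauchy's estimate.
\<close>

section \<open>Bounded holomorphic families in function spaces\<close>

text \<open>The order of the quantifiers shapes the proof: \<open>Pr\<close> and \<open>N\<close>
  are chosen before the compact set \<open>J\<close>, and the radius must be uniform in
  \<open>s\<close> and \<open>f\<close>. Hence all constants are tracked explicitly, and the leading
  spectral data are given by formulas in the operator alone. The analytic extension \<open>K\<close>
  of \<open>kappa\<close> is a product of the proof: it is \<open>kappa M g s\<close> times the
  perturbed eigenvalue. A compactness argument would not by itself give a rate that is uniform in
  \<open>s\<close>; the one-step contraction has a rate depending only on \<open>\<epsilon>\<close>,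
  \<open>\<gamma>\<close>, the dimension and a bound for the exponents. The operator reads its
  argument only on \<open>sphere1_eps \<epsilon>\<close>. Therefore a gauge \<open>q\<close> that
  sees nothing else already bounds the full Hoelder norm of the image, and contraction in
  \<open>q\<close> becomes decay of the powers in norm at the cost of one application of the
  operator.\<close>

lemma deriv_bound_half_ball:
  fixes f :: "complex \<Rightarrow> complex"
  assumes "f holomorphic_on ball c r" "\<And>z. z \<in> ball c r \<Longrightarrow> cmod (f z) \<le> M" "z \<in> ball c (r/2)"
  shows "cmod (deriv f z) \<le> 4 * M / r"
proof -
  have r: "r > 0"
    using assms(3) zero_le_dist[of c z] by (simp del: zero_le_dist)
  have sub: "cball z (r/4) \<subseteq> ball c r"
  proof
    fix w assume "w \<in> cball z (r/4)"
    moreover have "dist c w \<le> dist c z + dist z w" by (rule dist_triangle)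
    ultimately show "w \<in> ball c r" using assms(3) r by simp
  qed
  have "cmod ((deriv ^^ 1) f z) \<le> fact 1 * M / (r/4)^1"
  proof (rule Cauchy_inequality)
    show "f holomorphic_on ball z (r/4)"
      using sub assms(1) by (meson ball_subset_cball holomorphic_on_subset subset_trans)
    show "continuous_on (cball z (r/4)) f"
      using sub assms(1) by (meson holomorphic_on_imp_continuous_on holomorphic_on_subset)
    show "0 < r/4" using r by simp
    fix x assume "cmod (z - x) = r/4"
    then have "x \<in> ball c r" using sub by (auto simp: dist_norm)
    then show "cmod (f x) \<le> M" by (rule assms(2))
  qed
  then show ?thesis by (simp add: field_simps)
qed

lemma bounded_holomorphic_lipschitz:
  fixes f :: "complex \<Rightarrow> complex"
  assumes "f holomorphic_on ball c r" "\<And>z. z \<in> ball c r \<Longrightarrow> cmod (f z) \<le> M"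
    and "x \<in> ball c (r/2)" "y \<in> ball c (r/2)"
  shows "cmod (f x - f y) \<le> 4 * M / r * cmod (x - y)"
proof (rule field_differentiable_bound[of "ball c (r/2)" f "deriv f"])
  show "(f has_field_derivative deriv f z) (at z within ball c (r/2))" if "z \<in> ball c (r/2)" for z
  proof -
    have "z \<in> ball c r" using that zero_le_dist[of c z] by (simp del: zero_le_dist)
    then show ?thesis
      using assms(1) by (meson DERIV_subset holomorphic_derivI open_ball subset_UNIV)
  qed
qed (use assms deriv_bound_half_ball[OF assms(1,2)] in auto)

text \<open>The Lipschitz estimate is used for \<open>deriv f\<close>: it is bounded by
  \<open>4 * M / r\<close> on the half ball, hence Lipschitz with constant
  \<open>32 * M / r^2\<close> on the quarter ball. The mean value inequality for
  \<open>f z - z * deriv f c\<close> then gives the quadratic remainder.\<close>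

lemma bounded_holomorphic_taylor:
  fixes f :: "complex \<Rightarrow> complex"
  assumes "f holomorphic_on ball c r" "\<And>z. z \<in> ball c r \<Longrightarrow> cmod (f z) \<le> M" "cmod h < r/4"
  shows "cmod (f (c + h) - f c - h * deriv f c) \<le> 32 * M / r^2 * (cmod h)^2"
proof -
  have r: "r > 0" using assms(3) norm_ge_zero[of h] by linarith
  have "\<And>z. z \<in> ball c r \<Longrightarrow> 0 \<le> cmod (f z)" by simp
  have hd: "deriv f holomorphic_on ball c (r/2)"
    by (rule holomorphic_on_subset[OF holomorphic_deriv[OF assms(1)]]) (use r in auto)
  have b: "cmod (deriv f x - deriv f c) \<le> 32 * M / r^2 * cmod (x - c)" if "x \<in> ball c (r/2/2)" for x
  proof -
    have "cmod (deriv f x - deriv f c) \<le> 4 * (4 * M / r) / (r/2) * cmod (x - c)"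
      by (rule bounded_holomorphic_lipschitz[OF hd deriv_bound_half_ball[OF assms(1,2)]])
        (use that r in auto)
    also have "4 * (4 * M / r) / (r/2) = 32 * M / r^2" using r by (simp add: power2_eq_square)
    finally show ?thesis .
  qed
  have M: "0 \<le> M" using assms(2)[of c] r by (meson centre_in_ball norm_ge_zero order_trans)
  have "cmod ((\<lambda>z. f z - z * deriv f c) (c + h) - (\<lambda>z. f z - z * deriv f c) c)
      \<le> (32 * M / r^2 * cmod h) * cmod (c + h - c)"
  proof (rule field_differentiable_bound[of "cball c (cmod h)" _ "\<lambda>z. deriv f z - deriv f c"])
    fix z assume z: "z \<in> cball c (cmod h)"
    then have z2: "z \<in> ball c (r/2/2)" "z \<in> ball c r" using assms(3) r by auto
    have "(f has_field_derivative deriv f z) (at z within cball c (cmod h))"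
      using assms(1) z2 by (meson DERIV_subset holomorphic_derivI open_ball subset_UNIV)
    then show "((\<lambda>z. f z - z * deriv f c) has_field_derivative deriv f z - deriv f c)
        (at z within cball c (cmod h))"
      by (auto intro!: derivative_eq_intros)
    have "cmod (deriv f z - deriv f c) \<le> 32 * M / r^2 * cmod (z - c)" by (rule b[OF z2(1)])
    also have "\<dots> \<le> 32 * M / r^2 * cmod h"
      using z M by (intro mult_left_mono) (auto simp: dist_norm norm_minus_commute)
    finally show "cmod (deriv f z - deriv f c) \<le> 32 * M / r^2 * cmod h" .
  qed (auto simp: dist_norm)
  then show ?thesis by (simp add: algebra_simps power2_eq_square)
qed

lemma holomorphic_on_suminf:
  fixes f :: "nat \<Rightarrow> complex \<Rightarrow> complex"
  assumes "open U" "\<And>n. f n holomorphic_on U" "\<And>n z. z \<in> U \<Longrightarrow> cmod (f n z) \<le> a n" "summable a"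
  shows "(\<lambda>z. \<Sum>n. f n z) holomorphic_on U"
proof (rule holomorphic_uniform_sequence[OF assms(1)])
  show "(\<lambda>z. \<Sum>i<n. f i z) holomorphic_on U" for n
    by (intro holomorphic_intros assms)
  fix x assume "x \<in> U"
  then obtain d where "d > 0" "cball x d \<subseteq> U" using assms(1) open_contains_cball by blast
  moreover have "uniform_limit U (\<lambda>n z. \<Sum>i<n. f i z) (\<lambda>z. \<Sum>n. f n z) sequentially"
    by (rule Weierstrass_m_test) (use assms in auto)
  ultimately show "\<exists>d>0. cball x d \<subseteq> U \<and>
      uniform_limit (cball x d) (\<lambda>n z. \<Sum>i<n. f i z) (\<lambda>z. \<Sum>n. f n z) sequentially"
    using uniform_limit_on_subset by blast
qed

text \<open>The Neumann series for the inverse of \<open>w - X\<close>. Summation is pointwise in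
  \<open>v\<close>, so the formula makes sense without a topology on operators.\<close>

definition resolvent_series ::
  "(('a \<Rightarrow> complex) \<Rightarrow> 'a \<Rightarrow> complex) \<Rightarrow> complex \<Rightarrow> ('a \<Rightarrow> complex) \<Rightarrow> 'a \<Rightarrow> complex" where
  "resolvent_series X w \<phi> v = (\<Sum>n. (X ^^ n) \<phi> v / w ^ Suc n)"

text \<open>
  The last assumption says that the norm is determined by functionals that are combinations of three
  evaluations; through them, estimates for scalar holomorphic functions pass to the norm.
\<close>

locale function_space =
  fixes B :: "('a \<Rightarrow> complex) set" and nrm :: "('a \<Rightarrow> complex) \<Rightarrow> real"
  assumes zero_mem: "(\<lambda>_. 0) \<in> B"
    and add_mem: "\<phi> \<in> B \<Longrightarrow> \<psi> \<in> B \<Longrightarrow> (\<lambda>v. \<phi> v + \<psi> v) \<in> B"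
    and scale_mem: "\<phi> \<in> B \<Longrightarrow> (\<lambda>v. c * \<phi> v) \<in> B"
    and nrm_add: "\<phi> \<in> B \<Longrightarrow> \<psi> \<in> B \<Longrightarrow> nrm (\<lambda>v. \<phi> v + \<psi> v) \<le> nrm \<phi> + nrm \<psi>"
    and nrm_scale: "\<phi> \<in> B \<Longrightarrow> nrm (\<lambda>v. c * \<phi> v) \<le> cmod c * nrm \<phi>"
    and eval_le: "\<phi> \<in> B \<Longrightarrow> cmod (\<phi> v) \<le> nrm \<phi>"
    and limit_mem: "(\<And>n. \<phi>s n \<in> B) \<Longrightarrow> (\<And>n. nrm (\<phi>s n) \<le> M) \<Longrightarrow>
        uniform_limit UNIV \<phi>s \<psi> sequentially \<Longrightarrow> \<psi> \<in> B"
    and nrm_leI: "\<phi> \<in> B \<Longrightarrow>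
        (\<And>a b c u v w. (\<And>\<psi>. \<psi> \<in> B \<Longrightarrow> cmod (a * \<psi> u + b * \<psi> v + c * \<psi> w) \<le> nrm \<psi>) \<Longrightarrow>
           cmod (a * \<phi> u + b * \<phi> v + c * \<phi> w) \<le> M) \<Longrightarrow> nrm \<phi> \<le> M"
begin

lemma nrm_nonneg: "\<phi> \<in> B \<Longrightarrow> 0 \<le> nrm \<phi>"
  using eval_le[of \<phi> undefined] by (meson norm_ge_zero order_trans)

lemma nrm_zero: "nrm (\<lambda>_. 0) = 0"
  using nrm_scale[OF zero_mem, of 0] nrm_nonneg[OF zero_mem] by simp

lemma diff_mem: "\<phi> \<in> B \<Longrightarrow> \<psi> \<in> B \<Longrightarrow> (\<lambda>v. \<phi> v - \<psi> v) \<in> B"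
  using add_mem[of \<phi> "\<lambda>v. - 1 * \<psi> v"] scale_mem[of \<psi> "-1"] by simp

lemma nrm_diff: "\<phi> \<in> B \<Longrightarrow> \<psi> \<in> B \<Longrightarrow> nrm (\<lambda>v. \<phi> v - \<psi> v) \<le> nrm \<phi> + nrm \<psi>"
  using nrm_add[of \<phi> "\<lambda>v. - 1 * \<psi> v"] scale_mem[of \<psi> "-1"] nrm_scale[of \<psi> "-1"] by simp

lemma nrm_le_scaleI: "\<phi> \<in> B \<Longrightarrow> nrm \<phi> \<le> M \<Longrightarrow> nrm (\<lambda>v. c * \<phi> v) \<le> cmod c * M"
  by (rule order_trans[OF nrm_scale]) (auto intro: mult_left_mono)

lemma sum_mem: "(\<And>n. n < (N::nat) \<Longrightarrow> \<phi>s n \<in> B) \<Longrightarrow> (\<lambda>v. \<Sum>n<N. \<phi>s n v) \<in> B"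
  by (induction N) (simp_all add: zero_mem add_mem)

lemma nrm_sum: "(\<And>n. n < (N::nat) \<Longrightarrow> \<phi>s n \<in> B) \<Longrightarrow>
    nrm (\<lambda>v. \<Sum>n<N. \<phi>s n v) \<le> (\<Sum>n<N. nrm (\<phi>s n))"
proof (induction N)
  case (Suc N)
  have "nrm (\<lambda>v. (\<Sum>n<N. \<phi>s n v) + \<phi>s N v) \<le> nrm (\<lambda>v. \<Sum>n<N. \<phi>s n v) + nrm (\<phi>s N)"
    by (rule nrm_add) (use Suc.prems sum_mem in auto)
  then show ?case using Suc by force
qed (simp add: nrm_zero)

text \<open>By \<open>nrm_leI\<close> the norm is a supremum of moduli of finite combinations of
  evaluations, hence lower semicontinuous under pointwise convergence. Uniform convergence serves to
  keep the limit in the space.\<close>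

lemma limit_nrm_le:
  assumes "\<And>n. \<phi>s n \<in> B" "\<And>n. nrm (\<phi>s n) \<le> M" "uniform_limit UNIV \<phi>s \<psi> sequentially"
  shows "\<psi> \<in> B" "nrm \<psi> \<le> M"
proof -
  show mem: "\<psi> \<in> B" by (rule limit_mem[OF assms])
  show "nrm \<psi> \<le> M"
  proof (rule nrm_leI[OF mem])
    fix a b c u v w
    assume *: "\<And>\<psi>. \<psi> \<in> B \<Longrightarrow> cmod (a * \<psi> u + b * \<psi> v + c * \<psi> w) \<le> nrm \<psi>"
    have l: "(\<lambda>n. \<phi>s n x) \<longlonglongrightarrow> \<psi> x" for x
      by (rule tendsto_uniform_limitI[OF assms(3)]) simp
    have "(\<lambda>n. cmod (a * \<phi>s n u + b * \<phi>s n v + c * \<phi>s n w)) \<longlonglongrightarrow>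
        cmod (a * \<psi> u + b * \<psi> v + c * \<psi> w)"
      by (intro tendsto_intros l)
    then show "cmod (a * \<psi> u + b * \<psi> v + c * \<psi> w) \<le> M"
      by (rule LIMSEQ_le_const2) (use * assms(1,2) order_trans in blast)
  qed
qed

text \<open>This takes the place of completeness: a norm-summable series converges uniformly, its
  partial sums are bounded in norm, and such limits stay in the space.\<close>

lemma series_mem:
  assumes "\<And>n. \<phi>s n \<in> B" "\<And>n. nrm (\<phi>s n) \<le> a n" "summable a"
  shows "(\<lambda>v. \<Sum>n. \<phi>s n v) \<in> B" "nrm (\<lambda>v. \<Sum>n. \<phi>s n v) \<le> suminf a"
proof -
  have 0: "0 \<le> a n" for n using assms(1,2) nrm_nonneg order_trans by blast
  have "uniform_limit UNIV (\<lambda>N v. \<Sum>n<N. \<phi>s n v) (\<lambda>v. \<Sum>n. \<phi>s n v) sequentially"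
    by (rule Weierstrass_m_test[OF _ assms(3)]) (use assms eval_le order_trans in blast)
  moreover have "nrm (\<lambda>v. \<Sum>n<N. \<phi>s n v) \<le> suminf a" for N
  proof -
    have "nrm (\<lambda>v. \<Sum>n<N. \<phi>s n v) \<le> (\<Sum>n<N. nrm (\<phi>s n))" by (rule nrm_sum) (rule assms)
    also have "\<dots> \<le> (\<Sum>n<N. a n)" by (rule sum_mono) (rule assms)
    also have "\<dots> \<le> suminf a" by (rule sum_le_suminf) (use assms 0 in auto)
    finally show ?thesis .
  qed
  ultimately show "(\<lambda>v. \<Sum>n. \<phi>s n v) \<in> B" "nrm (\<lambda>v. \<Sum>n. \<phi>s n v) \<le> suminf a"
    using limit_nrm_le[of "\<lambda>N v. \<Sum>n<N. \<phi>s n v" "suminf a" "\<lambda>v. \<Sum>n. \<phi>s n v"] sum_mem assms(1)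
    by auto
qed

section \<open>Holomorphic families with values in the function space\<close>

lemma bounded_family_lipschitz:
  assumes "\<And>z. z \<in> ball c r \<Longrightarrow> F z \<in> B" "\<And>z. z \<in> ball c r \<Longrightarrow> nrm (F z) \<le> M"
    and "\<And>v. (\<lambda>z. F z v) holomorphic_on ball c r"
    and "x \<in> ball c (r/2)" "y \<in> ball c (r/2)"
  shows "nrm (\<lambda>v. F x v - F y v) \<le> 4 * M / r * cmod (x - y)"
proof -
  have "x \<in> ball c r" "y \<in> ball c r"
    using assms(4,5) zero_le_dist[of c x] by (auto simp del: zero_le_dist)
  then have mem: "(\<lambda>v. F x v - F y v) \<in> B" using assms(1) diff_mem by blast
  show ?thesis
  proof (rule nrm_leI[OF mem])
    fix a b e u v w
    assume *: "\<And>\<psi>. \<psi> \<in> B \<Longrightarrow> cmod (a * \<psi> u + b * \<psi> v + e * \<psi> w) \<le> nrm \<psi>"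
    have "cmod ((\<lambda>z. a * F z u + b * F z v + e * F z w) x - (\<lambda>z. a * F z u + b * F z v + e * F z w) y)
        \<le> 4 * M / r * cmod (x - y)"
      by (rule bounded_holomorphic_lipschitz)
        (use assms * order_trans in \<open>auto intro!: holomorphic_intros, blast\<close>)
    then show "cmod (a * (F x u - F y u) + b * (F x v - F y v) + e * (F x w - F y w))
        \<le> 4 * M / r * cmod (x - y)" by (simp add: algebra_simps)
  qed
qed

text \<open>The derivative is defined pointwise, so its membership in the space has to be shown:
  difference quotients along a null sequence are bounded in norm by \<open>4 * M / r\<close> and
  converge uniformly. The quadratic estimate for the norming functionals then gives the rate in
  norm.\<close>

lemma bounded_family_derivative:
  assumes r: "r > 0" and F: "\<And>z. z \<in> ball c r \<Longrightarrow> F z \<in> B" "\<And>z. z \<in> ball c r \<Longrightarrow> nrm (F z) \<le> M"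
    and hol: "\<And>v. (\<lambda>z. F z v) holomorphic_on ball c r"
  defines "D \<equiv> \<lambda>v. deriv (\<lambda>z. F z v) c"
  shows "D \<in> B" "nrm D \<le> 4 * M / r"
    and "h \<noteq> 0 \<Longrightarrow> cmod h < r/4 \<Longrightarrow>
      nrm (\<lambda>v. (F (c + h) v - F c v) / h - D v) \<le> 32 * M / r^2 * cmod h"
proof -
  have q: "(\<lambda>v. (F (c + h) v - F c v) / h) \<in> B" "nrm (\<lambda>v. (F (c + h) v - F c v) / h) \<le> 4 * M / r"
    if "h \<noteq> 0" "cmod h < r/4" for h
  proof -
    have in1: "c + h \<in> ball c (r/2)" "c \<in> ball c (r/2)" using that r by (auto simp: dist_norm)
    have in2: "c + h \<in> ball c r" "c \<in> ball c r" using that r by (auto simp: dist_norm)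
    have d: "(\<lambda>v. F (c + h) v - F c v) \<in> B" using F in2 by (intro diff_mem) auto
    then show "(\<lambda>v. (F (c + h) v - F c v) / h) \<in> B"
      using scale_mem[OF d, of "1/h"] by (simp add: field_simps)
    have "nrm (\<lambda>v. F (c + h) v - F c v) \<le> 4 * M / r * cmod h"
      using bounded_family_lipschitz[OF F hol in1] by simp
    then have "nrm (\<lambda>v. 1/h * (F (c + h) v - F c v)) \<le> cmod (1/h) * (4 * M / r * cmod h)"
      by (rule nrm_le_scaleI[OF d])
    then show "nrm (\<lambda>v. (F (c + h) v - F c v) / h) \<le> 4 * M / r"
      using that by (simp add: norm_divide field_simps)
  qed
  have pt: "cmod (a * ((F (c + h) u - F c u) / h - D u) + b * ((F (c + h) v - F c v) / h - D v)
        + e * ((F (c + h) w - F c w) / h - D w)) \<le> 32 * M / r^2 * cmod h"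
    if *: "\<And>\<psi>. \<psi> \<in> B \<Longrightarrow> cmod (a * \<psi> u + b * \<psi> v + e * \<psi> w) \<le> nrm \<psi>"
      and h: "h \<noteq> 0" "cmod h < r/4" for a b e u v w h
  proof -
    define f where "f = (\<lambda>z. a * F z u + b * F z v + e * F z w)"
    have dF: "((\<lambda>z. F z x) has_field_derivative D x) (at c)" for x
      unfolding D_def using hol[of x] r by (meson centre_in_ball holomorphic_derivI open_ball)
    have "(f has_field_derivative a * D u + b * D v + e * D w) (at c)"
      unfolding f_def by (auto intro!: derivative_eq_intros dF)
    then have df: "deriv f c = a * D u + b * D v + e * D w" by (rule DERIV_imp_deriv)
    have "cmod (f (c + h) - f c - h * deriv f c) \<le> 32 * M / r^2 * (cmod h)^2"
    proof (rule bounded_holomorphic_taylor[OF _ _ h(2)])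
      show "f holomorphic_on ball c r" unfolding f_def by (intro holomorphic_intros hol)
      show "cmod (f z) \<le> M" if "z \<in> ball c r" for z
        unfolding f_def using * F that order_trans by blast
    qed
    moreover have "f (c + h) - f c - h * deriv f c =
        h * (a * ((F (c + h) u - F c u) / h - D u) + b * ((F (c + h) v - F c v) / h - D v)
        + e * ((F (c + h) w - F c w) / h - D w))"
      unfolding df using h by (simp add: f_def field_simps)
    ultimately have "cmod h * cmod (a * ((F (c + h) u - F c u) / h - D u)
        + b * ((F (c + h) v - F c v) / h - D v) + e * ((F (c + h) w - F c w) / h - D w))
        \<le> cmod h * (32 * M / r^2 * cmod h)"
      by (simp add: norm_mult power2_eq_square mult_ac)
    then show ?thesis by (rule mult_left_le_imp_le) (use h(1) in simp)
  qed
  define hs where "hs = (\<lambda>n. of_real (r / 8 / real (Suc n)) :: complex)"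
  have hs: "hs n \<noteq> 0" "cmod (hs n) < r/4" for n
  proof -
    show "hs n \<noteq> 0" using r unfolding hs_def by (simp del: of_nat_Suc)
    have "r / 8 / real (Suc n) \<le> r / 8 / 1" using r by (intro divide_left_mono) auto
    then have "r / 8 / real (Suc n) < r / 4" using r by linarith
    moreover have "0 \<le> r / 8 / real (Suc n)" using r by simp
    ultimately show "cmod (hs n) < r/4" unfolding hs_def norm_of_real by linarith
  qed
  have hs0: "hs \<longlonglongrightarrow> 0"
    unfolding hs_def using LIMSEQ_Suc[OF lim_const_over_n[of "of_real (r/8) :: complex"]] by simp
  \<comment> \<open>A single evaluation is one of the functionals bounded by the norm, so
    \<open>pt\<close> applies with a bound that is uniform in \<open>v\<close>.\<close>
  have ev: "cmod ((F (c + h) v - F c v) / h - D v) \<le> 32 * M / r^2 * cmod h"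
    if "h \<noteq> 0" "cmod h < r/4" for h v
    using pt[of 1 v 0 v 0 v h] that eval_le by simp
  have ul: "uniform_limit UNIV (\<lambda>n v. (F (c + hs n) v - F c v) / hs n) D sequentially"
  proof (rule uniform_limitI)
    fix \<epsilon> :: real assume "\<epsilon> > 0"
    have "(\<lambda>n. 32 * M / r^2 * cmod (hs n)) \<longlonglongrightarrow> 32 * M / r^2 * cmod 0"
      by (intro tendsto_intros hs0)
    then have "\<forall>\<^sub>F n in sequentially. 32 * M / r^2 * cmod (hs n) < \<epsilon>"
      using \<open>\<epsilon> > 0\<close> by (intro order_tendstoD) auto
    then show "\<forall>\<^sub>F n in sequentially. \<forall>x\<in>UNIV. dist ((F (c + hs n) x - F c x) / hs n) (D x) < \<epsilon>"
      by eventually_elim (use ev[OF hs] in \<open>auto simp: dist_norm intro: le_less_trans\<close>)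
  qed
  show D: "D \<in> B" "nrm D \<le> 4 * M / r"
    using limit_nrm_le[OF _ _ ul, of "4 * M / r"] q hs by auto
  show "nrm (\<lambda>v. (F (c + h) v - F c v) / h - D v) \<le> 32 * M / r^2 * cmod h"
    if h: "h \<noteq> 0" "cmod h < r/4"
    by (rule nrm_leI) (use q(1)[OF h] D(1) pt h in \<open>auto intro: diff_mem\<close>)
qed

section \<open>Linear maps and functionals with explicit bounds\<close>

definition linear_on :: "(('a \<Rightarrow> complex) \<Rightarrow> 'a \<Rightarrow> complex) \<Rightarrow> bool" where
  "linear_on A \<longleftrightarrow> (\<forall>\<phi>\<in>B. A \<phi> \<in> B) \<and>
     (\<forall>\<phi>\<in>B. \<forall>\<psi>\<in>B. A (\<lambda>v. \<phi> v + \<psi> v) = (\<lambda>v. A \<phi> v + A \<psi> v)) \<and>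
     (\<forall>c. \<forall>\<phi>\<in>B. A (\<lambda>v. c * \<phi> v) = (\<lambda>v. c * A \<phi> v))"

definition functional_on :: "(('a \<Rightarrow> complex) \<Rightarrow> complex) \<Rightarrow> real \<Rightarrow> bool" where
  "functional_on f K \<longleftrightarrow>
     (\<forall>\<phi>\<in>B. \<forall>\<psi>\<in>B. f (\<lambda>v. \<phi> v + \<psi> v) = f \<phi> + f \<psi>) \<and>
     (\<forall>c. \<forall>\<phi>\<in>B. f (\<lambda>v. c * \<phi> v) = c * f \<phi>) \<and> (\<forall>\<phi>\<in>B. cmod (f \<phi>) \<le> K * nrm \<phi>)"

lemma linear_onD:
  assumes "linear_on A" "\<phi> \<in> B" "\<psi> \<in> B"
  shows "A \<phi> \<in> B" "A (\<lambda>v. \<phi> v + \<psi> v) = (\<lambda>v. A \<phi> v + A \<psi> v)" "A (\<lambda>v. c * \<phi> v) = (\<lambda>v. c * A \<phi> v)"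
  using assms unfolding linear_on_def by auto

lemma linear_on_diff:
  assumes "linear_on A" "\<phi> \<in> B" "\<psi> \<in> B"
  shows "A (\<lambda>v. \<phi> v - \<psi> v) = (\<lambda>v. A \<phi> v - A \<psi> v)"
  using linear_onD(2)[OF assms(1,2), of "\<lambda>v. - 1 * \<psi> v"] linear_onD(3)[OF assms(1,3,3), of "-1"]
    scale_mem[OF assms(3), of "-1"] by simp

lemma linear_on_zero: "linear_on A \<Longrightarrow> A (\<lambda>v. 0) = (\<lambda>v. 0)"
  using linear_onD(3)[of A "\<lambda>_. 0" "\<lambda>_. 0" 0] zero_mem by simp

lemma linear_on_funpow: "linear_on A \<Longrightarrow> linear_on (A ^^ n)"
  by (induction n) (auto simp: linear_on_def)

lemma bounded_opI:
  "linear_on A \<Longrightarrow> (\<And>\<phi>. \<phi> \<in> B \<Longrightarrow> nrm (A \<phi>) \<le> C * nrm \<phi>) \<Longrightarrow> bounded_op B nrm A"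
  unfolding bounded_op_def linear_on_def by blast

lemma functional_on_eval: "functional_on (\<lambda>\<phi>. \<phi> v) 1"
  unfolding functional_on_def by (auto simp: eval_le)

lemma functional_on_op_eval:
  "linear_on A \<Longrightarrow> (\<And>\<phi>. \<phi> \<in> B \<Longrightarrow> nrm (A \<phi>) \<le> C * nrm \<phi>) \<Longrightarrow> functional_on (\<lambda>\<phi>. A \<phi> v) C"
  unfolding functional_on_def using linear_onD[of A] eval_le[of "A _" v]
  by (auto intro: order_trans[OF eval_le])

lemma functional_onD:
  assumes "functional_on f K" "\<phi> \<in> B" "\<psi> \<in> B"
  shows "f (\<lambda>v. \<phi> v + \<psi> v) = f \<phi> + f \<psi>" "f (\<lambda>v. c * \<phi> v) = c * f \<phi>"
    "cmod (f \<phi>) \<le> K * nrm \<phi>"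
  using assms unfolding functional_on_def by auto

lemma functional_on_zero: "functional_on f K \<Longrightarrow> f (\<lambda>_. 0) = 0"
  using functional_onD(2)[of f K "\<lambda>_. 0" "\<lambda>_. 0" 0] zero_mem by simp

lemma functional_on_sum:
  "functional_on f K \<Longrightarrow> (\<And>n. n < (N::nat) \<Longrightarrow> \<phi>s n \<in> B) \<Longrightarrow>
    f (\<lambda>v. \<Sum>n<N. \<phi>s n v) = (\<Sum>n<N. f (\<phi>s n))"
proof (induction N)
  case (Suc N)
  have "f (\<lambda>v. (\<Sum>n<N. \<phi>s n v) + \<phi>s N v) = f (\<lambda>v. \<Sum>n<N. \<phi>s n v) + f (\<phi>s N)"
    using Suc.prems sum_mem[of N \<phi>s] unfolding functional_on_def by auto
  then show ?case using Suc by simp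
qed (simp add: functional_on_zero)

text \<open>Additivity covers the finite sums. The tail of the series is itself an element of the
  space, with norm at most the tail of \<open>a\<close>, so boundedness of \<open>f\<close> makes
  its value tend to zero.\<close>

lemma functional_on_series:
  assumes f: "functional_on f K"
    and "\<And>n. \<phi>s n \<in> B" "\<And>n. nrm (\<phi>s n) \<le> a n" "summable a"
  shows "(\<lambda>n. f (\<phi>s n)) sums f (\<lambda>v. \<Sum>n. \<phi>s n v)"
proof -
  let ?s = "\<lambda>v. \<Sum>n. \<phi>s n v"
  have s: "?s \<in> B" by (rule series_mem[OF assms(2-4)])
  have sm: "summable (\<lambda>n. \<phi>s n v)" for v
    by (rule summable_comparison_test'[OF assms(4), of 0]) (use assms eval_le order_trans in blast)
  have tail: "cmod (f ?s - (\<Sum>n<N. f (\<phi>s n))) \<le> \<bar>K\<bar> * (\<Sum>n. a (n + N))" for N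
  proof -
    have p: "(\<lambda>v. \<Sum>n<N. \<phi>s n v) \<in> B" by (rule sum_mem) (rule assms)
    have sa: "summable (\<lambda>n. a (n + N))" using assms(4) by (simp add: summable_iff_shift)
    have t: "(\<lambda>v. \<Sum>n. \<phi>s (n + N) v) \<in> B" "nrm (\<lambda>v. \<Sum>n. \<phi>s (n + N) v) \<le> (\<Sum>n. a (n + N))"
      using series_mem[of "\<lambda>n. \<phi>s (n + N)" "\<lambda>n. a (n + N)"] assms sa by auto
    have "?s = (\<lambda>v. (\<Sum>n. \<phi>s (n + N) v) + (\<Sum>n<N. \<phi>s n v))"
      using suminf_split_initial_segment[OF sm] by auto
    then have "f ?s = f (\<lambda>v. \<Sum>n. \<phi>s (n + N) v) + f (\<lambda>v. \<Sum>n<N. \<phi>s n v)"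
      using f p t unfolding functional_on_def by auto
    then have "f ?s - (\<Sum>n<N. f (\<phi>s n)) = f (\<lambda>v. \<Sum>n. \<phi>s (n + N) v)"
      using functional_on_sum[OF f, of N \<phi>s] assms(2) by simp
    also have "cmod \<dots> \<le> K * nrm (\<lambda>v. \<Sum>n. \<phi>s (n + N) v)"
      using f t unfolding functional_on_def by auto
    also have "\<dots> \<le> \<bar>K\<bar> * nrm (\<lambda>v. \<Sum>n. \<phi>s (n + N) v)"
      by (rule mult_right_mono) (use nrm_nonneg t in auto)
    also have "\<dots> \<le> \<bar>K\<bar> * (\<Sum>n. a (n + N))" by (rule mult_left_mono) (use t in auto)
    finally show ?thesis .
  qed
  have "(\<lambda>N. \<bar>K\<bar> * (\<Sum>n. a (n + N))) \<longlonglongrightarrow> \<bar>K\<bar> * 0"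
    by (intro tendsto_intros suminf_exist_split2 assms)
  then have "(\<lambda>N. \<bar>K\<bar> * (\<Sum>n. a (n + N))) \<longlonglongrightarrow> 0" by simp
  then have "(\<lambda>N. f ?s - (\<Sum>n<N. f (\<phi>s n))) \<longlonglongrightarrow> 0"
    by (rule Lim_null_comparison[rotated]) (use tail in auto)
  then have "(\<lambda>N. f ?s - (f ?s - (\<Sum>n<N. f (\<phi>s n)))) \<longlonglongrightarrow> f ?s - 0" by (intro tendsto_intros)
  then show ?thesis unfolding sums_def by simp
qed

lemma op_norm_le:
  assumes "\<And>\<phi>. \<phi> \<in> B \<Longrightarrow> A \<phi> \<in> B" "\<And>\<phi>. \<phi> \<in> B \<Longrightarrow> nrm (A \<phi>) \<le> C * nrm \<phi>" "0 \<le> C"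
  shows "0 \<le> op_norm B nrm A" "op_norm B nrm A \<le> C"
proof -
  have le: "nrm (A \<phi>) / nrm \<phi> \<le> C" if "\<phi> \<in> B" for \<phi>
    using assms(2)[OF that] assms(3) nrm_nonneg[OF that]
    by (cases "nrm \<phi> = 0") (auto simp: divide_simps)
  show "op_norm B nrm A \<le> C"
    unfolding op_norm_def by (rule cSUP_least) (use zero_mem le in auto)
  \<comment> \<open>The zero function takes part in the supremum; its quotient is zero by the
    convention for division by zero.\<close>
  have "0 \<le> nrm (A (\<lambda>_. 0)) / nrm (\<lambda>_. 0)" by (simp add: nrm_zero)
  also have "\<dots> \<le> op_norm B nrm A"
    unfolding op_norm_def by (rule cSUP_upper) (use zero_mem le in \<open>auto intro!: bdd_aboveI2\<close>)
  finally show "0 \<le> op_norm B nrm A" .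
qed

text \<open>Cauchy's estimates, applied to the norming functionals, turn pointwise holomorphy and
  boundedness into differentiability in operator norm.\<close>

lemma op_analytic_onI:
  assumes U: "open U" and lin: "\<And>z. z \<in> U \<Longrightarrow> linear_on (F z)"
    and bd: "\<And>z \<phi>. z \<in> U \<Longrightarrow> \<phi> \<in> B \<Longrightarrow> nrm (F z \<phi>) \<le> C * nrm \<phi>"
    and hol: "\<And>\<phi> v. \<phi> \<in> B \<Longrightarrow> (\<lambda>z. F z \<phi> v) holomorphic_on U"
  shows "op_analytic_on B nrm F U"
  unfolding op_analytic_on_def
proof (intro conjI ballI)
  show "bounded_op B nrm (F z)" if "z \<in> U" for z using bounded_opI lin bd that by blast
  fix c assume "c \<in> U"
  then obtain r where r: "r > 0" "ball c r \<subseteq> U" using U openE by blast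
  \<comment> \<open>The candidate for the operator derivative is pointwise; it is linear by
    uniqueness of derivatives and bounded by \<open>fam\<close>.\<close>
  define D where "D = (\<lambda>\<phi> v. deriv (\<lambda>z. F z \<phi> v) c)"
  have der: "((\<lambda>z. F z \<phi> v) has_field_derivative D \<phi> v) (at c)" if "\<phi> \<in> B" for \<phi> v
    unfolding D_def using hol[OF that] U \<open>c \<in> U\<close> by (metis holomorphic_derivI)
  note fam = bounded_family_derivative[OF r(1), where F = "\<lambda>z. F z \<phi>" and c = c for \<phi>]
  have cond: "\<And>z. z \<in> ball c r \<Longrightarrow> F z \<phi> \<in> B" "\<And>z. z \<in> ball c r \<Longrightarrow> nrm (F z \<phi>) \<le> C * nrm \<phi>"
    "\<And>v. (\<lambda>z. F z \<phi> v) holomorphic_on ball c r" if "\<phi> \<in> B" for \<phi>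
    using r lin bd hol that linear_onD(1) by (blast intro: holomorphic_on_subset)+
  have Dlin: "linear_on D"
    unfolding linear_on_def
  proof (intro conjI ballI allI)
    show "D \<phi> \<in> B" if "\<phi> \<in> B" for \<phi>
      using fam(1)[OF cond[OF that]] unfolding D_def by simp
    fix \<phi> assume \<phi>: "\<phi> \<in> B"
    show "D (\<lambda>v. \<phi> v + \<psi> v) = (\<lambda>v. D \<phi> v + D \<psi> v)" if \<psi>: "\<psi> \<in> B" for \<psi>
    proof
      fix v
      have "((\<lambda>z. F z \<phi> v + F z \<psi> v) has_field_derivative D \<phi> v + D \<psi> v) (at c)"
        by (intro derivative_intros der \<phi> \<psi>)
      then have "((\<lambda>z. F z (\<lambda>v. \<phi> v + \<psi> v) v) has_field_derivative D \<phi> v + D \<psi> v) (at c)"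
        by (rule has_field_derivative_transform_within_open[OF _ U \<open>c \<in> U\<close>])
          (simp add: linear_onD(2)[OF lin \<phi> \<psi>])
      then show "D (\<lambda>v. \<phi> v + \<psi> v) v = D \<phi> v + D \<psi> v"
        unfolding D_def by (rule DERIV_imp_deriv)
    qed
    show "D (\<lambda>v. a * \<phi> v) = (\<lambda>v. a * D \<phi> v)" for a
    proof
      fix v
      have "((\<lambda>z. a * F z \<phi> v) has_field_derivative a * D \<phi> v) (at c)"
        by (auto intro!: derivative_eq_intros der \<phi>)
      then have "((\<lambda>z. F z (\<lambda>v. a * \<phi> v) v) has_field_derivative a * D \<phi> v) (at c)"
        by (rule has_field_derivative_transform_within_open[OF _ U \<open>c \<in> U\<close>])
          (simp add: linear_onD(3)[OF lin \<phi> \<phi>])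
      then show "D (\<lambda>v. a * \<phi> v) v = a * D \<phi> v"
        unfolding D_def by (rule DERIV_imp_deriv)
    qed
  qed
  have Dbd: "nrm (D \<phi>) \<le> 4 * C / r * nrm \<phi>" if "\<phi> \<in> B" for \<phi>
    using fam(2)[OF cond[OF that]] unfolding D_def by simp
  have "((\<lambda>h. op_norm B nrm (\<lambda>\<phi> v. (F (c + h) \<phi> v - F c \<phi> v) / h - D \<phi> v)) \<longlongrightarrow> 0) (at 0)"
  proof (rule Lim_null_comparison)
    have e: "\<forall>\<^sub>F h in at (0::complex). h \<noteq> 0 \<and> cmod h < r/4"
      unfolding eventually_at using r by (intro exI[of _ "r/4"]) (auto simp: dist_norm)
    show "\<forall>\<^sub>F h in at 0. norm (op_norm B nrm (\<lambda>\<phi> v. (F (c + h) \<phi> v - F c \<phi> v) / h - D \<phi> v))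
        \<le> 32 * \<bar>C\<bar> / r^2 * cmod h"
      using e
    proof eventually_elim
      case (elim h)
      let ?A = "\<lambda>\<phi> v. (F (c + h) \<phi> v - F c \<phi> v) / h - D \<phi> v"
      have "c + h \<in> ball c r" "c \<in> ball c r" using elim r by (auto simp: dist_norm)
      then have mem: "?A \<phi> \<in> B" if "\<phi> \<in> B" for \<phi>
        using scale_mem[OF diff_mem[of "F (c + h) \<phi>" "F c \<phi>"], of "1/h"] cond(1)[OF that]
          linear_onD(1)[OF Dlin that] that by (intro diff_mem) auto
      have nb: "nrm (?A \<phi>) \<le> 32 * \<bar>C\<bar> / r^2 * cmod h * nrm \<phi>" if "\<phi> \<in> B" for \<phi>
      proof -
        have "nrm (?A \<phi>) \<le> 32 * (C * nrm \<phi>) / r^2 * cmod h"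
          using fam(3)[OF cond[OF that]] elim unfolding D_def by simp
        also have "\<dots> = C * (32 * nrm \<phi> / r^2 * cmod h)" by simp
        also have "\<dots> \<le> \<bar>C\<bar> * (32 * nrm \<phi> / r^2 * cmod h)"
          by (rule mult_right_mono) (use nrm_nonneg[OF that] in auto)
        finally show ?thesis by (simp add: mult_ac)
      qed
      show ?case using op_norm_le[OF mem nb] by simp
    qed
    have "((\<lambda>h. 32 * \<bar>C\<bar> / r^2 * cmod h) \<longlongrightarrow> 32 * \<bar>C\<bar> / r^2 * cmod 0) (at 0)"
      by (intro tendsto_intros)
    then show "((\<lambda>h. 32 * \<bar>C\<bar> / r^2 * cmod h) \<longlongrightarrow> 0) (at 0)" by simp
  qed
  then show "\<exists>D. bounded_op B nrm D \<and>
      ((\<lambda>h. op_norm B nrm (\<lambda>\<phi> v. (F (c + h) \<phi> v - F c \<phi> v) / h - D \<phi> v)) \<longlongrightarrow> 0) (at 0)"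
    using bounded_opI[OF Dlin Dbd] by blast
qed

end

section \<open>The Neumann series of the resolvent\<close>

context function_space begin

context
  fixes X :: "('a \<Rightarrow> complex) \<Rightarrow> 'a \<Rightarrow> complex" and C t :: real and w :: complex
  assumes lin: "linear_on X"
    and bd: "\<forall>n. \<forall>\<phi>\<in>B. nrm ((X ^^ n) \<phi>) \<le> C * t ^ n * nrm \<phi>"
    and t: "0 \<le> t" "t < cmod w"
begin

lemma resolvent_terms:
  assumes "\<phi> \<in> B"
  shows "(\<lambda>v. (X ^^ n) \<phi> v / w ^ Suc n) \<in> B"
    and "nrm (\<lambda>v. (X ^^ n) \<phi> v / w ^ Suc n) \<le> C * nrm \<phi> / cmod w * (t / cmod w) ^ n"
    and "(\<lambda>n. C * nrm \<phi> / cmod w * (t / cmod w) ^ n) sums (C * nrm \<phi> / (cmod w - t))"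
proof -
  have m: "(X ^^ n) \<phi> \<in> B" using linear_onD(1)[OF linear_on_funpow[OF lin] assms assms] .
  have e: "(\<lambda>v. (X ^^ n) \<phi> v / w ^ Suc n) = (\<lambda>v. 1 / w ^ Suc n * (X ^^ n) \<phi> v)" by simp
  show "(\<lambda>v. (X ^^ n) \<phi> v / w ^ Suc n) \<in> B" unfolding e by (rule scale_mem[OF m])
  have "nrm (\<lambda>v. 1 / w ^ Suc n * (X ^^ n) \<phi> v) \<le> cmod (1 / w ^ Suc n) * (C * t ^ n * nrm \<phi>)"
    by (rule nrm_le_scaleI[OF m bd[rule_format, OF assms]])
  then show "nrm (\<lambda>v. (X ^^ n) \<phi> v / w ^ Suc n) \<le> C * nrm \<phi> / cmod w * (t / cmod w) ^ n"
    unfolding e by (simp add: norm_divide norm_mult norm_power power_divide mult_ac)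
  have "(\<lambda>n. (t / cmod w) ^ n) sums (1 / (1 - t / cmod w))"
    by (rule geometric_sums) (use t in \<open>auto simp: divide_simps\<close>)
  then have "(\<lambda>n. C * nrm \<phi> / cmod w * (t / cmod w) ^ n) sums
      (C * nrm \<phi> / cmod w * (1 / (1 - t / cmod w)))" by (rule sums_mult)
  moreover have "C * nrm \<phi> / cmod w * (1 / (1 - t / cmod w)) = C * nrm \<phi> / (cmod w - t)"
    using t by (auto simp: field_simps)
  ultimately show "(\<lambda>n. C * nrm \<phi> / cmod w * (t / cmod w) ^ n) sums (C * nrm \<phi> / (cmod w - t))"
    by (simp only:)
qed

lemma resolvent_series_mem:
  assumes "\<phi> \<in> B"
  shows "resolvent_series X w \<phi> \<in> B" "nrm (resolvent_series X w \<phi>) \<le> C / (cmod w - t) * nrm \<phi>"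
  using series_mem[OF resolvent_terms(1,2)[OF assms] sums_summable[OF resolvent_terms(3)[OF assms]]]
    sums_unique[OF resolvent_terms(3)[OF assms]]
  unfolding resolvent_series_def[abs_def] by auto

text \<open>Bounded functionals pass through the series. This is applied to evaluations, to
  \<open>X\<close> followed by an evaluation, and later to the stationary functional.\<close>

lemma functional_resolvent_series:
  assumes "functional_on f K" "\<phi> \<in> B"
  shows "(\<lambda>n. f ((X ^^ n) \<phi>) / w ^ Suc n) sums f (resolvent_series X w \<phi>)"
proof -
  have "(\<lambda>n. f (\<lambda>v. (X ^^ n) \<phi> v / w ^ Suc n)) sums f (resolvent_series X w \<phi>)"
    unfolding resolvent_series_def[abs_def]
    by (rule functional_on_series[OF assms(1) resolvent_terms(1,2)[OF assms(2)]
          sums_summable[OF resolvent_terms(3)[OF assms(2)]]])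
  moreover have "f (\<lambda>v. (X ^^ n) \<phi> v / w ^ Suc n) = f ((X ^^ n) \<phi>) / w ^ Suc n" for n
  proof -
    have m: "(X ^^ n) \<phi> \<in> B" using linear_onD(1)[OF linear_on_funpow[OF lin] assms(2,2)] .
    show ?thesis using functional_onD(2)[OF assms(1) m m, of "1 / w ^ Suc n"] by simp
  qed
  ultimately show ?thesis by simp
qed

text \<open>The series inverts \<open>w - X\<close> from both sides. In each case the sum of the
  terms \<open>(X ^^ Suc n) \<phi> v / w ^ Suc n\<close> is evaluated twice: by shifting the index,
  and by moving the additional \<open>X\<close> out of the sum or into the argument.\<close>

lemma resolvent_series_eq:
  assumes "\<phi> \<in> B"
  shows "X (resolvent_series X w \<phi>) = (\<lambda>v. w * resolvent_series X w \<phi> v - \<phi> v)"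
    and "resolvent_series X w (X \<phi>) = (\<lambda>v. w * resolvent_series X w \<phi> v - \<phi> v)"
proof -
  have w0: "w \<noteq> 0" using t by auto
  have s: "(\<lambda>n. (X ^^ n) \<phi> v / w ^ Suc n) sums resolvent_series X w \<phi> v" for v
    using functional_resolvent_series[OF functional_on_eval assms] .
  have "(\<lambda>n. w * ((X ^^ n) \<phi> v / w ^ Suc n)) sums (w * resolvent_series X w \<phi> v)" for v
    by (rule sums_mult[OF s])
  then have "(\<lambda>n. (X ^^ n) \<phi> v / w ^ n) sums (w * resolvent_series X w \<phi> v)" for v
    using w0 by simp
  then have s1: "(\<lambda>n. (X ^^ Suc n) \<phi> v / w ^ Suc n) sums (w * resolvent_series X w \<phi> v - \<phi> v)" for v
    by (subst sums_Suc_iff) simp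
  have bX: "nrm (X \<phi>) \<le> C * t * nrm \<phi>" if "\<phi> \<in> B" for \<phi> using bd[rule_format, OF that, of 1] by simp
  have "(\<lambda>n. X ((X ^^ n) \<phi>) v / w ^ Suc n) sums X (resolvent_series X w \<phi>) v" for v
    using functional_resolvent_series[OF functional_on_op_eval[OF lin bX] assms] .
  then have "(\<lambda>n. (X ^^ Suc n) \<phi> v / w ^ Suc n) sums X (resolvent_series X w \<phi>) v" for v by simp
  then have "X (resolvent_series X w \<phi>) v = w * resolvent_series X w \<phi> v - \<phi> v" for v
    using s1 by (rule sums_unique2)
  then show "X (resolvent_series X w \<phi>) = (\<lambda>v. w * resolvent_series X w \<phi> v - \<phi> v)" by auto
  have "(\<lambda>n. (X ^^ n) (X \<phi>) v / w ^ Suc n) sums resolvent_series X w (X \<phi>) v" for v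
    using functional_resolvent_series[OF functional_on_eval linear_onD(1)[OF lin assms assms]] .
  then have "(\<lambda>n. (X ^^ Suc n) \<phi> v / w ^ Suc n) sums resolvent_series X w (X \<phi>) v" for v
    by (simp add: funpow_swap1)
  then have "resolvent_series X w (X \<phi>) v = w * resolvent_series X w \<phi> v - \<phi> v" for v
    using s1 by (rule sums_unique2)
  then show "resolvent_series X w (X \<phi>) = (\<lambda>v. w * resolvent_series X w \<phi> v - \<phi> v)" by auto
qed

lemma linear_on_resolvent_series: "linear_on (resolvent_series X w)"
  unfolding linear_on_def
proof (intro conjI ballI allI)
  show "resolvent_series X w \<phi> \<in> B" if "\<phi> \<in> B" for \<phi> using resolvent_series_mem that by blast
  have s: "(\<lambda>n. (X ^^ n) \<phi> v / w ^ Suc n) sums resolvent_series X w \<phi> v" if "\<phi> \<in> B" for \<phi> v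
    using functional_resolvent_series[OF functional_on_eval that] .
  note l = linear_onD[OF linear_on_funpow[OF lin]]
  fix \<phi> assume \<phi>: "\<phi> \<in> B"
  show "resolvent_series X w (\<lambda>v. \<phi> v + \<psi> v) = (\<lambda>v. resolvent_series X w \<phi> v + resolvent_series X w \<psi> v)"
    if \<psi>: "\<psi> \<in> B" for \<psi>
  proof
    fix v
    show "resolvent_series X w (\<lambda>v. \<phi> v + \<psi> v) v = resolvent_series X w \<phi> v + resolvent_series X w \<psi> v"
      using sums_add[OF s[OF \<phi>] s[OF \<psi>], of v v] s[OF add_mem[OF \<phi> \<psi>], of v]
      by (simp add: l(2)[OF \<phi> \<psi>] add_divide_distrib sums_unique2)
  qed
  show "resolvent_series X w (\<lambda>v. c * \<phi> v) = (\<lambda>v. c * resolvent_series X w \<phi> v)" for c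
  proof
    fix v
    show "resolvent_series X w (\<lambda>v. c * \<phi> v) v = c * resolvent_series X w \<phi> v"
      using sums_mult[OF s[OF \<phi>], of c v] s[OF scale_mem[OF \<phi>], of c v]
      by (simp add: l(3)[OF \<phi> \<phi>] sums_unique2)
  qed
qed

text \<open>\<open>op_spectrum\<close> refers to the inverse of \<open>X - w\<close>, whence the
  sign in front of the resolvent series.\<close>

lemma not_in_op_spectrum: "w \<notin> op_spectrum B nrm X"
proof -
  let ?S = "resolvent_series X w"
  let ?T = "\<lambda>\<phi> v. - 1 * ?S \<phi> v"
  note S = linear_onD[OF linear_on_resolvent_series]
  have "linear_on ?T"
    unfolding linear_on_def using S scale_mem[OF S(1), where c = "-1"]
    by (auto simp: algebra_simps)
  moreover have "nrm (?T \<phi>) \<le> C / (cmod w - t) * nrm \<phi>" if "\<phi> \<in> B" for \<phi>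
    using nrm_le_scaleI[OF resolvent_series_mem[OF that], of "-1"] by simp
  ultimately have "bounded_op B nrm ?T" by (rule bounded_opI)
  moreover have "?T (\<lambda>v. X \<phi> v - w * \<phi> v) = \<phi>" "(\<lambda>v. X (?T \<phi>) v - w * ?T \<phi> v) = \<phi>"
    if \<phi>: "\<phi> \<in> B" for \<phi>
  proof -
    have X\<phi>: "X \<phi> \<in> B" using linear_onD(1)[OF lin \<phi> \<phi>] .
    have "?S (\<lambda>v. X \<phi> v - w * \<phi> v) = (\<lambda>v. ?S (X \<phi>) v - w * ?S \<phi> v)"
      using linear_on_diff[OF linear_on_resolvent_series X\<phi> scale_mem[OF \<phi>]] S(3)[OF \<phi> \<phi>] by simp
    then show "?T (\<lambda>v. X \<phi> v - w * \<phi> v) = \<phi>" by (simp add: resolvent_series_eq(2)[OF \<phi>])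
    have "X (?T \<phi>) = (\<lambda>v. - 1 * X (?S \<phi>) v)" by (rule linear_onD(3)[OF lin S(1)[OF \<phi> \<phi>] \<phi>])
    then show "(\<lambda>v. X (?T \<phi>) v - w * ?T \<phi> v) = \<phi>" by (simp add: resolvent_series_eq(1)[OF \<phi>])
  qed
  ultimately show ?thesis unfolding op_spectrum_def by blast
qed

end

lemma op_spectral_radius_le:
  assumes "linear_on X" "\<And>n \<phi>. \<phi> \<in> B \<Longrightarrow> nrm ((X ^^ n) \<phi>) \<le> C * t ^ n * nrm \<phi>" "0 \<le> t"
  shows "op_spectral_radius B nrm X \<le> ereal t"
  unfolding op_spectral_radius_def
  by (rule SUP_least) (use not_in_op_spectrum[of X C t] assms in \<open>force simp: not_less[symmetric]\<close>)

end

section \<open>Formulas for the leading eigenvalue, eigenvector, eigenfunctional and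
  projection\<close>

definition deflation ::
  "(('a \<Rightarrow> complex) \<Rightarrow> 'a \<Rightarrow> complex) \<Rightarrow> (('a \<Rightarrow> complex) \<Rightarrow> complex) \<Rightarrow> ('a \<Rightarrow> complex) \<Rightarrow>
   ('a \<Rightarrow> complex) \<Rightarrow> 'a \<Rightarrow> complex" where
  "deflation T p e \<phi> v = T \<phi> v - p \<phi> * e v"

text \<open>If \<open>T h = w h\<close> and \<open>p h = 1\<close>, then
  \<open>w - deflation T p e\<close> maps \<open>h\<close> to \<open>e\<close>, so \<open>h\<close>
  is the resolvent series of \<open>e\<close>. Applying \<open>p\<close> and multiplying by
  \<open>w\<close> turns \<open>p h = 1\<close> into the fixed point equation of this map.\<close>

definition eigenvalue_map ::
  "(('a \<Rightarrow> complex) \<Rightarrow> 'a \<Rightarrow> complex) \<Rightarrow> (('a \<Rightarrow> complex) \<Rightarrow> complex) \<Rightarrow> ('a \<Rightarrow> complex) \<Rightarrow>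
   complex \<Rightarrow> complex" where
  "eigenvalue_map T p e w = (\<Sum>n. p ((deflation T p e ^^ n) e) / w ^ n)"

text \<open>The fixed point is written as a limit of iterates, started at the unperturbed
  eigenvalue. The iterates are holomorphic in the parameter, and uniform convergence passes this on
  to the limit.\<close>

definition lead_eigenvalue ::
  "(('a \<Rightarrow> complex) \<Rightarrow> 'a \<Rightarrow> complex) \<Rightarrow> (('a \<Rightarrow> complex) \<Rightarrow> complex) \<Rightarrow> ('a \<Rightarrow> complex) \<Rightarrow> complex" where
  "lead_eigenvalue T p e = lim (\<lambda>k. (eigenvalue_map T p e ^^ k) 1)"

definition lead_vector ::
  "(('a \<Rightarrow> complex) \<Rightarrow> 'a \<Rightarrow> complex) \<Rightarrow> (('a \<Rightarrow> complex) \<Rightarrow> complex) \<Rightarrow> ('a \<Rightarrow> complex) \<Rightarrow>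
   'a \<Rightarrow> complex" where
  "lead_vector T p e = resolvent_series (deflation T p e) (lead_eigenvalue T p e) e"

definition lead_functional ::
  "(('a \<Rightarrow> complex) \<Rightarrow> 'a \<Rightarrow> complex) \<Rightarrow> (('a \<Rightarrow> complex) \<Rightarrow> complex) \<Rightarrow> ('a \<Rightarrow> complex) \<Rightarrow>
   ('a \<Rightarrow> complex) \<Rightarrow> complex" where
  "lead_functional T p e \<phi> = p (resolvent_series (deflation T p e) (lead_eigenvalue T p e) \<phi>)"

text \<open>The vector is normalised by \<open>p\<close>, and the functional by its value at
  \<open>e\<close>. Their pairing is therefore only close to one, hence the quotient.\<close>

definition lead_projection ::
  "(('a \<Rightarrow> complex) \<Rightarrow> 'a \<Rightarrow> complex) \<Rightarrow> (('a \<Rightarrow> complex) \<Rightarrow> complex) \<Rightarrow> ('a \<Rightarrow> complex) \<Rightarrow>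
   ('a \<Rightarrow> complex) \<Rightarrow> 'a \<Rightarrow> complex" where
  "lead_projection T p e \<phi> v =
     lead_functional T p e \<phi> / lead_functional T p e (lead_vector T p e) * lead_vector T p e v"

definition spectral_remainder ::
  "(('a \<Rightarrow> complex) \<Rightarrow> 'a \<Rightarrow> complex) \<Rightarrow> (('a \<Rightarrow> complex) \<Rightarrow> complex) \<Rightarrow> ('a \<Rightarrow> complex) \<Rightarrow>
   ('a \<Rightarrow> complex) \<Rightarrow> 'a \<Rightarrow> complex" where
  "spectral_remainder T p e \<phi> v = T \<phi> v - lead_eigenvalue T p e * lead_projection T p e \<phi> v"

section \<open>Perturbation of a simple dominant eigenvalue\<close>

text \<open>\<open>q\<close> is the gauge in which the deflated unperturbed operator contracts in
  one step. \<open>R z\<close> is bounded from \<open>q\<close> to the norm, so one can iterate in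
  \<open>q\<close> and return to the norm. Holomorphy is assumed along bounded holomorphic families,
  since the vectors \<open>(A z ^^ n) e\<close> vary with \<open>z\<close>. The radius
  \<open>\<rho>1\<close> makes \<open>A z\<close> and the scalar map contractions,
  \<open>\<rho>2\<close> keeps the pairing and the eigenvector near their values at zero, and
  \<open>\<rho>3\<close> makes the remainder contract.\<close>

locale perturbation = function_space B nrm
  for B :: "('a \<Rightarrow> complex) set" and nrm :: "('a \<Rightarrow> complex) \<Rightarrow> real" +
  fixes R :: "complex \<Rightarrow> ('a \<Rightarrow> complex) \<Rightarrow> 'a \<Rightarrow> complex" and p :: "('a \<Rightarrow> complex) \<Rightarrow> complex"
    and e :: "'a \<Rightarrow> complex" and q :: "('a \<Rightarrow> complex) \<Rightarrow> real" and \<delta> \<theta> L \<rho>1 \<rho>2 \<rho>3 :: real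
  assumes \<delta>: "0 < \<delta>" and \<theta>: "0 \<le> \<theta>" "\<theta> < 1" and L: "1 \<le> L"
    and R_lin: "\<And>z. z \<in> ball 0 \<delta> \<Longrightarrow> linear_on (R z)"
    and p_functional: "functional_on p L"
    and e_mem: "e \<in> B" and e_le: "nrm e \<le> L" and p_e: "p e = 1" and R0_e: "R 0 e = e"
    and p_R0: "\<And>\<phi>. \<phi> \<in> B \<Longrightarrow> p (R 0 \<phi>) = p \<phi>"
    and q_add: "\<And>\<phi> \<psi>. \<phi> \<in> B \<Longrightarrow> \<psi> \<in> B \<Longrightarrow> q (\<lambda>v. \<phi> v + \<psi> v) \<le> q \<phi> + q \<psi>"
    and q_le: "\<And>\<phi>. \<phi> \<in> B \<Longrightarrow> q \<phi> \<le> L * nrm \<phi>"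
    and p_le: "\<And>\<phi>. \<phi> \<in> B \<Longrightarrow> cmod (p \<phi>) \<le> q \<phi>"
    and R_le: "\<And>z \<phi>. z \<in> ball 0 \<delta> \<Longrightarrow> \<phi> \<in> B \<Longrightarrow> nrm (R z \<phi>) \<le> L * q \<phi>"
    and contraction: "\<And>\<phi>. \<phi> \<in> B \<Longrightarrow> q (deflation (R 0) p e \<phi>) \<le> \<theta> * q \<phi>"
    and R_hol: "\<And>\<Phi> K r v. r \<le> \<delta> \<Longrightarrow> (\<And>z. z \<in> ball 0 r \<Longrightarrow> \<Phi> z \<in> B) \<Longrightarrow>
        (\<And>z. z \<in> ball 0 r \<Longrightarrow> nrm (\<Phi> z) \<le> K) \<Longrightarrow> (\<And>v. (\<lambda>z. \<Phi> z v) holomorphic_on ball 0 r) \<Longrightarrow>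
        (\<lambda>z. R z (\<Phi> z) v) holomorphic_on ball 0 r"
    and p_hol: "\<And>\<Phi> K r. r \<le> \<delta> \<Longrightarrow> (\<And>z. z \<in> ball 0 r \<Longrightarrow> \<Phi> z \<in> B) \<Longrightarrow>
        (\<And>z. z \<in> ball 0 r \<Longrightarrow> nrm (\<Phi> z) \<le> K) \<Longrightarrow> (\<And>v. (\<lambda>z. \<Phi> z v) holomorphic_on ball 0 r) \<Longrightarrow>
        (\<lambda>z. p (\<Phi> z)) holomorphic_on ball 0 r"
    and \<rho>1: "0 < \<rho>1" "\<rho>1 \<le> \<delta> / 2" "\<rho>1 * (4 * L ^ 2 / \<delta>) \<le> (1 - \<theta>) / 2"
        "\<rho>1 * (4 * L ^ 4 / \<delta>) \<le> (1 - \<theta>) ^ 2 / 256"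
    and \<rho>2: "0 < \<rho>2" "\<rho>2 \<le> \<rho>1 / 2" "\<rho>2 * (4 * (64 * L ^ 4 / (1 - \<theta>) ^ 2) / \<rho>1) \<le> 1 / 2"
        "\<rho>2 * (4 * (16 * L ^ 3 / (1 - \<theta>)) / \<rho>1) \<le> 1 / 2"
    and \<rho>3: "0 < \<rho>3" "\<rho>3 \<le> \<rho>2 / 2"
        "\<rho>3 * (L * (4 * (2 * (128 * L ^ 3 / (1 - \<theta>) ^ 2)) / \<rho>2)) \<le> (1 - \<theta>) / 4"
begin

text \<open>The distance of \<open>\<theta>\<close> to one is halved twice: \<open>\<theta>1\<close>
  is the rate of \<open>A z\<close>, while \<open>\<theta>2\<close> is both a lower bound for the
  modulus of the eigenvalue and the rate of the remainder. The gap between them makes the resolvent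
  series converge.\<close>

definition "\<theta>1 = (1 + \<theta>) / 2"
definition "\<theta>2 = (3 + \<theta>) / 4"
definition "A z = deflation (R z) p e"
abbreviation "lam z \<equiv> lead_eigenvalue (R z) p e"
abbreviation "hv z \<equiv> lead_vector (R z) p e"
abbreviation "ell z \<equiv> lead_functional (R z) p e"
abbreviation "Pr z \<equiv> lead_projection (R z) p e"
abbreviation "N z \<equiv> spectral_remainder (R z) p e"

section \<open>Powers of the deflated operators\<close>

lemma \<theta>12: "0 < \<theta>1" "\<theta>1 < \<theta>2" "\<theta>2 < 1" "1/2 \<le> \<theta>1" "\<theta>2 - \<theta>1 = (1 - \<theta>) / 4" "\<theta> \<le> \<theta>1"
  using \<theta> unfolding \<theta>1_def \<theta>2_def by (auto simp: field_simps)

lemma q_nonneg: "\<phi> \<in> B \<Longrightarrow> 0 \<le> q \<phi>"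
  using p_le[of \<phi>] norm_ge_zero[of "p \<phi>"] by linarith

lemma radii: "\<rho>1 < \<delta>" "\<rho>2 < \<rho>1" "\<rho>3 < \<rho>2" "\<rho>2 \<le> \<delta>" "\<rho>3 \<le> \<delta>" "\<rho>3 \<le> \<rho>1"
  using \<delta> \<rho>1(1,2) \<rho>2(1,2) \<rho>3(1,2) by auto

lemma R_mem: "z \<in> ball 0 \<delta> \<Longrightarrow> \<phi> \<in> B \<Longrightarrow> R z \<phi> \<in> B"
  using linear_onD(1)[OF R_lin] by blast

lemma A_apply: "A z \<phi> v = R z \<phi> v - p \<phi> * e v"
  by (simp add: A_def deflation_def)

lemma A_linear: "z \<in> ball 0 \<delta> \<Longrightarrow> linear_on (A z)"
  unfolding linear_on_def
proof (intro conjI ballI allI)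
  assume z: "z \<in> ball 0 \<delta>"
  note l = linear_onD[OF R_lin[OF z]] and f = functional_onD[OF p_functional]
  fix \<phi> assume \<phi>: "\<phi> \<in> B"
  show "A z \<phi> \<in> B"
    unfolding A_def deflation_def[abs_def] by (intro diff_mem scale_mem e_mem l[OF \<phi> \<phi>])
  show "A z (\<lambda>v. \<phi> v + \<psi> v) = (\<lambda>v. A z \<phi> v + A z \<psi> v)" if "\<psi> \<in> B" for \<psi>
    unfolding A_def deflation_def by (simp add: l[OF \<phi> that] f[OF \<phi> that] algebra_simps)
  show "A z (\<lambda>v. c * \<phi> v) = (\<lambda>v. c * A z \<phi> v)" for c
    unfolding A_def deflation_def by (simp add: l[OF \<phi> \<phi>] f[OF \<phi> \<phi>] algebra_simps)
qed

lemma A_mem: "z \<in> ball 0 \<delta> \<Longrightarrow> \<phi> \<in> B \<Longrightarrow> A z \<phi> \<in> B"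
  using linear_onD(1)[OF A_linear] by blast

lemma A_pow_mem: "z \<in> ball 0 \<delta> \<Longrightarrow> \<phi> \<in> B \<Longrightarrow> (A z ^^ n) \<phi> \<in> B"
  using linear_onD(1)[OF linear_on_funpow[OF A_linear]] by blast

lemma A_nrm_le:
  assumes "z \<in> ball 0 \<delta>" "\<phi> \<in> B"
  shows "nrm (A z \<phi>) \<le> 2 * L * q \<phi>"
proof -
  have "nrm (A z \<phi>) \<le> nrm (R z \<phi>) + nrm (\<lambda>v. p \<phi> * e v)"
    unfolding A_def deflation_def[abs_def]
    by (rule nrm_diff) (use assms R_mem scale_mem e_mem in auto)
  also have "nrm (\<lambda>v. p \<phi> * e v) \<le> cmod (p \<phi>) * L" by (rule nrm_le_scaleI[OF e_mem e_le])
  also have "\<dots> \<le> q \<phi> * L" using p_le[OF assms(2)] L by (intro mult_right_mono) auto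
  finally show ?thesis using R_le[OF assms] by (simp add: mult.commute[of "q \<phi>"])
qed

text \<open>For fixed \<open>\<phi>\<close> the family \<open>R z \<phi>\<close> is bounded by
  \<open>L * q \<phi>\<close>, so Cauchy's estimate keeps \<open>q\<close> instead of the norm on
  the right-hand side.\<close>

lemma R_close:
  assumes "z \<in> ball 0 \<rho>1" "\<phi> \<in> B"
  shows "nrm (\<lambda>v. R z \<phi> v - R 0 \<phi> v) \<le> 4 * L / \<delta> * cmod z * q \<phi>"
proof -
  have "nrm (\<lambda>v. R z \<phi> v - R 0 \<phi> v) \<le> 4 * (L * q \<phi>) / \<delta> * cmod (z - 0)"
  proof (rule bounded_family_lipschitz[where F = "\<lambda>z. R z \<phi>"])
    show "(\<lambda>z. R z \<phi> v) holomorphic_on ball 0 \<delta>" for v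
      by (rule R_hol[where \<Phi> = "\<lambda>_. \<phi>" and K = "nrm \<phi>"]) (use assms in auto)
  qed (use assms R_mem R_le \<rho>1 in auto)
  then show ?thesis by (simp add: mult_ac)
qed

lemma q_close:
  assumes "z \<in> ball 0 \<rho>1" "\<phi> \<in> B"
  shows "q (\<lambda>v. R z \<phi> v - R 0 \<phi> v) \<le> 4 * L\<^sup>2 / \<delta> * cmod z * q \<phi>"
proof -
  have z: "z \<in> ball 0 \<delta>" "0 \<in> ball (0::complex) \<delta>" using assms(1) radii \<delta> by auto
  have "q (\<lambda>v. R z \<phi> v - R 0 \<phi> v) \<le> L * nrm (\<lambda>v. R z \<phi> v - R 0 \<phi> v)"
    by (rule q_le) (intro diff_mem R_mem z assms)
  also have "\<dots> \<le> L * (4 * L / \<delta> * cmod z * q \<phi>)"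
    using R_close[OF assms] L by (intro mult_left_mono) auto
  finally show ?thesis by (simp add: power2_eq_square mult_ac)
qed

lemma q_A:
  assumes "z \<in> ball 0 \<rho>1" "\<phi> \<in> B"
  shows "q (A z \<phi>) \<le> \<theta>1 * q \<phi>"
proof -
  have z: "z \<in> ball 0 \<delta>" "0 \<in> ball (0::complex) \<delta>" using assms(1) radii \<delta> by auto
  have "A z \<phi> = (\<lambda>v. A 0 \<phi> v + (R z \<phi> v - R 0 \<phi> v))" unfolding A_def deflation_def by auto
  then have "q (A z \<phi>) \<le> q (A 0 \<phi>) + q (\<lambda>v. R z \<phi> v - R 0 \<phi> v)"
    using q_add[of "A 0 \<phi>" "\<lambda>v. R z \<phi> v - R 0 \<phi> v"] A_mem R_mem diff_mem z assms by simp
  also have "\<dots> \<le> \<theta> * q \<phi> + 4 * L\<^sup>2 / \<delta> * cmod z * q \<phi>"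
    using contraction[OF assms(2)] q_close[OF assms] unfolding A_def by simp
  also have "\<dots> = (\<theta> + cmod z * (4 * L\<^sup>2 / \<delta>)) * q \<phi>" by (simp add: algebra_simps)
  also have "\<dots> \<le> \<theta>1 * q \<phi>"
  proof (rule mult_right_mono)
    have "cmod z * (4 * L\<^sup>2 / \<delta>) \<le> \<rho>1 * (4 * L\<^sup>2 / \<delta>)"
      using assms(1) \<delta> by (intro mult_right_mono) auto
    then show "\<theta> + cmod z * (4 * L\<^sup>2 / \<delta>) \<le> \<theta>1" using \<rho>1(3) \<theta> unfolding \<theta>1_def by argo
  qed (use assms q_nonneg in auto)
  finally show ?thesis .
qed

lemma q_A_pow:
  assumes "z \<in> ball 0 \<rho>1" "\<phi> \<in> B"
  shows "q ((A z ^^ n) \<phi>) \<le> \<theta>1 ^ n * q \<phi>"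
proof (induction n)
  case (Suc n)
  have z: "z \<in> ball 0 \<delta>" using assms(1) radii by auto
  have "q ((A z ^^ Suc n) \<phi>) \<le> \<theta>1 * q ((A z ^^ n) \<phi>)"
    using q_A[OF assms(1) A_pow_mem[OF z assms(2)]] by simp
  also have "\<dots> \<le> \<theta>1 * (\<theta>1 ^ n * q \<phi>)" using Suc \<theta>12 by (intro mult_left_mono) auto
  finally show ?case by simp
qed simp

text \<open>All applications but the outermost one are measured in \<open>q\<close>; the outermost
  one returns to the norm.\<close>

lemma A_pow_bound:
  assumes "z \<in> ball 0 \<rho>1" "\<phi> \<in> B"
  shows "nrm ((A z ^^ n) \<phi>) \<le> (4 * L\<^sup>2) * \<theta>1 ^ n * nrm \<phi>"
proof (cases n)
  case 0
  have "1 \<le> 4 * L\<^sup>2" using one_le_power[OF L, of 2] by linarith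
  then show ?thesis using 0 mult_right_mono[of 1 "4 * L\<^sup>2" "nrm \<phi>"] nrm_nonneg[OF assms(2)] by simp
next
  case (Suc m)
  have z: "z \<in> ball 0 \<delta>" using assms(1) radii by auto
  have "nrm ((A z ^^ n) \<phi>) \<le> 2 * L * q ((A z ^^ m) \<phi>)"
    using A_nrm_le[OF z A_pow_mem[OF z assms(2)]] Suc by simp
  also have "\<dots> \<le> 2 * L * (\<theta>1 ^ m * (L * nrm \<phi>))"
    using order_trans[OF q_A_pow[OF assms] mult_left_mono[OF q_le[OF assms(2)]]] L \<theta>12
    by (intro mult_left_mono) auto
  \<comment> \<open>As \<open>1/2 \<le> \<theta>1\<close>, the factor \<open>2 * \<theta>1\<close>
    supplies the power that was lost in the outermost application.\<close>
  also have "\<dots> \<le> 2 * L * ((2 * \<theta>1) * \<theta>1 ^ m * (L * nrm \<phi>))"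
    using L \<theta>12 nrm_nonneg[OF assms(2)] by (intro mult_left_mono mult_right_mono) auto
  finally show ?thesis using Suc by (simp add: power2_eq_square mult_ac)
qed

lemma A_pow_hol:
  assumes "r \<le> \<rho>1" "\<And>z. z \<in> ball 0 r \<Longrightarrow> \<Phi> z \<in> B" "\<And>z. z \<in> ball 0 r \<Longrightarrow> nrm (\<Phi> z) \<le> K"
    "\<And>v. (\<lambda>z. \<Phi> z v) holomorphic_on ball 0 r"
  shows "(\<lambda>z. (A z ^^ n) (\<Phi> z) v) holomorphic_on ball 0 r"
proof (induction n arbitrary: v)
  case (Suc n)
  have sub: "z \<in> ball 0 \<rho>1" "z \<in> ball 0 \<delta>" if "z \<in> ball 0 r" for z using that assms(1) radii by auto
  have r\<delta>: "r \<le> \<delta>" using assms(1) radii by simp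
  have b: "nrm ((A z ^^ n) (\<Phi> z)) \<le> (4 * L\<^sup>2) * \<theta>1 ^ n * K" if "z \<in> ball 0 r" for z
    using order_trans[OF A_pow_bound[OF sub(1)[OF that] assms(2)[OF that]] mult_left_mono[OF assms(3)[OF that]]]
      \<theta>12 by auto
  have m: "(A z ^^ n) (\<Phi> z) \<in> B" if "z \<in> ball 0 r" for z
    using A_pow_mem[OF sub(2)[OF that] assms(2)[OF that]] .
  have "(\<lambda>z. R z ((A z ^^ n) (\<Phi> z)) v - p ((A z ^^ n) (\<Phi> z)) * e v) holomorphic_on ball 0 r"
    by (intro holomorphic_intros R_hol[OF r\<delta> m b Suc] p_hol[OF r\<delta> m b Suc])
  moreover have "(A z ^^ Suc n) (\<Phi> z) v = R z ((A z ^^ n) (\<Phi> z)) v - p ((A z ^^ n) (\<Phi> z)) * e v" for z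
    using A_apply[of z "(A z ^^ n) (\<Phi> z)" v] by simp
  ultimately show ?case by (simp only:)
qed (simp add: assms)

section \<open>The scalar fixed point equation for the eigenvalue\<close>

definition "b n z = p ((A z ^^ n) e)"

lemma b_0 [simp]: "b 0 z = 1"
  by (simp add: b_def p_e)

lemma b_hol: "b n holomorphic_on ball 0 \<rho>1"
  unfolding b_def
proof (rule p_hol)
  have sub: "z \<in> ball 0 \<delta>" if "z \<in> ball 0 \<rho>1" for z using that radii by auto
  show "nrm ((A z ^^ n) e) \<le> (4 * L\<^sup>2) * \<theta>1 ^ n * nrm e" if "z \<in> ball 0 \<rho>1" for z
    by (rule A_pow_bound[OF that e_mem])
  show "(\<lambda>z. (A z ^^ n) e v) holomorphic_on ball 0 \<rho>1" for v
    by (rule A_pow_hol[where \<Phi> = "\<lambda>_. e" and K = "nrm e"]) (auto simp: e_mem)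
qed (use radii A_pow_mem e_mem in auto)

text \<open>The coefficients of positive index are small because
  \<open>A z e = R z e - R 0 e\<close>: \<open>R 0\<close> fixes \<open>e\<close>, and
  \<open>p e = 1\<close>. The last condition on \<open>\<rho>1\<close> says how small.\<close>

lemma b_bound:
  assumes "z \<in> ball 0 \<rho>1"
  shows "cmod (b (Suc n) z) \<le> \<theta>1 ^ n * ((1 - \<theta>)\<^sup>2 / 256)"
    and "cmod (b n z) \<le> \<theta>1 ^ n * q e"
proof -
  have z: "z \<in> ball 0 \<delta>" using assms radii by auto
  have "cmod (p ((A z ^^ n) e)) \<le> \<theta>1 ^ n * q e"
    using p_le[OF A_pow_mem[OF z e_mem]] q_A_pow[OF assms e_mem] order_trans by blast
  then show "cmod (b n z) \<le> \<theta>1 ^ n * q e" unfolding b_def .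
  have Ae: "A z e = (\<lambda>v. R z e v - R 0 e v)" unfolding A_def deflation_def by (auto simp: R0_e p_e)
  have "cmod (b (Suc n) z) \<le> q ((A z ^^ n) (A z e))"
    unfolding b_def funpow_Suc_right o_apply by (rule p_le[OF A_pow_mem[OF z A_mem[OF z e_mem]]])
  also have "\<dots> \<le> \<theta>1 ^ n * q (A z e)" by (rule q_A_pow[OF assms A_mem[OF z e_mem]])
  also have "\<dots> \<le> \<theta>1 ^ n * ((1 - \<theta>)\<^sup>2 / 256)"
  proof (rule mult_left_mono)
    have "q (A z e) \<le> 4 * L\<^sup>2 / \<delta> * cmod z * q e" unfolding Ae by (rule q_close[OF assms e_mem])
    also have "\<dots> \<le> 4 * L\<^sup>2 / \<delta> * \<rho>1 * (L * L)"
    proof (intro mult_mono)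
      show "q e \<le> L * L" using q_le[OF e_mem] mult_left_mono[OF e_le, of L] L by linarith
    qed (use assms \<delta> \<rho>1 q_nonneg[OF e_mem] in auto)
    also have "\<dots> = \<rho>1 * (4 * L^4 / \<delta>)" by (simp add: power2_eq_square power4_eq_xxxx)
    also have "\<dots> \<le> (1 - \<theta>)\<^sup>2 / 256" by (rule \<rho>1)
    finally show "q (A z e) \<le> (1 - \<theta>)\<^sup>2 / 256" .
  qed (use \<theta>12 in auto)
  finally show "cmod (b (Suc n) z) \<le> \<theta>1 ^ n * ((1 - \<theta>)\<^sup>2 / 256)" .
qed

text \<open>The choice gives \<open>1 - 2 * \<omega> = \<theta>2\<close>, so the disc of radius
  \<open>2 * \<omega>\<close> around one stays where the series converge.\<close>

definition "\<omega> = (1 - \<theta>) / 8"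

lemma \<omega>: "0 < \<omega>" using \<theta> by (simp add: \<omega>_def)

lemma w_large: "w \<in> ball 1 (2 * \<omega>) \<Longrightarrow> \<theta>2 < cmod w"
  using norm_triangle_ineq2[of 1 "1 - w"] unfolding \<omega>_def \<theta>2_def by (auto simp: dist_norm field_simps)

abbreviation "Phi z \<equiv> eigenvalue_map (R z) p e"

lemma Phi_eq: "Phi z w = (\<Sum>n. b n z / w ^ n)"
  unfolding eigenvalue_map_def b_def A_def by simp

lemma geometric_quotient:
  assumes "0 \<le> x" "x < y"
  shows "summable (\<lambda>n. c * (x / y :: real) ^ n)" "(\<Sum>n. c * (x / y) ^ n) = c * y / (y - x)"
proof -
  have g: "(\<lambda>n. c * (x / y) ^ n) sums (c * (1 / (1 - x / y)))"
    by (intro sums_mult geometric_sums) (use assms in \<open>auto simp: divide_simps\<close>)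
  then show "summable (\<lambda>n. c * (x / y :: real) ^ n)" by (rule sums_summable)
  show "(\<Sum>n. c * (x / y) ^ n) = c * y / (y - x)" using sums_unique[OF g] assms by (simp add: field_simps)
qed

lemma Phi_term_bound:
  assumes "z \<in> ball 0 \<rho>1" "w \<in> ball 1 (2 * \<omega>)"
  shows "cmod (b n z / w ^ n) \<le> q e * (\<theta>1 / \<theta>2) ^ n"
proof -
  have "cmod (b n z / w ^ n) \<le> \<theta>1 ^ n * q e / \<theta>2 ^ n"
    unfolding norm_divide norm_power
    by (intro frac_le power_mono b_bound assms zero_less_power)
      (use w_large[OF assms(2)] \<theta>12 q_nonneg[OF e_mem] in auto)
  then show ?thesis by (simp add: power_divide mult.commute)
qed

lemma Phi_near_1:
  assumes "z \<in> ball 0 \<rho>1" "w \<in> ball 1 (2 * \<omega>)"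
  shows "cmod (Phi z w - 1) \<le> \<omega> / 8"
proof -
  have sm: "summable (\<lambda>n. b n z / w ^ n)"
    by (rule summable_comparison_test'[OF geometric_quotient(1)[of \<theta>1 \<theta>2 "q e"], of 0])
      (use Phi_term_bound[OF assms] \<theta>12 in auto)
  have "Phi z w - 1 = (\<Sum>n. b (Suc n) z / w ^ Suc n)"
    unfolding Phi_eq using suminf_split_head[OF sm] by simp
  also have "cmod \<dots> \<le> (\<Sum>n. (1 - \<theta>)\<^sup>2 / 256 / \<theta>2 * (\<theta>1 / \<theta>2) ^ n)"
  proof (rule norm_suminf_le)
    show "norm (b (Suc n) z / w ^ Suc n) \<le> (1 - \<theta>)\<^sup>2 / 256 / \<theta>2 * (\<theta>1 / \<theta>2) ^ n" for n
    proof -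
      have "norm (b (Suc n) z / w ^ Suc n) \<le> \<theta>1 ^ n * ((1 - \<theta>)\<^sup>2 / 256) / \<theta>2 ^ Suc n"
        unfolding norm_divide norm_power
        by (intro frac_le power_mono b_bound assms zero_less_power)
          (use w_large[OF assms(2)] \<theta>12 in auto)
      then show ?thesis by (simp add: power_divide mult_ac)
    qed
  qed (use geometric_quotient(1) \<theta>12 in auto)
  also have "\<dots> = (1 - \<theta>)\<^sup>2 / 256 / (\<theta>2 - \<theta>1)"
    by (subst geometric_quotient(2)) (use \<theta>12(1-4) in \<open>auto simp: field_simps\<close>)
  \<comment> \<open>The constant 256 is made for this equality, with
    \<open>\<theta>2 - \<theta>1 = (1 - \<theta>) / 4\<close>.\<close>
  also have "\<dots> = \<omega> / 8" unfolding \<theta>12 \<omega>_def using \<theta> by (simp add: field_simps power2_eq_square)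
  finally show ?thesis .
qed

lemma Phi_hol:
  assumes "U = ball c r" "\<And>x. x \<in> U \<Longrightarrow> \<zeta> x \<in> ball 0 \<rho>1" "\<And>x. x \<in> U \<Longrightarrow> w x \<in> ball 1 (2 * \<omega>)"
    "\<zeta> holomorphic_on U" "w holomorphic_on U"
  shows "(\<lambda>x. Phi (\<zeta> x) (w x)) holomorphic_on U"
  unfolding Phi_eq
proof (rule holomorphic_on_suminf)
  have "w x \<noteq> 0" if "x \<in> U" for x using w_large[OF assms(3)[OF that]] \<theta>12 by auto
  moreover have "(b n \<circ> \<zeta>) holomorphic_on U" for n
    by (rule holomorphic_on_compose_gen[OF assms(4) b_hol]) (use assms(2) in auto)
  ultimately show "(\<lambda>x. b n (\<zeta> x) / w x ^ n) holomorphic_on U" for n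
    using assms(5) by (auto intro!: holomorphic_intros simp: o_def)
  show "summable (\<lambda>n. q e * (\<theta>1 / \<theta>2) ^ n)" by (rule geometric_quotient) (use \<theta>12 in auto)
qed (use assms Phi_term_bound in auto)

text \<open>\<open>Phi z - 1\<close> is at most \<open>\<omega> / 8\<close> on the disc of radius
  \<open>2 * \<omega>\<close>, so Cauchy's estimate gives the constant
  \<open>4 * (\<omega> / 8) / (2 * \<omega>) = 1/4\<close> on the disc of half the radius.\<close>

lemma Phi_contraction:
  assumes "z \<in> ball 0 \<rho>1" "x \<in> ball 1 \<omega>" "y \<in> ball 1 \<omega>"
  shows "cmod (Phi z x - Phi z y) \<le> 1/4 * cmod (x - y)"
proof -
  have "cmod ((\<lambda>w. Phi z w - 1) x - (\<lambda>w. Phi z w - 1) y) \<le> 4 * (\<omega> / 8) / (2 * \<omega>) * cmod (x - y)"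
    by (rule bounded_holomorphic_lipschitz[where c = 1])
      (use assms Phi_near_1 in \<open>auto intro!: holomorphic_intros Phi_hol[where \<zeta> = "\<lambda>_. z"]\<close>)
  then show ?thesis using \<omega> by (simp add: field_simps)
qed

text \<open>The map sends the open disc of radius \<open>\<omega>\<close>, on which it contracts by
  1/4, into the closed disc of radius \<open>\<omega> / 8\<close>. The rate of the iteration is
  independent of \<open>z\<close>, which later gives uniform convergence.\<close>

lemma lam_fixpoint:
  assumes z: "z \<in> ball 0 \<rho>1"
  shows "Phi z (lam z) = lam z" "lam z \<in> cball 1 (\<omega> / 8)"
    "cmod ((Phi z ^^ k) 1 - lam z) \<le> (1/4) ^ k * \<omega>" "(Phi z ^^ k) 1 \<in> ball 1 \<omega>"
proof -
  let ?s = "cball (1::complex) (\<omega> / 8)"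
  have sub: "?s \<subseteq> ball 1 \<omega>" "ball 1 \<omega> \<subseteq> ball (1::complex) (2 * \<omega>)" using \<omega> by auto
  have maps: "Phi z w \<in> ?s" if "w \<in> ball 1 \<omega>" for w
    using Phi_near_1[OF z, of w] that sub by (auto simp: dist_norm norm_minus_commute)
  have "\<exists>!x\<in>?s. Phi z x = x"
  proof (rule Banach_fix[where c = "1/4", OF compact_imp_complete[OF compact_cball]])
    show "?s \<noteq> {}" using \<omega> by simp
    show "Phi z ` ?s \<subseteq> ?s" using maps sub by blast
    show "dist (Phi z x) (Phi z y) \<le> 1/4 * dist x y" if "x \<in> ?s" "y \<in> ?s" for x y
      unfolding dist_norm by (rule Phi_contraction[OF z]) (use that sub in blast)+
  qed auto
  then obtain x where x: "x \<in> ?s" "Phi z x = x" by blast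
  have it: "(Phi z ^^ k) 1 \<in> ball 1 \<omega> \<and> cmod ((Phi z ^^ k) 1 - x) \<le> (1/4) ^ k * \<omega>" for k
  proof (induction k)
    case 0
    then show ?case using x(1) \<omega> by (auto simp: dist_norm)
  next
    case (Suc k)
    have "cmod (Phi z ((Phi z ^^ k) 1) - Phi z x) \<le> 1/4 * cmod ((Phi z ^^ k) 1 - x)"
      by (rule Phi_contraction[OF z]) (use Suc x sub in auto)
    then have "cmod ((Phi z ^^ Suc k) 1 - x) \<le> (1/4) ^ Suc k * \<omega>" using Suc x by auto
    moreover have "(Phi z ^^ Suc k) 1 \<in> ball 1 \<omega>" using maps[of "(Phi z ^^ k) 1"] Suc sub(1) by auto
    ultimately show ?case by blast
  qed
  have "(\<lambda>k. (Phi z ^^ k) 1 - x) \<longlonglongrightarrow> 0"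
  proof (rule Lim_null_comparison)
    show "\<forall>\<^sub>F k in sequentially. norm ((Phi z ^^ k) 1 - x) \<le> (1/4) ^ k * \<omega>" using it by auto
    have "(\<lambda>k. (1/4) ^ k * \<omega>) \<longlonglongrightarrow> 0 * \<omega>" by (intro tendsto_intros LIMSEQ_realpow_zero) auto
    then show "(\<lambda>k. (1/4) ^ k * \<omega>) \<longlonglongrightarrow> 0" by simp
  qed
  then have "(\<lambda>k. (Phi z ^^ k) 1) \<longlonglongrightarrow> x" by (simp add: LIM_zero_iff)
  then have lx: "lam z = x" unfolding lead_eigenvalue_def by (rule limI)
  show "Phi z (lam z) = lam z" "lam z \<in> ?s"
    "cmod ((Phi z ^^ k) 1 - lam z) \<le> (1/4) ^ k * \<omega>" "(Phi z ^^ k) 1 \<in> ball 1 \<omega>"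
    unfolding lx using x it by auto
qed

lemma lam_large: "z \<in> ball 0 \<rho>1 \<Longrightarrow> \<theta>2 < cmod (lam z)"
  using lam_fixpoint(2)[of z] w_large[of "lam z"] \<omega> by auto

lemma lam_bound: "z \<in> ball 0 \<rho>1 \<Longrightarrow> cmod (lam z - 1) \<le> 1/2" "z \<in> ball 0 \<rho>1 \<Longrightarrow> cmod (lam z) \<le> 2"
proof -
  show *: "cmod (lam z - 1) \<le> 1/2" if "z \<in> ball 0 \<rho>1"
    using lam_fixpoint(2)[OF that] \<theta> by (auto simp: dist_norm norm_minus_commute \<omega>_def)
  show "cmod (lam z) \<le> 2" if "z \<in> ball 0 \<rho>1"
    using *[OF that] norm_triangle_sub[of "lam z" 1] by simp
qed

lemma lam_hol: "lam holomorphic_on ball 0 \<rho>1"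
proof (rule holomorphic_uniform_sequence[OF open_ball])
  show "(\<lambda>z. (Phi z ^^ k) 1) holomorphic_on ball 0 \<rho>1" for k
  proof (induction k)
    case (Suc k)
    have "(\<lambda>z. Phi ((\<lambda>z. z) z) ((Phi z ^^ k) 1)) holomorphic_on ball 0 \<rho>1"
    proof (rule Phi_hol[OF refl])
      show "(Phi z ^^ k) 1 \<in> ball 1 (2 * \<omega>)" if "z \<in> ball 0 \<rho>1" for z
        using lam_fixpoint(4)[OF that, of k] \<omega> by simp
    qed (use Suc in \<open>auto intro: holomorphic_intros\<close>)
    then show ?case by simp
  qed simp
  fix x assume "x \<in> ball (0::complex) \<rho>1"
  then obtain d where d: "d > 0" "cball x d \<subseteq> ball 0 \<rho>1" using open_contains_cball open_ball by blast
  have "uniform_limit (ball 0 \<rho>1) (\<lambda>k z. (Phi z ^^ k) 1) lam sequentially"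
  proof (rule uniform_limitI)
    fix \<epsilon> :: real assume "\<epsilon> > 0"
    have "(\<lambda>k. (1/4) ^ k * \<omega>) \<longlonglongrightarrow> 0 * \<omega>" by (intro tendsto_intros LIMSEQ_realpow_zero) auto
    then have "\<forall>\<^sub>F k in sequentially. (1/4) ^ k * \<omega> < \<epsilon>"
      using \<open>\<epsilon> > 0\<close> by (intro order_tendstoD) auto
    then show "\<forall>\<^sub>F k in sequentially. \<forall>z\<in>ball 0 \<rho>1. dist ((Phi z ^^ k) 1) (lam z) < \<epsilon>"
      by eventually_elim (use lam_fixpoint(3) in \<open>auto simp: dist_norm intro: le_less_trans[OF lam_fixpoint(3)]\<close>)
  qed
  then show "\<exists>d>0. cball x d \<subseteq> ball 0 \<rho>1 \<and> uniform_limit (cball x d) (\<lambda>k z. (Phi z ^^ k) 1) lam sequentially"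
    using d uniform_limit_on_subset by blast
qed

end

section \<open>The leading eigenvector and eigenfunctional\<close>

context perturbation begin

context
  fixes z :: complex
  assumes z: "z \<in> ball 0 \<rho>1"
begin

lemma z\<delta>: "z \<in> ball 0 \<delta>" using z radii by auto

lemma resolvent_conditions:
  "linear_on (A z)" "\<forall>n. \<forall>\<phi>\<in>B. nrm ((A z ^^ n) \<phi>) \<le> 4 * L\<^sup>2 * \<theta>1 ^ n * nrm \<phi>"
  "0 \<le> \<theta>1" "\<theta>1 < cmod (lam z)" "lam z \<noteq> 0"
  using A_linear[OF z\<delta>] A_pow_bound[OF z] \<theta>12 lam_large[OF z] by auto

lemmas resolvent_A = resolvent_series_mem[OF resolvent_conditions(1-4)]
  functional_resolvent_series[OF resolvent_conditions(1-4)]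
  resolvent_series_eq[OF resolvent_conditions(1-4)]
  linear_on_resolvent_series[OF resolvent_conditions(1-4)]

lemma hv_eq: "hv z = resolvent_series (A z) (lam z) e"
  unfolding lead_vector_def A_def ..

lemma ell_eq: "ell z \<phi> = p (resolvent_series (A z) (lam z) \<phi>)"
  unfolding lead_functional_def A_def ..

lemma inverse_gap: "1 / (cmod (lam z) - \<theta>1) \<le> 4 / (1 - \<theta>)"
  using frac_le[of 1 1 "\<theta>2 - \<theta>1" "cmod (lam z) - \<theta>1"] lam_large[OF z] \<theta>12(2,5) \<theta> by simp

lemma hv_mem: "hv z \<in> B" unfolding hv_eq by (rule resolvent_A(1)[OF e_mem])

lemma hv_le: "nrm (hv z) \<le> 16 * L ^ 3 / (1 - \<theta>)"
proof -
  have "nrm (hv z) \<le> 4 * L\<^sup>2 / (cmod (lam z) - \<theta>1) * nrm e"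
    unfolding hv_eq by (rule resolvent_A(2)[OF e_mem])
  also have "\<dots> = (4 * L\<^sup>2) * (1 / (cmod (lam z) - \<theta>1)) * nrm e" by simp
  also have "\<dots> \<le> (4 * L\<^sup>2) * (4 / (1 - \<theta>)) * L"
    using inverse_gap e_le nrm_nonneg[OF e_mem] \<theta> resolvent_conditions(4) by (intro mult_mono) auto
  finally show ?thesis by (simp add: power2_eq_square power3_eq_cube mult_ac)
qed

text \<open>Multiplied by \<open>lam z\<close>, this normalisation is the fixed point equation for
  the eigenvalue.\<close>

lemma p_hv: "p (hv z) = 1"
proof -
  have s: "(\<lambda>n. p ((A z ^^ n) e) / lam z ^ Suc n) sums p (hv z)"
    unfolding hv_eq by (rule resolvent_A(3)[OF p_functional e_mem])
  have "(\<lambda>n. lam z * (p ((A z ^^ n) e) / lam z ^ Suc n)) sums (lam z * p (hv z))"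
    by (rule sums_mult[OF s])
  then have "(\<lambda>n. b n z / lam z ^ n) sums (lam z * p (hv z))"
    using resolvent_conditions(5) by (simp add: b_def)
  then have "lam z * p (hv z) = Phi z (lam z)" unfolding Phi_eq by (rule sums_unique)
  then show ?thesis using lam_fixpoint(1)[OF z] resolvent_conditions(5) by simp
qed

lemma R_hv: "R z (hv z) = (\<lambda>v. lam z * hv z v)"
proof
  fix v
  have "A z (hv z) v = lam z * hv z v - e v"
    using resolvent_A(4)[OF e_mem] unfolding hv_eq by simp
  then show "R z (hv z) v = lam z * hv z v" using A_apply[of z "hv z" v] p_hv by simp
qed

lemma ell_add: "\<phi> \<in> B \<Longrightarrow> \<psi> \<in> B \<Longrightarrow> ell z (\<lambda>v. \<phi> v + \<psi> v) = ell z \<phi> + ell z \<psi>"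
  unfolding ell_eq using linear_onD[OF resolvent_A(6)] functional_onD(1)[OF p_functional] by simp

lemma ell_scale: "\<phi> \<in> B \<Longrightarrow> ell z (\<lambda>v. c * \<phi> v) = c * ell z \<phi>"
  unfolding ell_eq using linear_onD[OF resolvent_A(6)] functional_onD(2)[OF p_functional] by simp

lemma ell_e: "ell z e = 1" unfolding ell_eq hv_eq[symmetric] by (rule p_hv)

text \<open>The resolvent series of \<open>A z \<phi>\<close> is \<open>lam z\<close> times that of
  \<open>\<phi>\<close> minus \<open>\<phi>\<close>. The resulting term \<open>- p \<phi>\<close> is
  cancelled by the rank-one part \<open>p \<phi> * ell z e\<close>, because
  \<open>ell z e = 1\<close>.\<close>

lemma ell_R:
  assumes "\<phi> \<in> B"
  shows "ell z (R z \<phi>) = lam z * ell z \<phi>"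
proof -
  have m: "resolvent_series (A z) (lam z) \<phi> \<in> B" by (rule resolvent_A(1)[OF assms])
  have "ell z (A z \<phi>) = p (\<lambda>v. lam z * resolvent_series (A z) (lam z) \<phi> v - \<phi> v)"
    unfolding ell_eq resolvent_A(5)[OF assms] ..
  also have "\<dots> = p (\<lambda>v. lam z * resolvent_series (A z) (lam z) \<phi> v + - 1 * \<phi> v)" by simp
  also have "\<dots> = lam z * ell z \<phi> - p \<phi>"
    using functional_onD(1)[OF p_functional scale_mem[OF m] scale_mem[OF assms], of "lam z" "- 1"]
      functional_onD(2)[OF p_functional m m] functional_onD(2)[OF p_functional assms assms, of "- 1"]
    by (simp add: ell_eq)
  finally have 1: "ell z (A z \<phi>) = lam z * ell z \<phi> - p \<phi>" .
  have "R z \<phi> = (\<lambda>v. A z \<phi> v + p \<phi> * e v)" using A_apply by auto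
  then have "ell z (R z \<phi>) = ell z (A z \<phi>) + p \<phi> * ell z e"
    using ell_add[OF A_mem[OF z\<delta> assms] scale_mem[OF e_mem]] ell_scale[OF e_mem] by simp
  then show ?thesis using 1 ell_e by simp
qed

text \<open>A bound in terms of \<open>q\<close> instead of the norm makes the projection bounded
  from \<open>q\<close> to the norm; only so can the remainder be estimated in
  \<open>q\<close>.\<close>

lemma ell_le:
  assumes "\<phi> \<in> B"
  shows "cmod (ell z \<phi>) \<le> 4 / (1 - \<theta>) * q \<phi>"
proof -
  have s: "(\<lambda>n. p ((A z ^^ n) \<phi>) / lam z ^ Suc n) sums ell z \<phi>"
    unfolding ell_eq by (rule resolvent_A(3)[OF p_functional assms])
  have "cmod (ell z \<phi>) = cmod (\<Sum>n. p ((A z ^^ n) \<phi>) / lam z ^ Suc n)" using sums_unique[OF s] by simp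
  also have "\<dots> \<le> (\<Sum>n. q \<phi> / \<theta>2 * (\<theta>1 / \<theta>2) ^ n)"
  proof (rule norm_suminf_le)
    show "norm (p ((A z ^^ n) \<phi>) / lam z ^ Suc n) \<le> q \<phi> / \<theta>2 * (\<theta>1 / \<theta>2) ^ n" for n
    proof -
      have "norm (p ((A z ^^ n) \<phi>) / lam z ^ Suc n) \<le> \<theta>1 ^ n * q \<phi> / \<theta>2 ^ Suc n"
        unfolding norm_divide norm_power
        by (intro frac_le power_mono zero_less_power order_trans[OF p_le[OF A_pow_mem[OF z\<delta> assms]] q_A_pow[OF z assms]])
          (use lam_large[OF z] \<theta>12 q_nonneg[OF assms] in auto)
      then show ?thesis by (simp add: power_divide mult_ac)
    qed
  qed (use geometric_quotient(1) \<theta>12 in auto)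
  also have "\<dots> = q \<phi> / (\<theta>2 - \<theta>1)" by (subst geometric_quotient(2)) (use \<theta>12(1-4) in auto)
  also have "\<dots> = 4 / (1 - \<theta>) * q \<phi>" unfolding \<theta>12 by simp
  finally show ?thesis .
qed

end

section \<open>Values at zero and holomorphy in the parameter\<close>

lemma zero_in [simp]: "0 \<in> ball (0::complex) \<rho>1" "0 \<in> ball (0::complex) \<rho>2" "0 \<in> ball (0::complex) \<rho>3"
  "0 \<in> ball (0::complex) \<delta>"
  using \<rho>1 \<rho>2 \<rho>3 \<delta> by auto

lemma A_0_e: "A 0 e = (\<lambda>_. 0)" using A_apply[of 0 e] by (auto simp: R0_e p_e)

lemma A_0_pow_e: "(A 0 ^^ Suc n) e = (\<lambda>_. 0)"
  by (induction n) (simp_all add: A_0_e linear_on_zero[OF A_linear[OF zero_in(4)]])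

lemma p_A_0: "\<phi> \<in> B \<Longrightarrow> p (A 0 \<phi>) = 0"
proof -
  assume \<phi>: "\<phi> \<in> B"
  have "A 0 \<phi> = (\<lambda>v. R 0 \<phi> v + (- p \<phi>) * e v)" using A_apply by auto
  then have "p (A 0 \<phi>) = p (R 0 \<phi>) + (- p \<phi>) * p e"
    using functional_onD(1)[OF p_functional R_mem[OF zero_in(4) \<phi>] scale_mem[OF e_mem, of "- p \<phi>"]]
      functional_onD(2)[OF p_functional e_mem e_mem, of "- p \<phi>"] by simp
  then show ?thesis using p_R0[OF \<phi>] p_e by simp
qed

text \<open>As \<open>A 0 e = 0\<close>, the map \<open>Phi 0\<close> is constant with value
  one.\<close>

lemma lam_0: "lam 0 = 1"
proof -
  have "b (Suc n) 0 = 0" for n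
    unfolding b_def A_0_pow_e using functional_on_zero[OF p_functional] .
  then have "b n 0 / w ^ n = 0" if "n \<notin> {0}" for n and w :: complex using that by (cases n) auto
  then have "Phi 0 w = 1" for w unfolding Phi_eq by (subst suminf_finite[of "{0}"]) auto
  then show ?thesis using lam_fixpoint(1)[OF zero_in(1)] by simp
qed

lemma hv_0: "hv 0 = e"
proof
  fix v
  have "(A 0 ^^ n) e v / 1 ^ Suc n = 0" if "n \<notin> {0}" for n
    using that A_0_pow_e[of "n - 1"] by auto
  then show "hv 0 v = e v"
    unfolding hv_eq[OF zero_in(1)] resolvent_series_def lam_0
    by (subst suminf_finite[of "{0}"]) auto
qed

text \<open>Since \<open>p\<close> is invariant under \<open>R 0\<close>, it vanishes on the range
  of \<open>A 0\<close>, and only the first term of the series remains.\<close>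

lemma ell_0: "\<phi> \<in> B \<Longrightarrow> ell 0 \<phi> = p \<phi>"
proof -
  assume \<phi>: "\<phi> \<in> B"
  have s: "(\<lambda>n. p ((A 0 ^^ n) \<phi>) / 1 ^ Suc n) sums ell 0 \<phi>"
    using resolvent_A(3)[OF zero_in(1) p_functional \<phi>] unfolding ell_eq[OF zero_in(1)] lam_0 .
  have "p ((A 0 ^^ n) \<phi>) / 1 ^ Suc n = 0" if "n \<notin> {0}" for n
    using that p_A_0[OF A_pow_mem[OF zero_in(4) \<phi>], of "n - 1"]
    by (cases n) auto
  then have "(\<lambda>n. p ((A 0 ^^ n) \<phi>) / 1 ^ Suc n) sums (\<Sum>n\<in>{0}. p ((A 0 ^^ n) \<phi>) / 1 ^ Suc n)"
    by (intro sums_finite) auto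
  from sums_unique2[OF s this] show ?thesis by simp
qed

lemma resolvent_hol:
  assumes "r \<le> \<rho>1" "\<And>z. z \<in> ball 0 r \<Longrightarrow> \<Phi> z \<in> B" "\<And>z. z \<in> ball 0 r \<Longrightarrow> nrm (\<Phi> z) \<le> K"
    "\<And>v. (\<lambda>z. \<Phi> z v) holomorphic_on ball 0 r"
  shows "(\<lambda>z. resolvent_series (A z) (lam z) (\<Phi> z) v) holomorphic_on ball 0 r"
  unfolding resolvent_series_def
proof (rule holomorphic_on_suminf[where a = "\<lambda>n. 4 * L\<^sup>2 * K / \<theta>2 * (\<theta>1 / \<theta>2) ^ n"])
  have sub: "z \<in> ball 0 \<rho>1" "z \<in> ball 0 \<delta>" if "z \<in> ball 0 r" for z using that assms(1) radii by auto
  have lh: "lam holomorphic_on ball 0 r" by (rule holomorphic_on_subset[OF lam_hol]) (use assms(1) in auto)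
  show "(\<lambda>z. (A z ^^ n) (\<Phi> z) v / lam z ^ Suc n) holomorphic_on ball 0 r" for n
    by (intro holomorphic_intros A_pow_hol[OF assms] lh) (use resolvent_conditions(5)[OF sub(1)] in auto)
  show "cmod ((A z ^^ n) (\<Phi> z) v / lam z ^ Suc n) \<le> 4 * L\<^sup>2 * K / \<theta>2 * (\<theta>1 / \<theta>2) ^ n"
    if zr: "z \<in> ball 0 r" for n z
  proof -
    have "cmod ((A z ^^ n) (\<Phi> z) v) \<le> 4 * L\<^sup>2 * \<theta>1 ^ n * K"
      using eval_le[OF A_pow_mem[OF sub(2)[OF zr] assms(2)[OF zr]], of n v]
        A_pow_bound[OF sub(1)[OF zr] assms(2)[OF zr], of n]
        mult_left_mono[OF assms(3)[OF zr], of "4 * L\<^sup>2 * \<theta>1 ^ n"] \<theta>12 by simp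
    then have "cmod ((A z ^^ n) (\<Phi> z) v / lam z ^ Suc n) \<le> 4 * L\<^sup>2 * \<theta>1 ^ n * K / \<theta>2 ^ Suc n"
      unfolding norm_divide norm_power
      by (intro frac_le power_mono zero_less_power)
        (use lam_large[OF sub(1)[OF zr]] \<theta>12 order_trans[OF nrm_nonneg[OF assms(2)[OF zr]] assms(3)[OF zr]] in auto)
    then show ?thesis by (simp add: power_divide mult_ac)
  qed
qed (use geometric_quotient(1) \<theta>12 in auto)

lemma hv_hol: "(\<lambda>z. hv z v) holomorphic_on ball 0 \<rho>1"
proof -
  have "(\<lambda>z. resolvent_series (A z) (lam z) e v) holomorphic_on ball 0 \<rho>1"
    by (rule resolvent_hol[where \<Phi> = "\<lambda>_. e" and K = "nrm e"]) (use e_mem in auto)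
  then show ?thesis by (rule holomorphic_transform) (simp add: hv_eq)
qed

lemma ell_hol:
  assumes "\<And>z. z \<in> ball 0 \<rho>1 \<Longrightarrow> \<Phi> z \<in> B" "\<And>z. z \<in> ball 0 \<rho>1 \<Longrightarrow> nrm (\<Phi> z) \<le> K"
    "\<And>v. (\<lambda>z. \<Phi> z v) holomorphic_on ball 0 \<rho>1"
  shows "(\<lambda>z. ell z (\<Phi> z)) holomorphic_on ball 0 \<rho>1"
proof -
  have "(\<lambda>z. p (resolvent_series (A z) (lam z) (\<Phi> z))) holomorphic_on ball 0 \<rho>1"
  proof (rule p_hol)
    show "resolvent_series (A z) (lam z) (\<Phi> z) \<in> B" if "z \<in> ball 0 \<rho>1" for z
      by (rule resolvent_A(1)[OF that assms(1)[OF that]])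
    show "nrm (resolvent_series (A z) (lam z) (\<Phi> z)) \<le> 4 * L\<^sup>2 * (4 / (1 - \<theta>)) * K" if "z \<in> ball 0 \<rho>1" for z
    proof -
      have "nrm (resolvent_series (A z) (lam z) (\<Phi> z)) \<le> 4 * L\<^sup>2 / (cmod (lam z) - \<theta>1) * nrm (\<Phi> z)"
        by (rule resolvent_A(2)[OF that assms(1)[OF that]])
      also have "\<dots> = 4 * L\<^sup>2 * (1 / (cmod (lam z) - \<theta>1)) * nrm (\<Phi> z)" by simp
      also have "\<dots> \<le> 4 * L\<^sup>2 * (4 / (1 - \<theta>)) * K"
        using inverse_gap[OF that] assms that nrm_nonneg \<theta> resolvent_conditions(4)[OF that]
        by (intro mult_mono) auto
      finally show ?thesis .
    qed
  qed (use resolvent_hol[OF order.refl assms] radii in auto)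
  then show ?thesis by (rule holomorphic_transform) (simp add: ell_eq)
qed

lemma ell_hv_hol: "(\<lambda>z. ell z (hv z)) holomorphic_on ball 0 \<rho>1"
  by (rule ell_hol[OF hv_mem hv_le hv_hol])

text \<open>The pairing is one at zero and bounded on the disc of radius \<open>\<rho>1\<close>;
  Cauchy's estimate bounds its change, and the third condition on \<open>\<rho>2\<close> makes this
  change at most 1/2.\<close>

lemma ell_hv_near_1:
  assumes "z \<in> ball 0 \<rho>2"
  shows "cmod (ell z (hv z) - 1) \<le> 1/2"
proof -
  have "cmod (ell z (hv z) - ell 0 (hv 0)) \<le> 4 * (64 * L ^ 4 / (1 - \<theta>)\<^sup>2) / \<rho>1 * cmod (z - 0)"
  proof (rule bounded_holomorphic_lipschitz[OF ell_hv_hol])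
    fix w assume w: "w \<in> ball (0::complex) \<rho>1"
    have "cmod (ell w (hv w)) \<le> 4 / (1 - \<theta>) * (L * (16 * L ^ 3 / (1 - \<theta>)))"
      using order_trans[OF ell_le[OF w hv_mem[OF w]] mult_left_mono[OF order_trans[OF q_le[OF hv_mem[OF w]]
        mult_left_mono[OF hv_le[OF w]]]]] L \<theta> by auto
    then show "cmod (ell w (hv w)) \<le> 64 * L ^ 4 / (1 - \<theta>)\<^sup>2"
      by (simp add: power2_eq_square power3_eq_cube power4_eq_xxxx mult_ac)
  qed (use assms \<rho>2(1,2) \<rho>1(1) in auto)
  also have "\<dots> \<le> 4 * (64 * L ^ 4 / (1 - \<theta>)\<^sup>2) / \<rho>1 * \<rho>2"
    using assms \<rho>1 by (intro mult_left_mono) auto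
  also have "\<dots> \<le> 1/2" using \<rho>2(3) by (simp add: mult_ac)
  finally show ?thesis using ell_0[OF e_mem] p_e by (simp add: hv_0)
qed

lemma ell_hv_large: "z \<in> ball 0 \<rho>2 \<Longrightarrow> 1/2 \<le> cmod (ell z (hv z))"
  using ell_hv_near_1[of z] norm_triangle_ineq2[of 1 "1 - ell z (hv z)"] by (simp add: norm_minus_commute)

lemma ell_hv_nz: "z \<in> ball 0 \<rho>2 \<Longrightarrow> ell z (hv z) \<noteq> 0"
  using ell_hv_large[of z] by auto

text \<open>Where \<open>e\<close> is one, the real part of the eigenvector is at least 1/2, so its
  integral against a positive measure cannot vanish. This is what the identification of the
  eigenvalue rests on.\<close>

lemma hv_near_e:
  assumes "z \<in> ball 0 \<rho>2"
  shows "cmod (hv z v - e v) \<le> 1/2"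
proof -
  have zz: "z \<in> ball 0 \<rho>1" using assms radii by auto
  have "cmod (hv z v - e v) \<le> nrm (\<lambda>v. hv z v - hv 0 v)"
    using eval_le[OF diff_mem[OF hv_mem[OF zz] e_mem]] hv_0 by simp
  also have "\<dots> \<le> 4 * (16 * L ^ 3 / (1 - \<theta>)) / \<rho>1 * cmod (z - 0)"
    by (rule bounded_family_lipschitz[OF hv_mem hv_le hv_hol]) (use assms \<rho>2(1,2) \<rho>1(1) in auto)
  also have "\<dots> \<le> 4 * (16 * L ^ 3 / (1 - \<theta>)) / \<rho>1 * \<rho>2"
    using assms \<rho>1 \<theta> L by (intro mult_left_mono) auto
  also have "\<dots> \<le> 1/2" using \<rho>2(4) by (simp add: mult_ac)
  finally show ?thesis .
qed

section \<open>The spectral projection and the remainder\<close>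

lemma Pr_eq: "Pr z \<phi> = (\<lambda>v. ell z \<phi> / ell z (hv z) * hv z v)"
  unfolding lead_projection_def[abs_def] ..

lemma N_eq: "N z \<phi> = (\<lambda>v. R z \<phi> v - lam z * Pr z \<phi> v)"
  unfolding spectral_remainder_def[abs_def] ..

context
  fixes z :: complex
  assumes z: "z \<in> ball 0 \<rho>2"
begin

lemma z1: "z \<in> ball 0 \<rho>1" and z2: "z \<in> ball 0 \<delta>" using z radii by auto

lemma Pr_linear: "linear_on (Pr z)"
  unfolding linear_on_def Pr_eq
  by (auto simp: ell_add[OF z1] ell_scale[OF z1] add_divide_distrib distrib_right
      intro!: scale_mem[OF hv_mem[OF z1]] simp del: times_divide_eq_left)

lemma Pr_le:
  assumes "\<phi> \<in> B"
  shows "nrm (Pr z \<phi>) \<le> 128 * L ^ 3 / (1 - \<theta>)\<^sup>2 * q \<phi>"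
proof -
  have "nrm (Pr z \<phi>) \<le> cmod (ell z \<phi> / ell z (hv z)) * (16 * L ^ 3 / (1 - \<theta>))"
    unfolding Pr_eq by (rule nrm_le_scaleI[OF hv_mem[OF z1] hv_le[OF z1]])
  also have "\<dots> \<le> (4 / (1 - \<theta>) * q \<phi> / (1/2)) * (16 * L ^ 3 / (1 - \<theta>))"
    unfolding norm_divide
    by (intro mult_right_mono frac_le ell_le[OF z1 assms] ell_hv_large[OF z])
      (use q_nonneg[OF assms] \<theta> L in auto)
  finally show ?thesis by (simp add: power2_eq_square mult_ac)
qed

lemma R_Pr:
  assumes "\<phi> \<in> B"
  shows "R z (Pr z \<phi>) = (\<lambda>v. lam z * Pr z \<phi> v)"
proof -
  have "R z (\<lambda>v. c * hv z v) = (\<lambda>v. lam z * (c * hv z v))" for c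
    using linear_onD(3)[OF R_lin[OF z2] hv_mem[OF z1] hv_mem[OF z1]] R_hv[OF z1] by (simp add: mult_ac)
  then show ?thesis unfolding Pr_eq by blast
qed

lemma Pr_R: "\<phi> \<in> B \<Longrightarrow> Pr z (R z \<phi>) = (\<lambda>v. lam z * Pr z \<phi> v)"
  unfolding Pr_eq using ell_R[OF z1] by (simp add: mult.assoc)

lemma Pr_Pr: "\<phi> \<in> B \<Longrightarrow> Pr z (Pr z \<phi>) = Pr z \<phi>"
  using Pr_eq[of z "\<lambda>v. ell z \<phi> / ell z (hv z) * hv z v"] Pr_eq[of z \<phi>]
    ell_scale[OF z1 hv_mem[OF z1], of "ell z \<phi> / ell z (hv z)"] ell_hv_nz[OF z] by simp

lemma Pr_mem: "\<phi> \<in> B \<Longrightarrow> Pr z \<phi> \<in> B" using linear_onD(1)[OF Pr_linear] by blast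

lemma N_linear: "linear_on (N z)"
  unfolding linear_on_def
proof (intro conjI ballI allI)
  note l = linear_onD[OF R_lin[OF z2]] and f = linear_onD[OF Pr_linear]
  fix \<phi> assume \<phi>: "\<phi> \<in> B"
  show "N z \<phi> \<in> B" unfolding N_eq by (intro diff_mem scale_mem l[OF \<phi> \<phi>] f[OF \<phi> \<phi>])
  show "N z (\<lambda>v. \<phi> v + \<psi> v) = (\<lambda>v. N z \<phi> v + N z \<psi> v)" if "\<psi> \<in> B" for \<psi>
    unfolding N_eq by (simp add: l[OF \<phi> that] f[OF \<phi> that] algebra_simps)
  show "N z (\<lambda>v. c * \<phi> v) = (\<lambda>v. c * N z \<phi> v)" for c
    unfolding N_eq by (simp add: l[OF \<phi> \<phi>] f[OF \<phi> \<phi>] algebra_simps)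
qed

lemma N_mem: "\<phi> \<in> B \<Longrightarrow> N z \<phi> \<in> B" using linear_onD(1)[OF N_linear] by blast

lemma N_pow_mem: "\<phi> \<in> B \<Longrightarrow> (N z ^^ n) \<phi> \<in> B"
  using linear_onD(1)[OF linear_on_funpow[OF N_linear]] by blast

lemma Pr_N: "\<phi> \<in> B \<Longrightarrow> Pr z (N z \<phi>) = (\<lambda>_. 0)"
  unfolding N_eq
  using linear_on_diff[OF Pr_linear R_mem[OF z2] scale_mem[OF Pr_mem, where c = "lam z"]]
    linear_onD(3)[OF Pr_linear Pr_mem Pr_mem, of \<phi> \<phi> "lam z"] Pr_R Pr_Pr by simp

lemma N_Pr: "\<phi> \<in> B \<Longrightarrow> N z (Pr z \<phi>) = (\<lambda>_. 0)"
  unfolding N_eq using R_Pr Pr_Pr by simp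

text \<open>The mixed terms vanish. For \<open>n = 0\<close> the identity would read
  \<open>\<phi> = Pr z \<phi> + \<phi>\<close>, hence the restriction on \<open>n\<close>.\<close>

lemma R_pow:
  assumes "1 \<le> n" "\<phi> \<in> B"
  shows "(R z ^^ n) \<phi> = (\<lambda>v. lam z ^ n * Pr z \<phi> v + (N z ^^ n) \<phi> v)"
  using assms(1)
proof (induction n rule: dec_induct)
  case base
  then show ?case by (simp add: N_eq)
next
  case (step n)
  have Nn: "Pr z ((N z ^^ n) \<phi>) = (\<lambda>_. 0)"
    using step(1) Pr_N[OF N_pow_mem[OF assms(2)], of "n - 1"] by (cases n) auto
  have "(R z ^^ Suc n) \<phi> = R z (\<lambda>v. lam z ^ n * Pr z \<phi> v + (N z ^^ n) \<phi> v)" using step by simp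
  also have "\<dots> = (\<lambda>v. lam z ^ n * (lam z * Pr z \<phi> v) + R z ((N z ^^ n) \<phi>) v)"
    using linear_onD(2,3)[OF R_lin[OF z2]] scale_mem Pr_mem[OF assms(2)] N_pow_mem[OF assms(2), of n]
      R_Pr[OF assms(2)] by simp
  also have "R z ((N z ^^ n) \<phi>) = (N z ^^ Suc n) \<phi>" using N_eq[of z "(N z ^^ n) \<phi>"] Nn by simp
  finally show ?case by (simp add: mult_ac)
qed

end

lemma Pr_0: "\<phi> \<in> B \<Longrightarrow> Pr 0 \<phi> = (\<lambda>v. p \<phi> * e v)"
  unfolding Pr_eq using ell_0 hv_0 e_mem p_e by simp

lemma Pr_hol:
  assumes "\<phi> \<in> B"
  shows "(\<lambda>z. Pr z \<phi> v) holomorphic_on ball 0 \<rho>2"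
proof -
  have sub: "ball 0 \<rho>2 \<subseteq> ball (0::complex) \<rho>1" using radii by auto
  have "(\<lambda>z. ell z \<phi>) holomorphic_on ball 0 \<rho>1"
    by (rule ell_hol[where \<Phi> = "\<lambda>_. \<phi>" and K = "nrm \<phi>"]) (use assms in auto)
  then show ?thesis
    unfolding Pr_eq using holomorphic_on_subset[OF _ sub] ell_hv_hol hv_hol ell_hv_nz
    by (auto intro!: holomorphic_intros)
qed

lemma N_hol:
  assumes "\<phi> \<in> B"
  shows "(\<lambda>z. N z \<phi> v) holomorphic_on ball 0 \<rho>2"
proof -
  have sub: "ball 0 \<rho>2 \<subseteq> ball (0::complex) \<rho>1" using radii by auto
  have "(\<lambda>z. R z \<phi> v) holomorphic_on ball 0 \<rho>2"
    by (rule R_hol[where \<Phi> = "\<lambda>_. \<phi>" and K = "nrm \<phi>"]) (use assms radii in auto)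
  then show ?thesis
    unfolding N_eq using holomorphic_on_subset[OF lam_hol sub] Pr_hol[OF assms]
    by (auto intro!: holomorphic_intros)
qed

definition "CN = 2 * L + 4 * (128 * L ^ 3 / (1 - \<theta>)\<^sup>2)"

lemma Pr_scaled:
  assumes "z \<in> ball 0 \<rho>2" "\<phi> \<in> B"
  shows "(\<lambda>v. lam z * Pr z \<phi> v) \<in> B" "nrm (\<lambda>v. lam z * Pr z \<phi> v) \<le> 2 * (128 * L ^ 3 / (1 - \<theta>)\<^sup>2) * q \<phi>"
proof -
  have zz: "z \<in> ball 0 \<rho>1" using assms radii by auto
  show "(\<lambda>v. lam z * Pr z \<phi> v) \<in> B" by (intro scale_mem Pr_mem assms)
  have "nrm (\<lambda>v. lam z * Pr z \<phi> v) \<le> cmod (lam z) * (128 * L ^ 3 / (1 - \<theta>)\<^sup>2 * q \<phi>)"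
    by (intro nrm_le_scaleI Pr_mem Pr_le assms)
  also have "\<dots> \<le> 2 * (128 * L ^ 3 / (1 - \<theta>)\<^sup>2 * q \<phi>)"
    using lam_bound(2)[OF zz] q_nonneg[OF assms(2)] L by (intro mult_right_mono) auto
  finally show "nrm (\<lambda>v. lam z * Pr z \<phi> v) \<le> 2 * (128 * L ^ 3 / (1 - \<theta>)\<^sup>2) * q \<phi>" by (simp add: mult_ac)
qed

text \<open>Since \<open>lam 0 = 1\<close> and \<open>Pr 0 \<phi>\<close> is \<open>p \<phi>\<close>
  times \<open>e\<close>, the remainder is the contraction \<open>A z\<close> plus a term that
  vanishes at zero.\<close>

lemma N_split: "\<phi> \<in> B \<Longrightarrow> N z \<phi> = (\<lambda>v. A z \<phi> v + (lam 0 * Pr 0 \<phi> v - lam z * Pr z \<phi> v))"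
  unfolding N_eq by (auto simp: A_apply lam_0 Pr_0)

lemma N_nrm_le:
  assumes "z \<in> ball 0 \<rho>2" "\<phi> \<in> B"
  shows "nrm (N z \<phi>) \<le> CN * q \<phi>"
proof -
  have z: "z \<in> ball 0 \<delta>" using assms radii by auto
  have "nrm (N z \<phi>) \<le> nrm (A z \<phi>) + nrm (\<lambda>v. lam 0 * Pr 0 \<phi> v - lam z * Pr z \<phi> v)"
    unfolding N_split[OF assms(2), of z]
    by (intro nrm_add A_mem diff_mem Pr_scaled assms z zero_in)
  also have "nrm (\<lambda>v. lam 0 * Pr 0 \<phi> v - lam z * Pr z \<phi> v) \<le>
      nrm (\<lambda>v. lam 0 * Pr 0 \<phi> v) + nrm (\<lambda>v. lam z * Pr z \<phi> v)"
    by (intro nrm_diff Pr_scaled assms zero_in)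
  finally have "nrm (N z \<phi>) \<le>
      nrm (A z \<phi>) + (nrm (\<lambda>v. lam 0 * Pr 0 \<phi> v) + nrm (\<lambda>v. lam z * Pr z \<phi> v))" by simp
  then show ?thesis
    using Pr_scaled(2)[OF assms] Pr_scaled(2)[OF zero_in(2) assms(2)] A_nrm_le[OF z assms(2)]
    unfolding CN_def distrib_right by linarith
qed

lemma q_N:
  assumes "z \<in> ball 0 \<rho>3" "\<phi> \<in> B"
  shows "q (N z \<phi>) \<le> \<theta>2 * q \<phi>"
proof -
  let ?c = "2 * (128 * L ^ 3 / (1 - \<theta>)\<^sup>2)"
  let ?d = "\<lambda>v. lam 0 * Pr 0 \<phi> v - lam z * Pr z \<phi> v"
  have z: "z \<in> ball 0 \<rho>2" "z \<in> ball 0 \<rho>1" "z \<in> ball 0 \<delta>" using assms radii by auto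
  have sub: "ball 0 \<rho>2 \<subseteq> ball (0::complex) \<rho>1" using radii by auto
  have d: "?d \<in> B" by (intro diff_mem Pr_scaled assms z zero_in)
  have "q (N z \<phi>) \<le> q (A z \<phi>) + q ?d"
    unfolding N_split[OF assms(2), of z] by (intro q_add A_mem assms z d)
  also have "q ?d \<le> L * nrm ?d" by (rule q_le[OF d])
  \<comment> \<open>Cauchy's estimate for the family \<open>lam z * Pr z \<phi>\<close> on the disc
    of radius \<open>\<rho>2\<close>, whose bound is a multiple of \<open>q \<phi>\<close>.\<close>
  also have "nrm ?d \<le> 4 * (?c * q \<phi>) / \<rho>2 * cmod (0 - z)"
    by (rule bounded_family_lipschitz[where F = "\<lambda>z v. lam z * Pr z \<phi> v", OF Pr_scaled])
      (use assms \<rho>3(1,2) \<rho>2(1) Pr_hol[OF assms(2)] holomorphic_on_subset[OF lam_hol sub]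
        in \<open>auto intro!: holomorphic_intros\<close>)
  also have "\<dots> \<le> 4 * (?c * q \<phi>) / \<rho>2 * \<rho>3"
    using assms \<rho>2(1) L q_nonneg[OF assms(2)] by (intro mult_left_mono) auto
  finally have "q (N z \<phi>) \<le> \<theta>1 * q \<phi> + L * (4 * (?c * q \<phi>) / \<rho>2 * \<rho>3)"
    using q_A[OF z(2) assms(2)] L by (auto simp: mult_left_mono)
  also have "\<dots> = (\<theta>1 + \<rho>3 * (L * (4 * ?c / \<rho>2))) * q \<phi>" by (simp add: algebra_simps)
  also have "\<dots> \<le> \<theta>2 * q \<phi>"
    using \<rho>3(3) \<theta>12(5) q_nonneg[OF assms(2)] by (intro mult_right_mono) linarith+
  finally show ?thesis .
qed

lemma N_pow_bound:
  assumes "z \<in> ball 0 \<rho>3" "\<phi> \<in> B"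
  shows "nrm ((N z ^^ n) \<phi>) \<le> (2 * L * CN) * \<theta>2 ^ n * nrm \<phi>"
proof -
  have z: "z \<in> ball 0 \<rho>2" using assms radii by auto
  have CN: "2 \<le> CN" unfolding CN_def using L \<theta> by (simp add: add_increasing2)
  have qp: "q ((N z ^^ n) \<phi>) \<le> \<theta>2 ^ n * q \<phi>" for n
  proof (induction n)
    case (Suc n)
    have "q ((N z ^^ Suc n) \<phi>) \<le> \<theta>2 * q ((N z ^^ n) \<phi>)"
      using q_N[OF assms(1) N_pow_mem[OF z assms(2)]] by simp
    also have "\<dots> \<le> \<theta>2 * (\<theta>2 ^ n * q \<phi>)" using Suc \<theta>12 by (intro mult_left_mono) auto
    finally show ?case by simp
  qed simp
  show ?thesis
  proof (cases n)
    case 0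
    have "1 * 1 \<le> (2 * L) * CN" by (rule mult_mono) (use L CN in auto)
    then show ?thesis using 0 mult_right_mono[of 1 "2 * L * CN" "nrm \<phi>"] nrm_nonneg[OF assms(2)] by simp
  next
    case (Suc m)
    have "nrm ((N z ^^ n) \<phi>) \<le> CN * q ((N z ^^ m) \<phi>)"
      using N_nrm_le[OF z N_pow_mem[OF z assms(2)]] Suc by simp
    also have "\<dots> \<le> CN * (\<theta>2 ^ m * (L * nrm \<phi>))"
      using order_trans[OF qp mult_left_mono[OF q_le[OF assms(2)]]] CN \<theta>12
      by (intro mult_left_mono) auto
    also have "\<dots> \<le> CN * ((2 * \<theta>2) * \<theta>2 ^ m * (L * nrm \<phi>))"
      using L \<theta>12 CN nrm_nonneg[OF assms(2)] by (intro mult_left_mono mult_right_mono) auto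
    finally show ?thesis using Suc by (simp add: mult_ac)
  qed
qed

lemma Pr_op_analytic: "op_analytic_on B nrm Pr (ball 0 \<rho>3)"
proof (rule op_analytic_onI[where C = "128 * L ^ 3 / (1 - \<theta>)\<^sup>2 * L"])
  have sub: "ball 0 \<rho>3 \<subseteq> ball (0::complex) \<rho>2" using radii by auto
  then show "linear_on (Pr z)" if "z \<in> ball 0 \<rho>3" for z using Pr_linear that by blast
  show "nrm (Pr z \<phi>) \<le> 128 * L ^ 3 / (1 - \<theta>)\<^sup>2 * L * nrm \<phi>" if "z \<in> ball 0 \<rho>3" "\<phi> \<in> B" for z \<phi>
    using order_trans[OF Pr_le[of z \<phi>] mult_left_mono[OF q_le[OF that(2)], of "128 * L ^ 3 / (1 - \<theta>)\<^sup>2"]]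
      that sub L by (auto simp: mult_ac)
  show "(\<lambda>z. Pr z \<phi> v) holomorphic_on ball 0 \<rho>3" if "\<phi> \<in> B" for \<phi> v
    by (rule holomorphic_on_subset[OF Pr_hol[OF that] sub])
qed auto

text \<open>The scalar stands for \<open>exp (- q z)\<close> with \<open>q\<close> the derivative of
  \<open>Lambda\<close>. The radius \<open>r\<close> is left free so that it can be made small
  against a bound for \<open>\<alpha>\<close>.\<close>

lemma scaled_N:
  fixes \<alpha> :: complex
  defines "N' \<equiv> \<lambda>z \<phi> v. exp (\<alpha> * z) * N z \<phi> v"
  assumes r: "r \<le> \<rho>3"
  shows "op_analytic_on B nrm N' (ball 0 r)"
    and "z \<in> ball 0 r \<Longrightarrow> op_spectral_radius B nrm (N' z) \<le> ereal (exp (cmod \<alpha> * r) * \<theta>2)"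
    and "z \<in> ball 0 r \<Longrightarrow> \<phi> \<in> B \<Longrightarrow> (N' z ^^ n) \<phi> = (\<lambda>v. exp (\<alpha> * z) ^ n * (N z ^^ n) \<phi> v)"
proof -
  have sub: "ball 0 r \<subseteq> ball (0::complex) \<rho>3" "ball 0 r \<subseteq> ball (0::complex) \<rho>2" using radii r by auto
  have ex: "cmod (exp (\<alpha> * z)) \<le> exp (cmod \<alpha> * r)" if "z \<in> ball 0 r" for z
  proof -
    have "cmod (exp (\<alpha> * z)) \<le> exp (cmod (\<alpha> * z))" by (rule norm_exp)
    also have "\<dots> \<le> exp (cmod \<alpha> * r)" using that by (auto simp: norm_mult intro!: mult_left_mono)
    finally show ?thesis .
  qed
  have lin: "linear_on (N' z)" if "z \<in> ball 0 r" for z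
  proof -
    have zz: "z \<in> ball 0 \<rho>2" using that sub by blast
    note l = linear_onD[OF N_linear[OF zz]]
    show ?thesis
      unfolding N'_def linear_on_def using l scale_mem[OF l(1)] by (auto simp: algebra_simps)
  qed
  show pw: "(N' z ^^ n) \<phi> = (\<lambda>v. exp (\<alpha> * z) ^ n * (N z ^^ n) \<phi> v)"
    if "z \<in> ball 0 r" "\<phi> \<in> B" for z n \<phi>
  proof (induction n)
    case (Suc n)
    have zz: "z \<in> ball 0 \<rho>2" using that sub by blast
    have m: "(N z ^^ n) \<phi> \<in> B" by (rule N_pow_mem[OF zz that(2)])
    have "(N' z ^^ Suc n) \<phi> = N' z (\<lambda>v. exp (\<alpha> * z) ^ n * (N z ^^ n) \<phi> v)" using Suc by simp
    also have "\<dots> = (\<lambda>v. exp (\<alpha> * z) ^ n * N' z ((N z ^^ n) \<phi>) v)" by (rule linear_onD(3)[OF lin[OF that(1)] m m])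
    finally show ?case by (simp add: N'_def mult_ac)
  qed simp
  have CN: "0 \<le> CN" unfolding CN_def using L \<theta> by simp
  show "op_analytic_on B nrm N' (ball 0 r)"
  proof (rule op_analytic_onI[OF _ lin, where C = "exp (cmod \<alpha> * r) * (CN * L)"])
    show "nrm (N' z \<phi>) \<le> exp (cmod \<alpha> * r) * (CN * L) * nrm \<phi>" if "z \<in> ball 0 r" "\<phi> \<in> B" for z \<phi>
    proof -
      have zz: "z \<in> ball 0 \<rho>2" using that sub by blast
      have "nrm (N' z \<phi>) \<le> cmod (exp (\<alpha> * z)) * (CN * q \<phi>)"
        unfolding N'_def by (rule nrm_le_scaleI[OF N_mem[OF zz that(2)] N_nrm_le[OF zz that(2)]])
      also have "\<dots> \<le> exp (cmod \<alpha> * r) * (CN * (L * nrm \<phi>))"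
        using ex[OF that(1)] q_le[OF that(2)] CN q_nonneg[OF that(2)] by (intro mult_mono) auto
      finally show ?thesis by (simp add: mult_ac)
    qed
    show "(\<lambda>z. N' z \<phi> v) holomorphic_on ball 0 r" if "\<phi> \<in> B" for \<phi> v
      unfolding N'_def using holomorphic_on_subset[OF N_hol[OF that] sub(2)] by (auto intro!: holomorphic_intros)
  qed auto
  show "op_spectral_radius B nrm (N' z) \<le> ereal (exp (cmod \<alpha> * r) * \<theta>2)" if "z \<in> ball 0 r"
  proof (rule op_spectral_radius_le[OF lin[OF that], where C = "2 * L * CN"])
    fix n \<phi> assume \<phi>: "\<phi> \<in> B"
    have zz: "z \<in> ball 0 \<rho>2" "z \<in> ball 0 \<rho>3" using that sub by blast+
    have "nrm ((N' z ^^ n) \<phi>) \<le> cmod (exp (\<alpha> * z) ^ n) * (2 * L * CN * \<theta>2 ^ n * nrm \<phi>)"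
      unfolding pw[OF that \<phi>] by (rule nrm_le_scaleI[OF N_pow_mem[OF zz(1) \<phi>] N_pow_bound[OF zz(2) \<phi>]])
    also have "\<dots> \<le> exp (cmod \<alpha> * r) ^ n * (2 * L * CN * \<theta>2 ^ n * nrm \<phi>)"
      unfolding norm_power using ex[OF that] CN L \<theta>12 nrm_nonneg[OF \<phi>]
      by (intro mult_right_mono power_mono) auto
    finally show "nrm ((N' z ^^ n) \<phi>) \<le> 2 * L * CN * (exp (cmod \<alpha> * r) * \<theta>2) ^ n * nrm \<phi>"
      by (simp add: power_mult_distrib mult_ac)
  qed (use \<theta>12 in auto)
qed

end

section \<open>The simplex and the Hilbert metric\<close>

lemma norm1_sphere1: "v \<in> sphere1 \<Longrightarrow> (\<Sum>i\<in>UNIV. v $ i) = 1"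
  unfolding sphere1_def norm1_def by (metis (mono_tags, lifting) abs_of_nonneg mem_Collect_eq sum.cong)

lemma sphere1_nonneg: "v \<in> sphere1 \<Longrightarrow> 0 \<le> v $ i"
  unfolding sphere1_def by simp

lemma sphere1I: "(\<And>i. 0 \<le> v $ i) \<Longrightarrow> (\<Sum>i\<in>UNIV. v $ i) = 1 \<Longrightarrow> v \<in> sphere1"
  unfolding sphere1_def norm1_def by simp

lemma sphere1_le_1: "v \<in> sphere1 \<Longrightarrow> v $ i \<le> 1"
  using norm1_sphere1[of v] member_le_sum[of i UNIV "\<lambda>i. v $ i"] sphere1_nonneg by fastforce

lemma inner_vec_sum: "(u :: real ^ 'n) \<bullet> v = (\<Sum>i\<in>UNIV. u $ i * v $ i)"
  by (simp add: inner_vec_def)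

lemma axis_sphere1: "axis i 1 \<in> (sphere1 :: (real ^ 'n) set)"
  by (rule sphere1I) (auto simp: axis_def)

lemma inner_axis_sphere1: "axis i 1 \<bullet> (v :: real ^ 'n) = v $ i"
  by (simp add: inner_axis')

text \<open>The coordinates of \<open>v\<close> are its products with the vertices of the simplex,
  and every \<open>f\<close> in the simplex is a convex combination of these.\<close>

lemma sphere1_eps_iff:
  assumes "v \<in> sphere1"
  shows "v \<in> sphere1_eps \<epsilon> \<longleftrightarrow> (\<forall>i. \<epsilon> \<le> v $ i)"
proof
  assume "v \<in> sphere1_eps \<epsilon>"
  then show "\<forall>i. \<epsilon> \<le> v $ i"
    unfolding sphere1_eps_def using axis_sphere1 inner_axis_sphere1 by (metis (no_types, lifting) mem_Collect_eq)
next
  assume *: "\<forall>i. \<epsilon> \<le> v $ i"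
  have "\<epsilon> \<le> f \<bullet> v" if f: "f \<in> sphere1" for f
  proof -
    have "\<epsilon> = (\<Sum>i\<in>UNIV. f $ i * \<epsilon>)" using norm1_sphere1[OF f] by (simp add: sum_distrib_right[symmetric])
    also have "\<dots> \<le> (\<Sum>i\<in>UNIV. f $ i * v $ i)"
      using * sphere1_nonneg[OF f] by (intro sum_mono mult_left_mono) auto
    finally show ?thesis by (simp add: inner_vec_sum)
  qed
  then show "v \<in> sphere1_eps \<epsilon>" using assms unfolding sphere1_eps_def by auto
qed

lemma sphere1_epsD:
  assumes "v \<in> sphere1_eps \<epsilon>"
  shows "v \<in> sphere1" "\<epsilon> \<le> v $ i" "f \<in> sphere1 \<Longrightarrow> \<epsilon> \<le> f \<bullet> v" "f \<in> sphere1 \<Longrightarrow> \<epsilon> \<le> v \<bullet> f"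
proof -
  show s: "v \<in> sphere1" using assms unfolding sphere1_eps_def by simp
  show "\<epsilon> \<le> v $ i" using assms sphere1_eps_iff[OF s] by auto
  show "f \<in> sphere1 \<Longrightarrow> \<epsilon> \<le> f \<bullet> v" "f \<in> sphere1 \<Longrightarrow> \<epsilon> \<le> v \<bullet> f"
    using assms unfolding sphere1_eps_def by (auto simp: inner_commute)
qed

lemma sphere1_inner_le_1:
  assumes "f \<in> sphere1" "v \<in> sphere1"
  shows "f \<bullet> v \<le> 1"
proof -
  have "(\<Sum>i\<in>UNIV. f $ i * v $ i) \<le> (\<Sum>i\<in>UNIV. f $ i * 1)"
    using assms sphere1_nonneg sphere1_le_1 by (intro sum_mono mult_left_mono) auto
  then show ?thesis using norm1_sphere1[OF assms(1)] by (simp add: inner_vec_sum)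
qed

lemma closed_sphere1: "closed (sphere1 :: (real ^ 'n) set)"
proof -
  have "sphere1 = (\<Inter>i. {v :: real ^ 'n. 0 \<le> v $ i}) \<inter> {v. (\<Sum>i\<in>UNIV. \<bar>v $ i\<bar>) = 1}"
    unfolding sphere1_def norm1_def by auto
  moreover have "closed \<dots>"
    by (intro closed_Int closed_INT ballI closed_Collect_le closed_Collect_eq continuous_intros)
  ultimately show ?thesis by simp
qed

lemma compact_sphere1: "compact (sphere1 :: (real ^ 'n) set)"
proof -
  have "norm v \<le> 1" if "v \<in> sphere1" for v :: "real ^ 'n"
    using norm_le_l1_cart[of v] that unfolding sphere1_def norm1_def by (metis (mono_tags, lifting) mem_Collect_eq)
  then have "bounded (sphere1 :: (real ^ 'n) set)" by (auto intro: boundedI)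
  then show ?thesis using closed_sphere1 compact_eq_bounded_closed by blast
qed

lemma sphere1_eps_eq: "sphere1_eps \<epsilon> = sphere1 \<inter> (\<Inter>i. {v :: real ^ 'n. \<epsilon> \<le> v $ i})"
  using sphere1_eps_iff sphere1_epsD(1) by blast

lemma closed_sphere1_eps: "closed (sphere1_eps \<epsilon> :: (real ^ 'n) set)"
  unfolding sphere1_eps_eq
  by (intro closed_Int closed_sphere1 closed_INT ballI closed_Collect_le continuous_intros)

lemma convex_sphere1_eps:
  assumes "0 < \<epsilon>"
  shows "convex (sphere1_eps \<epsilon> :: (real ^ 'n) set)"
proof (rule convexI)
  fix x y :: "real ^ 'n" and a b :: real
  assume xy: "x \<in> sphere1_eps \<epsilon>" "y \<in> sphere1_eps \<epsilon>" and ab: "0 \<le> a" "0 \<le> b" "a + b = 1"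
  have c: "\<epsilon> \<le> (a *\<^sub>R x + b *\<^sub>R y) $ i" for i
  proof -
    have "\<epsilon> = a * \<epsilon> + b * \<epsilon>" using ab by (simp add: distrib_right[symmetric])
    also have "\<dots> \<le> a * x $ i + b * y $ i"
      using xy ab sphere1_epsD(2) by (intro add_mono mult_left_mono) auto
    finally show ?thesis by simp
  qed
  have "a *\<^sub>R x + b *\<^sub>R y \<in> sphere1"
  proof (rule sphere1I)
    show "0 \<le> (a *\<^sub>R x + b *\<^sub>R y) $ i" for i using c[of i] assms by simp
    show "(\<Sum>i\<in>UNIV. (a *\<^sub>R x + b *\<^sub>R y) $ i) = 1"
      using xy ab by (simp add: sum.distrib sum_distrib_left[symmetric] norm1_sphere1 sphere1_epsD(1))
  qed
  then show "a *\<^sub>R x + b *\<^sub>R y \<in> sphere1_eps \<epsilon>" using c sphere1_eps_iff by blast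
qed

lemma sphere1_borel [measurable]: "sphere1 \<in> sets borel"
  using closed_sphere1 by (rule borel_closed)

lemma sphere1_eps_borel [measurable]: "sphere1_eps \<epsilon> \<in> sets borel"
  using closed_sphere1_eps by (rule borel_closed)

section \<open>The cross-ratio metric and its comparison with the norm\<close>

context
  fixes u v :: "real ^ 'n"
  assumes uv: "u \<in> sphere1" "v \<in> sphere1"
begin

lemma hilbert_m_upper:
  assumes "0 \<le> l" "\<forall>i. l * v $ i \<le> u $ i"
  shows "l \<le> 1" "l \<le> hilbert_m u v"
proof -
  have 1: "l \<le> 1" if "0 \<le> l" "\<forall>i. l * v $ i \<le> u $ i" for l
    using sum_mono[of UNIV "\<lambda>i. l * v $ i" "\<lambda>i. u $ i"] that norm1_sphere1[OF uv(1)] norm1_sphere1[OF uv(2)]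
    by (simp add: sum_distrib_left[symmetric])
  show "l \<le> 1" using 1 assms by blast
  show "l \<le> hilbert_m u v"
    unfolding hilbert_m_def by (rule cSup_upper) (use assms 1 in \<open>auto intro!: bdd_aboveI[of _ 1]\<close>)
qed

lemma hilbert_m_le: "hilbert_m u v * v $ i \<le> u $ i"
proof (cases "v $ i = 0")
  case True
  then show ?thesis using sphere1_nonneg[OF uv(1)] by simp
next
  case False
  then have p: "0 < v $ i" using sphere1_nonneg[OF uv(2), of i] by simp
  have "hilbert_m u v \<le> u $ i / v $ i"
    unfolding hilbert_m_def
  proof (rule cSup_least)
    show "{l. l \<ge> 0 \<and> (\<forall>i. l * v $ i \<le> u $ i)} \<noteq> {}"
      using sphere1_nonneg[OF uv(1)] by (auto intro!: exI[of _ 0])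
  qed (use p in \<open>auto simp: field_simps\<close>)
  then show ?thesis using p by (simp add: field_simps)
qed

lemma hilbert_m_nonneg: "0 \<le> hilbert_m u v"
  by (rule hilbert_m_upper(2)) (use sphere1_nonneg[OF uv(1)] in auto)

lemma hilbert_m_le_1: "hilbert_m u v \<le> 1"
  by (rule hilbert_m_upper(1)[OF hilbert_m_nonneg]) (use hilbert_m_le in auto)

end

lemma hilbert_product:
  assumes "u \<in> sphere1" "v \<in> sphere1"
  shows "0 \<le> hilbert_m u v * hilbert_m v u" "hilbert_m u v * hilbert_m v u \<le> 1"
    "hilbert_m u v * hilbert_m v u \<le> hilbert_m u v" "hilbert_m u v * hilbert_m v u \<le> hilbert_m v u"
  using hilbert_m_nonneg[OF assms] hilbert_m_nonneg[OF assms(2,1)]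
    hilbert_m_le_1[OF assms] hilbert_m_le_1[OF assms(2,1)]
  by (simp_all add: mult_le_one mult_left_le mult_left_le_one_le)

lemma hilbert_dist_bounds:
  assumes "u \<in> sphere1" "v \<in> sphere1"
  shows "0 \<le> hilbert_dist u v" "hilbert_dist u v \<le> 1"
    "1 - hilbert_m u v * hilbert_m v u \<le> 2 * hilbert_dist u v"
    "hilbert_dist u v \<le> 1 - hilbert_m u v * hilbert_m v u"
proof -
  let ?y = "hilbert_m u v * hilbert_m v u"
  note y = hilbert_product(1,2)[OF assms]
  show "0 \<le> hilbert_dist u v" "hilbert_dist u v \<le> 1" unfolding hilbert_dist_def using y by (auto simp: divide_simps)
  have "(1 - ?y) * (1 + ?y) \<le> (1 - ?y) * 2" by (rule mult_left_mono) (use y in auto)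
  then show "1 - ?y \<le> 2 * hilbert_dist u v" unfolding hilbert_dist_def using y by (simp add: divide_simps mult_ac)
  have "(1 - ?y) * 1 \<le> (1 - ?y) * (1 + ?y)" by (rule mult_left_mono) (use y in auto)
  then show "hilbert_dist u v \<le> 1 - ?y" unfolding hilbert_dist_def using y by (simp add: divide_simps mult_ac)
qed

text \<open>With \<open>a = hilbert_m u v\<close>, the vectors \<open>u - a v\<close> and
  \<open>(1 - a) v\<close> are nonnegative with coordinate sum \<open>1 - a\<close> each, and their
  difference is \<open>u - v\<close>.\<close>

lemma norm_le_hilbert_dist:
  assumes "u \<in> sphere1" "v \<in> sphere1"
  shows "norm (u - v) \<le> 4 * hilbert_dist u v"
proof -
  let ?a = "hilbert_m u v"
  note a = hilbert_m_le[OF assms] hilbert_m_le_1[OF assms]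
  have "norm (u - v) \<le> (\<Sum>i\<in>UNIV. \<bar>(u - v) $ i\<bar>)" by (rule norm_le_l1_cart)
  also have "\<dots> \<le> (\<Sum>i\<in>UNIV. (u $ i - ?a * v $ i) + (1 - ?a) * v $ i)"
  proof (rule sum_mono)
    fix i
    have "0 \<le> (1 - ?a) * v $ i" using a sphere1_nonneg[OF assms(2)] by simp
    then show "\<bar>(u - v) $ i\<bar> \<le> (u $ i - ?a * v $ i) + (1 - ?a) * v $ i"
      using a(1)[of i] by (simp add: algebra_simps abs_le_iff)
  qed
  also have "\<dots> = 2 * (1 - ?a)"
    using norm1_sphere1[OF assms(1)] norm1_sphere1[OF assms(2)]
    by (simp add: sum.distrib sum_subtractf sum_distrib_left[symmetric])
  also have "\<dots> \<le> 2 * (1 - ?a * hilbert_m v u)" using hilbert_product(3)[OF assms] by simp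
  also have "\<dots> \<le> 4 * hilbert_dist u v" using hilbert_dist_bounds(3)[OF assms] by simp
  finally show ?thesis .
qed

lemma hilbert_dist_pos:
  assumes "u \<in> sphere1" "v \<in> sphere1" "u \<noteq> v"
  shows "0 < hilbert_dist u v"
  using norm_le_hilbert_dist[OF assms(1,2)] assms(3) by (smt (verit) zero_less_norm_iff right_minus_eq)

lemma hilbert_m_eps:
  assumes "u \<in> sphere1_eps \<epsilon>" "v \<in> sphere1_eps \<epsilon>" "0 < \<epsilon>"
  shows "\<epsilon> \<le> hilbert_m u v" "1 - norm (u - v) / \<epsilon> \<le> hilbert_m u v"
proof -
  note s = sphere1_epsD(1)[OF assms(1)] sphere1_epsD(1)[OF assms(2)]
  have "\<epsilon> * v $ i \<le> u $ i" for i
    using mult_left_mono[OF sphere1_le_1[OF s(2), of i], of \<epsilon>] sphere1_epsD(2)[OF assms(1), of i] assms(3) by linarith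
  then show "\<epsilon> \<le> hilbert_m u v" using hilbert_m_upper(2)[OF s] assms(3) by simp
  show "1 - norm (u - v) / \<epsilon> \<le> hilbert_m u v"
  proof (cases "0 \<le> 1 - norm (u - v) / \<epsilon>")
    case True
    show ?thesis
    proof (rule hilbert_m_upper(2)[OF s True], intro allI)
      fix i
      have "norm (u - v) * \<epsilon> \<le> norm (u - v) * v $ i" using sphere1_epsD(2)[OF assms(2)] by (intro mult_left_mono) auto
      then have "norm (u - v) \<le> norm (u - v) / \<epsilon> * v $ i" using assms(3) by (simp add: field_simps)
      moreover have "v $ i - u $ i \<le> norm (u - v)"
        using component_le_norm_cart[of "u - v" i] by (simp add: abs_le_iff)
      ultimately show "(1 - norm (u - v) / \<epsilon>) * v $ i \<le> u $ i" by (simp add: algebra_simps)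
    qed
  next
    case False
    then show ?thesis using hilbert_m_nonneg[OF s] by linarith
  qed
qed

lemma hilbert_product_eps:
  assumes "u \<in> sphere1_eps \<epsilon>" "v \<in> sphere1_eps \<epsilon>" "0 < \<epsilon>"
  shows "\<epsilon>\<^sup>2 \<le> hilbert_m u v * hilbert_m v u"
  unfolding power2_eq_square using hilbert_m_eps(1) assms by (intro mult_mono) (auto intro: order_trans[OF less_imp_le])

text \<open>Together with \<open>norm_le_hilbert_dist\<close> this makes the metric and the norm
  equivalent on \<open>sphere1_eps \<epsilon>\<close>. Near the boundary of the simplex such a bound
  fails.\<close>

lemma hilbert_dist_le_norm:
  assumes "u \<in> sphere1_eps \<epsilon>" "v \<in> sphere1_eps \<epsilon>" "0 < \<epsilon>"
  shows "hilbert_dist u v \<le> 2 / \<epsilon> * norm (u - v)"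
proof -
  note s = sphere1_epsD(1)[OF assms(1)] sphere1_epsD(1)[OF assms(2)]
  let ?x = "norm (u - v) / \<epsilon>"
  have "1 - 2 * ?x \<le> hilbert_m u v * hilbert_m v u"
  proof (cases "?x \<le> 1")
    case True
    have "(1 - ?x) * (1 - ?x) \<le> hilbert_m u v * hilbert_m v u"
      using hilbert_m_eps(2)[OF assms] hilbert_m_eps(2)[OF assms(2,1,3)] True hilbert_m_nonneg[OF s]
      by (intro mult_mono) (auto simp: norm_minus_commute)
    moreover have "1 - 2 * ?x \<le> (1 - ?x) * (1 - ?x)" using zero_le_square[of ?x] by (simp add: algebra_simps)
    ultimately show ?thesis by linarith
  next
    case False
    then show ?thesis using hilbert_product(1)[OF s] by linarith
  qed
  then show ?thesis using hilbert_dist_bounds(4)[OF s] by simp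
qed

section \<open>Matrices with comparable entries and their contraction property\<close>

definition uniformly_positive :: "real \<Rightarrow> real \<Rightarrow> real ^ 'n ^ 'n \<Rightarrow> bool" where
  "uniformly_positive c \<epsilon> h \<longleftrightarrow> 0 < mat_norm1 h \<and> (\<forall>i j. c * mat_norm1 h \<le> h $ i $ j) \<and>
     (\<forall>v\<in>sphere1. act h v \<in> sphere1_eps \<epsilon> \<and> act (transpose h) v \<in> sphere1_eps \<epsilon>)"

lemma mat_norm1_transpose: "mat_norm1 (transpose h) = mat_norm1 h"
  unfolding mat_norm1_def transpose_def by (simp add: sum.swap[of "\<lambda>i j. h $ j $ i"])

lemma uniformly_positive_transpose: "uniformly_positive c \<epsilon> h \<Longrightarrow> uniformly_positive c \<epsilon> (transpose h)"
  unfolding uniformly_positive_def by (auto simp: mat_norm1_transpose) (simp add: transpose_def)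

context
  fixes c \<epsilon> :: real and h :: "real ^ 'n ^ 'n"
  assumes c: "0 < c" and h: "uniformly_positive c \<epsilon> h"
begin

lemma up_entry: "c * mat_norm1 h \<le> h $ i $ j" "0 < h $ i $ j" "0 < mat_norm1 h"
proof -
  show m: "0 < mat_norm1 h" "c * mat_norm1 h \<le> h $ i $ j" using h unfolding uniformly_positive_def by auto
  show "0 < h $ i $ j" using m mult_pos_pos[OF c m(1)] by linarith
qed

lemma up_row_le: "(\<Sum>j\<in>UNIV. h $ i $ j) \<le> mat_norm1 h"
proof -
  have "0 \<le> (\<Sum>j\<in>UNIV. h $ k $ j)" for k by (rule sum_nonneg) (rule less_imp_le[OF up_entry(2)])
  then show ?thesis
    unfolding mat_norm1_def using member_le_sum[of i UNIV "\<lambda>i. \<Sum>j\<in>UNIV. h $ i $ j"] by simp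
qed

lemma up_mv_component: "(h *v x) $ i = (\<Sum>j\<in>UNIV. h $ i $ j * x $ j)"
  by (simp add: matrix_vector_mult_def)

lemma up_mv_mono:
  assumes "\<And>j. 0 \<le> x $ j"
  shows "c * mat_norm1 h * (\<Sum>j\<in>UNIV. x $ j) \<le> (h *v x) $ i"
  unfolding up_mv_component sum_distrib_left
  using up_entry(1) assms by (intro sum_mono mult_right_mono) auto

lemma up_mv_lower: "v \<in> sphere1 \<Longrightarrow> c * mat_norm1 h \<le> (h *v v) $ i"
  using up_mv_mono[of v i] sphere1_nonneg[of v] norm1_sphere1[of v] by simp

lemma up_mv_pos: "v \<in> sphere1 \<Longrightarrow> 0 < (h *v v) $ i"
  using up_mv_lower[of v i] mult_pos_pos[OF c up_entry(3)] by linarith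

lemma up_mv_upper: "v \<in> sphere1 \<Longrightarrow> (h *v v) $ i \<le> (\<Sum>j\<in>UNIV. h $ i $ j)"
  unfolding up_mv_component
  using up_entry(2) sphere1_le_1 less_imp_le[OF up_entry(2)] by (intro sum_mono) (auto intro: mult_left_le)

lemma up_norm1_eq: "v \<in> sphere1 \<Longrightarrow> norm1 (h *v v) = (\<Sum>i\<in>UNIV. (h *v v) $ i)"
  unfolding norm1_def using up_mv_pos by (intro sum.cong) (auto intro: abs_of_pos)

lemma up_norm1_bounds:
  assumes "v \<in> sphere1"
  shows "c * mat_norm1 h \<le> norm1 (h *v v)" "norm1 (h *v v) \<le> mat_norm1 h" "0 < norm1 (h *v v)"
proof -
  show 1: "c * mat_norm1 h \<le> norm1 (h *v v)"
    unfolding up_norm1_eq[OF assms]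
    using member_le_sum[of undefined UNIV "\<lambda>i. (h *v v) $ i"] up_mv_lower[OF assms, of undefined]
      up_mv_pos[OF assms] by (force intro: less_imp_le)
  show "norm1 (h *v v) \<le> mat_norm1 h"
    unfolding up_norm1_eq[OF assms] mat_norm1_def by (intro sum_mono up_mv_upper assms)
  show "0 < norm1 (h *v v)" using 1 mult_pos_pos[OF c up_entry(3)] by linarith
qed

lemma up_act_mem: "v \<in> sphere1 \<Longrightarrow> act h v \<in> sphere1_eps \<epsilon>"
  using h unfolding uniformly_positive_def by blast

lemma up_act_scale: "v \<in> sphere1 \<Longrightarrow> h *v v = norm1 (h *v v) *\<^sub>R act h v"
  unfolding act_def using up_norm1_bounds(3)[of v] by simp

lemma up_inner_bounds:
  assumes "f \<in> sphere1" "v \<in> sphere1"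
  shows "c * mat_norm1 h \<le> f \<bullet> (h *v v)" "f \<bullet> (h *v v) \<le> mat_norm1 h" "0 < f \<bullet> (h *v v)"
proof -
  have "c * mat_norm1 h = (\<Sum>i\<in>UNIV. f $ i * (c * mat_norm1 h))"
    using norm1_sphere1[OF assms(1)] by (simp add: sum_distrib_right[symmetric])
  also have "\<dots> \<le> (\<Sum>i\<in>UNIV. f $ i * (h *v v) $ i)"
    using up_mv_lower assms sphere1_nonneg by (intro sum_mono mult_left_mono) auto
  finally show 1: "c * mat_norm1 h \<le> f \<bullet> (h *v v)" by (simp add: inner_vec_sum)
  have "f \<bullet> (h *v v) \<le> (\<Sum>i\<in>UNIV. 1 * (h *v v) $ i)"
    unfolding inner_vec_sum
    using up_mv_pos[OF assms(2)] assms sphere1_le_1 by (intro sum_mono mult_right_mono) (auto intro: less_imp_le)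
  then show "f \<bullet> (h *v v) \<le> mat_norm1 h"
    using up_norm1_bounds(2)[OF assms(2)] up_norm1_eq[OF assms(2)] by simp
  show "0 < f \<bullet> (h *v v)" using 1 mult_pos_pos[OF c up_entry(3)] by linarith
qed

text \<open>With \<open>a = hilbert_m u v\<close>, the nonnegative vector \<open>u - a v\<close> has
  coordinate sum \<open>1 - a\<close>, so all coordinates of its image are at least
  \<open>c * (1 - a) * mat_norm1 h\<close>, while those of \<open>h *v v\<close> are at most
  \<open>mat_norm1 h\<close>. In this way the slack improves the constant \<open>a\<close>.\<close>

lemma up_mv_dominates:
  assumes "u \<in> sphere1" "v \<in> sphere1"
  shows "(hilbert_m u v + c * (1 - hilbert_m u v)) * (h *v v) $ i \<le> (h *v u) $ i"
proof -
  let ?a = "hilbert_m u v"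
  let ?x = "u - ?a *\<^sub>R v"
  have a: "?a \<le> 1" by (rule hilbert_m_le_1[OF assms])
  have "c * (1 - ?a) * (h *v v) $ i \<le> c * (1 - ?a) * mat_norm1 h"
    using up_mv_upper[OF assms(2)] up_row_le a c by (intro mult_left_mono) (auto intro: order_trans)
  also have "\<dots> = c * mat_norm1 h * (\<Sum>j\<in>UNIV. ?x $ j)"
    using norm1_sphere1[OF assms(1)] norm1_sphere1[OF assms(2)]
    by (simp add: sum_subtractf sum_distrib_left[symmetric])
  also have "\<dots> \<le> (h *v ?x) $ i"
    by (rule up_mv_mono) (use hilbert_m_le[OF assms] in auto)
  also have "\<dots> = (h *v u) $ i - ?a * (h *v v) $ i"
    by (simp add: matrix_vector_mult_diff_distrib matrix_vector_mult_scaleR)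
  finally show ?thesis by (simp add: algebra_simps)
qed

lemma up_act_hilbert_m:
  assumes "u \<in> sphere1" "v \<in> sphere1" "0 \<le> \<epsilon>"
  shows "(hilbert_m u v + c * (1 - hilbert_m u v)) * (norm1 (h *v v) / norm1 (h *v u)) \<le> hilbert_m (act h u) (act h v)"
proof -
  note act = sphere1_epsD(1)[OF up_act_mem[OF assms(1)]] sphere1_epsD(1)[OF up_act_mem[OF assms(2)]]
  note n = up_norm1_bounds(3)[OF assms(1)] up_norm1_bounds(3)[OF assms(2)]
  let ?a = "hilbert_m u v + c * (1 - hilbert_m u v)"
  have a: "0 \<le> ?a" using hilbert_m_nonneg[OF assms(1,2)] hilbert_m_le_1[OF assms(1,2)] c by simp
  show ?thesis
  proof (rule hilbert_m_upper(2)[OF act])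
    show "\<forall>i. ?a * (norm1 (h *v v) / norm1 (h *v u)) * act h v $ i \<le> act h u $ i"
    proof
      fix i
      have "?a * (norm1 (h *v v) / norm1 (h *v u)) * act h v $ i = ?a * (h *v v) $ i / norm1 (h *v u)"
        unfolding act_def using n by (simp add: field_simps)
      also have "\<dots> \<le> (h *v u) $ i / norm1 (h *v u)"
        using up_mv_dominates[OF assms(1,2)] n by (intro divide_right_mono) auto
      also have "\<dots> = act h u $ i" unfolding act_def by simp
      finally show "?a * (norm1 (h *v v) / norm1 (h *v u)) * act h v $ i \<le> act h u $ i" .
    qed
  qed (use a n in auto)
qed

text \<open>In the product of the two one-sided bounds the ratios of norms cancel. If
  \<open>a\<close> and \<open>b\<close> are the two values of \<open>hilbert_m\<close>, one minus
  the product of the improved constants is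
  \<open>(1 - c) * ((1 - a * b) + c * (1 - a) * (1 - b))\<close>, and
  \<open>(1 - a) * (1 - b) \<le> 1 - a * b\<close>.\<close>

lemma up_act_contraction:
  assumes "u \<in> sphere1" "v \<in> sphere1" "c \<le> 1" "0 \<le> \<epsilon>"
  shows "hilbert_dist (act h u) (act h v) \<le> (1 - c\<^sup>2) * hilbert_dist u v"
proof -
  note act = sphere1_epsD(1)[OF up_act_mem[OF assms(1)]] sphere1_epsD(1)[OF up_act_mem[OF assms(2)]]
  note n = up_norm1_bounds(3)[OF assms(1)] up_norm1_bounds(3)[OF assms(2)]
  define a where "a = hilbert_m u v"
  define b where "b = hilbert_m v u"
  define y where "y = hilbert_m (act h u) (act h v) * hilbert_m (act h v) (act h u)"
  have ab: "0 \<le> a" "a \<le> 1" "0 \<le> b" "b \<le> 1"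
    unfolding a_def b_def using hilbert_m_nonneg hilbert_m_le_1 assms by auto
  have "((a + c * (1 - a)) * (norm1 (h *v v) / norm1 (h *v u))) * ((b + c * (1 - b)) * (norm1 (h *v u) / norm1 (h *v v))) \<le> y"
    unfolding y_def a_def b_def
    using ab c n hilbert_m_nonneg[OF act]
    by (intro mult_mono up_act_hilbert_m assms) (auto simp: a_def b_def)
  moreover have "(x * (p / q)) * (x' * (q / p)) = x * x'" if "0 < p" "0 < q" for x x' p q :: real
    using that by simp
  ultimately have y: "(a + c * (1 - a)) * (b + c * (1 - b)) \<le> y" using n by simp
  have y1: "y \<le> 1" unfolding y_def by (rule hilbert_product(2)[OF act])
  have "a * b \<le> (a + c * (1 - a)) * (b + c * (1 - b))" using ab c by (intro mult_mono) auto
  then have aby: "a * b \<le> y" using y by linarith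
  have "(1 - a) * (1 - b) \<le> 1 - a * b"
  proof -
    have "(1 - a) * (1 - b) \<le> 1 - a" using ab by (intro mult_left_le) auto
    also have "\<dots> \<le> 1 - a * b" using mult_left_le[of b a] ab by simp
    finally show ?thesis .
  qed
  then have "(1 - c) * c * ((1 - a) * (1 - b)) \<le> (1 - c) * c * (1 - a * b)"
    using assms c by (intro mult_left_mono) auto
  then have d: "1 - y \<le> (1 - c\<^sup>2) * (1 - a * b)"
    using y by (simp add: algebra_simps power2_eq_square)
  have "(1 - y) / (1 + y) \<le> (1 - c\<^sup>2) * (1 - a * b) / (1 + a * b)"
    using d aby y1 ab by (intro frac_le) (auto intro: add_pos_nonneg order_trans[of 0 "1-y"])
  then show ?thesis unfolding hilbert_dist_def y_def a_def b_def by simp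
qed

end

section \<open>Hoelder functions on the simplex\<close>

text \<open>Two distinct points make the set of Hoelder quotients nonempty; the supremum of the
  empty set of reals is unspecified.\<close>

lemma two_points_sphere1:
  assumes "2 \<le> CARD('n)"
  obtains u v :: "real ^ 'n" where "u \<in> sphere1" "v \<in> sphere1" "u \<noteq> v"
proof -
  obtain i j :: 'n where "i \<noteq> j"
    using assms card_le_Suc0_iff_eq[of "UNIV :: 'n set"] by force
  then have "axis i (1::real) \<noteq> axis j 1" by (auto simp: axis_eq_axis)
  then show thesis using axis_sphere1 that by blast
qed

lemma unimodular_multiple:
  fixes x :: complex
  obtains t where "cmod t = 1" "t * x = of_real (cmod x)"
proof (cases "x = 0")
  case False
  then show thesis
    using that[of "cnj x / of_real (cmod x)"]
    by (simp add: norm_divide complex_norm_square[symmetric] power2_eq_square mult.commute)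
qed (use that[of 1] in simp)

context
  fixes \<gamma> :: real
  assumes card: "2 \<le> CARD('n::finite)"
begin

lemma holder_spaceD:
  fixes \<phi> :: "real ^ 'n \<Rightarrow> complex"
  assumes "\<phi> \<in> holder_space \<gamma>"
  shows "continuous_on sphere1 \<phi>" "v \<notin> sphere1 \<Longrightarrow> \<phi> v = 0"
    "x \<in> sphere1 \<Longrightarrow> u \<in> sphere1 \<Longrightarrow> w \<in> sphere1 \<Longrightarrow> u \<noteq> w \<Longrightarrow>
       cmod (\<phi> x) + cmod (\<phi> u - \<phi> w) / hilbert_dist u w powr \<gamma> \<le> holder_norm \<gamma> \<phi>"
    "cmod (\<phi> v) \<le> holder_norm \<gamma> \<phi>" "0 \<le> holder_norm \<gamma> \<phi>"
    "u \<in> sphere1 \<Longrightarrow> w \<in> sphere1 \<Longrightarrow> cmod (\<phi> u - \<phi> w) \<le> holder_norm \<gamma> \<phi> * hilbert_dist u w powr \<gamma>"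
proof -
  have b: "bdd_above ((\<lambda>v. cmod (\<phi> v)) ` sphere1)" "bdd_above (holder_quotients \<gamma> \<phi>)"
    and "continuous_on sphere1 \<phi>" "\<And>v. v \<notin> sphere1 \<Longrightarrow> \<phi> v = 0"
    using assms unfolding holder_space_def by auto
  then show "continuous_on sphere1 \<phi>" and z: "\<And>v. v \<notin> sphere1 \<Longrightarrow> \<phi> v = 0" by auto
  have t: "cmod (\<phi> x) + cmod (\<phi> u - \<phi> w) / hilbert_dist u w powr \<gamma> \<le> holder_norm \<gamma> \<phi>"
    if "x \<in> sphere1" "u \<in> sphere1" "w \<in> sphere1" "u \<noteq> w" for x u w
    unfolding holder_norm_def
    by (intro add_mono cSUP_upper cSup_upper b that) (use that in \<open>auto simp: holder_quotients_def\<close>)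
  then show "x \<in> sphere1 \<Longrightarrow> u \<in> sphere1 \<Longrightarrow> w \<in> sphere1 \<Longrightarrow> u \<noteq> w \<Longrightarrow>
       cmod (\<phi> x) + cmod (\<phi> u - \<phi> w) / hilbert_dist u w powr \<gamma> \<le> holder_norm \<gamma> \<phi>" by blast
  obtain u0 w0 :: "real ^ 'n" where 0: "u0 \<in> sphere1" "w0 \<in> sphere1" "u0 \<noteq> w0"
    using two_points_sphere1[OF card] by blast
  have q: "0 \<le> cmod (\<phi> u - \<phi> w) / hilbert_dist u w powr \<gamma>" for u w by simp
  show n: "0 \<le> holder_norm \<gamma> \<phi>" using t[OF 0(1) 0] q[of u0 w0] norm_ge_zero[of "\<phi> u0"] by linarith
  show "cmod (\<phi> v) \<le> holder_norm \<gamma> \<phi>"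
  proof (cases "v \<in> sphere1")
    case True
    then show ?thesis using t[OF True 0] q[of u0 w0] by linarith
  qed (use z n in simp)
  show "cmod (\<phi> u - \<phi> w) \<le> holder_norm \<gamma> \<phi> * hilbert_dist u w powr \<gamma>" if "u \<in> sphere1" "w \<in> sphere1"
  proof (cases "u = w")
    case False
    then have "0 < hilbert_dist u w powr \<gamma>" using hilbert_dist_pos[OF that] by simp
    moreover have "cmod (\<phi> u - \<phi> w) / hilbert_dist u w powr \<gamma> \<le> holder_norm \<gamma> \<phi>"
      using t[OF that(1) that False] norm_ge_zero[of "\<phi> u"] by linarith
    ultimately show ?thesis by (simp add: field_simps)
  qed (use n in simp)
qed

lemma holder_spaceI:
  fixes \<phi> :: "real ^ 'n \<Rightarrow> complex"
  assumes "continuous_on sphere1 \<phi>" "\<And>v. v \<notin> sphere1 \<Longrightarrow> \<phi> v = 0"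
    and "\<And>v. v \<in> sphere1 \<Longrightarrow> cmod (\<phi> v) \<le> C"
    and "\<And>u v. u \<in> sphere1 \<Longrightarrow> v \<in> sphere1 \<Longrightarrow> cmod (\<phi> u - \<phi> v) \<le> K * hilbert_dist u v powr \<gamma>"
  shows "\<phi> \<in> holder_space \<gamma>" "holder_norm \<gamma> \<phi> \<le> C + K"
proof -
  obtain u0 w0 :: "real ^ 'n" where 0: "u0 \<in> sphere1" "w0 \<in> sphere1" "u0 \<noteq> w0"
    using two_points_sphere1[OF card] by blast
  have q: "cmod (\<phi> u - \<phi> v) / hilbert_dist u v powr \<gamma> \<le> K" if "u \<in> sphere1" "v \<in> sphere1" "u \<noteq> v" for u v
    using assms(4)[OF that(1,2)] hilbert_dist_pos[OF that] by (simp add: field_simps)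
  show "\<phi> \<in> holder_space \<gamma>"
    unfolding holder_space_def holder_quotients_def using assms q by (auto intro!: bdd_aboveI)
  show "holder_norm \<gamma> \<phi> \<le> C + K"
    unfolding holder_norm_def
  proof (rule add_mono)
    show "(SUP v\<in>sphere1. cmod (\<phi> v)) \<le> C" by (rule cSUP_least) (use 0 assms in auto)
    show "Sup (holder_quotients \<gamma> \<phi>) \<le> K"
      by (rule cSup_least) (use 0 q in \<open>auto simp: holder_quotients_def\<close>)
  qed
qed

text \<open>The two suprema in the norm run over independent variables, so a bound for sums of
  single terms is a bound for the sum of the suprema.\<close>

lemma holder_normI:
  fixes \<phi> :: "real ^ 'n \<Rightarrow> complex"
  assumes "\<And>x u w. x \<in> sphere1 \<Longrightarrow> u \<in> sphere1 \<Longrightarrow> w \<in> sphere1 \<Longrightarrow> u \<noteq> w \<Longrightarrow>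
       cmod (\<phi> x) + cmod (\<phi> u - \<phi> w) / hilbert_dist u w powr \<gamma> \<le> M"
  shows "holder_norm \<gamma> \<phi> \<le> M"
proof -
  obtain u0 w0 :: "real ^ 'n" where 0: "u0 \<in> sphere1" "w0 \<in> sphere1" "u0 \<noteq> w0"
    using two_points_sphere1[OF card] by blast
  have "Sup (holder_quotients \<gamma> \<phi>) \<le> M - cmod (\<phi> x)" if "x \<in> sphere1" for x
    by (rule cSup_least) (use 0 assms[OF that] in \<open>force simp: holder_quotients_def\<close>)+
  then have "(SUP v\<in>sphere1. cmod (\<phi> v)) \<le> M - Sup (holder_quotients \<gamma> \<phi>)"
    by (intro cSUP_least) (use 0 in force)+
  then show ?thesis unfolding holder_norm_def by simp
qed

lemma holder_function_space:
  "function_space (holder_space \<gamma> :: (real ^ 'n \<Rightarrow> complex) set) (holder_norm \<gamma>)"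
proof
  note D = holder_spaceD
  let ?B = "holder_space \<gamma> :: (real ^ 'n \<Rightarrow> complex) set"
  show "(\<lambda>_. 0) \<in> ?B" by (rule holder_spaceI[where C = 0 and K = 0]) auto
  show add: "(\<lambda>v. \<phi> v + \<psi> v) \<in> ?B" if p: "\<phi> \<in> ?B" "\<psi> \<in> ?B" for \<phi> \<psi>
  proof (rule holder_spaceI)
    show "continuous_on sphere1 (\<lambda>v. \<phi> v + \<psi> v)" by (intro continuous_intros D(1) p)
    show "cmod (\<phi> v + \<psi> v) \<le> holder_norm \<gamma> \<phi> + holder_norm \<gamma> \<psi>" for v
      by (intro norm_triangle_mono D(4) p)
    show "cmod ((\<phi> u + \<psi> u) - (\<phi> v + \<psi> v)) \<le> (holder_norm \<gamma> \<phi> + holder_norm \<gamma> \<psi>) * hilbert_dist u v powr \<gamma>"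
      if "u \<in> sphere1" "v \<in> sphere1" for u v
      using norm_triangle_ineq[of "\<phi> u - \<phi> v" "\<psi> u - \<psi> v"] D(6)[OF p(1) that] D(6)[OF p(2) that]
      by (simp add: algebra_simps)
    show "\<phi> v + \<psi> v = 0" if "v \<notin> sphere1" for v
      using D(2)[OF p(1) that] D(2)[OF p(2) that] by simp
  qed
  show sc: "(\<lambda>v. c * \<phi> v) \<in> ?B" if p: "\<phi> \<in> ?B" for \<phi> c
  proof (rule holder_spaceI)
    show "continuous_on sphere1 (\<lambda>v. c * \<phi> v)" by (intro continuous_intros D(1) p)
    show "cmod (c * \<phi> v) \<le> cmod c * holder_norm \<gamma> \<phi>" for v
      unfolding norm_mult by (intro mult_left_mono D(4) p) auto
    show "cmod (c * \<phi> u - c * \<phi> v) \<le> cmod c * holder_norm \<gamma> \<phi> * hilbert_dist u v powr \<gamma>"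
      if "u \<in> sphere1" "v \<in> sphere1" for u v
      unfolding right_diff_distrib[symmetric] norm_mult mult.assoc by (intro mult_left_mono D(6) p that) auto
    show "c * \<phi> v = 0" if "v \<notin> sphere1" for v using D(2)[OF p that] by simp
  qed
  show "holder_norm \<gamma> (\<lambda>v. \<phi> v + \<psi> v) \<le> holder_norm \<gamma> \<phi> + holder_norm \<gamma> \<psi>"
    if p: "\<phi> \<in> ?B" "\<psi> \<in> ?B" for \<phi> \<psi>
  proof (rule holder_normI)
    fix x u w :: "real ^ 'n" assume s: "x \<in> sphere1" "u \<in> sphere1" "w \<in> sphere1" "u \<noteq> w"
    have "cmod (\<phi> u + \<psi> u - (\<phi> w + \<psi> w)) / hilbert_dist u w powr \<gamma> \<le>
       (cmod (\<phi> u - \<phi> w) + cmod (\<psi> u - \<psi> w)) / hilbert_dist u w powr \<gamma>"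
      using norm_triangle_ineq[of "\<phi> u - \<phi> w" "\<psi> u - \<psi> w"] by (intro divide_right_mono) (auto simp: algebra_simps)
    then show "cmod (\<phi> x + \<psi> x) + cmod (\<phi> u + \<psi> u - (\<phi> w + \<psi> w)) / hilbert_dist u w powr \<gamma> \<le>
        holder_norm \<gamma> \<phi> + holder_norm \<gamma> \<psi>"
      using D(3)[OF p(1) s] D(3)[OF p(2) s] norm_triangle_ineq[of "\<phi> x" "\<psi> x"]
      unfolding add_divide_distrib by linarith
  qed
  show "holder_norm \<gamma> (\<lambda>v. c * \<phi> v) \<le> cmod c * holder_norm \<gamma> \<phi>" if p: "\<phi> \<in> ?B" for \<phi> c
  proof (rule holder_normI)
    fix x u w :: "real ^ 'n" assume s: "x \<in> sphere1" "u \<in> sphere1" "w \<in> sphere1" "u \<noteq> w"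
    have "cmod c * (cmod (\<phi> x) + cmod (\<phi> u - \<phi> w) / hilbert_dist u w powr \<gamma>) \<le> cmod c * holder_norm \<gamma> \<phi>"
      by (intro mult_left_mono D(3)[OF p s]) auto
    then show "cmod (c * \<phi> x) + cmod (c * \<phi> u - c * \<phi> w) / hilbert_dist u w powr \<gamma> \<le> cmod c * holder_norm \<gamma> \<phi>"
      by (simp add: right_diff_distrib[symmetric] norm_mult distrib_left)
  qed
  show "cmod (\<phi> v) \<le> holder_norm \<gamma> \<phi>" if "\<phi> \<in> ?B" for \<phi> v by (rule D(4)[OF that])
  show "\<psi> \<in> ?B" if "\<And>n. \<phi>s n \<in> ?B" "\<And>n. holder_norm \<gamma> (\<phi>s n) \<le> M" "uniform_limit UNIV \<phi>s \<psi> sequentially"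
    for \<phi>s :: "nat \<Rightarrow> real ^ 'n \<Rightarrow> complex" and \<psi> M
  proof (rule holder_spaceI)
    have l: "(\<lambda>n. \<phi>s n v) \<longlonglongrightarrow> \<psi> v" for v by (rule tendsto_uniform_limitI[OF that(3)]) simp
    show "continuous_on sphere1 \<psi>"
      by (rule uniform_limit_theorem[OF _ uniform_limit_on_subset[OF that(3)]]) (use D(1)[OF that(1)] in auto)
    show "\<psi> v = 0" if "v \<notin> sphere1" for v
      using l[of v] D(2)[OF \<open>\<And>n. \<phi>s n \<in> ?B\<close> that] by (simp add: LIMSEQ_const_iff)
    show "cmod (\<psi> v) \<le> M" for v
      by (rule LIMSEQ_le_const2[OF tendsto_norm[OF l]]) (use D(4)[OF that(1)] that(2) order_trans in blast)
    show "cmod (\<psi> u - \<psi> v) \<le> M * hilbert_dist u v powr \<gamma>" if uv: "u \<in> sphere1" "v \<in> sphere1" for u v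
    proof (rule LIMSEQ_le_const2[OF tendsto_norm[OF tendsto_diff[OF l l]]], intro exI allI impI)
      fix n
      have "cmod (\<phi>s n u - \<phi>s n v) \<le> holder_norm \<gamma> (\<phi>s n) * hilbert_dist u v powr \<gamma>"
        by (rule D(6)[OF \<open>\<And>n. \<phi>s n \<in> ?B\<close> uv])
      also have "\<dots> \<le> M * hilbert_dist u v powr \<gamma>"
        using \<open>\<And>n. holder_norm \<gamma> (\<phi>s n) \<le> M\<close> by (intro mult_right_mono) auto
      finally show "cmod (\<phi>s n u - \<phi>s n v) \<le> M * hilbert_dist u v powr \<gamma>" .
    qed
  qed
  show "holder_norm \<gamma> \<phi> \<le> M"
    if p: "\<phi> \<in> ?B" and t: "\<And>a b c u v w. (\<And>\<psi>. \<psi> \<in> ?B \<Longrightarrow> cmod (a * \<psi> u + b * \<psi> v + c * \<psi> w) \<le> holder_norm \<gamma> \<psi>)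
        \<Longrightarrow> cmod (a * \<phi> u + b * \<phi> v + c * \<phi> w) \<le> M" for \<phi> M
  proof (rule holder_normI)
    fix x u w :: "real ^ 'n" assume s: "x \<in> sphere1" "u \<in> sphere1" "w \<in> sphere1" "u \<noteq> w"
    let ?d = "hilbert_dist u w powr \<gamma>"
    have d: "0 < ?d" using hilbert_dist_pos[OF s(2-4)] by simp
    \<comment> \<open>The two terms of the norm are rotated to nonnegative reals. Their sum is then
      one combination of the values at \<open>x\<close>, \<open>u\<close> and \<open>w\<close>, and
      this combination is bounded by the norm on the whole space.\<close>
    obtain a where a: "cmod a = 1" "a * \<phi> x = of_real (cmod (\<phi> x))" by (rule unimodular_multiple)
    obtain b where b: "cmod b = 1" "b * (\<phi> u - \<phi> w) = of_real (cmod (\<phi> u - \<phi> w))" by (rule unimodular_multiple)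
    have eq: "a * \<psi> x + (b / of_real ?d) * \<psi> u + (- b / of_real ?d) * \<psi> w = a * \<psi> x + b * (\<psi> u - \<psi> w) / of_real ?d"
      for \<psi> :: "real ^ 'n \<Rightarrow> complex" by (simp add: right_diff_distrib diff_divide_distrib)
    have "cmod (a * \<phi> x + (b / of_real ?d) * \<phi> u + (- b / of_real ?d) * \<phi> w) \<le> M"
    proof (rule t)
      fix \<psi> assume \<psi>: "\<psi> \<in> ?B"
      have "cmod (a * \<psi> x + b * (\<psi> u - \<psi> w) / of_real ?d) \<le> cmod (\<psi> x) + cmod (\<psi> u - \<psi> w) / ?d"
        using norm_triangle_ineq[of "a * \<psi> x" "b * (\<psi> u - \<psi> w) / of_real ?d"] a(1) b(1) d
        by (simp add: norm_mult norm_divide)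
      also have "\<dots> \<le> holder_norm \<gamma> \<psi>" by (rule D(3)[OF \<psi> s])
      finally show "cmod (a * \<psi> x + (b / of_real ?d) * \<psi> u + (- b / of_real ?d) * \<psi> w) \<le> holder_norm \<gamma> \<psi>"
        unfolding eq .
    qed
    moreover have "a * \<phi> x + b * (\<phi> u - \<phi> w) / of_real ?d = of_real (cmod (\<phi> x) + cmod (\<phi> u - \<phi> w) / ?d)"
      unfolding a b by simp
    moreover have "0 \<le> cmod (\<phi> x) + cmod (\<phi> u - \<phi> w) / ?d" using d by simp
    ultimately show "cmod (\<phi> x) + cmod (\<phi> u - \<phi> w) / ?d \<le> M"
      unfolding eq by (metis abs_of_nonneg norm_of_real)
  qed
qed

end

section \<open>A gauge for the contraction\<close>

text \<open>
  Near zero \<open>D\<close> is a large multiple of \<open>d powr \<gamma>\<close>, which absorbs the defect \<open>1 - y \<le> C * d\<close>. Away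
  from zero only \<open>\<beta> \<le> y\<close> is available, and \<open>D\<close> is \<open>1 - b * d powr (- \<sigma>)\<close>, where \<open>\<sigma>\<close> is so large that
  the decrease of \<open>D\<close> from \<open>d\<close> to \<open>\<tau> * d\<close> outweighs the factor \<open>\<beta>\<close>.
\<close>

lemma contraction_gauge:
  fixes \<beta> C \<tau> \<gamma> :: real
  assumes \<beta>: "0 < \<beta>" "\<beta> \<le> 1" and C: "0 \<le> C" and \<tau>: "0 < \<tau>" "\<tau> < 1" and \<gamma>: "0 < \<gamma>" "\<gamma> \<le> 1"
  obtains D :: "real \<Rightarrow> real" and K \<theta>
  where "0 \<le> \<theta>" "\<theta> < 1" "1 \<le> K"
    "\<And>d. 0 \<le> d \<Longrightarrow> d \<le> 1 \<Longrightarrow> 0 \<le> D d \<and> D d \<le> 1 \<and> d powr \<gamma> / 2 \<le> D d \<and> D d \<le> K * d powr \<gamma>"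
    "\<And>d d' y. 0 < d \<Longrightarrow> d \<le> 1 \<Longrightarrow> 0 \<le> d' \<Longrightarrow> d' \<le> \<tau> * d \<Longrightarrow> \<beta> \<le> y \<Longrightarrow> y \<le> 1 \<Longrightarrow>
       1 - y \<le> C * d \<Longrightarrow> (1 - y) + y * D d' \<le> \<theta> * D d"
proof -
  define t where "t = \<tau> powr \<gamma>"
  have t: "0 < t" "t < 1" unfolding t_def using \<tau> \<gamma> by (auto intro: powr_less_mono2[of \<gamma> \<tau> 1, simplified])
  \<comment> \<open>Chosen for \<open>C \<le> A * (1 - t) / 2\<close>: near zero, half of the
    decrease of \<open>A * d powr \<gamma>\<close> pays for the defect \<open>1 - y\<close>.\<close>
  define A where "A = 1 + 2 * C / (1 - t)"
  have A: "1 \<le> A" unfolding A_def using C t by simp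
  have AC: "C \<le> A * (1 - t) / 2"
  proof -
    have "2 * C / (1 - t) * (1 - t) = 2 * C" using t by simp
    then have "A * (1 - t) = 1 - t + 2 * C" unfolding A_def distrib_right by simp
    then show ?thesis using t by simp
  qed
  \<comment> \<open>Chosen for \<open>\<tau> powr (- \<sigma>) = 2 / \<beta>\<close>: one
    contraction step multiplies \<open>d powr (- \<sigma>)\<close> by so much that a factor 2 is
    left after multiplication by \<open>\<beta>\<close>.\<close>
  define \<sigma> where "\<sigma> = ln (2 / \<beta>) / (- ln \<tau>)"
  have \<sigma>: "0 < \<sigma>" unfolding \<sigma>_def using \<beta> \<tau> by (intro divide_pos_pos) auto
  have \<tau>\<sigma>: "\<tau> powr (- \<sigma>) = 2 / \<beta>"
    unfolding powr_def \<sigma>_def using \<beta> \<tau> by (simp add: ln_div exp_diff)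
  \<comment> \<open>Small enough for \<open>b * d powr (- \<sigma>) \<le> \<beta> / 4\<close>
    wherever \<open>A * d powr \<gamma> > 1/2\<close>, so that \<open>D d\<close> is at least
    \<open>1 - \<beta> / 4\<close> there.\<close>
  define b where "b = \<beta> / 4 * (2 * A) powr (- (\<sigma> / \<gamma>))"
  have pA: "(2 * A) powr (- (\<sigma> / \<gamma>)) \<le> 1" using powr_mono[of "- (\<sigma> / \<gamma>)" 0 "2 * A"] A \<sigma> \<gamma> by simp
  have b: "0 < b" "b < 1"
  proof -
    show "0 < b" unfolding b_def using \<beta> A by simp
    have "b \<le> \<beta> / 4 * 1" unfolding b_def using \<beta> pA by (intro mult_left_mono) auto
    then show "b < 1" using \<beta> by simp
  qed
  \<comment> \<open>As \<open>0 powr (- \<sigma>) = 0\<close>, the second branch would be one at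
    zero; the value there is set separately.\<close>
  define D where "D = (\<lambda>d. if d = 0 then 0 else max (min (A * d powr \<gamma>) (1/2)) (1 - b * d powr (- \<sigma>)))"
  \<comment> \<open>One rate for each case: \<open>A * d powr \<gamma> \<le> 1/2\<close>; larger
    \<open>d\<close> with \<open>D (\<tau> * d) \<le> 1/2\<close>; and \<open>D (\<tau> * d)\<close>
    given by the branch with exponent \<open>- \<sigma>\<close>.\<close>
  define \<theta> where "\<theta> = max ((1 + t) / 2) (max ((1 - \<beta> / 2) / (1 - \<beta> / 4)) (1 - b))"
  have \<theta>: "0 \<le> \<theta>" "\<theta> < 1"
    unfolding \<theta>_def using t b \<beta> by (auto simp: max_def divide_simps)
  have \<theta>_ge: "(1 + t) / 2 \<le> \<theta>" "(1 - \<beta> / 2) / (1 - \<beta> / 4) \<le> \<theta>" "1 - b \<le> \<theta>"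
    unfolding \<theta>_def by auto
  define K where "K = A + b powr (- (\<gamma> / \<sigma>))"
  have bounds: "0 \<le> D d \<and> D d \<le> 1 \<and> d powr \<gamma> / 2 \<le> D d \<and> D d \<le> K * d powr \<gamma>" if "0 \<le> d" "d \<le> 1" for d
  proof (cases "d = 0")
    case False
    then have d: "0 < d" using that by simp
    have dg: "0 < d powr \<gamma>" "d powr \<gamma> \<le> 1" using d that \<gamma> by (auto intro: powr_le1)
    have lo: "d powr \<gamma> / 2 \<le> min (A * d powr \<gamma>) (1/2)"
      using dg A mult_right_mono[of "1/2" A "d powr \<gamma>"] by auto
    define m where "m = min (A * d powr \<gamma>) (1/2)"
    define e where "e = 1 - b * d powr (- \<sigma>)"
    have Dd: "D d = max m e" unfolding D_def m_def e_def using False by simp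
    \<comment> \<open>Where the left-hand side is positive, \<open>d\<close> is bounded below, so
      that a fixed multiple of \<open>d powr \<gamma>\<close> is at least one.\<close>
    have "1 - b * d powr (- \<sigma>) \<le> K * d powr \<gamma>"
    proof (cases "1 \<le> b * d powr (- \<sigma>)")
      case True
      moreover have "0 \<le> K * d powr \<gamma>" unfolding K_def using A dg by simp
      ultimately show ?thesis by linarith
    next
      case False
      then have "b \<le> d powr \<sigma>" using d by (simp add: powr_minus field_simps)
      then have "b powr (\<gamma> / \<sigma>) \<le> (d powr \<sigma>) powr (\<gamma> / \<sigma>)" using b \<gamma> \<sigma> by (intro powr_mono2) auto
      then have "b powr (\<gamma> / \<sigma>) \<le> d powr \<gamma>" using \<sigma> by (simp add: powr_powr)
      then have "1 \<le> b powr (- (\<gamma> / \<sigma>)) * d powr \<gamma>" using b by (simp add: powr_minus field_simps)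
      moreover have "0 \<le> A * d powr \<gamma>" using A dg by simp
      moreover have "0 < b * d powr (- \<sigma>)" using b d by simp
      ultimately show ?thesis unfolding K_def distrib_right by linarith
    qed
    moreover have "A * d powr \<gamma> \<le> K * d powr \<gamma>" unfolding K_def using dg by (intro mult_right_mono) auto
    moreover have "0 < b * d powr (- \<sigma>)" using b d by simp
    ultimately have e: "e \<le> K * d powr \<gamma>" "e \<le> 1" "m \<le> K * d powr \<gamma>"
      unfolding e_def m_def by (auto intro: min.coboundedI1)
    have m: "d powr \<gamma> / 2 \<le> m" "m \<le> 1/2" using lo unfolding m_def by auto
    show ?thesis
    proof (cases "m \<le> e")
      case True
      then have "D d = e" unfolding Dd by simp
      then show ?thesis using e m True dg(1) by linarith
    next
      case False
      then have "D d = m" unfolding Dd by simp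
      then show ?thesis using e m dg(1) by linarith
    qed
  qed (simp add: D_def)
  have main: "(1 - y) + y * D d' \<le> \<theta> * D d"
    if d: "0 < d" "d \<le> 1" and d': "0 \<le> d'" "d' \<le> \<tau> * d" and y: "\<beta> \<le> y" "y \<le> 1" "1 - y \<le> C * d" for d d' y
  proof -
    have td: "0 < \<tau> * d" "\<tau> * d \<le> 1" using d \<tau> by (auto intro: mult_le_one less_imp_le)
    \<comment> \<open>By monotonicity of both branches, \<open>d' = \<tau> * d\<close> is the worst
      case.\<close>
    have "D d' \<le> D (\<tau> * d)"
    proof (cases "d' = 0")
      case True
      then show ?thesis using bounds[of "\<tau> * d"] td by (simp add: D_def)
    next
      case False
      then have "0 < d'" using d' by simp
      moreover have "A * d' powr \<gamma> \<le> A * (\<tau> * d) powr \<gamma>"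
        using A d' \<gamma> by (intro mult_left_mono powr_mono2) auto
      moreover have "b * (\<tau> * d) powr (- \<sigma>) \<le> b * d' powr (- \<sigma>)"
        using b d' \<open>0 < d'\<close> \<sigma> by (intro mult_left_mono powr_mono2') auto
      ultimately show ?thesis using td unfolding D_def by (auto simp: max_def min_def)
    qed
    then have le: "(1 - y) + y * D d' \<le> (1 - y) + y * D (\<tau> * d)" using y \<beta> by (intro add_left_mono mult_left_mono) auto
    define x where "x = d powr (- \<sigma>)"
    have x: "1 \<le> x" unfolding x_def powr_minus using d \<sigma> by (intro one_le_inverse powr_le1) auto
    have Dd: "min (A * d powr \<gamma>) (1/2) \<le> D d" "1 - b * x \<le> D d" "0 \<le> D d"
      using bounds[of d] d unfolding D_def x_def by auto
    have D\<tau>: "D (\<tau> * d) = max (min (A * (t * d powr \<gamma>)) (1/2)) (1 - b * (2 / \<beta> * x))"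
      using td d \<tau> \<tau>\<sigma> unfolding D_def t_def x_def by (simp add: powr_mult)
    have "(1 - y) + y * D (\<tau> * d) \<le> \<theta> * D d"
    proof (cases "min (A * (t * d powr \<gamma>)) (1/2) \<le> 1 - b * (2 / \<beta> * x)")
      case True
      then have "(1 - y) + y * D (\<tau> * d) = 1 - y / \<beta> * (2 * b * x)" unfolding D\<tau> by (simp add: algebra_simps)
      also have "\<dots> \<le> 1 - 1 * (2 * b * x)"
        using y \<beta> b x by (intro diff_left_mono mult_right_mono) auto
      also have "\<dots> \<le> (1 - b) * (1 - b * x)"
      proof -
        have "b * 1 \<le> b * x" using b x by (intro mult_left_mono) auto
        moreover have "0 \<le> b * (b * x)" using b x by simp
        ultimately show ?thesis by (simp add: algebra_simps)
      qed
      also have "\<dots> \<le> (1 - b) * D d" using b Dd by (intro mult_left_mono) auto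
      also have "\<dots> \<le> \<theta> * D d" using \<theta>_ge Dd by (intro mult_right_mono) auto
      finally show ?thesis .
    next
      case False
      then have D': "D (\<tau> * d) \<le> A * (t * d powr \<gamma>)" "D (\<tau> * d) \<le> 1/2" unfolding D\<tau> by auto
      show ?thesis
      proof (cases "A * d powr \<gamma> \<le> 1/2")
        case True
        have dg: "d \<le> d powr \<gamma>" using powr_mono'[of \<gamma> 1 d] d \<gamma> by simp
        have D0: "0 \<le> D (\<tau> * d)" using bounds[of "\<tau> * d"] td by simp
        have "y * D (\<tau> * d) \<le> D (\<tau> * d)" using y D0 \<beta> by (intro mult_left_le_one_le) auto
        then have "(1 - y) + y * D (\<tau> * d) \<le> C * d + A * (t * d powr \<gamma>)" using y D' by linarith
        also have "C * d \<le> A * (1 - t) / 2 * d powr \<gamma>" using AC dg d C A t by (intro mult_mono) auto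
        also have "A * (1 - t) / 2 * d powr \<gamma> + A * (t * d powr \<gamma>) = (1 + t) / 2 * (A * d powr \<gamma>)"
          by (simp add: field_simps)
        also have "\<dots> \<le> \<theta> * D d" using \<theta>_ge Dd True A \<theta> by (intro mult_mono) auto
        finally show ?thesis by simp
      next
        case False
        have "(1 - y) + y * D (\<tau> * d) \<le> (1 - y) + y * (1/2)" using D' y \<beta> by (intro add_left_mono mult_left_mono) auto
        also have "\<dots> \<le> 1 - \<beta> / 2" using y by simp
        also have "\<dots> = (1 - \<beta> / 2) / (1 - \<beta> / 4) * (1 - \<beta> / 4)" using \<beta> by simp
        also have "\<dots> \<le> \<theta> * D d"
        proof (intro mult_mono \<theta>_ge)
          have "1 < 2 * A * d powr \<gamma>" using False by simp
          then have "1 powr (\<sigma> / \<gamma>) \<le> (2 * A * d powr \<gamma>) powr (\<sigma> / \<gamma>)"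
            using \<sigma> \<gamma> by (intro powr_mono2) auto
          also have "\<dots> = (2 * A) powr (\<sigma> / \<gamma>) * d powr \<sigma>"
            using A d \<gamma> by (simp add: powr_mult powr_powr)
          finally have "(2 * A) powr (- (\<sigma> / \<gamma>)) * x \<le> 1"
            unfolding x_def powr_minus using A d by (simp add: field_simps)
          then have "\<beta> / 4 * ((2 * A) powr (- (\<sigma> / \<gamma>)) * x) \<le> \<beta> / 4 * 1" using \<beta> by (intro mult_left_mono) auto
          then have "b * x \<le> \<beta> / 4" unfolding b_def by (simp add: mult.assoc)
          then show "1 - \<beta> / 4 \<le> D d" using Dd by linarith
        qed (use \<beta> \<theta> in auto)
        finally show ?thesis .
      qed
    qed
    then show ?thesis using le by linarith
  qed
  have "1 \<le> K" unfolding K_def using A by (simp add: add_increasing2)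
  then show thesis using that[of \<theta> K D] \<theta> bounds main by blast
qed

text \<open>Both signs of \<open>s\<close> at once, at the cost of a constant on either side. Only
  the bound \<open>b\<close> for the exponent enters the constants, which makes the estimates
  uniform in \<open>s\<close>.\<close>

lemma powr_between:
  fixes c N x s :: real
  assumes "0 < c" "c \<le> 1" "0 < N" "c * N \<le> x" "x \<le> N" "\<bar>s\<bar> \<le> b"
  shows "c powr b * N powr s \<le> x powr s" "x powr s \<le> c powr (- b) * N powr s"
proof -
  have x: "0 < x" using mult_pos_pos[OF assms(1,3)] assms(4) by linarith
  have cb: "c powr b \<le> c powr \<bar>s\<bar>" "c powr (- \<bar>s\<bar>) \<le> c powr (- b)" "c powr b \<le> 1" "1 \<le> c powr (- b)"
    using assms powr_mono'[of "\<bar>s\<bar>" b c] powr_mono'[of "-b" "-\<bar>s\<bar>" c] powr_mono'[of 0 b c] powr_mono'[of "-b" 0 c]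
    by auto
  have N: "0 < N powr s" using assms by simp
  have *: "c powr b * N powr s \<le> x powr s \<and> x powr s \<le> c powr (- b) * N powr s"
  proof (cases "0 \<le> s")
    case True
    have "c powr b * N powr s \<le> c powr s * N powr s" using cb(1) True N by (intro mult_right_mono) auto
    also have "\<dots> = (c * N) powr s" using assms by (simp add: powr_mult)
    also have "\<dots> \<le> x powr s" using assms True by (intro powr_mono2) auto
    finally have 1: "c powr b * N powr s \<le> x powr s" .
    have "x powr s \<le> 1 * N powr s" using assms x True by (simp add: powr_mono2)
    also have "\<dots> \<le> c powr (- b) * N powr s" using cb N by (intro mult_right_mono) auto
    finally show ?thesis using 1 by blast
  next
    case False
    have "c powr b * N powr s \<le> 1 * N powr s" using cb N by (intro mult_right_mono) auto
    also have "\<dots> \<le> x powr s" using assms x False by (simp add: powr_mono2')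
    finally have 1: "c powr b * N powr s \<le> x powr s" .
    have "x powr s \<le> (c * N) powr s" using assms False by (intro powr_mono2') auto
    also have "\<dots> = c powr (- \<bar>s\<bar>) * N powr s" using assms False by (simp add: powr_mult)
    also have "\<dots> \<le> c powr (- b) * N powr s" using cb N by (intro mult_right_mono) auto
    finally show ?thesis using 1 by blast
  qed
  then show "c powr b * N powr s \<le> x powr s" "x powr s \<le> c powr (- b) * N powr s" by auto
qed

text \<open>Moments at two endpoints thus dominate those with exponents in between, and the minimum
  provides a common lower bound.\<close>

lemma powr_le_sum:
  fixes x s a b :: real
  assumes "0 < x" "a \<le> s" "s \<le> b"
  shows "x powr s \<le> x powr a + x powr b" "min (x powr a) (x powr b) \<le> x powr s"
  using assms powr_mono[of s b x] powr_mono'[of a s x] powr_mono[of a s x] powr_mono'[of s b x]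
    powr_ge_zero[of x a] powr_ge_zero[of x b]
  by (cases "1 \<le> x"; simp add: min_def; linarith)+

section \<open>Eigenmeasures of the transfer operators\<close>

lemma continuous_matrix_vector_mult: "continuous_on UNIV (\<lambda>p :: (real ^ 'n ^ 'm) \<times> (real ^ 'n). fst p *v snd p)"
  unfolding matrix_vector_mult_def by (intro continuous_on_vec_lambda continuous_intros)

lemma matrix_vector_mult_measurable [measurable]:
  fixes f :: "'b \<Rightarrow> real ^ 'n ^ 'm"
  assumes [measurable]: "f \<in> borel_measurable N" "g \<in> borel_measurable N"
  shows "(\<lambda>x. f x *v g x) \<in> borel_measurable N"
  by (rule borel_measurable_continuous_Pair[OF assms continuous_matrix_vector_mult])

lemma norm1_measurable [measurable]: "norm1 \<in> borel_measurable borel"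
  unfolding norm1_def[abs_def] by (intro borel_measurable_continuous_onI continuous_intros)

lemma mat_norm1_measurable [measurable]: "(mat_norm1 :: real ^ 'n ^ 'n \<Rightarrow> real) \<in> borel_measurable borel"
  unfolding mat_norm1_def[abs_def] by (intro borel_measurable_continuous_onI continuous_intros)

lemma transpose_measurable [measurable]: "(transpose :: real ^ 'n ^ 'n \<Rightarrow> real ^ 'n ^ 'n) \<in> borel_measurable borel"
  unfolding transpose_def[abs_def]
  by (intro borel_measurable_continuous_onI continuous_on_vec_lambda continuous_intros)

lemma act_measurable [measurable]:
  fixes f :: "'b \<Rightarrow> real ^ 'n ^ 'n"
  assumes [measurable]: "f \<in> borel_measurable N" "g \<in> borel_measurable N"
  shows "(\<lambda>x. act (f x) (g x)) \<in> borel_measurable N"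
  unfolding act_def by measurable

lemma nonneg_matrices_measurable [measurable]: "(nonneg_matrices :: (real ^ 'n ^ 'n) set) \<in> sets borel"
proof -
  have "nonneg_matrices = (\<Inter>i. \<Inter>j. {h :: real ^ 'n ^ 'n. 0 \<le> h $ i $ j})"
    unfolding nonneg_matrices_def by auto
  moreover have "closed \<dots>" by (intro closed_INT ballI closed_Collect_le continuous_intros)
  ultimately show ?thesis by simp
qed

lemma continuous_sphere1_measurable:
  fixes \<phi> :: "real ^ 'n \<Rightarrow> 'b::real_normed_vector"
  assumes "continuous_on sphere1 \<phi>"
  shows "(\<lambda>v. indicator sphere1 v *\<^sub>R \<phi> v) \<in> borel_measurable borel"
  by (rule borel_measurable_continuous_on_indicator[OF _ assms]) simp

lemma set_integrable_sphere1:
  fixes w :: "real ^ 'n \<Rightarrow> 'b::{banach, second_countable_topology}"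
  assumes "prob_space \<eta>" "sets \<eta> = sets borel" "continuous_on UNIV w"
  shows "set_integrable \<eta> sphere1 w"
proof -
  interpret E: prob_space \<eta> by (rule assms)
  note [measurable_cong] = assms(2) and [measurable] = borel_measurable_continuous_onI[OF assms(3)]
  have "bounded (w ` sphere1)"
    using compact_continuous_image[OF continuous_on_subset[OF assms(3)] compact_sphere1] compact_imp_bounded by blast
  then obtain k where k: "\<And>v. v \<in> sphere1 \<Longrightarrow> norm (w v) \<le> k" unfolding bounded_iff by blast
  show ?thesis
    unfolding set_integrable_def
    by (rule E.integrable_const_bound[where B = "\<bar>k\<bar>"])
      (auto intro!: AE_I2 simp: indicator_def intro: order_trans[OF k abs_ge_self])
qed

locale matrix_law = prob_space \<mu>
  for \<mu> :: "(real ^ 'n ^ 'n) measure" +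
  fixes \<epsilon> c :: real
  assumes sets_\<mu> [measurable_cong, simp]: "sets \<mu> = sets borel"
    and eps: "0 < \<epsilon>" "\<epsilon> < 1" and c: "0 < c" "c \<le> 1"
    and up: "AE h in \<mu>. uniformly_positive c \<epsilon> h"
    and card: "2 \<le> CARD('n)"
begin

lemma space_\<mu> [simp]: "space \<mu> = UNIV"
  using sets_eq_imp_space_eq[OF sets_\<mu>] by simp

lemma AE_nonneg: "AE h in \<mu>. h \<in> nonneg_matrices"
  using up
proof eventually_elim
  case (elim h)
  then show ?case unfolding nonneg_matrices_def using up_entry(2)[OF c(1) elim] by (auto intro: less_imp_le)
qed

lemma set_integral_nonneg_matrices:
  fixes F :: "real ^ 'n ^ 'n \<Rightarrow> 'b::{banach, second_countable_topology}"
  assumes [measurable]: "F \<in> borel_measurable borel"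
  shows "(LINT h:nonneg_matrices|\<mu>. F h) = (LINT h|\<mu>. F h)"
  unfolding set_lebesgue_integral_def
  by (rule integral_cong_AE) (use AE_nonneg in \<open>auto elim!: eventually_mono\<close>)

lemma nonempty_sphere1_eps: "(sphere1_eps \<epsilon> :: (real ^ 'n) set) \<noteq> {}"
proof -
  have "\<exists>h :: real ^ 'n ^ 'n. uniformly_positive c \<epsilon> h" by (rule eventually_happens'[OF ae_filter_bot up])
  then show ?thesis using up_act_mem[OF c(1)] axis_sphere1 by blast
qed

end

text \<open>\<open>T\<close> is going to be the identity or the transposition, so that
  \<open>P_op\<close> and \<open>P_star_op\<close> are treated together.\<close>

locale transfer_eigenmeasure = matrix_law \<mu> \<epsilon> c
  for \<mu> :: "(real ^ 'n ^ 'n) measure" and \<epsilon> c :: real +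
  fixes T :: "real ^ 'n ^ 'n \<Rightarrow> real ^ 'n ^ 'n" and s k :: real and \<eta> :: "(real ^ 'n) measure"
  assumes T [measurable]: "T \<in> borel_measurable borel"
    and upT: "AE h in \<mu>. uniformly_positive c \<epsilon> (T h)"
    and T_norm: "\<And>h. mat_norm1 (T h) = mat_norm1 h"
    and moment: "integrable \<mu> (\<lambda>h. mat_norm1 h powr s)"
    and eigen: "eigenmeasure (\<lambda>\<phi> v. LINT h:nonneg_matrices|\<mu>. norm1 (T h *v v) powr s * \<phi> (act (T h) v)) k \<eta>"
begin

lemma eta: "prob_space \<eta>" "sets \<eta> = sets borel" "emeasure \<eta> sphere1 = 1"
  "\<And>\<phi>. continuous_on sphere1 \<phi> \<Longrightarrow>
     (LINT v:sphere1|\<eta>. LINT h:nonneg_matrices|\<mu>. norm1 (T h *v v) powr s * \<phi> (act (T h) v)) =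
     k * (LINT v:sphere1|\<eta>. \<phi> v)"
  using eigen unfolding eigenmeasure_def by auto

lemma eta_sphere1: "AE v in \<eta>. v \<in> sphere1"
proof -
  interpret E: prob_space \<eta> by (rule eta)
  have "E.prob sphere1 = 1" by (simp add: E.emeasure_eq_measure[symmetric] measure_def eta)
  then show ?thesis using E.AE_in_set_eq_1[of sphere1] eta(2) by simp
qed

lemma eta_set_integral:
  fixes F :: "real ^ 'n \<Rightarrow> 'b::{banach, second_countable_topology}"
  assumes "(\<lambda>v. indicator sphere1 v *\<^sub>R F v) \<in> borel_measurable borel"
    "\<And>v. v \<in> sphere1 \<Longrightarrow> norm (F v) \<le> K"
  shows "set_integrable \<eta> sphere1 F"
proof -
  interpret E: prob_space \<eta> by (rule eta)
  show ?thesis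
    unfolding set_integrable_def
    by (rule E.integrable_const_bound[where B = "\<bar>K\<bar>"])
      (use assms eta(2) in \<open>auto intro!: AE_I2 simp: indicator_def cong: measurable_cong_sets intro: order_trans[OF _ abs_ge_self]\<close>)
qed

text \<open>The test function one: its image at \<open>v\<close> is comparable with the moment of
  \<open>mat_norm1 h powr s\<close>, uniformly in \<open>v\<close>. The bound keeps the eigenvalue
  away from zero uniformly on compact sets of exponents.\<close>

lemma k_lower: "c powr \<bar>s\<bar> * (\<integral>h. mat_norm1 h powr s \<partial>\<mu>) \<le> k"
proof -
  interpret E: prob_space \<eta> by (rule eta)
  let ?m = "\<integral>h. mat_norm1 h powr s \<partial>\<mu>"
  let ?P = "\<lambda>v. \<integral>h. norm1 (T h *v v) powr s \<partial>\<mu>"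
  have between: "c powr \<bar>s\<bar> * mat_norm1 h powr s \<le> norm1 (T h *v v) powr s"
    "norm1 (T h *v v) powr s \<le> c powr (- \<bar>s\<bar>) * mat_norm1 h powr s"
    if "v \<in> sphere1" "uniformly_positive c \<epsilon> (T h)" for v h
    using powr_between[of c "mat_norm1 h" "norm1 (T h *v v)" s "\<bar>s\<bar>"] c
      up_norm1_bounds[OF c(1) that(2,1)] up_entry(3)[OF c(1) that(2)] T_norm[of h] by auto
  have int: "integrable \<mu> (\<lambda>h. norm1 (T h *v v) powr s)" if "v \<in> sphere1" for v
  proof (rule Bochner_Integration.integrable_bound[OF integrable_mult_right[OF moment, of "c powr (- \<bar>s\<bar>)"]])
    show "AE h in \<mu>. norm (norm1 (T h *v v) powr s) \<le> norm (c powr (- \<bar>s\<bar>) * mat_norm1 h powr s)"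
      using upT by eventually_elim (use between(2)[OF that] in force)
  qed simp
  have lo: "c powr \<bar>s\<bar> * ?m \<le> ?P v" and hi: "?P v \<le> c powr (- \<bar>s\<bar>) * ?m" if "v \<in> sphere1" for v
  proof -
    have "(\<integral>h. c powr \<bar>s\<bar> * mat_norm1 h powr s \<partial>\<mu>) \<le> ?P v"
      by (rule integral_mono_AE[OF integrable_mult_right[OF moment] int[OF that]])
        (use upT in \<open>eventually_elim; use between(1)[OF that] in force\<close>)
    then show "c powr \<bar>s\<bar> * ?m \<le> ?P v" by simp
    have "?P v \<le> (\<integral>h. c powr (- \<bar>s\<bar>) * mat_norm1 h powr s \<partial>\<mu>)"
      by (rule integral_mono_AE[OF int[OF that] integrable_mult_right[OF moment]])
        (use upT in \<open>eventually_elim; use between(2)[OF that] in force\<close>)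
    then show "?P v \<le> c powr (- \<bar>s\<bar>) * ?m" by simp
  qed
  have P0: "0 \<le> ?P v" for v by (rule Bochner_Integration.integral_nonneg) simp
  have [measurable]: "?P \<in> borel_measurable borel"
    by (rule borel_measurable_lebesgue_integral) measurable
  have si: "set_integrable \<eta> sphere1 ?P"
    by (rule eta_set_integral[where K = "c powr (- \<bar>s\<bar>) * ?m"]) (use hi P0 in auto)
  have "(\<integral>v. c powr \<bar>s\<bar> * ?m \<partial>\<eta>) \<le> (\<integral>v. indicator sphere1 v *\<^sub>R ?P v \<partial>\<eta>)"
    by (rule integral_mono_AE) (use si eta_sphere1 lo in \<open>auto simp: set_integrable_def elim!: eventually_mono\<close>)
  also have "\<dots> = (LINT v:sphere1|\<eta>. LINT h:nonneg_matrices|\<mu>. norm1 (T h *v v) powr s * 1)"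
    unfolding set_lebesgue_integral_def[of \<eta>] by (simp add: set_integral_nonneg_matrices)
  also have "\<dots> = k * (LINT v:sphere1|\<eta>. 1)" by (rule eta(4)) simp
  also have "(LINT v:sphere1|\<eta>. (1::real)) = 1"
    unfolding set_lebesgue_integral_def using eta by (simp add: measure_def)
  finally show ?thesis by (simp add: E.prob_space)
qed

lemma moment_pos: "0 < (\<integral>h. mat_norm1 h powr s \<partial>\<mu>)"
proof -
  have "AE h in \<mu>. 0 < mat_norm1 h powr s"
    using upT by eventually_elim (use up_entry(3)[OF c(1)] T_norm in \<open>fastforce\<close>)
  then have "AE h in \<mu>. \<not> (mat_norm1 h powr s = 0)" by eventually_elim simp
  then have "\<not> (AE h in \<mu>. mat_norm1 h powr s = 0)"
    using AE_False AE_conjI eventually_mono by (smt (verit, best))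
  moreover have "0 \<le> (\<integral>h. mat_norm1 h powr s \<partial>\<mu>)" by (rule Bochner_Integration.integral_nonneg) simp
  ultimately show ?thesis using integral_nonneg_eq_0_iff_AE[OF moment] by (simp add: less_le)
qed

lemma k_pos: "0 < k"
  using k_lower moment_pos c by (smt (verit) mult_pos_pos powr_gt_zero)

text \<open>The distance to \<open>sphere1_eps \<epsilon>\<close> is a continuous test function that
  vanishes after one step. As the eigenvalue is positive, its integral against the eigenmeasure is
  zero.\<close>

lemma eta_eps: "AE v in \<eta>. v \<in> sphere1_eps \<epsilon>"
proof -
  let ?S = "sphere1_eps \<epsilon> :: (real ^ 'n) set"
  let ?\<phi> = "\<lambda>v. infdist v ?S"
  have cont: "continuous_on A ?\<phi>" for A by (intro continuous_intros)
  then have [measurable]: "?\<phi> \<in> borel_measurable borel" by (rule borel_measurable_continuous_onI)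
  have "(LINT h:nonneg_matrices|\<mu>. norm1 (T h *v v) powr s * ?\<phi> (act (T h) v)) = 0" if "v \<in> sphere1" for v
  proof -
    have "(LINT h:nonneg_matrices|\<mu>. norm1 (T h *v v) powr s * ?\<phi> (act (T h) v)) =
        (\<integral>h. norm1 (T h *v v) powr s * ?\<phi> (act (T h) v) \<partial>\<mu>)"
      by (rule set_integral_nonneg_matrices) measurable
    also have "\<dots> = (\<integral>h. 0 \<partial>\<mu>)"
      by (rule integral_cong_AE) (use upT in \<open>auto elim!: eventually_mono intro!: infdist_zero up_act_mem[OF c(1)] that\<close>)
    finally show ?thesis by simp
  qed
  then have "(LINT v:sphere1|\<eta>. LINT h:nonneg_matrices|\<mu>. norm1 (T h *v v) powr s * ?\<phi> (act (T h) v)) = (LINT v:sphere1|\<eta>. 0)"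
    unfolding set_lebesgue_integral_def[of \<eta>] by (intro Bochner_Integration.integral_cong) (auto simp: indicator_def)
  then have "(LINT v:sphere1|\<eta>. ?\<phi> v) = 0" using eta(4)[OF cont] k_pos by simp
  moreover have "set_integrable \<eta> sphere1 ?\<phi>" by (rule set_integrable_sphere1[OF eta(1,2) cont])
  ultimately have "AE v in \<eta>. indicator sphere1 v *\<^sub>R ?\<phi> v = 0"
    unfolding set_lebesgue_integral_def set_integrable_def
    by (subst (asm) integral_nonneg_eq_0_iff_AE) (auto intro!: AE_I2 mult_nonneg_nonneg infdist_nonneg)
  then show ?thesis
    using eta_sphere1
  proof eventually_elim
    case (elim v)
    then have "infdist v ?S = 0" by simp
    then show ?case using in_closed_iff_infdist_zero[OF closed_sphere1_eps nonempty_sphere1_eps] by blast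
  qed
qed

end

section \<open>The tilted kernel\<close>

text \<open>For nonnegative exponents the lower bound \<open>a\<close> for \<open>p / q\<close> is
  used, for negative ones the upper bound \<open>1 / b\<close>. Recording which of the two avoids a
  loss when such estimates are multiplied.\<close>

lemma powr_ratio:
  fixes p q a b s :: real
  assumes "0 < p" "0 < q" "0 < a" "0 < b" "a * q \<le> p" "b * p \<le> q"
  shows "(if 0 \<le> s then a else b) powr \<bar>s\<bar> * q powr s \<le> p powr s"
proof (cases "0 \<le> s")
  case True
  have "(a * q) powr s \<le> p powr s" using assms True by (intro powr_mono2) auto
  then show ?thesis using assms True by (simp add: powr_mult)
next
  case False
  have "(q / b) powr s \<le> p powr s" using assms False by (intro powr_mono2') (auto simp: field_simps)
  then show ?thesis using assms False by (simp add: powr_divide powr_minus_divide)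
qed

lemma norm_exp_minus_1_le: "cmod (exp w - 1) \<le> cmod w * exp (cmod w)"
proof -
  have "cmod (exp w - exp 0) \<le> exp (cmod w) * cmod (w - 0)"
  proof (rule field_differentiable_bound[of "cball 0 (cmod w)" exp exp])
    show "cmod (exp z) \<le> exp (cmod w)" if "z \<in> cball 0 (cmod w)" for z
      using norm_exp[of z] that by (auto intro: order_trans)
  qed (auto intro: DERIV_subset[OF DERIV_exp])
  then show ?thesis by (simp add: mult.commute)
qed

lemma ln_ratio_bound:
  fixes p q y b :: real
  assumes "0 < p" "0 < q" "0 < y" "y \<le> 1" "y powr b * q \<le> p" "y powr b * p \<le> q"
  shows "\<bar>ln (p / q)\<bar> \<le> b * ln (1 / y)"
proof -
  have "ln (y powr b * q) \<le> ln p" "ln (y powr b * p) \<le> ln q" using assms by (simp_all add: ln_le_cancel_iff)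
  moreover have "ln (y powr b * q) = b * ln y + ln q" "ln (y powr b * p) = b * ln y + ln p"
    using assms by (simp_all add: ln_mult ln_powr)
  ultimately show ?thesis using assms by (simp add: ln_div abs_le_iff)
qed

text \<open>\<open>a1\<close> and \<open>a2\<close> enclose the exponents \<open>s + Re z\<close>
  for \<open>cmod z < \<delta>\<close>. In the constants, \<open>b\<close>, \<open>\<kappa>0\<close>
  and the moments at these endpoints stand in for \<open>s\<close> and \<open>\<kappa>\<close>, so
  that the constants are common to a compact set of exponents.\<close>

locale tilted_kernel = matrix_law \<mu> \<epsilon> c
  for \<mu> :: "(real ^ 'n ^ 'n) measure" and \<epsilon> c :: real +
  fixes s \<kappa> :: real and \<eta> :: "(real ^ 'n) measure" and f :: "real ^ 'n"
    and b \<delta> a1 a2 \<kappa>0 :: real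
  assumes prob_\<eta>: "prob_space \<eta>" and sets_\<eta> [measurable_cong, simp]: "sets \<eta> = sets borel"
    and \<eta>_eps: "AE u in \<eta>. u \<in> sphere1_eps \<epsilon>"
    and s: "\<bar>s\<bar> \<le> b" and \<kappa>0: "0 < \<kappa>0" "\<kappa>0 \<le> \<kappa>"
    and \<delta>: "0 < \<delta>" and a12: "a1 \<le> s - \<delta>" "s + \<delta> \<le> a2"
    and moments: "integrable \<mu> (\<lambda>h. mat_norm1 h powr a1)" "integrable \<mu> (\<lambda>h. mat_norm1 h powr a2)"
    and eigenfunction: "\<And>v. v \<in> sphere1_eps \<epsilon> \<Longrightarrow> (\<integral>h. r_fun \<eta> s (h *v v) \<partial>\<mu>) = \<kappa> * r_fun \<eta> s v"
    and f: "f \<in> sphere1"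
begin

sublocale E: prob_space \<eta> by (rule prob_\<eta>)

abbreviation "S\<epsilon> \<equiv> sphere1_eps \<epsilon> :: (real ^ 'n) set"
abbreviation "r \<equiv> r_fun \<eta> s"

lemma \<kappa>_pos: "0 < \<kappa>" using \<kappa>0 by simp

lemma b_nonneg: "0 \<le> b" using s by linarith

lemma r_measurable [measurable]: "r \<in> borel_measurable borel"
  unfolding r_fun_def[abs_def] set_lebesgue_integral_def
  by (rule E.borel_measurable_lebesgue_integral) measurable

lemma r_bounds:
  assumes "0 < c'" "c' \<le> 1" "0 < N" "\<And>u. u \<in> sphere1 \<Longrightarrow> c' * N \<le> x \<bullet> u \<and> x \<bullet> u \<le> N"
  shows "set_integrable \<eta> sphere1 (\<lambda>u. (x \<bullet> u) powr s)" "c' powr b * N powr s \<le> r x" "r x \<le> c' powr (- b) * N powr s"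
proof -
  have ae: "AE u in \<eta>. u \<in> sphere1" using \<eta>_eps by eventually_elim (rule sphere1_epsD)
  have p: "c' powr b * N powr s \<le> (x \<bullet> u) powr s" "(x \<bullet> u) powr s \<le> c' powr (- b) * N powr s" if "u \<in> sphere1" for u
    using powr_between[OF assms(1-3) _ _ s] assms(4)[OF that] by auto
  show i: "set_integrable \<eta> sphere1 (\<lambda>u. (x \<bullet> u) powr s)"
    unfolding set_integrable_def
    by (rule E.integrable_const_bound[where B = "c' powr (- b) * N powr s"])
      (use ae p(2) in \<open>auto elim!: eventually_mono\<close>)
  have "(\<integral>u. c' powr b * N powr s \<partial>\<eta>) \<le> r x"
    unfolding r_fun_def set_lebesgue_integral_def
    by (rule integral_mono_AE) (use ae p(1) i in \<open>auto simp: set_integrable_def elim!: eventually_mono\<close>)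
  then show "c' powr b * N powr s \<le> r x" by (simp add: E.prob_space)
  have "r x \<le> (\<integral>u. c' powr (- b) * N powr s \<partial>\<eta>)"
    unfolding r_fun_def set_lebesgue_integral_def
    by (rule integral_mono_AE) (use ae p(2) i in \<open>auto simp: set_integrable_def elim!: eventually_mono\<close>)
  then show "r x \<le> c' powr (- b) * N powr s" by (simp add: E.prob_space)
qed

lemma r_sphere:
  assumes "v \<in> S\<epsilon>"
  shows "set_integrable \<eta> sphere1 (\<lambda>u. (v \<bullet> u) powr s)" "\<epsilon> powr b \<le> r v" "r v \<le> \<epsilon> powr (- b)" "0 < r v"
proof -
  have *: "\<epsilon> * 1 \<le> v \<bullet> u \<and> v \<bullet> u \<le> 1" if "u \<in> sphere1" for u
    using sphere1_epsD(4)[OF assms that] sphere1_inner_le_1[OF sphere1_epsD(1)[OF assms] that] by simp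
  show "set_integrable \<eta> sphere1 (\<lambda>u. (v \<bullet> u) powr s)" "r v \<le> \<epsilon> powr (- b)"
    and 1: "\<epsilon> powr b \<le> r v" using r_bounds[of \<epsilon> 1 v] * eps by auto
  show "0 < r v" using less_le_trans[OF _ 1] eps by simp
qed

lemma r_image:
  assumes "v \<in> sphere1" "uniformly_positive c \<epsilon> h"
  shows "set_integrable \<eta> sphere1 (\<lambda>u. ((h *v v) \<bullet> u) powr s)" "0 < r (h *v v)"
    "r (h *v v) \<le> c powr (- b) * mat_norm1 h powr s"
proof -
  have *: "c * mat_norm1 h \<le> (h *v v) \<bullet> u \<and> (h *v v) \<bullet> u \<le> mat_norm1 h" if "u \<in> sphere1" for u
    using up_inner_bounds(1,2)[OF c(1) assms(2) that assms(1)] by (simp add: inner_commute)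
  note rb = r_bounds[OF c up_entry(3)[OF c(1) assms(2)] *]
  show "set_integrable \<eta> sphere1 (\<lambda>u. ((h *v v) \<bullet> u) powr s)" "r (h *v v) \<le> c powr (- b) * mat_norm1 h powr s"
    using rb(1,3) by auto
  have "0 < c powr b * mat_norm1 h powr s" using c up_entry(3)[OF c(1) assms(2)] by simp
  then show "0 < r (h *v v)" using rb(2) by simp
qed

lemma r_scale:
  assumes "0 < t" "\<And>u. u \<in> sphere1 \<Longrightarrow> 0 \<le> x \<bullet> u"
  shows "r (t *\<^sub>R x) = t powr s * r x"
proof -
  have "r (t *\<^sub>R x) = (\<integral>u. t powr s * (indicator sphere1 u *\<^sub>R (x \<bullet> u) powr s) \<partial>\<eta>)"
    unfolding r_fun_def set_lebesgue_integral_def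
    by (rule Bochner_Integration.integral_cong) (use assms in \<open>auto simp: indicator_def powr_mult\<close>)
  then show ?thesis unfolding r_fun_def set_lebesgue_integral_def by simp
qed

lemma r_act:
  assumes "v \<in> sphere1" "uniformly_positive c \<epsilon> h"
  shows "r (h *v v) = norm1 (h *v v) powr s * r (act h v)"
proof -
  have "0 \<le> act h v \<bullet> u" if "u \<in> sphere1" for u
    using sphere1_epsD(4)[OF up_act_mem[OF c(1) assms(2,1)] that] eps by simp
  then show ?thesis
    using r_scale[OF up_norm1_bounds(3)[OF c(1) assms(2,1)], of "act h v"] up_act_scale[OF c(1) assms(2,1)] by simp
qed

lemma r_ratio:
  assumes "set_integrable \<eta> sphere1 (\<lambda>u. (x \<bullet> u) powr s)" "set_integrable \<eta> sphere1 (\<lambda>u. (x' \<bullet> u) powr s)"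
    and "0 < a" "0 < a'"
    and "\<And>u. u \<in> sphere1 \<Longrightarrow> 0 < x \<bullet> u \<and> 0 < x' \<bullet> u \<and> a * (x' \<bullet> u) \<le> x \<bullet> u \<and> a' * (x \<bullet> u) \<le> x' \<bullet> u"
  shows "(if 0 \<le> s then a else a') powr \<bar>s\<bar> * r x' \<le> r x"
proof -
  let ?k = "(if 0 \<le> s then a else a') powr \<bar>s\<bar>"
  have "(\<integral>u. ?k * (indicator sphere1 u *\<^sub>R (x' \<bullet> u) powr s) \<partial>\<eta>) \<le> r x"
    unfolding r_fun_def set_lebesgue_integral_def
  proof (rule integral_mono)
    show "?k * (indicator sphere1 u *\<^sub>R (x' \<bullet> u) powr s) \<le> indicator sphere1 u *\<^sub>R (x \<bullet> u) powr s" for u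
      using powr_ratio[of "x \<bullet> u" "x' \<bullet> u" a a' s] assms(3-5) by (auto simp: indicator_def)
  qed (use assms(1,2) in \<open>auto simp: set_integrable_def\<close>)
  then show ?thesis unfolding r_fun_def set_lebesgue_integral_def by simp
qed

text \<open>\<open>W v\<close> is the density with respect to \<open>\<mu>\<close> of the Markov
  kernel that arises from the Doob transform with the eigenfunction \<open>r\<close>. The vector
  \<open>f\<close> enters \<open>F\<close> only through \<open>Y\<close>, because the powers of
  \<open>f \<bullet> v\<close> with exponent \<open>s\<close> cancel in \<open>R_op\<close>.\<close>

definition "W v h = r (h *v v) / (\<kappa> * r v)"
definition "Y v h = (f \<bullet> (h *v v)) / (f \<bullet> v)"
definition F :: "complex \<Rightarrow> real ^ 'n \<Rightarrow> real ^ 'n ^ 'n \<Rightarrow> complex" where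
  "F z v h = of_real (W v h) * exp (z * of_real (ln (Y v h)))"

lemma W_measurable [measurable]: "W v \<in> borel_measurable borel"
  unfolding W_def[abs_def] by measurable

lemma F_measurable [measurable]: "F z v \<in> borel_measurable borel"
proof -
  have [measurable]: "(exp :: complex \<Rightarrow> complex) \<in> borel_measurable borel"
    by (intro borel_measurable_continuous_onI continuous_intros)
  show ?thesis unfolding F_def[abs_def] Y_def by measurable
qed

lemma W_pos: "v \<in> S\<epsilon> \<Longrightarrow> uniformly_positive c \<epsilon> h \<Longrightarrow> 0 < W v h"
  unfolding W_def using r_image(2)[OF sphere1_epsD(1)] r_sphere(4) \<kappa>_pos by simp

lemma Y_pos: "v \<in> S\<epsilon> \<Longrightarrow> uniformly_positive c \<epsilon> h \<Longrightarrow> 0 < Y v h"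
  unfolding Y_def using up_inner_bounds(3)[OF c(1) _ f sphere1_epsD(1)] sphere1_epsD(3)[OF _ f] eps by fastforce

text \<open>The factor of an integrable envelope \<open>\<Gamma>\<close> for the kernels
  \<open>F z v\<close>. The envelope is independent of \<open>v\<close>, \<open>z\<close>,
  \<open>s\<close> and \<open>f\<close>, since its two powers cover every exponent
  \<open>s + Re z\<close>.\<close>

definition "Cc = (c * \<epsilon>) powr (- (b + \<delta>)) / \<kappa>0"
definition "\<Gamma> h = Cc * (mat_norm1 h powr a1 + mat_norm1 h powr a2)"

lemma \<Gamma>_integrable: "integrable \<mu> \<Gamma>"
  unfolding \<Gamma>_def[abs_def] using moments by auto

lemma Cc_pos: "0 < Cc" unfolding Cc_def using c eps \<kappa>0 by simp

lemma \<Gamma>_nonneg: "0 \<le> \<Gamma> h" unfolding \<Gamma>_def using Cc_pos by simp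

definition "Mom = (\<integral>h. \<Gamma> h \<partial>\<mu>)"

lemma Mom_nonneg: "0 \<le> Mom" unfolding Mom_def by (rule Bochner_Integration.integral_nonneg) (rule \<Gamma>_nonneg)

lemma F_bound:
  assumes v: "v \<in> S\<epsilon>" and h: "uniformly_positive c \<epsilon> h" and z: "cmod z < \<delta>"
  shows "cmod (F z v h) \<le> \<Gamma> h"
proof -
  let ?N = "mat_norm1 h" and ?t = "Re z"
  have t: "\<bar>?t\<bar> \<le> \<delta>" using z abs_Re_le_cmod[of z] by linarith
  note v1 = sphere1_epsD(1)[OF v]
  have N: "0 < ?N" by (rule up_entry(3)[OF c(1) h])
  have fv: "\<epsilon> \<le> f \<bullet> v" "f \<bullet> v \<le> 1" using sphere1_epsD(3)[OF v f] sphere1_inner_le_1[OF f v1] by auto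
  have 1: "W v h \<le> c powr (- b) * ?N powr s / (\<kappa>0 * \<epsilon> powr b)"
    unfolding W_def
    by (intro frac_le r_image(3)[OF v1 h] mult_mono \<kappa>0 r_sphere(2)[OF v])
      (use c N \<kappa>0 eps less_imp_le[OF r_image(2)[OF v1 h]] in auto)
  have "Y v h powr ?t = (f \<bullet> (h *v v)) powr ?t * (f \<bullet> v) powr (- ?t)"
    unfolding Y_def using up_inner_bounds(3)[OF c(1) h f v1] fv eps by (simp add: powr_divide powr_minus_divide)
  also have "\<dots> \<le> (c powr (- \<delta>) * ?N powr ?t) * (\<epsilon> powr (- \<delta>) * 1 powr (- ?t))"
    by (intro mult_mono powr_between(2) c N eps up_inner_bounds[OF c(1) h f v1] t)
      (use fv eps t c N in auto)
  finally have 2: "Y v h powr ?t \<le> c powr (- \<delta>) * ?N powr ?t * \<epsilon> powr (- \<delta>)" by simp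
  have "cmod (F z v h) = W v h * Y v h powr ?t"
    unfolding F_def using W_pos[OF v h] Y_pos[OF v h]
    by (simp add: norm_mult powr_def mult.commute)
  also have "\<dots> \<le> (c powr (- b) * ?N powr s / (\<kappa>0 * \<epsilon> powr b)) * (c powr (- \<delta>) * ?N powr ?t * \<epsilon> powr (- \<delta>))"
    using W_pos[OF v h] by (intro mult_mono 1 2) (use c N \<kappa>0 in auto)
  also have "\<dots> = (c powr (- b) * c powr (- \<delta>)) * (\<epsilon> powr (- b) * \<epsilon> powr (- \<delta>)) / \<kappa>0 * (?N powr s * ?N powr ?t)"
    by (simp add: powr_minus_divide)
  also have "\<dots> = Cc * ?N powr (s + ?t)"
    unfolding Cc_def using c eps by (simp add: powr_add[symmetric] powr_mult)
  also have "\<dots> \<le> \<Gamma> h"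
    unfolding \<Gamma>_def using Cc_pos powr_le_sum(1)[OF N, of a1 "s + ?t" a2] a12 t
    by (intro mult_left_mono) (auto simp: abs_le_iff)
  finally show ?thesis .
qed

section \<open>Comparison of the kernels at two points\<close>

lemma ln_hilbert_product:
  assumes u: "u \<in> S\<epsilon>" and v: "v \<in> S\<epsilon>"
  shows "- ln (hilbert_m u v * hilbert_m v u) \<le> 2 / \<epsilon>\<^sup>2 * hilbert_dist u v"
proof -
  note u1 = sphere1_epsD(1)[OF u] and v1 = sphere1_epsD(1)[OF v]
  define y where "y = hilbert_m u v * hilbert_m v u"
  have y: "\<epsilon>\<^sup>2 \<le> y" "0 < y" "y \<le> 1"
    using hilbert_product_eps[OF u v eps(1)] hilbert_product(2)[OF u1 v1] eps unfolding y_def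
    by (auto intro: less_le_trans[of 0 "\<epsilon>\<^sup>2"])
  have "- ln y = ln (1 / y)" using y by (simp add: ln_div)
  also have "\<dots> \<le> 1 / y - 1" using y by (intro ln_le_minus_one) auto
  also have "\<dots> = (1 - y) / y" using y by (simp add: field_simps)
  also have "\<dots> \<le> (2 * hilbert_dist u v) / \<epsilon>\<^sup>2"
    using hilbert_dist_bounds(3)[OF u1 v1] hilbert_dist_bounds(1)[OF u1 v1] y eps unfolding y_def by (intro frac_le) auto
  finally show ?thesis unfolding y_def by simp
qed

lemma hilbert_inner:
  assumes "u \<in> sphere1" "v \<in> sphere1" "x \<in> sphere1"
  shows "hilbert_m u v * (v \<bullet> x) \<le> u \<bullet> x"
proof -
  have "hilbert_m u v * (v \<bullet> x) = (\<Sum>i\<in>UNIV. hilbert_m u v * v $ i * x $ i)"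
    by (simp add: inner_vec_sum sum_distrib_left mult.assoc)
  also have "\<dots> \<le> (\<Sum>i\<in>UNIV. u $ i * x $ i)"
    using hilbert_m_le[OF assms(1,2)] sphere1_nonneg[OF assms(3)] by (intro sum_mono mult_right_mono) auto
  finally show ?thesis by (simp add: inner_vec_sum)
qed

lemma hilbert_inner_image:
  assumes "u \<in> sphere1" "v \<in> sphere1" "x \<in> sphere1" "uniformly_positive c \<epsilon> h"
  shows "hilbert_m u v * ((h *v v) \<bullet> x) \<le> (h *v u) \<bullet> x"
proof -
  have "hilbert_m u v * (h *v v) $ i \<le> (h *v u) $ i" for i
  proof -
    have "hilbert_m u v * (h *v v) $ i \<le> (hilbert_m u v + c * (1 - hilbert_m u v)) * (h *v v) $ i"
      using c hilbert_m_le_1[OF assms(1,2)] less_imp_le[OF up_mv_pos[OF c(1) assms(4,2)]]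
      by (intro mult_right_mono) auto
    also have "\<dots> \<le> (h *v u) $ i" by (rule up_mv_dominates[OF c(1) assms(4,1,2)])
    finally show ?thesis .
  qed
  moreover have "hilbert_m u v * ((h *v v) \<bullet> x) = (\<Sum>i\<in>UNIV. hilbert_m u v * (h *v v) $ i * x $ i)"
    by (simp add: inner_vec_sum sum_distrib_left mult.assoc)
  ultimately show ?thesis
    using sphere1_nonneg[OF assms(3)] unfolding inner_vec_sum[of "h *v u"] by (auto intro!: sum_mono mult_right_mono)
qed

text \<open>Numerator and denominator of \<open>W\<close> are compared by \<open>powr_ratio\<close>.
  If one of \<open>hilbert_m u v\<close> and \<open>hilbert_m v u\<close> serves the numerator, the
  other one serves the denominator, so the result is a power of their product, which is what the
  metric measures.\<close>

lemma W_ratio: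
  assumes u: "u \<in> S\<epsilon>" and v: "v \<in> S\<epsilon>" and h: "uniformly_positive c \<epsilon> h"
  shows "(hilbert_m u v * hilbert_m v u) powr \<bar>s\<bar> * W v h \<le> W u h"
proof -
  note u1 = sphere1_epsD(1)[OF u] and v1 = sphere1_epsD(1)[OF v]
  define a where "a = hilbert_m u v"
  define a' where "a' = hilbert_m v u"
  have a: "0 < a" "0 < a'" unfolding a_def a'_def
    using hilbert_m_eps(1)[OF u v eps(1)] hilbert_m_eps(1)[OF v u eps(1)] eps by auto
  have 1: "(if 0 \<le> s then a else a') powr \<bar>s\<bar> * r (h *v v) \<le> r (h *v u)"
  proof (rule r_ratio[OF r_image(1)[OF u1 h] r_image(1)[OF v1 h] a])
    fix x :: "real ^ 'n" assume x: "x \<in> sphere1"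
    have "0 < (h *v w) \<bullet> x" if "w \<in> sphere1" for w
      using up_inner_bounds(3)[OF c(1) h x that] by (subst inner_commute)
    then show "0 < (h *v u) \<bullet> x \<and> 0 < (h *v v) \<bullet> x \<and> a * ((h *v v) \<bullet> x) \<le> (h *v u) \<bullet> x \<and>
        a' * ((h *v u) \<bullet> x) \<le> (h *v v) \<bullet> x"
      unfolding a_def a'_def using hilbert_inner_image[OF _ _ x h] u1 v1 by blast
  qed
  have 2: "(if 0 \<le> s then a' else a) powr \<bar>s\<bar> * r u \<le> r v"
    by (rule r_ratio[OF r_sphere(1)[OF v] r_sphere(1)[OF u] a(2,1)])
      (use sphere1_epsD(4)[OF u] sphere1_epsD(4)[OF v] eps hilbert_inner u1 v1 in \<open>force simp: a_def a'_def\<close>)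
  have "(a * a') powr \<bar>s\<bar> * (r (h *v v) * r u) =
      ((if 0 \<le> s then a else a') powr \<bar>s\<bar> * r (h *v v)) * ((if 0 \<le> s then a' else a) powr \<bar>s\<bar> * r u)"
    using a by (auto simp: powr_mult)
  also have "\<dots> \<le> r (h *v u) * r v"
    using 1 2 r_image(2)[OF u1 h] r_image(2)[OF v1 h] r_sphere(4)[OF u] by (intro mult_mono) auto
  finally show ?thesis
    unfolding W_def a_def a'_def using \<kappa>_pos r_sphere(4)[OF u] r_sphere(4)[OF v] by (simp add: field_simps)
qed

lemma Y_ratio:
  assumes u: "u \<in> S\<epsilon>" and v: "v \<in> S\<epsilon>" and h: "uniformly_positive c \<epsilon> h"
  shows "(hilbert_m u v * hilbert_m v u) * Y v h \<le> Y u h"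
proof -
  note u1 = sphere1_epsD(1)[OF u] and v1 = sphere1_epsD(1)[OF v]
  have p: "0 < f \<bullet> u" "0 < f \<bullet> v" using sphere1_epsD(3)[OF u f] sphere1_epsD(3)[OF v f] eps by auto
  have "(hilbert_m u v * (f \<bullet> (h *v v))) * (hilbert_m v u * (f \<bullet> u)) \<le> (f \<bullet> (h *v u)) * (f \<bullet> v)"
    using hilbert_inner_image[OF u1 v1 f h] hilbert_inner[OF v1 u1 f] p hilbert_m_nonneg[OF v1 u1]
      up_inner_bounds(3)[OF c(1) h f u1] by (intro mult_mono) (auto simp: inner_commute)
  then show ?thesis unfolding Y_def using p by (simp add: field_simps)
qed

definition "Lc = (b + \<delta>) * 2 / \<epsilon>\<^sup>2 * exp ((b + \<delta>) * 2 / \<epsilon>\<^sup>2)"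

lemma Lc_nonneg: "0 \<le> Lc" unfolding Lc_def using b_nonneg \<delta> by simp

text \<open>\<open>F z u h\<close> is \<open>F z v h\<close> times \<open>exp w\<close>, where
  \<open>w\<close> collects the logarithms of the ratios of \<open>W\<close> and \<open>Y\<close>.
  By the ratio bounds, \<open>w\<close> is at most a multiple of the distance.\<close>

lemma F_lipschitz:
  assumes u: "u \<in> S\<epsilon>" and v: "v \<in> S\<epsilon>" and h: "uniformly_positive c \<epsilon> h" and z: "cmod z < \<delta>"
  shows "cmod (F z u h - F z v h) \<le> \<Gamma> h * (Lc * hilbert_dist u v)"
proof -
  note u1 = sphere1_epsD(1)[OF u] and v1 = sphere1_epsD(1)[OF v]
  define y where "y = hilbert_m u v * hilbert_m v u"
  have y: "\<epsilon>\<^sup>2 \<le> y" "0 < y" "y \<le> 1"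
    using hilbert_product_eps[OF u v eps(1)] hilbert_product(2)[OF u1 v1] eps unfolding y_def
    by (auto intro: less_le_trans[of 0 "\<epsilon>\<^sup>2"])
  have ly: "ln (1 / y) \<le> 2 / \<epsilon>\<^sup>2 * hilbert_dist u v"
    using ln_hilbert_product[OF u v] y(2) unfolding y_def[symmetric] by (simp add: ln_div)
  have ly0: "0 \<le> ln (1 / y)" using y by simp
  define w where "w = of_real (ln (W u h / W v h)) + z * of_real (ln (Y u h / Y v h))"
  note Wp = W_pos[OF u h] W_pos[OF v h] and Yp = Y_pos[OF u h] Y_pos[OF v h]
  have "\<bar>ln (W u h / W v h)\<bar> \<le> \<bar>s\<bar> * ln (1 / y)"
    by (rule ln_ratio_bound) (use Wp y W_ratio[OF u v h] W_ratio[OF v u h] in \<open>auto simp: y_def mult.commute[of "hilbert_m v u"]\<close>)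
  moreover have "\<bar>ln (Y u h / Y v h)\<bar> \<le> 1 * ln (1 / y)"
    by (rule ln_ratio_bound) (use Yp y Y_ratio[OF u v h] Y_ratio[OF v u h] in \<open>auto simp: y_def mult.commute[of "hilbert_m v u"]\<close>)
  ultimately have "cmod w \<le> \<bar>s\<bar> * ln (1 / y) + cmod z * (1 * ln (1 / y))"
    unfolding w_def by (intro norm_triangle_le add_mono) (auto simp: norm_mult intro!: mult_left_mono)
  also have "\<dots> \<le> b * ln (1 / y) + \<delta> * (1 * ln (1 / y))"
    using s z ly0 by (intro add_mono mult_right_mono) auto
  also have "\<dots> = (b + \<delta>) * ln (1 / y)" by (simp add: distrib_right)
  also have "\<dots> \<le> (b + \<delta>) * (2 / \<epsilon>\<^sup>2 * hilbert_dist u v)" using ly b_nonneg \<delta> by (intro mult_left_mono) auto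
  also have "\<dots> = (b + \<delta>) * 2 / \<epsilon>\<^sup>2 * hilbert_dist u v" by (simp only: times_divide_eq_left times_divide_eq_right mult.assoc)
  finally have w: "cmod w \<le> (b + \<delta>) * 2 / \<epsilon>\<^sup>2 * hilbert_dist u v" .
  also have "\<dots> \<le> (b + \<delta>) * 2 / \<epsilon>\<^sup>2 * 1"
    using hilbert_dist_bounds(2)[OF u1 v1] b_nonneg \<delta> by (intro mult_left_mono) auto
  finally have w1: "cmod w \<le> (b + \<delta>) * 2 / \<epsilon>\<^sup>2" by simp
  have "exp w = (of_real (W u h) / of_real (W v h)) * (exp (z * of_real (ln (Y u h))) / exp (z * of_real (ln (Y v h))))"
    unfolding w_def exp_add exp_of_real using Wp Yp by (simp add: ln_div exp_diff right_diff_distrib)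
  then have Fu: "F z u h = F z v h * exp w" unfolding F_def using Wp by (simp add: field_simps)
  have "cmod (F z u h - F z v h) = cmod (F z v h) * cmod (exp w - 1)"
    unfolding Fu norm_mult[symmetric] by (simp add: algebra_simps)
  also have "\<dots> \<le> \<Gamma> h * (cmod w * exp (cmod w))"
    using F_bound[OF v h z] norm_exp_minus_1_le \<Gamma>_nonneg by (intro mult_mono) auto
  also have "\<dots> \<le> \<Gamma> h * ((b + \<delta>) * 2 / \<epsilon>\<^sup>2 * hilbert_dist u v * exp ((b + \<delta>) * 2 / \<epsilon>\<^sup>2))"
    using w w1 \<Gamma>_nonneg b_nonneg \<delta> hilbert_dist_bounds(1)[OF u1 v1] by (intro mult_left_mono mult_mono) auto
  finally show ?thesis unfolding Lc_def by (simp add: mult_ac)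
qed

text \<open>Total mass one is the eigenfunction equation for \<open>r\<close>.\<close>

lemma W_integral:
  assumes "v \<in> S\<epsilon>"
  shows "integrable \<mu> (W v)" "(\<integral>h. W v h \<partial>\<mu>) = 1"
proof -
  show "integrable \<mu> (W v)"
  proof (rule Bochner_Integration.integrable_bound[OF \<Gamma>_integrable])
    show "AE h in \<mu>. norm (W v h) \<le> norm (\<Gamma> h)"
      using up by eventually_elim (use F_bound[OF assms, of _ 0] \<delta> in \<open>auto simp: F_def intro: order_trans[OF _ abs_ge_self]\<close>)
  qed simp
  show "(\<integral>h. W v h \<partial>\<mu>) = 1"
    unfolding W_def using eigenfunction[OF assms] \<kappa>_pos r_sphere(4)[OF assms] by simp
qed

end

section \<open>Holomorphic parameter integrals and differences of averages\<close>

lemma norm_integral_le_AE: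
  fixes u :: "'b \<Rightarrow> 'c::{banach, second_countable_topology}"
  assumes "integrable M u" "integrable M w" "AE h in M. norm (u h) \<le> w h"
  shows "norm (\<integral>h. u h \<partial>M) \<le> (\<integral>h. w h \<partial>M)"
  by (rule order_trans[OF integral_norm_bound integral_mono_AE]) (use assms in auto)

text \<open>By Cauchy's estimates the bound \<open>g\<close> for the integrand also controls its
  derivative and the second order remainder, so differentiation under the integral is
  dominated.\<close>

lemma holomorphic_integral:
  fixes G :: "complex \<Rightarrow> 'b \<Rightarrow> complex"
  assumes meas: "\<And>z. z \<in> ball 0 r \<Longrightarrow> G z \<in> borel_measurable M"
    and hol: "AE h in M. (\<lambda>z. G z h) holomorphic_on ball 0 r"
    and bd: "AE h in M. \<forall>z\<in>ball 0 r. cmod (G z h) \<le> g h"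
    and g: "integrable M g"
  shows "(\<lambda>z. \<integral>h. G z h \<partial>M) holomorphic_on ball 0 r"
  unfolding holomorphic_on_open[OF open_ball]
proof
  fix c :: complex assume c: "c \<in> ball 0 r"
  then obtain \<rho> where \<rho>: "\<rho> > 0" "ball c \<rho> \<subseteq> ball 0 r" using openE[OF open_ball] by blast
  have int: "integrable M (G z)" if "z \<in> ball 0 r" for z
    by (rule Bochner_Integration.integrable_bound[OF g meas[OF that]])
      (use bd that in \<open>auto elim!: eventually_mono intro: order_trans[OF _ abs_ge_self]\<close>)
  define w where "w = (\<lambda>n. of_real (\<rho> / 8 / real (Suc n)) :: complex)"
  have w0: "w \<longlonglongrightarrow> 0"
    unfolding w_def using LIMSEQ_Suc[OF lim_const_over_n[of "of_real (\<rho>/8) :: complex"]] by simp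
  have w: "w n \<noteq> 0" "c + w n \<in> ball 0 r" for n
  proof -
    show "w n \<noteq> 0" using \<rho> unfolding w_def by (simp del: of_nat_Suc)
    have "\<rho> / 8 / real (Suc n) \<le> \<rho> / 8 / 1" using \<rho> by (intro divide_left_mono) auto
    then have "\<rho> / 8 / real (Suc n) < \<rho>" using \<rho> by linarith
    moreover have "0 \<le> \<rho> / 8 / real (Suc n)" using \<rho> by simp
    ultimately have "cmod (w n) < \<rho>" unfolding w_def norm_of_real by linarith
    then have "c + w n \<in> ball c \<rho>" by (simp add: dist_norm)
    then show "c + w n \<in> ball 0 r" using \<rho>(2) by blast
  qed
  \<comment> \<open>A limit along a fixed sequence is measurable; outside a null set it is the
    complex derivative.\<close>
  define d where "d h = lim (\<lambda>n. (G (c + w n) h - G c h) / w n)" for h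
  have dm: "d \<in> borel_measurable M"
    unfolding d_def using meas w c by (intro borel_measurable_lim_metric borel_measurable_divide borel_measurable_diff) auto
  have dd: "AE h in M. (\<lambda>z. G z h) holomorphic_on ball c \<rho> \<and> (\<forall>z\<in>ball c \<rho>. cmod (G z h) \<le> g h) \<and> d h = deriv (\<lambda>z. G z h) c"
    using hol bd
  proof eventually_elim
    case (elim h)
    have h: "(\<lambda>z. G z h) holomorphic_on ball c \<rho>" using elim(1) \<rho>(2) holomorphic_on_subset by blast
    then have "((\<lambda>z. G z h) has_field_derivative deriv (\<lambda>z. G z h) c) (at c)"
      using \<rho>(1) by (meson centre_in_ball holomorphic_derivI open_ball)
    then have "((\<lambda>y. (G (c + y) h - G c h) / y) \<longlongrightarrow> deriv (\<lambda>z. G z h) c) (at 0)"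
      by (simp add: DERIV_def)
    then have "(\<lambda>n. (G (c + w n) h - G c h) / w n) \<longlonglongrightarrow> deriv (\<lambda>z. G z h) c"
      using w0 w(1) unfolding tendsto_at_iff_sequentially o_def by auto
    then show ?case using h elim(2) \<rho>(2) unfolding d_def by (auto simp: limI)
  qed
  have di: "integrable M d"
  proof (rule Bochner_Integration.integrable_bound[OF _ dm])
    show "integrable M (\<lambda>h. 4 * g h / \<rho>)" using g by simp
    show "AE h in M. norm (d h) \<le> norm (4 * g h / \<rho>)"
      using dd
    proof eventually_elim
      case (elim h)
      then have "cmod (deriv (\<lambda>z. G z h) c) \<le> 4 * g h / \<rho>"
        using deriv_bound_half_ball[of "\<lambda>z. G z h" c \<rho> "g h" c] \<rho>(1) by auto
      then have "cmod (d h) \<le> 4 * g h / \<rho>" using elim by simp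
      then show ?case unfolding real_norm_def by (rule order_trans[OF _ abs_ge_self])
    qed
  qed
  have ineq: "cmod ((\<integral>h. G (c + x) h \<partial>M) - (\<integral>h. G c h \<partial>M) - x * (\<integral>h. d h \<partial>M)) \<le> (\<integral>h. 32 * g h / \<rho>\<^sup>2 \<partial>M) * (cmod x)\<^sup>2"
    if x: "cmod x < \<rho> / 4" for x
  proof -
    have "c + x \<in> ball c \<rho>" using x \<rho>(1) by (simp add: dist_norm)
    then have cx: "c + x \<in> ball 0 r" using \<rho>(2) by blast
    have "cmod ((\<integral>h. G (c + x) h \<partial>M) - (\<integral>h. G c h \<partial>M) - x * (\<integral>h. d h \<partial>M)) = cmod (\<integral>h. G (c + x) h - G c h - x * d h \<partial>M)"
      using int[OF cx] int[OF c] di by simp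
    also have "\<dots> \<le> (\<integral>h. 32 * g h / \<rho>\<^sup>2 * (cmod x)\<^sup>2 \<partial>M)"
    proof (rule norm_integral_le_AE)
      show "AE h in M. norm (G (c + x) h - G c h - x * d h) \<le> 32 * g h / \<rho>\<^sup>2 * (cmod x)\<^sup>2"
        using dd
      proof eventually_elim
        case (elim h)
        then show ?case using bounded_holomorphic_taylor[of "\<lambda>z. G z h" c \<rho> "g h" x] x by auto
      qed
    qed (use int[OF cx] int[OF c] di g in auto)
    finally show ?thesis by simp
  qed
  show "\<exists>f'. ((\<lambda>z. \<integral>h. G z h \<partial>M) has_field_derivative f') (at c)"
  proof
    let ?I = "\<lambda>z. \<integral>h. G z h \<partial>M" and ?C = "\<integral>h. 32 * g h / \<rho>\<^sup>2 \<partial>M"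
    have "((\<lambda>x. (?I (c + x) - ?I c) / x - (\<integral>h. d h \<partial>M)) \<longlongrightarrow> 0) (at 0)"
    proof (rule Lim_null_comparison)
      show "\<forall>\<^sub>F x in at 0. cmod ((?I (c + x) - ?I c) / x - (\<integral>h. d h \<partial>M)) \<le> ?C * cmod x"
        unfolding eventually_at
      proof (intro exI[of _ "\<rho> / 4"] conjI ballI impI)
        fix x :: complex assume x: "x \<noteq> 0 \<and> dist x 0 < \<rho> / 4"
        have "(?I (c + x) - ?I c) / x - (\<integral>h. d h \<partial>M) = (?I (c + x) - ?I c - x * (\<integral>h. d h \<partial>M)) / x"
          using x by (simp add: field_simps)
        also have "cmod \<dots> \<le> ?C * (cmod x)\<^sup>2 / cmod x"
          unfolding norm_divide using ineq[of x] x by (intro divide_right_mono) auto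
        finally show "cmod ((?I (c + x) - ?I c) / x - (\<integral>h. d h \<partial>M)) \<le> ?C * cmod x"
          using x by (simp add: power2_eq_square)
      qed (use \<rho> in auto)
      have "((\<lambda>x. ?C * cmod x) \<longlongrightarrow> ?C * cmod 0) (at 0)" by (intro tendsto_intros)
      then show "((\<lambda>x. ?C * cmod x) \<longlongrightarrow> 0) (at 0)" by simp
    qed
    then show "(?I has_field_derivative (\<integral>h. d h \<partial>M)) (at c)" unfolding DERIV_def by (rule LIM_zero_cancel)
  qed
qed

lemma average_bound:
  fixes \<psi> :: "'b \<Rightarrow> complex" and P :: "'b \<Rightarrow> real"
  assumes "integrable M P" "AE h in M. 0 \<le> P h" "integrable M (\<lambda>h. of_real (P h) * \<psi> h)"
    and "AE h in M. cmod (x - \<psi> h) \<le> B"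
  shows "cmod (of_real (\<integral>h. P h \<partial>M) * x - (\<integral>h. of_real (P h) * \<psi> h \<partial>M)) \<le> (\<integral>h. P h \<partial>M) * B"
proof -
  have i: "integrable M (\<lambda>h. of_real (P h) * x)" using assms(1) by (intro integrable_mult_left integrable_of_real)
  have "(\<integral>h. of_real (P h) * x \<partial>M) = of_real (\<integral>h. P h \<partial>M) * x" by simp
  then have "of_real (\<integral>h. P h \<partial>M) * x - (\<integral>h. of_real (P h) * \<psi> h \<partial>M) = (\<integral>h. of_real (P h) * x - of_real (P h) * \<psi> h \<partial>M)"
    using i assms(3) by simp
  also have "cmod \<dots> \<le> (\<integral>h. P h * B \<partial>M)"
  proof (rule norm_integral_le_AE)
    show "integrable M (\<lambda>h. P h * B)" using assms(1) by simp
    show "integrable M (\<lambda>h. of_real (P h) * x - of_real (P h) * \<psi> h)" using i assms(3) by simp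
    show "AE h in M. norm (of_real (P h) * x - of_real (P h) * \<psi> h) \<le> P h * B"
      using assms(2,4)
    proof eventually_elim
      case (elim h)
      have "norm (of_real (P h) * x - of_real (P h) * \<psi> h) = \<bar>P h\<bar> * cmod (x - \<psi> h)"
        unfolding right_diff_distrib[symmetric] norm_mult norm_of_real by simp
      then show ?case using elim by (simp add: mult_left_mono)
    qed
  qed
  finally show ?thesis by simp
qed

text \<open>Two weights of equal mass are coupled independently, at cost at most \<open>B\<close>
  for almost every pair. In place of a product measure, \<open>average_bound\<close> is used twice:
  over \<open>P\<close> with the other point fixed, then over \<open>Q\<close>.\<close>

lemma average_diff_bound:
  fixes \<psi>1 \<psi>2 :: "'b \<Rightarrow> complex" and P Q :: "'b \<Rightarrow> real"
  assumes P: "integrable M P" "AE h in M. 0 \<le> P h" "integrable M (\<lambda>h. of_real (P h) * \<psi>1 h)" "(\<integral>h. P h \<partial>M) = m"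
    and Q: "integrable M Q" "AE h in M. 0 \<le> Q h" "integrable M (\<lambda>h. of_real (Q h) * \<psi>2 h)" "(\<integral>h. Q h \<partial>M) = m"
    and B: "AE h' in M. AE h in M. cmod (\<psi>2 h' - \<psi>1 h) \<le> B"
  shows "cmod ((\<integral>h. of_real (P h) * \<psi>1 h \<partial>M) - (\<integral>h. of_real (Q h) * \<psi>2 h \<partial>M)) \<le> m * B"
proof -
  let ?c = "\<integral>h. of_real (P h) * \<psi>1 h \<partial>M"
  have m: "0 \<le> m" unfolding P(4)[symmetric] by (rule integral_nonneg_AE[OF P(2)])
  have 1: "AE h' in M. cmod (of_real m * \<psi>2 h' - ?c) \<le> m * B"
    using B by eventually_elim (use average_bound[OF P(1-3)] P(4) in simp)
  show ?thesis
  \<comment> \<open>Mass zero is treated separately, because the second averaging leaves a factor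
    \<open>m\<close> to be cancelled.\<close>
  proof (cases "m = 0")
    case True
    have z: "(\<integral>h. of_real (P h) * \<psi> h \<partial>M) = 0" if "integrable M P" "AE h in M. 0 \<le> P h" "(\<integral>h. P h \<partial>M) = 0"
      for P :: "'b \<Rightarrow> real" and \<psi> :: "'b \<Rightarrow> complex"
    proof -
      have "AE h in M. P h = 0" using integral_nonneg_eq_0_iff_AE[OF that(1,2)] that(3) by simp
      then have "AE h in M. of_real (P h) * \<psi> h = 0" by eventually_elim simp
      then show ?thesis by (rule integral_eq_zero_AE)
    qed
    then show ?thesis using P Q True by simp
  next
    case False
    have i: "integrable M (\<lambda>h. of_real (Q h) * (of_real m * \<psi>2 h))"
      using integrable_mult_right[OF Q(3), of "of_real m"] by (simp add: mult_ac)
    have "AE h' in M. cmod (?c - of_real m * \<psi>2 h') \<le> m * B"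
      using 1 by eventually_elim (simp add: norm_minus_commute)
    from average_bound[OF Q(1,2) i this]
    have "cmod (of_real m * ?c - (\<integral>h. of_real (Q h) * (of_real m * \<psi>2 h) \<partial>M)) \<le> m * (m * B)"
      unfolding Q(4) .
    moreover have "(\<integral>h. of_real (Q h) * (of_real m * \<psi>2 h) \<partial>M) = of_real m * (\<integral>h. of_real (Q h) * \<psi>2 h \<partial>M)"
      by (subst integral_mult_right_zero[symmetric]) (simp add: mult_ac)
    ultimately have "m * cmod (?c - (\<integral>h. of_real (Q h) * \<psi>2 h \<partial>M)) \<le> m * (m * B)"
      using m by (simp add: right_diff_distrib[symmetric] norm_mult)
    then show ?thesis using m False by (simp add: mult_le_cancel_left)
  qed
qed

section \<open>The tilted operators\<close>

text \<open>Since the values off the simplex are zero, continuity on the simplex gives measurability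
  on the whole space.\<close>

lemma holder_space_measurable:
  fixes \<phi> :: "real ^ 'n \<Rightarrow> complex"
  assumes "\<phi> \<in> holder_space \<gamma>"
  shows "\<phi> \<in> borel_measurable borel"
proof -
  have "(\<lambda>v. indicator sphere1 v *\<^sub>R \<phi> v) = \<phi>"
    using assms unfolding holder_space_def by (auto simp: indicator_def)
  then show ?thesis
    using continuous_sphere1_measurable[of \<phi>] assms unfolding holder_space_def by auto
qed

text \<open>In \<open>gauge\<close>, \<open>1 - c\<^sup>2\<close> is the contraction rate of the
  matrices, \<open>(\<epsilon>\<^sup>2) powr b\<close> a lower bound for the common mass of two
  kernels, and \<open>2 * b / \<epsilon>\<^sup>2 * d\<close> a bound for the remaining mass.
  \<open>D\<close>, \<open>K\<close> and \<open>\<theta>\<close> are parameters because they have to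
  be shared by all \<open>s\<close> and \<open>f\<close>.\<close>

locale tilted_operator = tilted_kernel \<mu> \<epsilon> c s \<kappa> \<eta> f b \<delta> a1 a2 \<kappa>0
  for \<mu> :: "(real ^ 'n ^ 'n) measure" and \<epsilon> c s \<kappa> :: real and \<eta> :: "(real ^ 'n) measure"
    and f :: "real ^ 'n" and b \<delta> a1 a2 \<kappa>0 :: real +
  fixes \<nu> :: "(real ^ 'n) measure" and \<gamma> \<theta> K :: real and D :: "real \<Rightarrow> real"
  assumes prob_\<nu>: "prob_space \<nu>" and sets_\<nu> [measurable_cong, simp]: "sets \<nu> = sets borel"
    and \<nu>_eps: "AE v in \<nu>. v \<in> sphere1_eps \<epsilon>"
    and eigen_\<nu>: "eigenmeasure (P_op \<mu> s) \<kappa> \<nu>"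
    and \<gamma>: "0 < \<gamma>" "\<gamma> \<le> 1"
    and \<theta>: "0 \<le> \<theta>" "\<theta> < 1" and K: "1 \<le> K"
    and D: "\<And>d. 0 \<le> d \<Longrightarrow> d \<le> 1 \<Longrightarrow> 0 \<le> D d \<and> D d \<le> 1 \<and> d powr \<gamma> / 2 \<le> D d \<and> D d \<le> K * d powr \<gamma>"
    and gauge: "\<And>d d' y. 0 < d \<Longrightarrow> d \<le> 1 \<Longrightarrow> 0 \<le> d' \<Longrightarrow> d' \<le> (1 - c\<^sup>2) * d \<Longrightarrow> (\<epsilon>\<^sup>2) powr b \<le> y \<Longrightarrow>
       y \<le> 1 \<Longrightarrow> 1 - y \<le> 2 * b / \<epsilon>\<^sup>2 * d \<Longrightarrow> (1 - y) + y * D d' \<le> \<theta> * D d"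
begin

sublocale V: prob_space \<nu> by (rule prob_\<nu>)

abbreviation "B \<equiv> holder_space \<gamma> :: (real ^ 'n \<Rightarrow> complex) set"
abbreviation "nrm \<equiv> holder_norm \<gamma> :: (real ^ 'n \<Rightarrow> complex) \<Rightarrow> real"
abbreviation "retract \<equiv> closest_point S\<epsilon>"

text \<open>The factor \<open>exp (- q z)\<close> is removed by putting \<open>q\<close> to zero and
  is restored at the end. The value at a point of the simplex is taken at the nearest point of
  \<open>sphere1_eps \<epsilon>\<close>, so the image is defined on the whole simplex and unchanged
  on \<open>sphere1_eps \<epsilon>\<close>.\<close>

definition Rt :: "complex \<Rightarrow> (real ^ 'n \<Rightarrow> complex) \<Rightarrow> real ^ 'n \<Rightarrow> complex" where
  "Rt z \<phi> v = (if v \<in> sphere1 then R_op \<mu> \<eta> \<epsilon> \<kappa> 0 s z f \<phi> (retract v) else 0)"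
definition e :: "real ^ 'n \<Rightarrow> complex" where "e v = (if v \<in> sphere1 then 1 else 0)"
definition p :: "(real ^ 'n \<Rightarrow> complex) \<Rightarrow> complex" where "p = pi_f \<nu> \<eta> s f"
text \<open>The term \<open>cmod (p \<phi>)\<close> makes \<open>q\<close> dominate \<open>p\<close>
  and see constants, to which the supremum is blind. On the diagonal the quotient is zero.\<close>

definition q :: "(real ^ 'n \<Rightarrow> complex) \<Rightarrow> real" where
  "q \<phi> = max (cmod (p \<phi>)) (SUP x\<in>S\<epsilon> \<times> S\<epsilon>. cmod (\<phi> (fst x) - \<phi> (snd x)) / D (hilbert_dist (fst x) (snd x)))"

sublocale H: function_space B nrm by (rule holder_function_space[OF card])

lemmas HD = holder_spaceD[OF card]

section \<open>The retraction onto the inner simplex\<close>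

lemma retract_mem: "retract v \<in> S\<epsilon>"
  by (rule closest_point_in_set[OF closed_sphere1_eps nonempty_sphere1_eps])

lemma retract_id: "v \<in> S\<epsilon> \<Longrightarrow> retract v = v" by (rule closest_point_self)

lemma retract_lipschitz: "norm (retract u - retract v) \<le> norm (u - v)"
  using closest_point_lipschitz[OF convex_sphere1_eps[OF eps(1)] closed_sphere1_eps nonempty_sphere1_eps, of u v]
  by (simp add: dist_norm)

text \<open>The closest point map is nonexpansive in the Euclidean norm; passing from the metric to
  the norm and back costs \<open>8 / \<epsilon>\<close>.\<close>

lemma retract_hilbert:
  assumes "u \<in> sphere1" "v \<in> sphere1"
  shows "hilbert_dist (retract u) (retract v) \<le> 8 / \<epsilon> * hilbert_dist u v"
proof -
  have "hilbert_dist (retract u) (retract v) \<le> 2 / \<epsilon> * norm (retract u - retract v)"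
    by (rule hilbert_dist_le_norm[OF retract_mem retract_mem eps(1)])
  also have "\<dots> \<le> 2 / \<epsilon> * (4 * hilbert_dist u v)"
    using retract_lipschitz[of u v] norm_le_hilbert_dist[OF assms] eps by (intro mult_left_mono) auto
  finally show ?thesis by simp
qed

lemma S\<epsilon>_dist: "u \<in> S\<epsilon> \<Longrightarrow> v \<in> S\<epsilon> \<Longrightarrow> 0 \<le> hilbert_dist u v \<and> hilbert_dist u v \<le> 1"
  using hilbert_dist_bounds(1,2)[OF sphere1_epsD(1)[of u \<epsilon>] sphere1_epsD(1)[of v \<epsilon>]] by simp

lemma holder_continuous_S\<epsilon>:
  fixes \<psi> :: "real ^ 'n \<Rightarrow> complex"
  assumes "\<And>u v. u \<in> S\<epsilon> \<Longrightarrow> v \<in> S\<epsilon> \<Longrightarrow> cmod (\<psi> u - \<psi> v) \<le> k * hilbert_dist u v powr \<gamma>" "0 \<le> k"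
  shows "continuous_on S\<epsilon> \<psi>"
  unfolding continuous_on_def
proof
  fix x assume x: "x \<in> S\<epsilon>"
  have "((\<lambda>u. \<psi> u - \<psi> x) \<longlongrightarrow> 0) (at x within S\<epsilon>)"
  proof (rule Lim_null_comparison)
    show "\<forall>\<^sub>F u in at x within S\<epsilon>. norm (\<psi> u - \<psi> x) \<le> k * (2 / \<epsilon> * norm (u - x)) powr \<gamma>"
      unfolding eventually_at_filter
    proof (intro always_eventually allI impI)
      fix u assume u: "u \<in> S\<epsilon>"
      have "hilbert_dist u x powr \<gamma> \<le> (2 / \<epsilon> * norm (u - x)) powr \<gamma>"
        using hilbert_dist_le_norm[OF u x eps(1)] S\<epsilon>_dist[OF u x] \<gamma> by (intro powr_mono2) auto
      then show "norm (\<psi> u - \<psi> x) \<le> k * (2 / \<epsilon> * norm (u - x)) powr \<gamma>"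
        using assms(1)[OF u x] assms(2) by (meson mult_left_mono order_trans)
    qed
    have "((\<lambda>u. 2 / \<epsilon> * norm (u - x)) \<longlongrightarrow> 2 / \<epsilon> * norm (x - x)) (at x within S\<epsilon>)" by (intro tendsto_intros)
    then have t: "((\<lambda>u. 2 / \<epsilon> * norm (u - x)) \<longlongrightarrow> 0) (at x within S\<epsilon>)" by simp
    have "((\<lambda>u. (2 / \<epsilon> * norm (u - x)) powr \<gamma>) \<longlongrightarrow> 0 powr \<gamma>) (at x within S\<epsilon>)"
      by (rule tendsto_powr'[OF t tendsto_const]) (use \<gamma> eps in \<open>auto intro!: always_eventually\<close>)
    from tendsto_mult[OF tendsto_const this]
    have "((\<lambda>u. k * (2 / \<epsilon> * norm (u - x)) powr \<gamma>) \<longlongrightarrow> k * 0 powr \<gamma>) (at x within S\<epsilon>)" .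
    then show "((\<lambda>u. k * (2 / \<epsilon> * norm (u - x)) powr \<gamma>) \<longlongrightarrow> 0) (at x within S\<epsilon>)" by simp
  qed
  then show "(\<psi> \<longlongrightarrow> \<psi> x) (at x within S\<epsilon>)" by (rule LIM_zero_cancel)
qed

lemma continuous_retract:
  "continuous_on S\<epsilon> \<psi> \<Longrightarrow> continuous_on UNIV (\<lambda>v. \<psi> (retract v))"
  by (rule continuous_on_compose2[OF _ continuous_on_closest_point[OF convex_sphere1_eps[OF eps(1)] closed_sphere1_eps nonempty_sphere1_eps]])
    (auto intro: retract_mem)

lemma extension_mem:
  fixes \<psi> :: "real ^ 'n \<Rightarrow> complex"
  assumes "\<And>u v. u \<in> S\<epsilon> \<Longrightarrow> v \<in> S\<epsilon> \<Longrightarrow> cmod (\<psi> u - \<psi> v) \<le> k * hilbert_dist u v powr \<gamma>" "0 \<le> k"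
    and "\<And>v. v \<in> S\<epsilon> \<Longrightarrow> cmod (\<psi> v) \<le> C"
  shows "(\<lambda>v. if v \<in> sphere1 then \<psi> (retract v) else 0) \<in> B"
    "nrm (\<lambda>v. if v \<in> sphere1 then \<psi> (retract v) else 0) \<le> C + 8 / \<epsilon> * k"
proof -
  let ?\<psi> = "\<lambda>v. if v \<in> sphere1 then \<psi> (retract v) else 0"
  have c: "continuous_on sphere1 ?\<psi>"
    using continuous_on_subset[OF continuous_retract[OF holder_continuous_S\<epsilon>[OF assms(1,2)]]]
    by (subst continuous_on_cong[OF refl, of _ _ "\<lambda>v. \<psi> (retract v)"]) auto
  have h: "cmod (?\<psi> u - ?\<psi> v) \<le> 8 / \<epsilon> * k * hilbert_dist u v powr \<gamma>" if uv: "u \<in> sphere1" "v \<in> sphere1" for u v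
  proof -
    have "cmod (?\<psi> u - ?\<psi> v) \<le> k * hilbert_dist (retract u) (retract v) powr \<gamma>"
      using uv assms(1)[OF retract_mem retract_mem] by simp
    also have "\<dots> \<le> k * (8 / \<epsilon> * hilbert_dist u v) powr \<gamma>"
      using retract_hilbert[OF uv] S\<epsilon>_dist[OF retract_mem retract_mem] \<gamma> assms(2)
      by (intro mult_left_mono powr_mono2) auto
    also have "\<dots> = k * ((8 / \<epsilon>) powr \<gamma> * hilbert_dist u v powr \<gamma>)"
      by (subst powr_mult) (use eps hilbert_dist_bounds(1)[OF uv] in auto)
    also have "\<dots> \<le> k * ((8 / \<epsilon>) powr 1 * hilbert_dist u v powr \<gamma>)"
      using eps \<gamma> assms(2) by (intro mult_left_mono mult_right_mono powr_mono) (auto simp: field_simps)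
    finally show ?thesis using eps by (simp add: mult_ac)
  qed
  have b: "cmod (?\<psi> v) \<le> C" if "v \<in> sphere1" for v using that assms(3)[OF retract_mem] by simp
  show "?\<psi> \<in> B" by (rule holder_spaceI(1)[OF card c _ b h]) auto
  show "nrm ?\<psi> \<le> C + 8 / \<epsilon> * k" by (rule holder_spaceI(2)[OF card c _ b h]) auto
qed

lemma act_mem: "uniformly_positive c \<epsilon> h \<Longrightarrow> v \<in> S\<epsilon> \<Longrightarrow> act h v \<in> S\<epsilon>"
  using up_act_mem[OF c(1)] sphere1_epsD(1) by blast

section \<open>The operator on the Hoelder space\<close>

lemma F_integrable:
  assumes v: "v \<in> S\<epsilon>" and z: "cmod z < \<delta>" and \<phi>: "\<phi> \<in> B"
  shows "integrable \<mu> (\<lambda>h. F z v h * \<phi> (act h v))"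
proof -
  note [measurable] = holder_space_measurable[OF \<phi>]
  show ?thesis
  proof (rule Bochner_Integration.integrable_bound[OF integrable_mult_left[OF \<Gamma>_integrable, of "nrm \<phi>"]])
    show "AE h in \<mu>. norm (F z v h * \<phi> (act h v)) \<le> norm (\<Gamma> h * nrm \<phi>)"
      using up
    proof eventually_elim
      case (elim h)
      have "norm (F z v h * \<phi> (act h v)) \<le> \<Gamma> h * nrm \<phi>"
        unfolding norm_mult by (intro mult_mono F_bound v elim z H.eval_le \<phi> \<Gamma>_nonneg) auto
      then show ?case unfolding real_norm_def by (rule order_trans[OF _ abs_ge_self])
    qed
  qed measurable
qed

text \<open>With \<open>f \<bullet> (h *v v)\<close> written as
  \<open>norm1 (h *v v) * (f \<bullet> act h v)\<close>, the powers of \<open>f\<close> cancel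
  against those in \<open>rf_fun\<close>, and homogeneity of \<open>r\<close> leaves the weight
  \<open>W v h\<close>. The statement is for measurable \<open>\<phi>\<close>, because iterates of
  \<open>R_op\<close> are zero off \<open>sphere1_eps \<epsilon>\<close> and need not be Hoelder
  functions.\<close>

lemma R_op_eq:
  assumes v: "v \<in> S\<epsilon>" and \<phi> [measurable]: "\<phi> \<in> borel_measurable borel"
  shows "R_op \<mu> \<eta> \<epsilon> \<kappa> q' s z f \<phi> v = exp (- of_real q' * z) * (\<integral>h. F z v h * \<phi> (act h v) \<partial>\<mu>)"
proof -
  note v1 = sphere1_epsD(1)[OF v]
  have [measurable]: "(exp :: complex \<Rightarrow> complex) \<in> borel_measurable borel"
    by (intro borel_measurable_continuous_onI continuous_intros)
  have [measurable]: "(\<lambda>h. act h v) \<in> borel_measurable borel" by measurable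
  let ?G = "\<lambda>h. exp (z * of_real (ln ((f \<bullet> (h *v v)) / (f \<bullet> v)) - q')) * \<phi> (act h v) *
      of_real ((f \<bullet> (h *v v)) powr s / (\<kappa> * (f \<bullet> v) powr s)) * of_real (rf_fun \<eta> s f (act h v) / rf_fun \<eta> s f v)"
  have [measurable]: "rf_fun \<eta> s f \<in> borel_measurable borel" unfolding rf_fun_def[abs_def] by measurable
  have m: "?G \<in> borel_measurable borel" by measurable
  have "R_op \<mu> \<eta> \<epsilon> \<kappa> q' s z f \<phi> v = (\<integral>h. ?G h \<partial>\<mu>)"
    unfolding R_op_def using v set_integral_nonneg_matrices[OF m] by simp
  also have "\<dots> = (\<integral>h. exp (- of_real q' * z) * (F z v h * \<phi> (act h v)) \<partial>\<mu>)"
  proof (rule integral_cong_AE)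
    show "AE h in \<mu>. ?G h = exp (- of_real q' * z) * (F z v h * \<phi> (act h v))"
      using up
    proof eventually_elim
      case (elim h)
      have fv: "0 < f \<bullet> v" "0 < f \<bullet> act h v"
        using sphere1_epsD(3)[OF v f] sphere1_epsD(3)[OF act_mem[OF elim v] f] eps by auto
      have n: "0 < norm1 (h *v v)" by (rule up_norm1_bounds(3)[OF c(1) elim v1])
      have "f \<bullet> (h *v v) = norm1 (h *v v) * (f \<bullet> act h v)"
        using up_act_scale[OF c(1) elim v1] by (metis inner_scaleR_right)
      then have "(f \<bullet> (h *v v)) powr s = norm1 (h *v v) powr s * (f \<bullet> act h v) powr s"
        using n fv by (simp add: powr_mult)
      then have "(f \<bullet> (h *v v)) powr s / (\<kappa> * (f \<bullet> v) powr s) * (rf_fun \<eta> s f (act h v) / rf_fun \<eta> s f v) = W v h"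
        unfolding rf_fun_def W_def r_act[OF v1 elim] using fv by (simp add: powr_minus field_simps)
      then have W: "complex_of_real ((f \<bullet> (h *v v)) powr s / (\<kappa> * (f \<bullet> v) powr s)) * of_real (rf_fun \<eta> s f (act h v) / rf_fun \<eta> s f v) = of_real (W v h)"
        by (metis of_real_mult)
      have "?G h = exp (z * of_real (ln (Y v h) - q')) * \<phi> (act h v) * of_real (W v h)"
        unfolding mult.assoc[of _ _ "of_real (rf_fun \<eta> s f (act h v) / rf_fun \<eta> s f v)"] W Y_def ..
      also have "exp (z * of_real (ln (Y v h) - q')) = exp (- of_real q' * z) * exp (z * of_real (ln (Y v h)))"
        by (simp add: exp_add[symmetric] algebra_simps)
      finally show ?case unfolding F_def by (simp add: mult_ac)
    qed
  qed (use m in measurable)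
  finally show ?thesis by simp
qed

lemma Rt_eq: "\<phi> \<in> B \<Longrightarrow> v \<in> S\<epsilon> \<Longrightarrow> Rt z \<phi> v = (\<integral>h. F z v h * \<phi> (act h v) \<partial>\<mu>)"
  unfolding Rt_def using sphere1_epsD(1)[of v \<epsilon>] R_op_eq[of v \<phi> 0 z] by (simp add: retract_id holder_space_measurable)

lemma Rt_eq': "\<phi> \<in> B \<Longrightarrow> Rt z \<phi> = (\<lambda>v. if v \<in> sphere1 then \<integral>h. F z (retract v) h * \<phi> (act h (retract v)) \<partial>\<mu> else 0)"
  unfolding Rt_def[abs_def] using R_op_eq[OF retract_mem, of \<phi> 0 z] by (auto simp: holder_space_measurable)

text \<open>Only the size and the Hoelder constant of \<open>\<phi>\<close> on
  \<open>sphere1_eps \<epsilon>\<close> enter, as the matrices map into this set. This is why the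
  gauge controls the full norm of the image.\<close>

lemma Rt_bound:
  assumes z: "cmod z < \<delta>" and \<phi>: "\<phi> \<in> B" and C: "\<And>v. v \<in> S\<epsilon> \<Longrightarrow> cmod (\<phi> v) \<le> C"
    and H: "\<And>u v. u \<in> S\<epsilon> \<Longrightarrow> v \<in> S\<epsilon> \<Longrightarrow> cmod (\<phi> u - \<phi> v) \<le> H * hilbert_dist u v powr \<gamma>" "0 \<le> H"
  shows "Rt z \<phi> \<in> B" "nrm (Rt z \<phi>) \<le> Mom * C + 8 / \<epsilon> * (Mom * (H + Lc * C))"
proof -
  let ?\<psi> = "\<lambda>v. \<integral>h. F z v h * \<phi> (act h v) \<partial>\<mu>"
  have C0: "0 \<le> C" using C[OF retract_mem] norm_ge_zero order_trans by blast
  have 1: "cmod (?\<psi> v) \<le> Mom * C" if v: "v \<in> S\<epsilon>" for v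
  proof -
    have "cmod (?\<psi> v) \<le> (\<integral>h. \<Gamma> h * C \<partial>\<mu>)"
    proof (rule norm_integral_le_AE[OF F_integrable[OF v z \<phi>]])
      show "AE h in \<mu>. cmod (F z v h * \<phi> (act h v)) \<le> \<Gamma> h * C"
        using up by eventually_elim
          (unfold norm_mult, intro mult_mono F_bound v z C act_mem \<Gamma>_nonneg norm_ge_zero)
    qed (use \<Gamma>_integrable in simp)
    then show ?thesis unfolding Mom_def by simp
  qed
  have 2: "cmod (?\<psi> u - ?\<psi> v) \<le> Mom * (H + Lc * C) * hilbert_dist u v powr \<gamma>" if u: "u \<in> S\<epsilon>" and v: "v \<in> S\<epsilon>" for u v
  proof -
    note u1 = sphere1_epsD(1)[OF u] and v1 = sphere1_epsD(1)[OF v]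
    let ?d = "hilbert_dist u v"
    have d: "0 \<le> ?d" "?d \<le> 1" using S\<epsilon>_dist[OF u v] by auto
    have dg: "?d \<le> ?d powr \<gamma>"
      using powr_mono'[of \<gamma> 1 ?d] d \<gamma> by simp
    have "?\<psi> u - ?\<psi> v = (\<integral>h. F z u h * \<phi> (act h u) - F z v h * \<phi> (act h v) \<partial>\<mu>)"
      using F_integrable[OF u z \<phi>] F_integrable[OF v z \<phi>] by simp
    also have "cmod \<dots> \<le> (\<integral>h. \<Gamma> h * ((H + Lc * C) * ?d powr \<gamma>) \<partial>\<mu>)"
    proof (rule norm_integral_le_AE)
      show "AE h in \<mu>. cmod (F z u h * \<phi> (act h u) - F z v h * \<phi> (act h v)) \<le> \<Gamma> h * ((H + Lc * C) * ?d powr \<gamma>)"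
        using up
      proof eventually_elim
        case (elim h)
        have au: "act h u \<in> S\<epsilon>" and av: "act h v \<in> S\<epsilon>" using act_mem elim u v by auto
        have "hilbert_dist (act h u) (act h v) \<le> (1 - c\<^sup>2) * ?d"
          by (rule up_act_contraction[OF c(1) elim u1 v1 c(2)]) (use eps in simp)
        also have "\<dots> \<le> 1 * ?d" using d by (intro mult_right_mono) auto
        finally have "hilbert_dist (act h u) (act h v) powr \<gamma> \<le> ?d powr \<gamma>"
          using S\<epsilon>_dist[OF au av] \<gamma> by (intro powr_mono2) auto
        then have "H * hilbert_dist (act h u) (act h v) powr \<gamma> \<le> H * ?d powr \<gamma>" using H(2) by (rule mult_left_mono)
        then have 1: "cmod (\<phi> (act h u) - \<phi> (act h v)) \<le> H * ?d powr \<gamma>" using H(1)[OF au av] by linarith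
        have "Lc * ?d \<le> Lc * ?d powr \<gamma>" using dg Lc_nonneg by (rule mult_left_mono)
        then have "\<Gamma> h * (Lc * ?d) \<le> \<Gamma> h * (Lc * ?d powr \<gamma>)" using \<Gamma>_nonneg by (rule mult_left_mono)
        then have 2: "cmod (F z u h - F z v h) \<le> \<Gamma> h * (Lc * ?d powr \<gamma>)" using F_lipschitz[OF u v elim z] by linarith
        have "F z u h * \<phi> (act h u) - F z v h * \<phi> (act h v) =
            F z u h * (\<phi> (act h u) - \<phi> (act h v)) + (F z u h - F z v h) * \<phi> (act h v)" by (simp add: algebra_simps)
        also have "cmod \<dots> \<le> \<Gamma> h * (H * ?d powr \<gamma>) + \<Gamma> h * (Lc * ?d powr \<gamma>) * C"
          by (intro norm_triangle_le add_mono; unfold norm_mult; intro mult_mono 1 2 F_bound u elim z C av)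
            (use C0 in \<open>auto intro!: mult_nonneg_nonneg \<Gamma>_nonneg Lc_nonneg\<close>)
        also have "\<dots> = \<Gamma> h * ((H + Lc * C) * ?d powr \<gamma>)" by (simp add: algebra_simps)
        finally show ?case .
      qed
    qed (use F_integrable[OF u z \<phi>] F_integrable[OF v z \<phi>] \<Gamma>_integrable in auto)
    finally show ?thesis unfolding Mom_def by (simp add: mult.assoc)
  qed
  have k: "0 \<le> Mom * (H + Lc * C)" using Mom_nonneg H(2) Lc_nonneg C0 by simp
  show "Rt z \<phi> \<in> B" unfolding Rt_eq'[OF \<phi>] by (rule extension_mem(1)[OF 2 k 1])
  show "nrm (Rt z \<phi>) \<le> Mom * C + 8 / \<epsilon> * (Mom * (H + Lc * C))"
    unfolding Rt_eq'[OF \<phi>] by (rule extension_mem(2)[OF 2 k 1])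
qed

lemma Rt_mem: "cmod z < \<delta> \<Longrightarrow> \<phi> \<in> B \<Longrightarrow> Rt z \<phi> \<in> B"
  by (rule Rt_bound(1)[where C = "nrm \<phi>" and H = "nrm \<phi>"])
    (auto intro: HD(4,5,6) sphere1_epsD(1))

lemma Rt_linear:
  assumes z: "cmod z < \<delta>"
  shows "H.linear_on (Rt z)"
  unfolding H.linear_on_def
proof (intro conjI ballI allI)
  note i = F_integrable[OF retract_mem z]
  fix \<phi> assume \<phi>: "\<phi> \<in> B"
  show "Rt z \<phi> \<in> B" by (rule Rt_mem[OF z \<phi>])
  show "Rt z (\<lambda>v. \<phi> v + \<psi> v) = (\<lambda>v. Rt z \<phi> v + Rt z \<psi> v)" if \<psi>: "\<psi> \<in> B" for \<psi>
    unfolding Rt_eq'[OF \<phi>] Rt_eq'[OF \<psi>] Rt_eq'[OF H.add_mem[OF \<phi> \<psi>]]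
    using i[OF \<phi>] i[OF \<psi>] by (auto simp: distrib_left)
  show "Rt z (\<lambda>v. a * \<phi> v) = (\<lambda>v. a * Rt z \<phi> v)" for a
  proof
    fix v
    have "(\<integral>h. F z (retract v) h * (a * \<phi> (act h (retract v))) \<partial>\<mu>) = a * (\<integral>h. F z (retract v) h * \<phi> (act h (retract v)) \<partial>\<mu>)"
      by (subst integral_mult_right_zero[symmetric]) (simp add: mult_ac)
    then show "Rt z (\<lambda>v. a * \<phi> v) v = a * Rt z \<phi> v"
      unfolding Rt_eq'[OF \<phi>] Rt_eq'[OF H.scale_mem[OF \<phi>]] by simp
  qed
qed

lemma Rt_holomorphic:
  assumes r: "r' \<le> \<delta>" and \<Phi>: "\<And>z. z \<in> ball 0 r' \<Longrightarrow> \<Phi> z \<in> B" "\<And>z. z \<in> ball 0 r' \<Longrightarrow> nrm (\<Phi> z) \<le> k"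
    "\<And>v. (\<lambda>z. \<Phi> z v) holomorphic_on ball 0 r'"
  shows "(\<lambda>z. Rt z (\<Phi> z) v) holomorphic_on ball 0 r'"
proof (cases "v \<in> sphere1")
  case False
  then show ?thesis unfolding Rt_def by simp
next
  case True
  let ?v = "retract v"
  have "(\<lambda>z. \<integral>h. F z ?v h * \<Phi> z (act h ?v) \<partial>\<mu>) holomorphic_on ball 0 r'"
  proof (rule holomorphic_integral)
    show "(\<lambda>h. F z ?v h * \<Phi> z (act h ?v)) \<in> borel_measurable \<mu>" if "z \<in> ball 0 r'" for z
    proof -
      note [measurable] = holder_space_measurable[OF \<Phi>(1)[OF that]]
      show ?thesis by measurable
    qed
    show "AE h in \<mu>. (\<lambda>z. F z ?v h * \<Phi> z (act h ?v)) holomorphic_on ball 0 r'"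
      unfolding F_def by (intro AE_I2 holomorphic_intros \<Phi>(3))
    show "AE h in \<mu>. \<forall>z\<in>ball 0 r'. cmod (F z ?v h * \<Phi> z (act h ?v)) \<le> \<Gamma> h * k"
      using up
    proof (eventually_elim, intro ballI)
      fix h :: "real ^ 'n ^ 'n" and z assume h: "uniformly_positive c \<epsilon> h" and z: "z \<in> ball (0::complex) r'"
      show "cmod (F z ?v h * \<Phi> z (act h ?v)) \<le> \<Gamma> h * k"
        unfolding norm_mult
        by (intro mult_mono F_bound retract_mem h order_trans[OF H.eval_le[OF \<Phi>(1)[OF z]] \<Phi>(2)[OF z]] \<Gamma>_nonneg)
          (use z r in auto)
    qed
    show "integrable \<mu> (\<lambda>h. \<Gamma> h * k)" using \<Gamma>_integrable by simp
  qed
  then show ?thesis by (rule holomorphic_transform) (use Rt_eq'[OF \<Phi>(1)] True in simp)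
qed

lemma e_bounds: "e \<in> B" "nrm e \<le> 1"
proof -
  have "continuous_on sphere1 e"
    by (subst continuous_on_cong[OF refl, of _ _ "\<lambda>_. 1"]) (auto simp: e_def)
  then have "e \<in> B \<and> nrm e \<le> 1 + 0"
    by (intro conjI holder_spaceI[OF card, where C = 1 and K = 0]) (auto simp: e_def)
  then show "e \<in> B" "nrm e \<le> 1" by auto
qed

lemma Rt_0_e: "Rt 0 e = e"
proof
  fix v
  show "Rt 0 e v = e v"
  proof (cases "v \<in> sphere1")
    case True
    have "(\<integral>h. F 0 (retract v) h * e (act h (retract v)) \<partial>\<mu>) = (\<integral>h. of_real (W (retract v) h) \<partial>\<mu>)"
    proof (rule integral_cong_AE)
      show "AE h in \<mu>. F 0 (retract v) h * e (act h (retract v)) = of_real (W (retract v) h)"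
        using up by eventually_elim (use act_mem[OF _ retract_mem] sphere1_epsD(1) in \<open>auto simp: F_def e_def\<close>)
    qed (use holder_space_measurable[OF e_bounds(1)] in measurable)
    then show ?thesis using W_integral(2)[OF retract_mem] True unfolding Rt_eq'[OF e_bounds(1)] by (simp add: e_def)
  qed (simp add: Rt_def e_def)
qed

end

section \<open>The stationary functional, the gauge and the one-step contraction\<close>

context tilted_operator begin

definition "den = (LINT v:sphere1|\<nu>. r v)"
text \<open>The density of the stationary functional with respect to \<open>\<nu>\<close>. The
  powers of \<open>f \<bullet> v\<close> in \<open>nu_f\<close> and \<open>rf_fun\<close> cancel, so
  \<open>f\<close> does not appear.\<close>

definition "wt v = indicator sphere1 v * r v / den"

lemma wt_measurable [measurable]: "wt \<in> borel_measurable borel"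
  unfolding wt_def[abs_def] by measurable

lemma den_facts: "integrable \<nu> (\<lambda>v. indicator sphere1 v * r v)" "0 < den"
proof -
  show i: "integrable \<nu> (\<lambda>v. indicator sphere1 v * r v)"
    by (rule V.integrable_const_bound[where B = "\<epsilon> powr (- b)"])
      (use \<nu>_eps in \<open>auto elim!: eventually_mono simp: indicator_def intro: r_sphere(3) order_trans[OF less_imp_le[OF r_sphere(4)]] simp: less_imp_le[OF r_sphere(4)]\<close>)
  have "(\<integral>v. \<epsilon> powr b \<partial>\<nu>) \<le> (\<integral>v. indicator sphere1 v * r v \<partial>\<nu>)"
  proof (rule integral_mono_AE[OF _ i])
    show "AE v in \<nu>. \<epsilon> powr b \<le> indicator sphere1 v * r v"
      using \<nu>_eps by eventually_elim (use r_sphere(2) sphere1_epsD(1) in \<open>auto simp: indicator_def\<close>)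
  qed simp
  then have "\<epsilon> powr b \<le> den" unfolding den_def set_lebesgue_integral_def by (simp add: V.prob_space)
  moreover have "0 < \<epsilon> powr b" using eps by simp
  ultimately show "0 < den" by linarith
qed

lemma wt_facts: "integrable \<nu> wt" "AE v in \<nu>. 0 \<le> wt v" "(\<integral>v. wt v \<partial>\<nu>) = 1"
proof -
  show "integrable \<nu> wt" unfolding wt_def[abs_def] using den_facts(1) by simp
  show "AE v in \<nu>. 0 \<le> wt v"
    using \<nu>_eps by eventually_elim (use r_sphere(4) den_facts(2) in \<open>auto simp: wt_def indicator_def intro!: less_imp_le\<close>)
  show "(\<integral>v. wt v \<partial>\<nu>) = 1"
    using den_facts(2) unfolding wt_def[abs_def] by (simp add: den_def set_lebesgue_integral_def)
qed

lemma wt_integrable: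
  assumes "\<phi> \<in> B"
  shows "integrable \<nu> (\<lambda>v. of_real (wt v) * \<phi> v)"
proof (rule Bochner_Integration.integrable_bound)
  show "integrable \<nu> (\<lambda>v. wt v * nrm \<phi>)" using wt_facts(1) by simp
  show "AE v in \<nu>. norm (of_real (wt v) * \<phi> v) \<le> norm (wt v * nrm \<phi>)"
    by (intro AE_I2) (auto simp: norm_mult abs_mult intro!: mult_mono order_trans[OF H.eval_le[OF assms] abs_ge_self])
  show "(\<lambda>v. of_real (wt v) * \<phi> v) \<in> borel_measurable \<nu>"
    using holder_space_measurable[OF assms] by measurable
qed

lemma p_eq:
  assumes "\<phi> \<in> B"
  shows "p \<phi> = (\<integral>v. of_real (wt v) * \<phi> v \<partial>\<nu>)"
proof -
  note [measurable] = holder_space_measurable[OF assms]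
  have [measurable]: "rf_fun \<eta> s f \<in> borel_measurable borel" unfolding rf_fun_def[abs_def] by measurable
  have "p \<phi> = (\<integral>v. indicator sphere1 v *\<^sub>R (of_real ((f \<bullet> v) powr s) * (\<phi> v * of_real (rf_fun \<eta> s f v))) \<partial>\<nu>) / of_real den"
    unfolding p_def pi_f_def nu_f_def den_def set_lebesgue_integral_def ..
  also have "\<dots> = (\<integral>v. indicator sphere1 v *\<^sub>R (of_real ((f \<bullet> v) powr s) * (\<phi> v * of_real (rf_fun \<eta> s f v))) / of_real den \<partial>\<nu>)"
    by simp
  also have "\<dots> = (\<integral>v. of_real (wt v) * \<phi> v \<partial>\<nu>)"
  proof (rule integral_cong_AE)
    show "AE v in \<nu>. indicator sphere1 v *\<^sub>R (of_real ((f \<bullet> v) powr s) * (\<phi> v * of_real (rf_fun \<eta> s f v))) / of_real den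
        = of_real (wt v) * \<phi> v"
      using \<nu>_eps
    proof eventually_elim
      case (elim v)
      have "0 < f \<bullet> v" using sphere1_epsD(3)[OF elim f] eps by simp
      then have "(f \<bullet> v) powr s * rf_fun \<eta> s f v = r v" unfolding rf_fun_def by (simp add: powr_minus field_simps)
      then have "complex_of_real ((f \<bullet> v) powr s) * of_real (rf_fun \<eta> s f v) = of_real (r v)" by (metis of_real_mult)
      then have "complex_of_real ((f \<bullet> v) powr s) * (\<phi> v * of_real (rf_fun \<eta> s f v)) = of_real (r v) * \<phi> v"
        by (simp add: mult_ac)
      then show ?case using sphere1_epsD(1)[OF elim] unfolding wt_def by simp
    qed
  qed measurable
  finally show ?thesis .
qed

text \<open>\<open>p\<close> is an average over \<open>sphere1_eps \<epsilon>\<close>, with a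
  nonnegative weight of total mass one.\<close>

lemma p_near:
  assumes "\<phi> \<in> B" "\<And>v. v \<in> S\<epsilon> \<Longrightarrow> cmod (x - \<phi> v) \<le> k"
  shows "cmod (x - p \<phi>) \<le> k"
proof -
  have "AE v in \<nu>. cmod (x - \<phi> v) \<le> k" using \<nu>_eps by eventually_elim (rule assms(2))
  from average_bound[OF wt_facts(1,2) wt_integrable[OF assms(1)] this] show ?thesis
    unfolding wt_facts(3) p_eq[OF assms(1)] by simp
qed

lemma p_functional: "H.functional_on p 1"
  unfolding H.functional_on_def
proof (intro conjI ballI allI)
  fix \<phi> assume \<phi>: "\<phi> \<in> B"
  show "p (\<lambda>v. \<phi> v + \<psi> v) = p \<phi> + p \<psi>" if \<psi>: "\<psi> \<in> B" for \<psi>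
    unfolding p_eq[OF \<phi>] p_eq[OF \<psi>] p_eq[OF H.add_mem[OF \<phi> \<psi>]]
    using wt_integrable[OF \<phi>] wt_integrable[OF \<psi>] by (simp add: distrib_left)
  show "p (\<lambda>v. a * \<phi> v) = a * p \<phi>" for a
    unfolding p_eq[OF \<phi>] p_eq[OF H.scale_mem[OF \<phi>]]
    by (subst integral_mult_right_zero[symmetric]) (simp add: mult_ac)
  show "cmod (p \<phi>) \<le> 1 * nrm \<phi>"
    using p_near[OF \<phi>, of 0 "nrm \<phi>"] H.eval_le[OF \<phi>] by simp
qed

lemma p_e: "p e = 1"
proof -
  have "(\<integral>v. of_real (wt v) * e v \<partial>\<nu>) = (\<integral>v. complex_of_real (wt v) \<partial>\<nu>)"
    by (rule Bochner_Integration.integral_cong) (auto simp: e_def wt_def indicator_def)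
  then show ?thesis unfolding p_eq[OF e_bounds(1)] using wt_facts(3) by simp
qed

lemma p_holomorphic:
  assumes \<Phi>: "\<And>z. z \<in> ball 0 r' \<Longrightarrow> \<Phi> z \<in> B" "\<And>z. z \<in> ball 0 r' \<Longrightarrow> nrm (\<Phi> z) \<le> k"
    "\<And>v. (\<lambda>z. \<Phi> z v) holomorphic_on ball 0 r'"
  shows "(\<lambda>z. p (\<Phi> z)) holomorphic_on ball 0 r'"
proof -
  have "(\<lambda>z. \<integral>v. of_real (wt v) * \<Phi> z v \<partial>\<nu>) holomorphic_on ball 0 r'"
  proof (rule holomorphic_integral)
    show "(\<lambda>v. of_real (wt v) * \<Phi> z v) \<in> borel_measurable \<nu>" if "z \<in> ball 0 r'" for z
      using holder_space_measurable[OF \<Phi>(1)[OF that]] by measurable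
    show "AE v in \<nu>. (\<lambda>z. of_real (wt v) * \<Phi> z v) holomorphic_on ball 0 r'"
      by (intro AE_I2 holomorphic_intros \<Phi>(3))
    show "AE v in \<nu>. \<forall>z\<in>ball 0 r'. cmod (of_real (wt v) * \<Phi> z v) \<le> wt v * k"
      using wt_facts(2)
    proof (eventually_elim, intro ballI)
      fix v :: "real ^ 'n" and z :: complex assume w: "0 \<le> wt v" and z: "z \<in> ball 0 r'"
      show "cmod (of_real (wt v) * \<Phi> z v) \<le> wt v * k"
        unfolding norm_mult using w order_trans[OF H.eval_le[OF \<Phi>(1)[OF z]] \<Phi>(2)[OF z]] by (intro mult_mono) auto
    qed
    show "integrable \<nu> (\<lambda>v. wt v * k)" using wt_facts(1) by simp
  qed
  then show ?thesis by (rule holomorphic_transform) (use p_eq[OF \<Phi>(1)] in simp)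
qed

lemma q_bdd:
  assumes \<phi>: "\<phi> \<in> B" and u: "u \<in> S\<epsilon>" and v: "v \<in> S\<epsilon>"
  shows "cmod (\<phi> u - \<phi> v) / D (hilbert_dist u v) \<le> 2 * nrm \<phi>"
proof -
  have d: "0 \<le> D (hilbert_dist u v)" "hilbert_dist u v powr \<gamma> / 2 \<le> D (hilbert_dist u v)"
    using D S\<epsilon>_dist[OF u v] by auto
  have "cmod (\<phi> u - \<phi> v) \<le> nrm \<phi> * hilbert_dist u v powr \<gamma>"
    using HD(6)[OF \<phi>] sphere1_epsD(1) u v by blast
  also have "\<dots> \<le> nrm \<phi> * (2 * D (hilbert_dist u v))" using d H.nrm_nonneg[OF \<phi>] by (intro mult_left_mono) auto
  finally show ?thesis
    using d(1) H.nrm_nonneg[OF \<phi>] by (cases "D (hilbert_dist u v) = 0") (auto simp: divide_simps mult_ac)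
qed

lemma q_bdd_above:
  "\<phi> \<in> B \<Longrightarrow> bdd_above ((\<lambda>x. cmod (\<phi> (fst x) - \<phi> (snd x)) / D (hilbert_dist (fst x) (snd x))) ` (S\<epsilon> \<times> S\<epsilon>))"
  using q_bdd by (intro bdd_aboveI2[where M = "2 * nrm \<phi>"]) auto

lemma p_le_q: "cmod (p \<phi>) \<le> q \<phi>" unfolding q_def by simp

lemma q_nonneg': "0 \<le> q \<phi>" using p_le_q[of \<phi>] norm_ge_zero order_trans by blast

lemma q_pair:
  assumes \<phi>: "\<phi> \<in> B" and u: "u \<in> S\<epsilon>" and v: "v \<in> S\<epsilon>"
  shows "cmod (\<phi> u - \<phi> v) \<le> q \<phi> * D (hilbert_dist u v)" "cmod (\<phi> u - \<phi> v) \<le> q \<phi>"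
    "cmod (\<phi> u - \<phi> v) \<le> (K * q \<phi>) * hilbert_dist u v powr \<gamma>"
proof -
  let ?d = "hilbert_dist u v"
  have d: "0 \<le> ?d" "?d \<le> 1" "0 \<le> D ?d" "D ?d \<le> 1" "?d powr \<gamma> / 2 \<le> D ?d" "D ?d \<le> K * ?d powr \<gamma>"
    using D S\<epsilon>_dist[OF u v] by auto
  show 1: "cmod (\<phi> u - \<phi> v) \<le> q \<phi> * D ?d"
  proof (cases "D ?d = 0")
    case True
    then have "?d powr \<gamma> = 0" using d(5) powr_ge_zero[of ?d \<gamma>] by linarith
    then have "u = v" using hilbert_dist_pos[OF sphere1_epsD(1)[OF u] sphere1_epsD(1)[OF v]] by auto
    then show ?thesis using q_nonneg' d by simp
  next
    case False
    have "cmod (\<phi> u - \<phi> v) / D ?d \<le> (SUP x\<in>S\<epsilon> \<times> S\<epsilon>. cmod (\<phi> (fst x) - \<phi> (snd x)) / D (hilbert_dist (fst x) (snd x)))"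
      using cSUP_upper[OF _ q_bdd_above[OF \<phi>], of "(u, v)"] u v by simp
    then have "cmod (\<phi> u - \<phi> v) / D ?d \<le> q \<phi>" unfolding q_def by simp
    then show ?thesis using False d by (simp add: divide_simps)
  qed
  also have "\<dots> \<le> q \<phi> * 1" using d q_nonneg' by (intro mult_left_mono) auto
  finally show "cmod (\<phi> u - \<phi> v) \<le> q \<phi>" by simp
  have "q \<phi> * D ?d \<le> q \<phi> * (K * ?d powr \<gamma>)" using d q_nonneg' by (intro mult_left_mono) auto
  then show "cmod (\<phi> u - \<phi> v) \<le> (K * q \<phi>) * ?d powr \<gamma>" using 1 by (simp add: mult_ac)
qed

lemma q_leI:
  assumes "cmod (p \<phi>) \<le> k" "\<And>u v. u \<in> S\<epsilon> \<Longrightarrow> v \<in> S\<epsilon> \<Longrightarrow> cmod (\<phi> u - \<phi> v) \<le> k * D (hilbert_dist u v)"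
  shows "q \<phi> \<le> k"
proof -
  have k: "0 \<le> k" using assms(1) norm_ge_zero order_trans by blast
  have "(SUP x\<in>S\<epsilon> \<times> S\<epsilon>. cmod (\<phi> (fst x) - \<phi> (snd x)) / D (hilbert_dist (fst x) (snd x))) \<le> k"
  proof (rule cSUP_least)
    show "S\<epsilon> \<times> S\<epsilon> \<noteq> {}" using nonempty_sphere1_eps by simp
    fix x assume "x \<in> S\<epsilon> \<times> S\<epsilon>"
    then have x: "fst x \<in> S\<epsilon>" "snd x \<in> S\<epsilon>" by auto
    have "0 \<le> D (hilbert_dist (fst x) (snd x))" using D S\<epsilon>_dist[OF x] by auto
    then show "cmod (\<phi> (fst x) - \<phi> (snd x)) / D (hilbert_dist (fst x) (snd x)) \<le> k"
      using assms(2)[OF x] k by (cases "D (hilbert_dist (fst x) (snd x)) = 0") (auto simp: divide_simps)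
  qed
  then show ?thesis unfolding q_def using assms(1) by simp
qed

lemma q_add:
  assumes "\<phi> \<in> B" "\<psi> \<in> B"
  shows "q (\<lambda>v. \<phi> v + \<psi> v) \<le> q \<phi> + q \<psi>"
proof (rule q_leI)
  show "cmod (p (\<lambda>v. \<phi> v + \<psi> v)) \<le> q \<phi> + q \<psi>"
    using H.functional_onD(1)[OF p_functional assms] p_le_q norm_triangle_mono by metis
  fix u v assume uv: "u \<in> S\<epsilon>" "v \<in> S\<epsilon>"
  have eq: "\<phi> u + \<psi> u - (\<phi> v + \<psi> v) = (\<phi> u - \<phi> v) + (\<psi> u - \<psi> v)" by simp
  show "cmod (\<phi> u + \<psi> u - (\<phi> v + \<psi> v)) \<le> (q \<phi> + q \<psi>) * D (hilbert_dist u v)"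
    unfolding eq distrib_right by (rule norm_triangle_mono[OF q_pair(1)[OF assms(1) uv] q_pair(1)[OF assms(2) uv]])
qed

lemma q_le_nrm:
  assumes "\<phi> \<in> B"
  shows "q \<phi> \<le> 2 * nrm \<phi>"
proof -
  have "cmod (p \<phi>) \<le> 2 * nrm \<phi>"
    using H.functional_onD(3)[OF p_functional assms assms] H.nrm_nonneg[OF assms] by simp
  moreover have "(SUP x\<in>S\<epsilon> \<times> S\<epsilon>. cmod (\<phi> (fst x) - \<phi> (snd x)) / D (hilbert_dist (fst x) (snd x))) \<le> 2 * nrm \<phi>"
    by (rule cSUP_least) (use nonempty_sphere1_eps q_bdd[OF assms] in auto)
  ultimately show ?thesis unfolding q_def by simp
qed

text \<open>As \<open>D \<le> 1\<close> on the range of the metric, the oscillation on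
  \<open>sphere1_eps \<epsilon>\<close> is at most \<open>q \<phi>\<close>, and so is the modulus of
  the average.\<close>

lemma sup_le_q:
  assumes "\<phi> \<in> B" "v \<in> S\<epsilon>"
  shows "cmod (\<phi> v) \<le> 2 * q \<phi>"
proof -
  have "cmod (\<phi> v - p \<phi>) \<le> q \<phi>" by (rule p_near[OF assms(1) q_pair(2)[OF assms]])
  then show ?thesis using p_le_q[of \<phi>] norm_triangle_sub[of "\<phi> v" "p \<phi>"] by linarith
qed

text \<open>The summand 2 covers the constant of \<open>q_le_nrm\<close>; the rest is
  \<open>Rt_bound\<close> for a function of size \<open>2 * q \<phi>\<close> with Hoelder constant
  \<open>K * q \<phi>\<close>.\<close>

definition "LL = 2 + 2 * Mom + 8 / \<epsilon> * (Mom * (K + 2 * Lc))"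

lemma LL_ge: "2 \<le> LL" unfolding LL_def using Mom_nonneg K Lc_nonneg eps by simp

lemma Rt_le_q:
  assumes "cmod z < \<delta>" "\<phi> \<in> B"
  shows "nrm (Rt z \<phi>) \<le> LL * q \<phi>"
proof -
  have "nrm (Rt z \<phi>) \<le> Mom * (2 * q \<phi>) + 8 / \<epsilon> * (Mom * (K * q \<phi> + Lc * (2 * q \<phi>)))"
    by (rule Rt_bound(2)[OF assms sup_le_q[OF assms(2)] q_pair(3)[OF assms(2)]]) (use K q_nonneg' in auto)
  also have "\<dots> = (LL - 2) * q \<phi>" unfolding LL_def by (simp add: algebra_simps add_divide_distrib)
  also have "\<dots> \<le> LL * q \<phi>" using q_nonneg' by (intro mult_right_mono) auto
  finally show ?thesis .
qed

text \<open>The kernels \<open>W u\<close> and \<open>W v\<close> have the part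
  \<open>y * W v\<close> in common. There both points are moved by the same matrix, which contracts
  their distance. The rest, of mass \<open>1 - y\<close> on either side, is paired arbitrarily at
  cost at most \<open>q \<phi>\<close>. The gauge inequality is the balance of the two
  contributions.\<close>

lemma Rt_0_contraction:
  assumes \<phi>: "\<phi> \<in> B" and u: "u \<in> S\<epsilon>" and v: "v \<in> S\<epsilon>"
  shows "cmod (Rt 0 \<phi> u - Rt 0 \<phi> v) \<le> \<theta> * q \<phi> * D (hilbert_dist u v)"
proof (cases "u = v")
  case True
  then show ?thesis using D[of "hilbert_dist u v"] S\<epsilon>_dist[OF u v] \<theta> q_nonneg' by simp
next
  case False
  note u1 = sphere1_epsD(1)[OF u] and v1 = sphere1_epsD(1)[OF v]
  let ?d = "hilbert_dist u v"
  have d: "0 < ?d" "?d \<le> 1" using hilbert_dist_pos[OF u1 v1 False] S\<epsilon>_dist[OF u v] by auto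
  define Z where "Z = hilbert_m u v * hilbert_m v u"
  have Z: "\<epsilon>\<^sup>2 \<le> Z" "0 < Z" "Z \<le> 1"
    using hilbert_product_eps[OF u v eps(1)] hilbert_product(2)[OF u1 v1] eps unfolding Z_def
    by (auto intro: less_le_trans[of 0 "\<epsilon>\<^sup>2"])
  \<comment> \<open>The exponent \<open>\<bar>s\<bar>\<close> of \<open>W_ratio\<close> is replaced
    by its bound \<open>b\<close>. This lowers the common mass and makes the rate independent of
    \<open>s\<close>.\<close>
  define y where "y = Z powr b"
  have y: "(\<epsilon>\<^sup>2) powr b \<le> y" "0 < y" "y \<le> 1" "y \<le> Z powr \<bar>s\<bar>"
    unfolding y_def using Z b_nonneg s eps by (auto intro: powr_mono2 powr_le1 powr_mono')
  have "1 + b * ln Z \<le> exp (b * ln Z)" by (rule exp_ge_add_one_self)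
  moreover have "y = exp (b * ln Z)" unfolding y_def powr_def using Z by simp
  ultimately have "1 - y \<le> b * (- ln Z)" by linarith
  also have "\<dots> \<le> b * (2 / \<epsilon>\<^sup>2 * ?d)"
    unfolding Z_def using ln_hilbert_product[OF u v] b_nonneg by (intro mult_left_mono) auto
  finally have y1: "1 - y \<le> 2 * b / \<epsilon>\<^sup>2 * ?d" by (simp add: mult_ac)
  \<comment> \<open>The largest value at the image distance that \<open>gauge\<close> permits for
    \<open>D\<close>; with it the two contributions add up to
    \<open>\<theta> * D ?d\<close>.\<close>
  define E where "E = (\<theta> * D ?d - (1 - y)) / y"
  let ?H = "q \<phi>"
  let ?\<psi>u = "\<lambda>h. \<phi> (act h u)" and ?\<psi>v = "\<lambda>h. \<phi> (act h v)"
  \<comment> \<open>What remains of the two kernels after removal of the common part.\<close>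
  let ?P = "\<lambda>h. W u h - y * W v h" and ?Q = "\<lambda>h. (1 - y) * W v h"
  note iu = F_integrable[OF u _ \<phi>, of 0, unfolded F_def, simplified, OF \<delta>]
    and iv = F_integrable[OF v _ \<phi>, of 0, unfolded F_def, simplified, OF \<delta>]
  have iuv: "integrable \<mu> (\<lambda>h. of_real (W v h) * ?\<psi>u h)"
  proof (rule Bochner_Integration.integrable_bound)
    show "integrable \<mu> (\<lambda>h. W v h * nrm \<phi>)" using W_integral(1)[OF v] by simp
    show "AE h in \<mu>. norm (of_real (W v h) * ?\<psi>u h) \<le> norm (W v h * nrm \<phi>)"
      by (intro AE_I2) (auto simp: norm_mult abs_mult intro!: mult_mono order_trans[OF H.eval_le[OF \<phi>] abs_ge_self])
    show "(\<lambda>h. of_real (W v h) * ?\<psi>u h) \<in> borel_measurable \<mu>"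
      using holder_space_measurable[OF \<phi>] by measurable
  qed
  have iP: "integrable \<mu> (\<lambda>h. of_real (?P h) * ?\<psi>u h)"
    using Bochner_Integration.integrable_diff[OF iu integrable_mult_right[OF iuv, of "of_real y"]]
    by (simp add: algebra_simps)
  have iQ: "integrable \<mu> (\<lambda>h. of_real (?Q h) * ?\<psi>v h)"
    using integrable_mult_right[OF iv, of "of_real (1 - y)"] by (simp add: mult_ac)
  have 1: "cmod ((\<integral>h. of_real (?P h) * ?\<psi>u h \<partial>\<mu>) - (\<integral>h. of_real (?Q h) * ?\<psi>v h \<partial>\<mu>)) \<le> (1 - y) * ?H"
  proof (rule average_diff_bound[OF _ _ iP _ _ _ iQ])
    show "integrable \<mu> ?P" "integrable \<mu> ?Q" "(\<integral>h. ?P h \<partial>\<mu>) = 1 - y" "(\<integral>h. ?Q h \<partial>\<mu>) = 1 - y"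
      using W_integral[OF u] W_integral[OF v] by auto
    show "AE h in \<mu>. 0 \<le> ?P h"
      using up
    proof eventually_elim
      case (elim h)
      have "y * W v h \<le> Z powr \<bar>s\<bar> * W v h" using y W_pos[OF v elim] by (intro mult_right_mono) auto
      also have "\<dots> \<le> W u h" unfolding Z_def by (rule W_ratio[OF u v elim])
      finally show ?case by simp
    qed
    show "AE h in \<mu>. 0 \<le> ?Q h" using up by eventually_elim (rule mult_nonneg_nonneg, use y in simp, rule less_imp_le[OF W_pos[OF v]])
    show "AE h' in \<mu>. AE h in \<mu>. cmod (?\<psi>v h' - ?\<psi>u h) \<le> ?H"
      using up
    proof eventually_elim
      case (elim h')
      show ?case
        using up by eventually_elim (intro q_pair(2) \<phi> act_mem elim u v)
    qed
  qed
  have i3: "integrable \<mu> (\<lambda>h. of_real (W v h) * (?\<psi>u h - ?\<psi>v h))"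
    using Bochner_Integration.integrable_diff[OF iuv iv] by (simp add: algebra_simps)
  have 2: "cmod (\<integral>h. of_real (W v h) * (?\<psi>u h - ?\<psi>v h) \<partial>\<mu>) \<le> (\<integral>h. W v h * (?H * E) \<partial>\<mu>)"
  proof (rule norm_integral_le_AE[OF i3])
    show "integrable \<mu> (\<lambda>h. W v h * (?H * E))" using W_integral(1)[OF v] by simp
    show "AE h in \<mu>. norm (of_real (W v h) * (?\<psi>u h - ?\<psi>v h)) \<le> W v h * (?H * E)"
      using up
    proof eventually_elim
      case (elim h)
      note a = act_mem[OF elim u] act_mem[OF elim v]
      have dc: "hilbert_dist (act h u) (act h v) \<le> (1 - c\<^sup>2) * ?d"
        by (rule up_act_contraction[OF c(1) elim u1 v1 c(2)]) (use eps in simp)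
      have "(1 - y) + y * D (hilbert_dist (act h u) (act h v)) \<le> \<theta> * D ?d"
        by (rule gauge[OF d _ dc y(1,3) y1]) (use S\<epsilon>_dist[OF a] in auto)
      then have "D (hilbert_dist (act h u) (act h v)) \<le> E" unfolding E_def using y by (simp add: field_simps)
      then have "cmod (?\<psi>u h - ?\<psi>v h) \<le> ?H * E"
        using q_pair(1)[OF \<phi> a] mult_left_mono[OF _ q_nonneg'[of \<phi>]] order_trans by blast
      then show ?case using W_pos[OF v elim] by (simp add: norm_mult)
    qed
  qed
  also have "(\<integral>h. W v h * (?H * E) \<partial>\<mu>) = ?H * E" using W_integral[OF v] by simp
  finally have 2: "cmod (\<integral>h. of_real (W v h) * (?\<psi>u h - ?\<psi>v h) \<partial>\<mu>) \<le> ?H * E" .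
  have "Rt 0 \<phi> u - Rt 0 \<phi> v = (\<integral>h. of_real (W u h) * ?\<psi>u h \<partial>\<mu>) - (\<integral>h. of_real (W v h) * ?\<psi>v h \<partial>\<mu>)"
    unfolding Rt_eq[OF \<phi> u] Rt_eq[OF \<phi> v] by (simp add: F_def)
  also have "(\<integral>h. of_real (W u h) * ?\<psi>u h \<partial>\<mu>) =
      (\<integral>h. of_real (?P h) * ?\<psi>u h \<partial>\<mu>) + of_real y * (\<integral>h. of_real (W v h) * ?\<psi>u h \<partial>\<mu>)"
  proof -
    have "(\<integral>h. of_real (W u h) * ?\<psi>u h \<partial>\<mu>) =
        (\<integral>h. of_real (?P h) * ?\<psi>u h + of_real y * (of_real (W v h) * ?\<psi>u h) \<partial>\<mu>)"
      by (simp add: algebra_simps)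
    then show ?thesis using iP integrable_mult_right[OF iuv, of "of_real y"] by simp
  qed
  also have "(\<integral>h. of_real (W v h) * ?\<psi>v h \<partial>\<mu>) =
      (\<integral>h. of_real (?Q h) * ?\<psi>v h \<partial>\<mu>) + of_real y * (\<integral>h. of_real (W v h) * ?\<psi>v h \<partial>\<mu>)"
  proof -
    have "(\<integral>h. of_real (W v h) * ?\<psi>v h \<partial>\<mu>) =
        (\<integral>h. of_real (?Q h) * ?\<psi>v h + of_real y * (of_real (W v h) * ?\<psi>v h) \<partial>\<mu>)"
      by (simp add: algebra_simps)
    also have "\<dots> = (\<integral>h. of_real (?Q h) * ?\<psi>v h \<partial>\<mu>) + (\<integral>h. of_real y * (of_real (W v h) * ?\<psi>v h) \<partial>\<mu>)"
      by (rule Bochner_Integration.integral_add[OF iQ integrable_mult_right[OF iv]])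
    finally show ?thesis by simp
  qed
  finally have "Rt 0 \<phi> u - Rt 0 \<phi> v =
      ((\<integral>h. of_real (?P h) * ?\<psi>u h \<partial>\<mu>) - (\<integral>h. of_real (?Q h) * ?\<psi>v h \<partial>\<mu>))
      + of_real y * (\<integral>h. of_real (W v h) * (?\<psi>u h - ?\<psi>v h) \<partial>\<mu>)"
    using iuv iv by (simp add: right_diff_distrib)
  also have "cmod \<dots> \<le> (1 - y) * ?H + y * (?H * E)"
    using 1 2 y by (intro norm_triangle_le add_mono) (auto simp: norm_mult intro: mult_left_mono)
  also have "\<dots> = ?H * ((1 - y) + y * E)" by (simp add: algebra_simps)
  also have "(1 - y) + y * E = \<theta> * D ?d" unfolding E_def using y by simp
  finally show ?thesis by (simp add: mult_ac)
qed

end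

section \<open>Eigenmeasures of shifted exponents\<close>

lemma Re_set_integral:
  fixes g :: "'b \<Rightarrow> complex"
  assumes "set_integrable M A g"
  shows "(LINT v:A|M. Re (g v)) = Re (LINT v:A|M. g v)" "(LINT v:A|M. Im (g v)) = Im (LINT v:A|M. g v)"
  using assms unfolding set_lebesgue_integral_def set_integrable_def
  by (simp_all add: integral_Re[symmetric] integral_Im[symmetric])

context tilted_operator begin

lemma r_continuous: "continuous_on S\<epsilon> r"
  unfolding continuous_on_sequentially
proof (intro allI ballI impI, elim conjE)
  fix x :: "nat \<Rightarrow> real ^ 'n" and a assume a: "a \<in> S\<epsilon>" and x: "\<forall>n. x n \<in> S\<epsilon>" "x \<longlonglongrightarrow> a"
  show "(r \<circ> x) \<longlonglongrightarrow> r a"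
    unfolding r_fun_def set_lebesgue_integral_def o_def
  proof (rule integral_dominated_convergence[where w = "\<lambda>_. \<epsilon> powr (- b)"])
    show "AE u in \<eta>. (\<lambda>i. indicator sphere1 u *\<^sub>R (x i \<bullet> u) powr s) \<longlonglongrightarrow> indicator sphere1 u *\<^sub>R (a \<bullet> u) powr s"
      using \<eta>_eps
    proof eventually_elim
      case (elim u)
      have "a \<bullet> u \<noteq> 0" using sphere1_epsD(4)[OF a sphere1_epsD(1)[OF elim]] eps by simp
      then show ?case by (intro tendsto_intros x(2)) auto
    qed
    show "AE u in \<eta>. norm (indicator sphere1 u *\<^sub>R (x i \<bullet> u) powr s) \<le> \<epsilon> powr (- b)" for i
      using \<eta>_eps
    proof eventually_elim
      case (elim u)
      note u = sphere1_epsD(1)[OF elim]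
      have xi: "x i \<in> S\<epsilon>" using x by blast
      have "(x i \<bullet> u) powr s \<le> \<epsilon> powr (- b) * 1 powr s"
        by (rule powr_between(2)) (use eps s sphere1_epsD(4)[OF xi u] sphere1_inner_le_1[OF sphere1_epsD(1)[OF xi] u] in auto)
      then show ?case using u by simp
    qed
  qed (auto)
qed

text \<open>The weight that conjugates the perturbed operator to a transfer operator: on
  \<open>sphere1_eps \<epsilon>\<close>, applying \<open>P_op \<mu> (s + t)\<close> to
  \<open>tilt t\<close> times \<open>\<phi>\<close> gives \<open>\<kappa> * tilt t\<close> times the
  image of \<open>\<phi>\<close> under \<open>Rt\<close> with parameter \<open>t\<close>. The
  retraction makes the weight continuous and positive everywhere.\<close>

definition "tilt t v = r (retract v) * (f \<bullet> retract v) powr t"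

lemma tilt_pos: "0 < tilt t v"
  unfolding tilt_def using r_sphere(4)[OF retract_mem, of v] sphere1_epsD(3)[OF retract_mem f, of v] eps
  by (intro mult_pos_pos) auto

lemma tilt_continuous: "continuous_on UNIV (tilt t)"
  unfolding tilt_def[abs_def]
proof (rule continuous_retract)
  show "continuous_on S\<epsilon> (\<lambda>v. r v * (f \<bullet> v) powr t)"
    by (intro continuous_intros r_continuous) (use sphere1_epsD(3)[OF _ f] eps in force)
qed

lemma holder_retract_continuous:
  assumes "\<phi> \<in> B"
  shows "continuous_on UNIV (\<lambda>v. \<phi> (retract v))"
  by (rule continuous_retract[OF continuous_on_subset[OF HD(1)[OF assms]]]) (auto intro: sphere1_epsD(1))

text \<open>The conjugation by \<open>tilt t\<close>, integrated against the eigenmeasure of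
  exponent \<open>s + t\<close>. For \<open>t = 0\<close> it yields the invariance of
  \<open>p\<close>; for an eigenvector it identifies the eigenvalue.\<close>

lemma transfer_eigen:
  assumes t: "\<bar>t\<bar> < \<delta>" and \<nu>': "prob_space \<nu>'" "sets \<nu>' = sets borel" "AE v in \<nu>'. v \<in> S\<epsilon>"
    and eig: "eigenmeasure (P_op \<mu> (s + t)) k' \<nu>'" and \<phi>: "\<phi> \<in> B"
  shows "of_real \<kappa> * (LINT v:sphere1|\<nu>'. of_real (tilt t v) * Rt (of_real t) \<phi> (retract v)) =
    of_real k' * (LINT v:sphere1|\<nu>'. of_real (tilt t v) * \<phi> (retract v))"
proof -
  interpret V': prob_space \<nu>' by (rule \<nu>')
  note [measurable_cong] = \<nu>'(2)
  have tz: "cmod (of_real t) < \<delta>" using t by simp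
  define \<psi> where "\<psi> v = of_real (tilt t v) * \<phi> (retract v)" for v
  define \<xi> where "\<xi> v = of_real (tilt t v) * Rt (of_real t) \<phi> (retract v)" for v
  have c\<psi>: "continuous_on A \<psi>" and c\<xi>: "continuous_on A \<xi>" for A
    unfolding \<psi>_def \<xi>_def
    using tilt_continuous holder_retract_continuous[OF \<phi>] holder_retract_continuous[OF Rt_mem[OF tz \<phi>]]
    by (auto intro!: continuous_intros intro: continuous_on_subset)
  note m = borel_measurable_continuous_onI[OF c\<psi>] borel_measurable_continuous_onI[OF c\<xi>]
  note [measurable] = m
  note si = set_integrable_sphere1[OF \<nu>'(1,2)]
  have key: "(\<integral>h. of_real (norm1 (h *v v) powr (s + t)) * \<psi> (act h v) \<partial>\<mu>) = of_real \<kappa> * \<xi> v"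
    "integrable \<mu> (\<lambda>h. of_real (norm1 (h *v v) powr (s + t)) * \<psi> (act h v))" if v: "v \<in> S\<epsilon>" for v
  proof -
    note v1 = sphere1_epsD(1)[OF v]
    have ae: "AE h in \<mu>. of_real (norm1 (h *v v) powr (s + t)) * \<psi> (act h v) = of_real (\<kappa> * tilt t v) * (F (of_real t) v h * \<phi> (act h v))"
      using up
    proof eventually_elim
      case (elim h)
      have a: "act h v \<in> S\<epsilon>" by (rule act_mem[OF elim v])
      have n: "0 < norm1 (h *v v)" by (rule up_norm1_bounds(3)[OF c(1) elim v1])
      have fv: "0 < f \<bullet> v" "0 < f \<bullet> act h v"
        using sphere1_epsD(3)[OF v f] sphere1_epsD(3)[OF a f] eps by auto
      have "f \<bullet> (h *v v) = norm1 (h *v v) * (f \<bullet> act h v)"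
        using up_act_scale[OF c(1) elim v1] by (metis inner_scaleR_right)
      then have "(f \<bullet> (h *v v)) powr t = norm1 (h *v v) powr t * (f \<bullet> act h v) powr t"
        using n fv by (simp add: powr_mult)
      moreover have "Y v h powr t = (f \<bullet> (h *v v)) powr t / (f \<bullet> v) powr t"
        unfolding Y_def using up_inner_bounds(3)[OF c(1) elim f v1] fv by (simp add: powr_divide)
      ultimately have "norm1 (h *v v) powr (s + t) * tilt t (act h v) = \<kappa> * tilt t v * (W v h * Y v h powr t)"
        unfolding tilt_def retract_id[OF a] retract_id[OF v] W_def r_act[OF v1 elim]
        using fv \<kappa>_pos r_sphere(4)[OF v] by (simp add: powr_add field_simps)
      moreover have "F (of_real t) v h = of_real (W v h * Y v h powr t)"
        unfolding F_def powr_def using Y_pos[OF v elim] by (simp add: exp_of_real[symmetric])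
      ultimately show ?case
        unfolding \<psi>_def retract_id[OF a] by (metis (no_types, opaque_lifting) mult.assoc of_real_mult)
    qed
    have [measurable]: "(\<lambda>h. F (of_real t) v h * \<phi> (act h v)) \<in> borel_measurable borel"
      using holder_space_measurable[OF \<phi>] by measurable
    have "(\<integral>h. of_real (norm1 (h *v v) powr (s + t)) * \<psi> (act h v) \<partial>\<mu>) = (\<integral>h. of_real (\<kappa> * tilt t v) * (F (of_real t) v h * \<phi> (act h v)) \<partial>\<mu>)"
      by (rule integral_cong_AE[OF _ _ ae]) measurable
    also have "\<dots> = of_real (\<kappa> * tilt t v) * Rt (of_real t) \<phi> v" unfolding Rt_eq[OF \<phi> v] by simp
    finally show "(\<integral>h. of_real (norm1 (h *v v) powr (s + t)) * \<psi> (act h v) \<partial>\<mu>) = of_real \<kappa> * \<xi> v"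
      unfolding \<xi>_def retract_id[OF v] by simp
    show "integrable \<mu> (\<lambda>h. of_real (norm1 (h *v v) powr (s + t)) * \<psi> (act h v))"
      by (subst integrable_cong_AE[OF _ _ ae]) (use F_integrable[OF v tz \<phi>] in \<open>auto\<close>)
  qed
  \<comment> \<open>\<open>eigenmeasure\<close> speaks of real test functions, so real and imaginary
    part are treated separately, by a common argument.\<close>
  have real_part: "\<kappa> * part (LINT v:sphere1|\<nu>'. \<xi> v) = k' * part (LINT v:sphere1|\<nu>'. \<psi> v)"
    if part: "part = Re \<or> part = Im" for part
  proof -
    have cp: "continuous_on UNIV part" using part by (auto intro!: continuous_intros)
    have [measurable]: "part \<in> borel_measurable borel" by (rule borel_measurable_continuous_onI[OF cp])
    have cpp: "continuous_on A (\<lambda>v. part (\<psi> v))" for A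
      by (rule continuous_on_compose2[OF cp c\<psi>]) auto
    have lin: "part (of_real x * w) = x * part w" for x w using part by auto
    have pint: "part (\<integral>h. g h \<partial>\<mu>) = (\<integral>h. part (g h) \<partial>\<mu>)" if "integrable \<mu> g" for g
      using part that by (auto simp: integral_Re integral_Im)
    have pset: "part (LINT v:sphere1|\<nu>'. g v) = (LINT v:sphere1|\<nu>'. part (g v))" if "continuous_on UNIV g" for g
      using part Re_set_integral[OF si[OF that]] by auto
    have P: "P_op \<mu> (s + t) (\<lambda>v. part (\<psi> v)) v = (\<integral>h. norm1 (h *v v) powr (s + t) * part (\<psi> (act h v)) \<partial>\<mu>)" for v
      unfolding P_op_def by (rule set_integral_nonneg_matrices) measurable
    have "(LINT v:sphere1|\<nu>'. P_op \<mu> (s + t) (\<lambda>v. part (\<psi> v)) v) = (LINT v:sphere1|\<nu>'. \<kappa> * part (\<xi> v))"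
      unfolding set_lebesgue_integral_def
    proof (rule integral_cong_AE)
      show "AE v in \<nu>'. indicator sphere1 v *\<^sub>R P_op \<mu> (s + t) (\<lambda>v. part (\<psi> v)) v = indicator sphere1 v *\<^sub>R (\<kappa> * part (\<xi> v))"
        using \<nu>'(3)
      proof eventually_elim
        case (elim v)
        have "P_op \<mu> (s + t) (\<lambda>v. part (\<psi> v)) v = part (of_real \<kappa> * \<xi> v)"
          unfolding P key(1)[OF elim, symmetric] pint[OF key(2)[OF elim]] lin ..
        then show ?case by (simp add: lin)
      qed
      show "(\<lambda>v. indicator sphere1 v *\<^sub>R P_op \<mu> (s + t) (\<lambda>v. part (\<psi> v)) v) \<in> borel_measurable \<nu>'"
        unfolding P by measurable
    qed measurable
    also have "\<dots> = \<kappa> * part (LINT v:sphere1|\<nu>'. \<xi> v)" unfolding pset[OF c\<xi>] by simp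
    finally show ?thesis
      using eig cpp unfolding eigenmeasure_def pset[OF c\<psi>] by metis
  qed
  have "of_real \<kappa> * (LINT v:sphere1|\<nu>'. \<xi> v) = of_real k' * (LINT v:sphere1|\<nu>'. \<psi> v)"
    using real_part[of Re] real_part[of Im] by (intro complex_eqI) auto
  then show ?thesis unfolding \<xi>_def \<psi>_def .
qed

lemma p_Rt_0:
  assumes \<phi>: "\<phi> \<in> B"
  shows "p (Rt 0 \<phi>) = p \<phi>"
proof -
  have *: "(LINT v:sphere1|\<nu>. of_real (tilt 0 v) * \<psi> (retract v)) = of_real den * p \<psi>" if \<psi>: "\<psi> \<in> B" for \<psi>
  proof -
    have "(LINT v:sphere1|\<nu>. of_real (tilt 0 v) * \<psi> (retract v)) = (\<integral>v. of_real den * (of_real (wt v) * \<psi> v) \<partial>\<nu>)"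
      unfolding set_lebesgue_integral_def
    proof (rule integral_cong_AE)
      show "AE v in \<nu>. indicator sphere1 v *\<^sub>R (of_real (tilt 0 v) * \<psi> (retract v)) = of_real den * (of_real (wt v) * \<psi> v)"
        using \<nu>_eps
      proof eventually_elim
        case (elim v)
        have "f \<bullet> v \<noteq> 0" using sphere1_epsD(3)[OF elim f] eps by simp
        then show ?case
          using sphere1_epsD(1)[OF elim] den_facts(2) unfolding tilt_def retract_id[OF elim] wt_def by simp
      qed
      show "(\<lambda>v. indicator sphere1 v *\<^sub>R (of_real (tilt 0 v) * \<psi> (retract v))) \<in> borel_measurable \<nu>"
        using borel_measurable_continuous_onI[OF tilt_continuous] borel_measurable_continuous_onI[OF holder_retract_continuous[OF \<psi>]]
        by measurable
      show "(\<lambda>v. of_real den * (of_real (wt v) * \<psi> v)) \<in> borel_measurable \<nu>"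
        using holder_space_measurable[OF \<psi>] by measurable
    qed
    also have "\<dots> = of_real den * p \<psi>" unfolding p_eq[OF \<psi>] by simp
    finally show ?thesis .
  qed
  have "of_real \<kappa> * (of_real den * p (Rt 0 \<phi>)) = of_real \<kappa> * (of_real den * p \<phi>)"
    using transfer_eigen[of 0 \<nu> \<kappa> \<phi>] \<delta> prob_\<nu> \<nu>_eps eigen_\<nu> \<phi> *[OF Rt_mem[of 0, OF _ \<phi>]] *[OF \<phi>] by simp
  then show ?thesis using \<kappa>_pos den_facts(2) by simp
qed

end

section \<open>Application of the perturbation theory\<close>

locale perturbed_operator = tilted_operator +
  fixes \<rho>1 \<rho>2 \<rho>3 :: real
  assumes \<rho>1: "0 < \<rho>1" "\<rho>1 \<le> \<delta> / 2" "\<rho>1 * (4 * LL ^ 2 / \<delta>) \<le> (1 - \<theta>) / 2"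
        "\<rho>1 * (4 * LL ^ 4 / \<delta>) \<le> (1 - \<theta>) ^ 2 / 256"
    and \<rho>2: "0 < \<rho>2" "\<rho>2 \<le> \<rho>1 / 2" "\<rho>2 * (4 * (64 * LL ^ 4 / (1 - \<theta>) ^ 2) / \<rho>1) \<le> 1 / 2"
        "\<rho>2 * (4 * (16 * LL ^ 3 / (1 - \<theta>)) / \<rho>1) \<le> 1 / 2"
    and \<rho>3: "0 < \<rho>3" "\<rho>3 \<le> \<rho>2 / 2"
        "\<rho>3 * (LL * (4 * (2 * (128 * LL ^ 3 / (1 - \<theta>) ^ 2)) / \<rho>2)) \<le> (1 - \<theta>) / 4"
begin

sublocale Q: perturbation B nrm Rt p e q \<delta> \<theta> LL \<rho>1 \<rho>2 \<rho>3
proof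
  show "0 < \<delta>" by (rule \<delta>)
  show "0 \<le> \<theta>" "\<theta> < 1" by (rule \<theta>)+
  show "1 \<le> LL" using LL_ge by simp
  show "H.linear_on (Rt z)" if "z \<in> ball 0 \<delta>" for z by (rule Rt_linear) (use that in simp)
  show "H.functional_on p LL"
    using p_functional LL_ge H.nrm_nonneg unfolding H.functional_on_def
    by (auto intro: order_trans[OF _ mult_right_mono[of 1 LL]])
  show "e \<in> B" by (rule e_bounds)
  show "nrm e \<le> LL" using e_bounds(2) LL_ge by simp
  show "p e = 1" by (rule p_e)
  show "Rt 0 e = e" by (rule Rt_0_e)
  show "p (Rt 0 \<phi>) = p \<phi>" if "\<phi> \<in> B" for \<phi> by (rule p_Rt_0[OF that])
  show "q (\<lambda>v. \<phi> v + \<psi> v) \<le> q \<phi> + q \<psi>" if "\<phi> \<in> B" "\<psi> \<in> B" for \<phi> \<psi> by (rule q_add[OF that])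
  show "q \<phi> \<le> LL * nrm \<phi>" if "\<phi> \<in> B" for \<phi>
    using q_le_nrm[OF that] mult_right_mono[OF LL_ge H.nrm_nonneg[OF that]] by linarith
  show "cmod (p \<phi>) \<le> q \<phi>" for \<phi> by (rule p_le_q)
  show "nrm (Rt z \<phi>) \<le> LL * q \<phi>" if "z \<in> ball 0 \<delta>" "\<phi> \<in> B" for z \<phi>
    by (rule Rt_le_q) (use that in auto)
  show "q (deflation (Rt 0) p e \<phi>) \<le> \<theta> * q \<phi>" if \<phi>: "\<phi> \<in> B" for \<phi>
  proof (rule q_leI)
    have R: "Rt 0 \<phi> \<in> B" by (rule Rt_mem[OF _ \<phi>]) (use \<delta> in simp)
    have d: "deflation (Rt 0) p e \<phi> = (\<lambda>v. Rt 0 \<phi> v + (- p \<phi>) * e v)" by (auto simp: deflation_def)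
    have "p (deflation (Rt 0) p e \<phi>) = p (Rt 0 \<phi>) + (- p \<phi>) * p e"
      unfolding d
      using H.functional_onD(1)[OF p_functional R H.scale_mem[OF e_bounds(1)]]
        H.functional_onD(2)[OF p_functional e_bounds(1) e_bounds(1), of "- p \<phi>"] by metis
    then have "p (deflation (Rt 0) p e \<phi>) = 0" using p_Rt_0[OF \<phi>] p_e by simp
    then show "cmod (p (deflation (Rt 0) p e \<phi>)) \<le> \<theta> * q \<phi>" using \<theta> q_nonneg' by simp
    show "cmod (deflation (Rt 0) p e \<phi> u - deflation (Rt 0) p e \<phi> v) \<le> \<theta> * q \<phi> * D (hilbert_dist u v)"
      if "u \<in> S\<epsilon>" "v \<in> S\<epsilon>" for u v
      using Rt_0_contraction[OF \<phi> that] that sphere1_epsD(1) by (auto simp: deflation_def e_def)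
  qed
  show "(\<lambda>z. Rt z (\<Phi> z) v) holomorphic_on ball 0 r'"
    if "r' \<le> \<delta>" "\<And>z. z \<in> ball 0 r' \<Longrightarrow> \<Phi> z \<in> B" "\<And>z. z \<in> ball 0 r' \<Longrightarrow> nrm (\<Phi> z) \<le> k"
      "\<And>v. (\<lambda>z. \<Phi> z v) holomorphic_on ball 0 r'" for \<Phi> k r' v
    by (rule Rt_holomorphic[OF that])
  show "(\<lambda>z. p (\<Phi> z)) holomorphic_on ball 0 r'"
    if "r' \<le> \<delta>" "\<And>z. z \<in> ball 0 r' \<Longrightarrow> \<Phi> z \<in> B" "\<And>z. z \<in> ball 0 r' \<Longrightarrow> nrm (\<Phi> z) \<le> k"
      "\<And>v. (\<lambda>z. \<Phi> z v) holomorphic_on ball 0 r'" for \<Phi> k r'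
    by (rule p_holomorphic[OF that(2-4)])
qed (use \<rho>1 \<rho>2 \<rho>3 in auto)

end

lemma op_analytic_on_subset: "op_analytic_on B nrm A U \<Longrightarrow> V \<subseteq> U \<Longrightarrow> op_analytic_on B nrm A V"
  unfolding op_analytic_on_def by blast

context perturbed_operator begin

text \<open>Off \<open>sphere1_eps \<epsilon>\<close> the two operators differ, but almost every
  matrix maps this set into itself, so the iterates agree on it up to the scalar. Measurability of
  the iterates of \<open>R_op\<close> is part of the induction.\<close>

lemma R_op_power:
  assumes z: "cmod z < \<delta>" and \<phi>: "\<phi> \<in> B" and v: "v \<in> S\<epsilon>"
  shows "(R_op \<mu> \<eta> \<epsilon> \<kappa> q' s z f ^^ n) \<phi> v = exp (- of_real q' * z) ^ n * (Rt z ^^ n) \<phi> v"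
proof -
  let ?R = "R_op \<mu> \<eta> \<epsilon> \<kappa> q' s z f" and ?c = "exp (- of_real q' * z)"
  have mem: "(Rt z ^^ n) \<phi> \<in> B" for n by (induction n) (auto simp: \<phi> Rt_mem[OF z])
  have "(?R ^^ n) \<phi> \<in> borel_measurable borel \<and> (\<forall>v\<in>S\<epsilon>. (?R ^^ n) \<phi> v = ?c ^ n * (Rt z ^^ n) \<phi> v)"
  proof (induction n)
    case 0
    then show ?case using holder_space_measurable[OF \<phi>] by simp
  next
    case (Suc n)
    note [measurable] = Suc[THEN conjunct1] holder_space_measurable[OF mem]
    have eq: "(?R ^^ Suc n) \<phi> v = ?c ^ Suc n * (Rt z ^^ Suc n) \<phi> v" if v: "v \<in> S\<epsilon>" for v
    proof -
      have "(?R ^^ Suc n) \<phi> v = ?c * (\<integral>h. F z v h * (?R ^^ n) \<phi> (act h v) \<partial>\<mu>)"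
        using R_op_eq[OF v Suc[THEN conjunct1]] by simp
      also have "(\<integral>h. F z v h * (?R ^^ n) \<phi> (act h v) \<partial>\<mu>) = (\<integral>h. ?c ^ n * (F z v h * (Rt z ^^ n) \<phi> (act h v)) \<partial>\<mu>)"
      proof (rule integral_cong_AE)
        show "AE h in \<mu>. F z v h * (?R ^^ n) \<phi> (act h v) = ?c ^ n * (F z v h * (Rt z ^^ n) \<phi> (act h v))"
          using up by eventually_elim (use Suc act_mem[OF _ v] in simp)
      qed measurable
      also have "\<dots> = ?c ^ n * (Rt z ^^ Suc n) \<phi> v" using Rt_eq[OF mem v] by simp
      finally show ?thesis by simp
    qed
    have "(?R ^^ Suc n) \<phi> = (\<lambda>v. if v \<in> S\<epsilon> then ?c ^ Suc n * (Rt z ^^ Suc n) \<phi> v else 0)"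
    proof
      fix v
      show "(?R ^^ Suc n) \<phi> v = (if v \<in> S\<epsilon> then ?c ^ Suc n * (Rt z ^^ Suc n) \<phi> v else 0)"
        using eq[of v] by (cases "v \<in> S\<epsilon>") (auto simp: R_op_def)
    qed
    moreover have "(\<lambda>v. if v \<in> S\<epsilon> then ?c ^ Suc n * (Rt z ^^ Suc n) \<phi> v else 0) \<in> borel_measurable borel"
      by (rule measurable_If_set) measurable
    ultimately show ?case using eq by auto
  qed
  then show ?thesis using v by blast
qed

definition "NN q' z \<phi> v = exp (- of_real q' * z) * Q.N z \<phi> v"

lemma decomposition:
  assumes r: "r' \<le> \<rho>3" and z: "z \<in> ball 0 r'" and n: "1 \<le> n" and \<phi>: "\<phi> \<in> B" and v: "v \<in> S\<epsilon>"
  shows "(R_op \<mu> \<eta> \<epsilon> \<kappa> q' s z f ^^ n) \<phi> v =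
    (exp (- of_real q' * z) * Q.lam z) ^ n * Q.Pr z \<phi> v + (NN q' z ^^ n) \<phi> v"
proof -
  have z2: "z \<in> ball 0 \<rho>2" "cmod z < \<delta>" using z r Q.radii by auto
  have N: "(NN q' z ^^ n) \<phi> = (\<lambda>v. exp (- of_real q' * z) ^ n * (Q.N z ^^ n) \<phi> v)"
    unfolding NN_def[abs_def] using Q.scaled_N(3)[OF r z \<phi>] by blast
  show ?thesis
    unfolding R_op_power[OF z2(2) \<phi> v] N Q.R_pow[OF z2(1) n \<phi>] by (simp add: power_mult_distrib distrib_left)
qed

lemma NN_facts:
  assumes r: "r' \<le> \<rho>3"
  shows "op_analytic_on B nrm (NN q') (ball 0 r')"
    and "z \<in> ball 0 r' \<Longrightarrow> op_spectral_radius B nrm (NN q' z) \<le> ereal (exp (\<bar>q'\<bar> * r') * Q.\<theta>2)"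
    and "z \<in> ball 0 r' \<Longrightarrow> \<phi> \<in> B \<Longrightarrow> Q.Pr z (NN q' z \<phi>) = (\<lambda>_. 0) \<and> NN q' z (Q.Pr z \<phi>) = (\<lambda>_. 0)"
proof -
  show "op_analytic_on B nrm (NN q') (ball 0 r')"
    unfolding NN_def[abs_def] using Q.scaled_N(1)[OF r, of "- of_real q'"] .
  show "op_spectral_radius B nrm (NN q' z) \<le> ereal (exp (\<bar>q'\<bar> * r') * Q.\<theta>2)" if "z \<in> ball 0 r'"
    unfolding NN_def[abs_def] using Q.scaled_N(2)[OF r that, of "- of_real q'"] by simp
  assume z: "z \<in> ball 0 r'" and \<phi>: "\<phi> \<in> B"
  have z2: "z \<in> ball 0 \<rho>2" using z r Q.radii by auto
  have "Q.Pr z (NN q' z \<phi>) = (\<lambda>v. exp (- of_real q' * z) * Q.Pr z (Q.N z \<phi>) v)"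
    unfolding NN_def[abs_def] by (rule H.linear_onD(3)[OF Q.Pr_linear[OF z2] Q.N_mem[OF z2 \<phi>] \<phi>])
  then show "Q.Pr z (NN q' z \<phi>) = (\<lambda>_. 0) \<and> NN q' z (Q.Pr z \<phi>) = (\<lambda>_. 0)"
    unfolding NN_def[abs_def] by (simp add: Q.Pr_N[OF z2 \<phi>] Q.N_Pr[OF z2 \<phi>])
qed

text \<open>The eigenvector is only known to be within 1/2 of one on
  \<open>sphere1_eps \<epsilon>\<close>. Multiplied by the positive weight \<open>tilt t\<close>,
  its integral has positive real part, so it can be cancelled.\<close>

lemma lam_real:
  assumes t: "\<bar>t\<bar> < \<rho>2" and \<nu>': "prob_space \<nu>'" "sets \<nu>' = sets borel" "AE v in \<nu>'. v \<in> S\<epsilon>"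
    and eig: "eigenmeasure (P_op \<mu> (s + t)) k' \<nu>'"
  shows "of_real \<kappa> * Q.lam (of_real t) = of_real k'"
proof -
  interpret V': prob_space \<nu>' by (rule \<nu>')
  note [measurable_cong] = \<nu>'(2)
  let ?z = "of_real t :: complex" and ?h = "Q.hv (of_real t)"
  have z: "?z \<in> ball 0 \<rho>2" "?z \<in> ball 0 \<rho>1" "\<bar>t\<bar> < \<delta>" using t Q.radii by auto
  have hB: "?h \<in> B" by (rule Q.hv_mem[OF z(2)])
  define g where "g v = of_real (tilt t v) * ?h (retract v)" for v
  have cg: "continuous_on A g" for A
    unfolding g_def using tilt_continuous holder_retract_continuous[OF hB]
    by (auto intro!: continuous_intros intro: continuous_on_subset)
  note [measurable] = borel_measurable_continuous_onI[OF cg]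
  note gi = set_integrable_sphere1[OF \<nu>'(1,2) cg]
  have "of_real \<kappa> * (LINT v:sphere1|\<nu>'. of_real (tilt t v) * Rt ?z ?h (retract v)) = of_real k' * (LINT v:sphere1|\<nu>'. g v)"
    unfolding g_def by (rule transfer_eigen[OF z(3) \<nu>' eig hB])
  also have "(LINT v:sphere1|\<nu>'. of_real (tilt t v) * Rt ?z ?h (retract v)) = (LINT v:sphere1|\<nu>'. Q.lam ?z * g v)"
    unfolding Q.R_hv[OF z(2)] g_def by (simp add: mult_ac)
  also have "\<dots> = Q.lam ?z * (LINT v:sphere1|\<nu>'. g v)" by simp
  finally have eq: "of_real \<kappa> * Q.lam ?z * (LINT v:sphere1|\<nu>'. g v) = of_real k' * (LINT v:sphere1|\<nu>'. g v)"
    by (simp add: mult.assoc)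
  have pos: "0 < Re (g v)" for v
  proof -
    have "cmod (?h (retract v) - e (retract v)) \<le> 1/2" by (rule Q.hv_near_e[OF z(1)])
    then have "1/2 \<le> Re (?h (retract v))"
      using abs_Re_le_cmod[of "?h (retract v) - e (retract v)"] sphere1_epsD(1)[OF retract_mem] by (auto simp: e_def abs_le_iff)
    then show ?thesis unfolding g_def using tilt_pos by simp
  qed
  have "Re (LINT v:sphere1|\<nu>'. g v) = (\<integral>v. indicator sphere1 v * Re (g v) \<partial>\<nu>')"
    using Re_set_integral(1)[OF gi] by (simp add: set_lebesgue_integral_def)
  moreover have "(\<integral>v. indicator sphere1 v * Re (g v) \<partial>\<nu>') \<noteq> 0"
  proof
    assume z: "(\<integral>v. indicator sphere1 v * Re (g v) \<partial>\<nu>') = 0"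
    have i: "integrable \<nu>' (\<lambda>v. indicator sphere1 v * Re (g v))"
      using integrable_Re[OF gi[unfolded set_integrable_def]] by simp
    have "AE v in \<nu>'. indicator sphere1 v * Re (g v) = 0"
      by (subst integral_nonneg_eq_0_iff_AE[OF i, symmetric]) (use z pos in \<open>auto intro!: AE_I2 simp: less_imp_le indicator_def\<close>)
    then have "AE v in \<nu>'. False"
      using \<nu>'(3) 
    proof eventually_elim
      case (elim v)
      then show ?case using pos[of v] sphere1_epsD(1)[OF elim(2)] by simp
    qed
    then show False by simp
  qed
  ultimately have "(LINT v:sphere1|\<nu>'. g v) \<noteq> 0" by auto
  then show ?thesis using eq by simp
qed

lemma lam_holomorphic: "(\<lambda>z. of_real \<kappa> * Q.lam z) holomorphic_on ball 0 \<rho>3"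
  by (intro holomorphic_intros holomorphic_on_subset[OF Q.lam_hol]) (use Q.radii in auto)

text \<open>Near \<open>s\<close> the function \<open>k\<close> is \<open>\<kappa>\<close> times the
  eigenvalue, so its logarithmic derivative is the real part of \<open>deriv Q.lam 0\<close>.
  Cauchy's estimate uses the bound 2 for the eigenvalue on the disc of radius
  \<open>\<rho>1\<close>.\<close>

lemma log_derivative_bound:
  assumes k: "\<And>t. \<bar>t\<bar> < \<rho>2 \<Longrightarrow> of_real \<kappa> * Q.lam (of_real t) = of_real (k (s + t))"
  shows "\<bar>deriv (\<lambda>x. ln (k x)) s\<bar> \<le> 8 / \<rho>1"
proof -
  let ?l = "deriv Q.lam 0"
  have "(Q.lam has_field_derivative ?l) (at (of_real 0))"
    using Q.lam_hol Q.zero_in(1) by (simp add: holomorphic_derivI)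
  then have "((\<lambda>t. Q.lam (of_real t)) has_vector_derivative ?l) (at 0)"
    by (rule has_vector_derivative_real_field)
  then have "((\<lambda>t. \<kappa> * Re (Q.lam (of_real t))) has_vector_derivative \<kappa> * Re ?l) (at 0)"
    by (intro has_vector_derivative_mult_right bounded_linear.has_vector_derivative[OF bounded_linear_Re])
  then have d: "((\<lambda>t. \<kappa> * Re (Q.lam (of_real t))) has_real_derivative \<kappa> * Re ?l) (at 0)"
    by (simp add: has_real_derivative_iff_has_vector_derivative)
  have eq: "\<kappa> * Re (Q.lam (of_real t)) = k (s + t)" if "\<bar>t\<bar> < \<rho>2" for t
    using arg_cong[OF k[OF that], of Re] by simp
  have dk: "((\<lambda>t. k (s + t)) has_real_derivative \<kappa> * Re ?l) (at 0)"
    by (rule has_field_derivative_transform_within_open[OF d, of "ball 0 \<rho>2"]) (use eq \<rho>2(1) in auto)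
  have k0: "k s = \<kappa>" using eq[of 0] \<rho>2(1) by (simp add: Q.lam_0)
  have "(k has_real_derivative \<kappa> * Re ?l) (at (s + 0))"
    using dk DERIV_shift[of k "\<kappa> * Re ?l" 0 s] by (simp add: add.commute)
  then have dk: "(k has_real_derivative \<kappa> * Re ?l) (at s)" by simp
  have "((\<lambda>x. ln (k x)) has_real_derivative inverse (k s) * (\<kappa> * Re ?l)) (at s)"
    by (rule DERIV_chain2[where f = ln and g = k, OF DERIV_ln dk]) (use k0 \<kappa>_pos in simp)
  then have "deriv (\<lambda>x. ln (k x)) s = Re ?l" using k0 \<kappa>_pos by (simp add: DERIV_imp_deriv)
  moreover have "cmod ?l \<le> 4 * 2 / \<rho>1"
    by (rule deriv_bound_half_ball[OF Q.lam_hol Q.lam_bound(2)]) (use \<rho>1 in auto)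
  ultimately show ?thesis using abs_Re_le_cmod[of ?l] by simp
qed

end

section \<open>The spectral decomposition\<close>

text \<open>The complement of the support is a union of open null sets, and by the Lindelof property
  countably many of them suffice.\<close>

lemma AE_measure_support:
  fixes \<mu> :: "'a::second_countable_topology measure"
  assumes "sets \<mu> = sets borel"
  shows "AE x in \<mu>. x \<in> measure_support \<mu>"
proof -
  define \<F> where "\<F> = {U. open U \<and> emeasure \<mu> U = 0}"
  obtain \<F>' where F': "\<F>' \<subseteq> \<F>" "countable \<F>'" "\<Union>\<F>' = \<Union>\<F>"
    using Lindelof[of \<F>] unfolding \<F>_def by blast
  have "(\<Union>U\<in>\<F>'. U) \<in> null_sets \<mu>"
    by (rule null_sets_UN'[OF F'(2)]) (use F'(1) assms in \<open>auto simp: \<F>_def null_sets_def\<close>)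
  then have "\<Union>\<F> \<in> null_sets \<mu>" using F'(3) by simp
  then show ?thesis
    by (rule AE_I') (auto simp: measure_support_def \<F>_def not_gr_zero)
qed

section \<open>Comparable entries from the action on the simplex\<close>

lemma matrix_vector_axis: "((h :: real ^ 'n ^ 'm) *v axis j 1) $ i = h $ i $ j"
  by (simp add: matrix_vector_mult_def axis_def if_distrib[of "\<lambda>x. _ * x"] cong: if_cong)

text \<open>Column \<open>j\<close> is the image of a vertex of the simplex. Normalised, it lies in
  \<open>sphere1_eps \<epsilon>\<close>, so each of its entries is at least
  \<open>\<epsilon>\<close> times its norm. A vanishing column would have \<open>act\<close> equal
  to zero, which is not in \<open>sphere1_eps \<epsilon>\<close>.\<close>

lemma column_bound:
  fixes h :: "real ^ 'n ^ 'n"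
  assumes "0 < \<epsilon>" "act h ` sphere1 \<subseteq> sphere1_eps \<epsilon>"
  shows "0 < h $ i $ j" "\<epsilon> * h $ k $ j \<le> h $ i $ j"
proof -
  let ?w = "h *v axis j 1"
  have a: "act h (axis j 1) \<in> sphere1_eps \<epsilon>" using assms(2) axis_sphere1 by blast
  have n: "norm1 ?w \<noteq> 0"
  proof
    assume "norm1 ?w = 0"
    then have "act h (axis j 1) = 0" unfolding act_def by simp
    then show False using sphere1_epsD(2)[OF a, of i] assms(1) by simp
  qed
  have n0: "0 \<le> norm1 ?w" unfolding norm1_def by (simp add: sum_nonneg)
  have "\<epsilon> \<le> h $ i $ j / norm1 ?w"
    using sphere1_epsD(2)[OF a, of i] by (simp add: act_def matrix_vector_axis)
  then have *: "\<epsilon> * norm1 ?w \<le> h $ i $ j" using n n0 by (simp add: field_simps)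
  moreover have "0 < \<epsilon> * norm1 ?w" using n n0 assms(1) by simp
  ultimately show "0 < h $ i $ j" by linarith
  have "h $ k $ j \<le> norm1 ?w"
    using member_le_sum[of k UNIV "\<lambda>i. \<bar>?w $ i\<bar>"] unfolding norm1_def by (simp add: matrix_vector_axis)
  then have "\<epsilon> * h $ k $ j \<le> \<epsilon> * norm1 ?w" using assms(1) by (intro mult_left_mono) auto
  then show "\<epsilon> * h $ k $ j \<le> h $ i $ j" using * by linarith
qed

text \<open>Any two entries are compared through the entry in the row of the one and the column of
  the other, which costs \<open>\<epsilon>\<^sup>2\<close>. Averaging over all entries gives the
  constant.\<close>

lemma uniformly_positiveI:
  fixes h :: "real ^ 'n ^ 'n"
  assumes \<epsilon>: "0 < \<epsilon>" and h: "act h ` sphere1 \<subseteq> sphere1_eps \<epsilon>" "act (transpose h) ` sphere1 \<subseteq> sphere1_eps \<epsilon>"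
  shows "uniformly_positive (\<epsilon>\<^sup>2 / CARD('n) ^ 2) \<epsilon> h"
  unfolding uniformly_positive_def
proof (intro conjI ballI allI)
  note pos = column_bound(1)[OF \<epsilon> h(1)]
  show "0 < mat_norm1 h" unfolding mat_norm1_def by (intro sum_pos pos) auto
  show "act h v \<in> sphere1_eps \<epsilon>" "act (transpose h) v \<in> sphere1_eps \<epsilon>" if "v \<in> sphere1" for v
    using h that by blast+
  fix i j
  have "\<epsilon>\<^sup>2 * h $ k $ l \<le> h $ i $ j" for k l
  proof -
    have "\<epsilon> * h $ k $ l \<le> h $ k $ j"
      using column_bound(2)[OF \<epsilon> h(2), of l k j] by (simp add: transpose_def)
    then have "\<epsilon> * (\<epsilon> * h $ k $ l) \<le> \<epsilon> * h $ k $ j" using \<epsilon> by (intro mult_left_mono) auto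
    also have "\<dots> \<le> h $ i $ j" by (rule column_bound(2)[OF \<epsilon> h(1)])
    finally show ?thesis by (simp add: power2_eq_square)
  qed
  then have "(\<Sum>k\<in>(UNIV :: 'n set). \<Sum>l\<in>(UNIV :: 'n set). \<epsilon>\<^sup>2 * h $ k $ l) \<le> (\<Sum>k\<in>(UNIV :: 'n set). \<Sum>l\<in>(UNIV :: 'n set). h $ i $ j)"
    by (intro sum_mono)
  then show "\<epsilon>\<^sup>2 / CARD('n) ^ 2 * mat_norm1 h \<le> h $ i $ j"
    unfolding mat_norm1_def by (simp add: sum_distrib_left[symmetric] field_simps power2_eq_square)
qed

lemma inner_transpose: "v \<bullet> (transpose h *v u) = (h *v v) \<bullet> (u :: real ^ 'n)" for h :: "real ^ 'n ^ 'n"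
  by (metis dot_lmul_matrix inner_commute transpose_matrix_vector)

text \<open>Fubini turns the eigenmeasure of the transposed operator into an eigenfunction.\<close>

lemma (in matrix_law) eigenfunction_of_transpose:
  assumes "transfer_eigenmeasure \<mu> \<epsilon> c transpose s k \<eta>" and v: "v \<in> sphere1_eps \<epsilon>"
  shows "(\<integral>h. r_fun \<eta> s (h *v v) \<partial>\<mu>) = k * r_fun \<eta> s v"
proof -
  interpret T: transfer_eigenmeasure \<mu> \<epsilon> c transpose s k \<eta> by (rule assms)
  interpret E: prob_space \<eta> by (rule T.eta)
  interpret PS: pair_sigma_finite \<eta> \<mu> ..
  note [measurable_cong] = T.eta(2)
  note v1 = sphere1_epsD(1)[OF v]
  let ?\<phi> = "\<lambda>u. (v \<bullet> u) powr s"
  let ?G = "\<lambda>u h. indicator sphere1 u * ((h *v v) \<bullet> u) powr s"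
  have cont: "continuous_on sphere1 ?\<phi>"
    by (intro continuous_intros) (use sphere1_epsD(4)[OF v] eps in force)
  have inner: "indicator sphere1 u *\<^sub>R (LINT h:nonneg_matrices|\<mu>. norm1 (transpose h *v u) powr s * ?\<phi> (act (transpose h) u))
      = (\<integral>h. ?G u h \<partial>\<mu>)" for u
  proof (cases "u \<in> sphere1")
    case True
    have "(LINT h:nonneg_matrices|\<mu>. norm1 (transpose h *v u) powr s * ?\<phi> (act (transpose h) u)) =
        (\<integral>h. norm1 (transpose h *v u) powr s * ?\<phi> (act (transpose h) u) \<partial>\<mu>)"
      by (rule set_integral_nonneg_matrices) measurable
    also have "\<dots> = (\<integral>h. ((h *v v) \<bullet> u) powr s \<partial>\<mu>)"
    proof (rule integral_cong_AE)
      show "AE h in \<mu>. norm1 (transpose h *v u) powr s * ?\<phi> (act (transpose h) u) = ((h *v v) \<bullet> u) powr s"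
        using up
      proof eventually_elim
        case (elim h)
        note ht = uniformly_positive_transpose[OF elim]
        have "(h *v v) \<bullet> u = norm1 (transpose h *v u) * (v \<bullet> act (transpose h) u)"
          using up_act_scale[OF c(1) ht True] inner_transpose[of v h u] by (metis inner_scaleR_right)
        moreover have "0 \<le> v \<bullet> act (transpose h) u"
          using sphere1_epsD(4)[OF v sphere1_epsD(1)[OF up_act_mem[OF c(1) ht True]]] eps by simp
        ultimately show ?case using up_norm1_bounds(3)[OF c(1) ht True] by (simp add: powr_mult)
      qed
    qed measurable
    finally show ?thesis using True by simp
  qed simp
  \<comment> \<open>The bound does not involve \<open>u\<close>; it gives integrability on the
    product and so justifies Fubini's theorem.\<close>
  have bnd: "AE h in \<mu>. \<forall>u. \<bar>?G u h\<bar> \<le> c powr (- \<bar>s\<bar>) * mat_norm1 h powr s"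
    using up
  proof (eventually_elim, intro allI)
    fix h :: "real ^ 'n ^ 'n" and u assume h: "uniformly_positive c \<epsilon> h"
    show "\<bar>?G u h\<bar> \<le> c powr (- \<bar>s\<bar>) * mat_norm1 h powr s"
    proof (cases "u \<in> sphere1")
      case True
      have "((h *v v) \<bullet> u) powr s \<le> c powr (- \<bar>s\<bar>) * mat_norm1 h powr s"
        by (rule powr_between(2)[OF c up_entry(3)[OF c(1) h]])
          (use up_inner_bounds(1,2)[OF c(1) h True v1] in \<open>auto simp: inner_commute\<close>)
      then show ?thesis using True by simp
    qed simp
  qed
  have Gi: "integrable \<mu> (\<lambda>h. ?G u h)" for u
    by (rule Bochner_Integration.integrable_bound[OF integrable_mult_right[OF T.moment, of "c powr (- \<bar>s\<bar>)"]])
      (use bnd in \<open>auto elim!: eventually_mono\<close>)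
  have "integrable (\<eta> \<Otimes>\<^sub>M \<mu>) (\<lambda>x. ?G (fst x) (snd x))"
  proof (rule PS.Fubini_integrable)
    show "integrable \<eta> (\<lambda>u. \<integral>h. norm (?G (fst (u, h)) (snd (u, h))) \<partial>\<mu>)"
    proof (rule E.integrable_const_bound[where B = "\<integral>h. c powr (- \<bar>s\<bar>) * mat_norm1 h powr s \<partial>\<mu>"])
      show "AE u in \<eta>. norm (\<integral>h. norm (?G (fst (u, h)) (snd (u, h))) \<partial>\<mu>) \<le> (\<integral>h. c powr (- \<bar>s\<bar>) * mat_norm1 h powr s \<partial>\<mu>)"
      proof (rule AE_I2)
        fix u
        show "norm (\<integral>h. norm (?G (fst (u, h)) (snd (u, h))) \<partial>\<mu>) \<le> (\<integral>h. c powr (- \<bar>s\<bar>) * mat_norm1 h powr s \<partial>\<mu>)"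
          by (rule norm_integral_le_AE) (use Gi[of u] T.moment bnd in \<open>auto elim!: eventually_mono simp: abs_mult\<close>)
      qed
    qed measurable
    show "AE u in \<eta>. integrable \<mu> (\<lambda>h. ?G (fst (u, h)) (snd (u, h)))" using Gi by simp
  qed measurable
  then have i: "integrable (\<eta> \<Otimes>\<^sub>M \<mu>) (\<lambda>(u, h). ?G u h)" by (simp add: case_prod_unfold)
  have "(\<integral>h. r_fun \<eta> s (h *v v) \<partial>\<mu>) = (\<integral>h. (\<integral>u. ?G u h \<partial>\<eta>) \<partial>\<mu>)"
    unfolding r_fun_def set_lebesgue_integral_def by simp
  also have "\<dots> = (\<integral>u. (\<integral>h. ?G u h \<partial>\<mu>) \<partial>\<eta>)" by (rule PS.Fubini_integral[OF i])
  also have "\<dots> = (LINT u:sphere1|\<eta>. LINT h:nonneg_matrices|\<mu>. norm1 (transpose h *v u) powr s * ?\<phi> (act (transpose h) u))"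
    unfolding set_lebesgue_integral_def[of \<eta>] inner ..
  also have "\<dots> = k * r_fun \<eta> s v" unfolding T.eta(4)[OF cont] r_fun_def ..
  finally show ?thesis .
qed

section \<open>Uniform constants over a compact set of exponents\<close>

lemma small_radius:
  fixes a x y b1 b2 :: real
  assumes "0 < a" "0 < x" "0 < y"
  obtains \<rho> where "0 < \<rho>" "\<rho> \<le> a" "\<rho> * b1 \<le> x" "\<rho> * b2 \<le> y"
proof
  let ?\<rho> = "min a (min (x / (\<bar>b1\<bar> + 1)) (y / (\<bar>b2\<bar> + 1)))"
  show p: "0 < ?\<rho>" using assms by auto
  show "?\<rho> \<le> a" by simp
  have g: "r * b \<le> x" if "0 < r" "r \<le> x / (\<bar>b\<bar> + 1)" for r b x :: real
  proof -
    have "r * b \<le> r * (\<bar>b\<bar> + 1)" using that by (intro mult_left_mono) auto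
    also have "\<dots> \<le> x" using that(2) by (simp add: field_simps)
    finally show ?thesis .
  qed
  show "?\<rho> * b1 \<le> x" "?\<rho> * b2 \<le> y" by (rule g[OF p]; simp)+
qed

locale product_setting =
  fixes M :: "'w measure" and g :: "nat \<Rightarrow> 'w \<Rightarrow> real ^ 'n ^ 'n" and \<mu> :: "(real ^ 'n ^ 'n) measure"
    and \<nu> \<nu>' :: "real \<Rightarrow> (real ^ 'n) measure" and \<epsilon> \<gamma> :: real
  assumes dim: "CARD('n) \<ge> 2" and iid: "iid_nonneg_matrices M g \<mu>" and eps: "0 < \<epsilon>" "\<epsilon> < 1"
    and act_eps: "\<And>h. h \<in> measure_support \<mu> \<Longrightarrow> act h ` sphere1 \<subseteq> sphere1_eps \<epsilon>"
    and act_transpose_eps: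
      "\<And>h. h \<in> measure_support \<mu> \<Longrightarrow> act (transpose h) ` sphere1 \<subseteq> sphere1_eps \<epsilon>"
    and nu: "\<And>s. s \<in> interior (I_all M g) - {0} \<Longrightarrow> A1_or_A2 M g \<mu> s \<Longrightarrow>
      eigenmeasure (P_op \<mu> s) (kappa M g s) (\<nu> s)"
    and nu': "\<And>s. s \<in> interior (I_all M g) - {0} \<Longrightarrow> A1_or_A2 M g \<mu> s \<Longrightarrow>
      eigenmeasure (P_star_op \<mu> s) (kappa M g s) (\<nu>' s)"
    and gamma: "0 < \<gamma>"
begin

definition "c = \<epsilon>\<^sup>2 / CARD('n) ^ 2"

lemma c: "0 < c" "c < 1"
proof -
  show "0 < c" unfolding c_def using eps by simp
  have "\<epsilon>\<^sup>2 < 1" using eps by (simp add: power_less_one_iff abs_square_less_1)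
  also have "1 \<le> real CARD('n) ^ 2" using dim by (intro one_le_power) auto
  finally show "c < 1" unfolding c_def using dim by (simp add: divide_less_eq)
qed

lemma law: "prob_space \<mu>" "sets \<mu> = sets borel" "g 1 \<in> borel_measurable M" "\<mu> = distr M borel (g 1)"
proof -
  interpret M: prob_space M using iid unfolding iid_nonneg_matrices_def by simp
  show m: "g 1 \<in> borel_measurable M"
    using iid unfolding iid_nonneg_matrices_def M.indep_vars_def by auto
  show d: "\<mu> = distr M borel (g 1)" using iid unfolding iid_nonneg_matrices_def by auto
  show "prob_space \<mu>" unfolding d by (rule M.prob_space_distr[OF m])
  show "sets \<mu> = sets borel" unfolding d by simp
qed

lemma moment_iff: "s \<in> I_all M g \<longleftrightarrow> integrable \<mu> (\<lambda>h. mat_norm1 h powr s)"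
proof -
  have "integrable \<mu> (\<lambda>h. mat_norm1 h powr s) \<longleftrightarrow> integrable M (\<lambda>\<omega>. mat_norm1 (g 1 \<omega>) powr s)"
    unfolding law(4) by (rule integrable_distr_eq[OF law(3)]) measurable
  then show ?thesis unfolding I_all_def I_plus_def I_minus_def by auto
qed

sublocale L: matrix_law \<mu> \<epsilon> c
proof (intro matrix_law.intro matrix_law_axioms.intro)
  show "prob_space \<mu>" by (rule law(1))
  show "AE h in \<mu>. uniformly_positive c \<epsilon> h"
    using AE_measure_support[OF law(2)]
    by eventually_elim (use uniformly_positiveI[OF eps(1) act_eps act_transpose_eps] in \<open>simp add: c_def\<close>)
  show "sets \<mu> = sets borel" by (rule law(2))
  show "0 < \<epsilon>" "\<epsilon> < 1" by (rule eps)+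
  show "0 < c" "c \<le> 1" using c by simp_all
  show "2 \<le> CARD('n)" by (rule dim)
qed

abbreviation "U \<equiv> interior (I_all M g) - {0}"

lemma open_U: "open U" by (intro open_Diff) auto

lemma transfer:
  assumes "s \<in> U" "A1_or_A2 M g \<mu> s"
  shows "transfer_eigenmeasure \<mu> \<epsilon> c (\<lambda>h. h) s (kappa M g s) (\<nu> s)"
    "transfer_eigenmeasure \<mu> \<epsilon> c transpose s (kappa M g s) (\<nu>' s)"
proof -
  have m: "integrable \<mu> (\<lambda>h. mat_norm1 h powr s)"
    using assms(1) interior_subset moment_iff by blast
  show "transfer_eigenmeasure \<mu> \<epsilon> c (\<lambda>h. h) s (kappa M g s) (\<nu> s)"
    by unfold_locales (use L.up m nu[OF assms] in \<open>auto simp: P_op_def[abs_def]\<close>)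
  show "transfer_eigenmeasure \<mu> \<epsilon> c transpose s (kappa M g s) (\<nu>' s)"
    by unfold_locales (use L.up m nu'[OF assms] in
        \<open>auto simp: P_star_op_def[abs_def] mat_norm1_transpose elim!: eventually_mono intro: uniformly_positive_transpose\<close>)
qed

definition "proj s z f = lead_projection (tilted_operator.Rt \<mu> \<epsilon> s (kappa M g s) (\<nu>' s) f z)
  (tilted_operator.p s (\<nu>' s) f (\<nu> s)) tilted_operator.e"
definition "rest s z f = perturbed_operator.NN \<mu> \<epsilon> s (kappa M g s) (\<nu>' s) f (\<nu> s) (deriv (Lambda M g) s) z"

text \<open>The ball avoids zero, so \<open>s + t\<close> has the sign of \<open>s\<close>, and the
  sign decides which condition is required.\<close>

lemma same_sign:
  assumes "ball s e \<subseteq> U" "\<bar>t\<bar> < e" "A1_or_A2 M g \<mu> s"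
  shows "A1_or_A2 M g \<mu> (s + t)"
proof -
  have e: "0 < e" using assms(2) by linarith
  have "s \<in> U" "s + t \<in> U" using assms(1,2) e by (auto simp: dist_real_def subset_iff)
  then have I: "s \<in> I_all M g" "s \<noteq> 0" "s + t \<noteq> 0" using interior_subset by auto
  have "0 \<notin> ball s e" using assms(1) by blast
  then have "e \<le> \<bar>s\<bar>" by (simp add: dist_real_def)
  then have "(0 < s \<and> 0 < s + t) \<or> (s < 0 \<and> s + t < 0)" using assms(2) by linarith
  then show ?thesis
    using assms(3) I(1) unfolding A1_or_A2_def I_all_def I_plus_def I_minus_def by auto
qed

lemma uniform_decomposition:
  assumes J: "compact J" "J \<subseteq> U" "J \<noteq> {}" and cond: "\<And>s. s \<in> J \<Longrightarrow> A1_or_A2 M g \<mu> s \<and> \<gamma> \<le> min \<bar>s\<bar> 1"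
  obtains \<delta> r where "0 < \<delta>" "r < 1"
    "\<And>f s. f \<in> sphere1 \<Longrightarrow> s \<in> J \<Longrightarrow>
       spectral_decomposition M g \<mu> (\<nu> s) (\<nu>' s) \<epsilon> \<gamma> s f \<delta> (\<lambda>z. proj s z f) (\<lambda>z. rest s z f)"
    "\<And>f s z. f \<in> sphere1 \<Longrightarrow> s \<in> J \<Longrightarrow> z \<in> ball 0 \<delta> \<Longrightarrow>
       op_spectral_radius (holder_space \<gamma>) (holder_norm \<gamma>) (rest s z f) \<le> ereal r"
proof -
  obtain d0 where d0: "0 < d0" "(\<Union>x\<in>J. ball x d0) \<subseteq> U"
    by (rule compact_subset_open_imp_ball_epsilon_subset[OF J(1) open_U J(2)])
  then have ballU: "ball s d0 \<subseteq> U" if "s \<in> J" for s using that by blast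
  \<comment> \<open>Half of the margin, so that the moments at \<open>a1\<close> and
    \<open>a2\<close> are still finite.\<close>
  define \<delta> where "\<delta> = d0 / 2"
  have \<delta>: "0 < \<delta>" "\<delta> < d0" unfolding \<delta>_def using d0 by auto
  obtain s1 where s1: "s1 \<in> J" "\<And>s. s \<in> J \<Longrightarrow> s1 \<le> s" using compact_attains_inf[OF J(1,3)] by blast
  obtain s2 where s2: "s2 \<in> J" "\<And>s. s \<in> J \<Longrightarrow> s \<le> s2" using compact_attains_sup[OF J(1,3)] by blast
  define a1 where "a1 = s1 - \<delta>"
  define a2 where "a2 = s2 + \<delta>"
  have "a1 \<in> ball s1 d0" "a2 \<in> ball s2 d0" using \<delta> by (auto simp: a1_def a2_def dist_real_def)
  then have "a1 \<in> U" "a2 \<in> U" using ballU[OF s1(1)] ballU[OF s2(1)] by blast+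
  then have mom: "integrable \<mu> (\<lambda>h. mat_norm1 h powr a1)" "integrable \<mu> (\<lambda>h. mat_norm1 h powr a2)"
    using moment_iff interior_subset by blast+
  have a12: "a1 \<le> s - \<delta>" "s + \<delta> \<le> a2" if "s \<in> J" for s
    using s1(2)[OF that] s2(2)[OF that] by (auto simp: a1_def a2_def)
  define b where "b = max \<bar>a1\<bar> \<bar>a2\<bar>"
  have b: "\<bar>s\<bar> \<le> b" if "s \<in> J" for s using a12[OF that] \<delta> unfolding b_def by linarith
  have b0: "0 \<le> b" unfolding b_def by simp
  \<comment> \<open>A common lower bound for the moments with exponents between \<open>a1\<close>
    and \<open>a2\<close>; it is positive as the integrand is positive almost surely.\<close>
  define m where "m = (\<integral>h. min (mat_norm1 h powr a1) (mat_norm1 h powr a2) \<partial>\<mu>)"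
  have mi: "integrable \<mu> (\<lambda>h. min (mat_norm1 h powr a1) (mat_norm1 h powr a2))"
    by (rule Bochner_Integration.integrable_min[OF mom])
  have AE_pos: "AE h in \<mu>. 0 < mat_norm1 h" using L.up by eventually_elim (rule up_entry(3)[OF c(1)])
  have m: "0 < m"
  proof -
    have "m \<noteq> 0"
    proof
      assume "m = 0"
      then have "AE h in \<mu>. min (mat_norm1 h powr a1) (mat_norm1 h powr a2) = 0"
        unfolding m_def by (subst (asm) integral_nonneg_eq_0_iff_AE[OF mi]) auto
      then have "AE h in \<mu>. False" using AE_pos by eventually_elim (simp add: min_def split: if_splits)
      then show False using L.AE_False by simp
    qed
    moreover have "0 \<le> m" unfolding m_def by (rule Bochner_Integration.integral_nonneg) simp
    ultimately show ?thesis by simp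
  qed
  define \<kappa>0 where "\<kappa>0 = c powr b * m"
  have \<kappa>0: "0 < \<kappa>0" unfolding \<kappa>0_def using c m by simp
  have \<kappa>_ge: "\<kappa>0 \<le> kappa M g s" if s: "s \<in> J" for s
  proof -
    interpret T: transfer_eigenmeasure \<mu> \<epsilon> c "\<lambda>h. h" s "kappa M g s" "\<nu> s"
      by (rule transfer) (use s J(2) cond in auto)
    have "m \<le> (\<integral>h. mat_norm1 h powr s \<partial>\<mu>)"
      unfolding m_def
    proof (rule integral_mono_AE[OF mi T.moment])
      show "AE h in \<mu>. min (mat_norm1 h powr a1) (mat_norm1 h powr a2) \<le> mat_norm1 h powr s"
        using AE_pos by eventually_elim (rule powr_le_sum(2), use a12[OF s] \<delta> in auto)
    qed
    moreover have "c powr b \<le> c powr \<bar>s\<bar>" using b[OF s] c by (intro powr_mono') auto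
    ultimately have "\<kappa>0 \<le> c powr \<bar>s\<bar> * (\<integral>h. mat_norm1 h powr s \<partial>\<mu>)"
      unfolding \<kappa>0_def using m c by (intro mult_mono) auto
    then show ?thesis using T.k_lower by linarith
  qed
  have \<gamma>: "0 < \<gamma>" "\<gamma> \<le> 1" using gamma cond s1(1) by auto
  have e2: "0 < (\<epsilon>\<^sup>2) powr b" "(\<epsilon>\<^sup>2) powr b \<le> 1" "0 \<le> 2 * b / \<epsilon>\<^sup>2" "0 < 1 - c\<^sup>2" "1 - c\<^sup>2 < 1"
    using eps c b0 by (auto intro!: powr_le1 power_le_one simp: power_less_one_iff abs_square_less_1)
  obtain D K \<theta> where gauge: "0 \<le> \<theta>" "\<theta> < 1" "1 \<le> K"
    "\<And>d. 0 \<le> d \<Longrightarrow> d \<le> 1 \<Longrightarrow> 0 \<le> D d \<and> D d \<le> 1 \<and> d powr \<gamma> / 2 \<le> D d \<and> D d \<le> K * d powr \<gamma>"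
    "\<And>d d' y. 0 < d \<Longrightarrow> d \<le> 1 \<Longrightarrow> 0 \<le> d' \<Longrightarrow> d' \<le> (1 - c\<^sup>2) * d \<Longrightarrow> (\<epsilon>\<^sup>2) powr b \<le> y \<Longrightarrow> y \<le> 1 \<Longrightarrow>
       1 - y \<le> 2 * b / \<epsilon>\<^sup>2 * d \<Longrightarrow> (1 - y) + y * D d' \<le> \<theta> * D d"
    by (rule contraction_gauge[OF e2 \<gamma>]) blast
  \<comment> \<open>This constant involves neither \<open>s\<close> nor \<open>f\<close>, so the
    radii can be chosen before these are fixed.\<close>
  define L where "L = tilted_operator.LL \<mu> \<epsilon> c b \<delta> a1 a2 \<kappa>0 K"
  have \<theta>0: "0 < 1 - \<theta>" "0 < (1 - \<theta>)\<^sup>2 / 256" "0 < (1 - \<theta>) / 2" "0 < (1 - \<theta>) / 4" using gauge(2) by auto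
  obtain \<rho>1 where \<rho>1: "0 < \<rho>1" "\<rho>1 \<le> \<delta> / 2" "\<rho>1 * (4 * L ^ 2 / \<delta>) \<le> (1 - \<theta>) / 2"
      "\<rho>1 * (4 * L ^ 4 / \<delta>) \<le> (1 - \<theta>)\<^sup>2 / 256"
    by (rule small_radius[of "\<delta> / 2" "(1 - \<theta>) / 2" "(1 - \<theta>)\<^sup>2 / 256" "4 * L ^ 2 / \<delta>" "4 * L ^ 4 / \<delta>"])
      (use \<delta> \<theta>0 in auto)
  obtain \<rho>2 where \<rho>2: "0 < \<rho>2" "\<rho>2 \<le> \<rho>1 / 2" "\<rho>2 * (4 * (64 * L ^ 4 / (1 - \<theta>)\<^sup>2) / \<rho>1) \<le> 1 / 2"
      "\<rho>2 * (4 * (16 * L ^ 3 / (1 - \<theta>)) / \<rho>1) \<le> 1 / 2"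
    by (rule small_radius[of "\<rho>1 / 2" "1/2" "1/2" "4 * (64 * L ^ 4 / (1 - \<theta>)\<^sup>2) / \<rho>1" "4 * (16 * L ^ 3 / (1 - \<theta>)) / \<rho>1"])
      (use \<rho>1 in auto)
  obtain \<rho>3 where \<rho>3: "0 < \<rho>3" "\<rho>3 \<le> \<rho>2 / 2"
      "\<rho>3 * (L * (4 * (2 * (128 * L ^ 3 / (1 - \<theta>)\<^sup>2)) / \<rho>2)) \<le> (1 - \<theta>) / 4"
    by (rule small_radius[of "\<rho>2 / 2" "(1 - \<theta>) / 4" 1 "L * (4 * (2 * (128 * L ^ 3 / (1 - \<theta>)\<^sup>2)) / \<rho>2)" 0])
      (use \<rho>2 \<theta>0 in auto)
  define t2 where "t2 = (3 + \<theta>) / 4"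
  have t2: "0 < t2" "t2 < 1" unfolding t2_def using gauge(1,2) by auto
  \<comment> \<open>The derivative of \<open>Lambda\<close> is going to be at most
    \<open>8 / \<rho>1\<close> in modulus. With this radius the factor \<open>exp (- q z)\<close>
    costs at most the inverse square root of \<open>t2\<close>, and the square root of
    \<open>t2\<close> remains as bound for the spectral radius.\<close>
  obtain \<rho> where \<rho>: "0 < \<rho>" "\<rho> \<le> \<rho>3" "\<rho> * (8 / \<rho>1) \<le> - ln t2 / 2"
    by (rule small_radius[of \<rho>3 "- ln t2 / 2" 1 "8 / \<rho>1"]) (use \<rho>3 t2 in auto)
  have inst: "perturbed_operator \<mu> \<epsilon> c s (kappa M g s) (\<nu>' s) f b \<delta> a1 a2 \<kappa>0 (\<nu> s) \<gamma> \<theta> K D \<rho>1 \<rho>2 \<rho>3"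
    if f: "f \<in> sphere1" and s: "s \<in> J" for f s
  proof -
    have sU: "s \<in> U" "A1_or_A2 M g \<mu> s" using s J(2) cond by auto
    interpret T: transfer_eigenmeasure \<mu> \<epsilon> c "\<lambda>h. h" s "kappa M g s" "\<nu> s" by (rule transfer[OF sU])
    interpret T': transfer_eigenmeasure \<mu> \<epsilon> c transpose s "kappa M g s" "\<nu>' s" by (rule transfer[OF sU])
    interpret TO: tilted_operator \<mu> \<epsilon> c s "kappa M g s" "\<nu>' s" f b \<delta> a1 a2 \<kappa>0 "\<nu> s" \<gamma> \<theta> K D
    proof (intro tilted_operator.intro tilted_kernel.intro tilted_kernel_axioms.intro tilted_operator_axioms.intro)
      show "matrix_law \<mu> \<epsilon> c" by (rule L.matrix_law_axioms)
      show "(\<integral>h. r_fun (\<nu>' s) s (h *v v) \<partial>\<mu>) = kappa M g s * r_fun (\<nu>' s) s v" if "v \<in> sphere1_eps \<epsilon>" for v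
        by (rule L.eigenfunction_of_transpose[OF transfer(2)[OF sU] that])
      show "\<bar>s\<bar> \<le> b" "0 < \<kappa>0" "\<kappa>0 \<le> kappa M g s" by (rule b[OF s] \<kappa>0 \<kappa>_ge[OF s])+
      show "prob_space (\<nu> s)" "prob_space (\<nu>' s)" by (rule T.eta T'.eta)+
      show "sets (\<nu> s) = sets borel" "sets (\<nu>' s) = sets borel" by (rule T.eta T'.eta)+
      show "AE v in \<nu> s. v \<in> sphere1_eps \<epsilon>" "AE v in \<nu>' s. v \<in> sphere1_eps \<epsilon>" by (rule T.eta_eps T'.eta_eps)+
      show "eigenmeasure (P_op \<mu> s) (kappa M g s) (\<nu> s)" by (rule nu[OF sU])
    qed (fact \<delta> a12[OF s] mom f \<gamma> gauge)+
    show ?thesis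
      by unfold_locales (use \<rho>1 \<rho>2 \<rho>3 in \<open>unfold L_def, auto\<close>)
  qed
  show thesis
  proof (rule that[OF \<rho>(1), of "exp (ln t2 / 2)"])
    show "exp (ln t2 / 2) < 1" using t2 by simp
    fix f :: "real ^ 'n" and s assume f: "f \<in> sphere1" and s: "s \<in> J"
    interpret P: perturbed_operator \<mu> \<epsilon> c s "kappa M g s" "\<nu>' s" f b \<delta> a1 a2 \<kappa>0 "\<nu> s" \<gamma> \<theta> K D \<rho>1 \<rho>2 \<rho>3
      by (rule inst[OF f s])
    have sA: "A1_or_A2 M g \<mu> s" using cond[OF s] by simp
    have small: "\<rho> \<le> \<rho>3" "\<rho>3 < \<rho>2" "\<rho>2 < \<delta>" using \<rho> P.Q.radii by auto
    \<comment> \<open>This serves twice: it shows that the eigenvalue extends \<open>kappa\<close>,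
      and it gives the bound for the derivative of \<open>Lambda\<close>.\<close>
    have lam: "of_real (kappa M g s) * P.Q.lam (of_real t) = of_real (kappa M g (s + t))" if t: "\<bar>t\<bar> < \<rho>2" for t
    proof -
      have td: "\<bar>t\<bar> < d0" using t small \<delta> by simp
      have st: "s + t \<in> U" using ballU[OF s] td by (auto simp: dist_real_def subset_iff)
      note A = same_sign[OF ballU[OF s] td sA]
      interpret T: transfer_eigenmeasure \<mu> \<epsilon> c "\<lambda>h. h" "s + t" "kappa M g (s + t)" "\<nu> (s + t)"
        by (rule transfer[OF st A])
      show ?thesis by (rule P.lam_real[OF t T.eta(1,2) T.eta_eps nu[OF st A]])
    qed
    let ?q = "deriv (Lambda M g) s"
    have qb: "\<bar>?q\<bar> \<le> 8 / \<rho>1"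
      using P.log_derivative_bound[of "kappa M g", OF lam] unfolding Lambda_def[abs_def] .
    have rest: "rest s z f = P.NN ?q z" and proj: "proj s z f = P.Q.Pr z" for z
      unfolding rest_def proj_def by simp_all
    show "op_spectral_radius (holder_space \<gamma>) (holder_norm \<gamma>) (rest s z f) \<le> ereal (exp (ln t2 / 2))"
      if z: "z \<in> ball 0 \<rho>" for z
    proof -
      have "\<bar>?q\<bar> * \<rho> \<le> 8 / \<rho>1 * \<rho>" using qb \<rho>(1) by (intro mult_right_mono) auto
      also have "\<dots> \<le> - ln t2 / 2" using \<rho>(3) by (simp add: mult.commute)
      finally have "exp (\<bar>?q\<bar> * \<rho>) * t2 \<le> exp (- ln t2 / 2) * exp (ln t2)" using t2 by (intro mult_mono) auto
      also have "\<dots> = exp (ln t2 / 2)" by (simp add: exp_add[symmetric])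
      finally have "ereal (exp (\<bar>?q\<bar> * \<rho>) * P.Q.\<theta>2) \<le> ereal (exp (ln t2 / 2))"
        unfolding P.Q.\<theta>2_def t2_def by simp
      then show ?thesis unfolding rest using P.NN_facts(2)[OF \<rho>(2) z] order_trans by blast
    qed
    show "spectral_decomposition M g \<mu> (\<nu> s) (\<nu>' s) \<epsilon> \<gamma> s f \<rho> (\<lambda>z. proj s z f) (\<lambda>z. rest s z f)"
      unfolding spectral_decomposition_def Let_def rest proj
    proof (intro conjI ballI)
      show "s + Re z \<in> I_all M g" if "z \<in> ball 0 \<rho>" for z
      proof -
        have "\<bar>Re z\<bar> < d0" using that small \<delta> abs_Re_le_cmod[of z] by simp
        then have "s + Re z \<in> ball s d0" by (simp add: dist_real_def)
        then show ?thesis using ballU[OF s] interior_subset by blast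
      qed
      show "\<exists>K. K holomorphic_on ball 0 \<rho> \<and> (\<forall>t. \<bar>t\<bar> < \<rho> \<longrightarrow> K (of_real t) = of_real (kappa M g (s + t))) \<and>
          (\<forall>z\<in>ball 0 \<rho>. \<forall>n\<ge>1. \<forall>\<phi>\<in>holder_space \<gamma>. \<forall>v\<in>sphere1_eps \<epsilon>.
            (R_op \<mu> (\<nu>' s) \<epsilon> (kappa M g s) ?q s z f ^^ n) \<phi> v =
            (exp (- of_real ?q * z) * K z / of_real (kappa M g s)) ^ n * P.Q.Pr z \<phi> v + (P.NN ?q z ^^ n) \<phi> v)"
      proof (intro exI[of _ "\<lambda>z. of_real (kappa M g s) * P.Q.lam z"] conjI allI impI ballI)
        show "(\<lambda>z. of_real (kappa M g s) * P.Q.lam z) holomorphic_on ball 0 \<rho>"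
          by (rule holomorphic_on_subset[OF P.lam_holomorphic]) (use small in auto)
        show "of_real (kappa M g s) * P.Q.lam (of_real t) = of_real (kappa M g (s + t))" if "\<bar>t\<bar> < \<rho>" for t
          by (rule lam) (use that small in simp)
        show "(R_op \<mu> (\<nu>' s) \<epsilon> (kappa M g s) ?q s z f ^^ n) \<phi> v =
            (exp (- of_real ?q * z) * (of_real (kappa M g s) * P.Q.lam z) / of_real (kappa M g s)) ^ n * P.Q.Pr z \<phi> v
            + (P.NN ?q z ^^ n) \<phi> v"
          if "z \<in> ball 0 \<rho>" "1 \<le> n" "\<phi> \<in> holder_space \<gamma>" "v \<in> sphere1_eps \<epsilon>" for z n \<phi> v
          using P.decomposition[OF \<rho>(2) that, of ?q] P.\<kappa>_pos by simp
      qed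
      show "op_analytic_on (holder_space \<gamma>) (holder_norm \<gamma>) P.Q.Pr (ball 0 \<rho>)"
        by (rule op_analytic_on_subset[OF P.Q.Pr_op_analytic]) (use small in auto)
      show "op_analytic_on (holder_space \<gamma>) (holder_norm \<gamma>) (P.NN ?q) (ball 0 \<rho>)"
        by (rule P.NN_facts(1)[OF \<rho>(2)])
      show "P.Q.Pr z (P.NN ?q z \<phi>) = (\<lambda>_. 0)" "P.NN ?q z (P.Q.Pr z \<phi>) = (\<lambda>_. 0)"
        if "z \<in> ball 0 \<rho>" "\<phi> \<in> holder_space \<gamma>" for z \<phi>
        using P.NN_facts(3)[OF \<rho>(2) that] by auto
      show "P.Q.Pr 0 \<phi> v = pi_f (\<nu> s) (\<nu>' s) s f \<phi>" if "\<phi> \<in> holder_space \<gamma>" "v \<in> sphere1_eps \<epsilon>" for \<phi> v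
        using P.Q.Pr_0[OF that(1)] sphere1_epsD(1)[OF that(2)] by (simp add: P.e_def P.p_def)
    qed
  qed
qed

end

theorem proposition3p5:
  fixes M :: "'w measure"
    and g :: "nat \<Rightarrow> 'w \<Rightarrow> real ^ 'n ^ 'n"
    and \<mu> :: "(real ^ 'n ^ 'n) measure"
    and \<nu> \<nu>' :: "real \<Rightarrow> (real ^ 'n) measure"
    and \<epsilon> \<gamma> :: real
  assumes dim: "CARD('n) \<ge> 2"
    and iid: "iid_nonneg_matrices M g \<mu>"
    and eps: "0 < \<epsilon>" "\<epsilon> < 1"
    and act_eps: "\<And>h. h \<in> measure_support \<mu> \<Longrightarrow> act h ` sphere1 \<subseteq> sphere1_eps \<epsilon>"
    and act_transpose_eps:
      "\<And>h. h \<in> measure_support \<mu> \<Longrightarrow> act (transpose h) ` sphere1 \<subseteq> sphere1_eps \<epsilon>"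
    and nu: "\<And>s. s \<in> interior (I_all M g) - {0} \<Longrightarrow> A1_or_A2 M g \<mu> s \<Longrightarrow>
      eigenmeasure (P_op \<mu> s) (kappa M g s) (\<nu> s)"
    and nu': "\<And>s. s \<in> interior (I_all M g) - {0} \<Longrightarrow> A1_or_A2 M g \<mu> s \<Longrightarrow>
      eigenmeasure (P_star_op \<mu> s) (kappa M g s) (\<nu>' s)"
    and gamma: "0 < \<gamma>"
  shows "\<exists>Pr N.
    (\<forall>s\<in>interior (I_all M g) - {0}. A1_or_A2 M g \<mu> s \<longrightarrow> \<gamma> \<le> min \<bar>s\<bar> 1 \<longrightarrow>
      (\<forall>f\<in>sphere1. \<exists>\<delta>>0.
        spectral_decomposition M g \<mu> (\<nu> s) (\<nu>' s) \<epsilon> \<gamma> s f \<delta> (\<lambda>z. Pr s z f) (\<lambda>z. N s z f))) \<and>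
    (\<forall>J. compact J \<longrightarrow> J \<subseteq> interior (I_all M g) - {0} \<longrightarrow>
      (\<forall>s\<in>J. A1_or_A2 M g \<mu> s \<and> \<gamma> \<le> min \<bar>s\<bar> 1) \<longrightarrow>
      (\<exists>\<delta>>0.
        (\<forall>f\<in>sphere1. \<forall>s\<in>J.
          spectral_decomposition M g \<mu> (\<nu> s) (\<nu>' s) \<epsilon> \<gamma> s f \<delta> (\<lambda>z. Pr s z f) (\<lambda>z. N s z f)) \<and>
        (SUP f\<in>sphere1. SUP s\<in>J. SUP z\<in>ball 0 \<delta>.
          op_spectral_radius (holder_space \<gamma>) (holder_norm \<gamma>) (N s z f)) < 1))"
proof -
  interpret product_setting M g \<mu> \<nu> \<nu>' \<epsilon> \<gamma>
    by unfold_locales (fact dim iid eps act_eps act_transpose_eps nu nu' gamma)+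
  show ?thesis
  proof (rule exI[of _ proj], rule exI[of _ rest], intro conjI ballI allI impI)
    fix s and f :: "real ^ 'n" assume s: "s \<in> U" "A1_or_A2 M g \<mu> s" "\<gamma> \<le> min \<bar>s\<bar> 1" and f: "f \<in> sphere1"
    obtain \<delta> r where "0 < \<delta>"
      "spectral_decomposition M g \<mu> (\<nu> s) (\<nu>' s) \<epsilon> \<gamma> s f \<delta> (\<lambda>z. proj s z f) (\<lambda>z. rest s z f)"
      by (rule uniform_decomposition[of "{s}"]) (use s f in auto)
    then show "\<exists>\<delta>>0. spectral_decomposition M g \<mu> (\<nu> s) (\<nu>' s) \<epsilon> \<gamma> s f \<delta> (\<lambda>z. proj s z f) (\<lambda>z. rest s z f)"
      by blast
  next
    fix J assume J: "compact J" "J \<subseteq> U" "\<forall>s\<in>J. A1_or_A2 M g \<mu> s \<and> \<gamma> \<le> min \<bar>s\<bar> 1"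
    show "\<exists>\<delta>>0. (\<forall>f\<in>sphere1. \<forall>s\<in>J.
          spectral_decomposition M g \<mu> (\<nu> s) (\<nu>' s) \<epsilon> \<gamma> s f \<delta> (\<lambda>z. proj s z f) (\<lambda>z. rest s z f)) \<and>
        (SUP f\<in>sphere1. SUP s\<in>J. SUP z\<in>ball 0 \<delta>.
          op_spectral_radius (holder_space \<gamma>) (holder_norm \<gamma>) (rest s z f)) < 1"
    proof (cases "J = {}")
      case True
      \<comment> \<open>In \<open>ereal\<close> the supremum over the empty set is minus
        infinity.\<close>
      have "(SUP f\<in>sphere1. SUP s\<in>J. SUP z\<in>ball 0 1.
          op_spectral_radius (holder_space \<gamma>) (holder_norm \<gamma>) (rest s z f)) \<le> ereal 0"
        using True by (intro SUP_least) auto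
      also have "\<dots> < 1" by simp
      finally show ?thesis using True by (intro exI[of _ 1]) auto
    next
      case False
      show ?thesis
      proof (rule uniform_decomposition[OF J(1,2) False])
        fix \<delta> r :: real
        assume \<delta>: "0 < \<delta>" and r: "r < 1"
          and sd: "\<And>f s. f \<in> sphere1 \<Longrightarrow> s \<in> J \<Longrightarrow>
            spectral_decomposition M g \<mu> (\<nu> s) (\<nu>' s) \<epsilon> \<gamma> s f \<delta> (\<lambda>z. proj s z f) (\<lambda>z. rest s z f)"
          and sr: "\<And>f s z. f \<in> sphere1 \<Longrightarrow> s \<in> J \<Longrightarrow> z \<in> ball 0 \<delta> \<Longrightarrow>
            op_spectral_radius (holder_space \<gamma>) (holder_norm \<gamma>) (rest s z f) \<le> ereal r"
        have "(SUP f\<in>sphere1. SUP s\<in>J. SUP z\<in>ball 0 \<delta>.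
            op_spectral_radius (holder_space \<gamma>) (holder_norm \<gamma>) (rest s z f)) \<le> ereal r"
          by (intro SUP_least sr)
        also have "ereal r < 1" using r by simp
        finally show ?thesis using \<delta> sd by blast
      qed (use J(3) in auto)
    qed
  qed
qed

end
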